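(* Let $1<\alpha<2$ and let $\Omega$ be the open unit disk in $\mathbb{R}^2$. Let $K\in\big(L^\infty(\Omega)\big)^{2\times 2}$ be such that $K(\mathbf{x})$ is symmetric positive definite and, for constants $\lambda_m,\lambda_M>0$, $$\lambda_m\,\xi^T\xi\ \le\ \xi^T K(\mathbf{x})\,\xi\ \le\ \lambda_M\,\xi^T\xi\qquad\text{for all }\xi\in\mathbb{R}^2,\ \mathbf{x}\in\Omega,$$ and assume $$\lambda_M\ <\ \frac{\sqrt{\alpha(2+\alpha)}}{2-\alpha}\,\lambda_m .$$ Then, given $f\in H^{-(\alpha-1)}_{\alpha/2}(\Omega)$, there exists a unique $\tilde u\in\mathcal{H}^{1}_{\alpha/2}(\Omega)$ satisfying $$B(\tilde u,\tilde v):=\Big(K\nabla\tilde u\,,\,(-\Delta)^{\frac{\alpha-2}{2}}\nabla\tilde v\Big)=F(\tilde v)\qquad\text{for all }\tilde v\in\mathcal{H}^{\alpha-1}_{\alpha/2}(\Omega),$$ where $F(\tilde v)=(f,\tilde v)$ is understood as a duality pairing. Moreover $$\|\tilde u\|_{\mathcal{H}^{1}_{\alpha/2}(\Omega)}\ \le\ \frac{1}{C_2}\,\|f\|_{H^{-(\alpha-1)}_{\alpha/2}(\Omega)},$$ where $C_2>0$ is the inf-sup constant of $B$, i.e. a constant (independent of $f$) such that $$\sup_{0\ne\tilde z\in\mathcal{H}^{\alpha-1}_{\alpha/2}(\Omega)}\frac{|B(\tilde w,\tilde z)|}{\|\tilde z\|_{\mathcal{H}^{\alpha-1}_{\alpha/2}(\Omega)}}\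 \ge\ C_2\,\|\tilde w\|_{\mathcal{H}^{1}_{\alpha/2}(\Omega)}\qquad\text{for all }\tilde w\in\mathcal{H}^{1}_{\alpha/2}(\Omega).$$
   Context: Notation. $\Omega=\{\mathbf{x}\in\mathbb{R}^2:|\mathbf{x}|<1\}$; polar coordinates $(r,\varphi)$; $\rho:=2r^2-1$; $\omega^{\gamma}:=(1-r^2)^{\gamma}$ on $\Omega$ (extended by $0$ outside $\Omega$). $L^2_\gamma(\Omega)$ is the weighted space with inner product $(f,g)_\gamma=\int_\Omega\omega^\gamma f\cdot g\,d\Omega$ (also for vector-valued functions). $P_n^{(a,b)}$ is the Jacobi polynomial of degree $n$. Basis. $\mathcal{V}_{0,1}:=\frac12$, and for $l\ge1$: $\mathcal{V}_{l,1}:=r^l\cos(l\varphi)$, $\mathcal{V}_{l,-1}:=r^l\sin(l\varphi)$. For $\gamma>-1$ the functions $\mathcal{V}_{l,\mu}(\mathbf{x})P_n^{(\gamma,l)}(\rho)$, $l,n\ge0$ integers, $\mu\in\{1,-1\}$, $(l,\mu)\ne(0,-1)$, form an orthogonal basis of $L^2_\gamma(\Omega)$. Spaces. For $\gamma>-1$, $s\in\mathbb{R}$, $H^s_\gamma(\Omega)$ is the space of series $u=\sum_{l,n,\mu}a_{l,n,\mu}\mathcal{V}_{l,\mu}P_n^{(\gamma,l)}(\rho)$ with $$\|u\|_{H^s_\gamma}^2:=\sum_{l,n,\mu}(n+1)^s(n+l+1)^s a_{l,n,\mu}^2\|\mathcal{V}_{l,\mu}P_n^{(\gamma,l)}(\rho)\|_{L^2_\gamma}^2<\infty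 .$$ For $s\ge0$ this is a subspace of $L^2_\gamma(\Omega)$; for $s<0$ it is identified with the dual of $H^{-s}_\gamma(\Omega)$ with pivot space $L^2_\gamma(\Omega)$, through $\langle\sum a_{l,n,\mu}e_{l,n,\mu},\sum b_{l,n,\mu}e_{l,n,\mu}\rangle=\sum a_{l,n,\mu}b_{l,n,\mu}\|e_{l,n,\mu}\|^2_{L^2_\gamma}$, $e_{l,n,\mu}=\mathcal{V}_{l,\mu}P_n^{(\gamma,l)}(\rho)$. (For $s\in\mathbb{N}$ it coincides, with equivalent norms, with the space of $f\in L^2_\gamma(\Omega)$ whose partial derivatives of order $s$ lie in $L^2_{\gamma+s}(\Omega)$.) Further, $\mathcal{H}^s_\beta(\Omega):=\{\tilde v=\omega^\beta v: v\in H^s_\beta(\Omega)\}$ with $\|\tilde v\|_{\mathcal{H}^s_\beta}:=\|v\|_{H^s_\beta}$. Operators. For $1<\alpha<2$, $(-\Delta)^{\frac{\alpha-2}{2}}$ is the Riesz potential of order $2-\alpha$ on $\mathbb{R}^2$: $(-\Delta)^{-\sigma/2}g(\mathbf{x})=\frac{1}{\gamma_2(\sigma)}\int_{\mathbb{R}^2}\frac{g(\mathbf{x}-\mathbf{y})}{|\mathbf{y}|^{2-\sigma}}d\mathbf{y}$, $\gamma_2(\sigma)=2^\sigma\pi\Gamma(\sigma/2)/\Gamma((2-\sigma)/2)$, $\sigma=2-\alpha$, applied componentwise to vector functions extended by zero outside $\Omega$, and restricted to $\Omega$. For $\tilde v=\omega^{\alpha/2}\sum_{l,n,\mu}a_{l,n,\mu}\mathcal{V}_{l,\mu}P_n^{(\alpha/2,l)}(\rho)$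 in a space $\mathcal{H}^s_{\alpha/2}(\Omega)$, $\nabla\tilde v$ and $(-\Delta)^{\frac{\alpha-2}{2}}\nabla\tilde v$ are obtained by applying $\nabla$ and $(-\Delta)^{\frac{\alpha-2}{2}}$ term by term to the basis series. If $\tilde u\in\mathcal{H}^1_{\alpha/2}(\Omega)$ then $\nabla\tilde u=\omega^{\alpha/2-1}U$ with $U\in(L^2_{\alpha/2-1}(\Omega))^2$, and if $\tilde v\in\mathcal{H}^{\alpha-1}_{\alpha/2}(\Omega)$ then $V:=(-\Delta)^{\frac{\alpha-2}{2}}\nabla\tilde v\in(L^2_{\alpha/2-1}(\Omega))^2$; thus $B(\tilde u,\tilde v)=\int_\Omega\omega^{\alpha/2-1}KU\cdot V\,d\Omega$. For $\tilde v=\omega^{\alpha/2}v$, $F(\tilde v)=(f,\tilde v)$ is the $L^2_{\alpha/2}$-duality pairing $\langle f,v\rangle$ between $H^{-(\alpha-1)}_{\alpha/2}(\Omega)$ and $H^{\alpha-1}_{\alpha/2}(\Omega)$ (equal to $\int_\Omega f\tilde v\,d\Omega$ for $f\in L^2_{\alpha/2}(\Omega)$). *)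

theory Defs
  imports "HOL-Analysis.Analysis"
begin

definition disk :: "(real^2) set" where
  "disk = ball 0 1"

definition weight :: "real \<Rightarrow> real^2 \<Rightarrow> real" where
  "weight \<gamma> x = (if x \<in> disk then (1 - (norm x)\<^sup>2) powr \<gamma> else 0)"

text \<open>
  Elements of the Lebesgue spaces on the disk are represented by functions on the plane whose
  values outside the disk are irrelevant; equality in these spaces is equality almost
  everywhere on the disk.
\<close>

definition Linfty :: "(real^2 \<Rightarrow> real) set" where
  "Linfty = {g \<in> borel_measurable (lebesgue_on disk).
               \<exists>C. AE x in lebesgue_on disk. \<bar>g x\<bar> \<le> C}"

definition L2 :: "real \<Rightarrow> (real^2 \<Rightarrow> 'b::euclidean_space) set" where
  "L2 \<gamma> = {g \<in> borel_measurable (lebesgue_on disk).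
             integrable (lebesgue_on disk) (\<lambda>x. weight \<gamma> x * (g x \<bullet> g x))}"

definition L2_inner :: "real \<Rightarrow> (real^2 \<Rightarrow> 'b::euclidean_space) \<Rightarrow> (real^2 \<Rightarrow> 'b) \<Rightarrow> real" where
  "L2_inner \<gamma> f g = (LINT x|lebesgue_on disk. weight \<gamma> x * (f x \<bullet> g x))"

definition L2_norm :: "real \<Rightarrow> (real^2 \<Rightarrow> 'b::euclidean_space) \<Rightarrow> real" where
  "L2_norm \<gamma> g = sqrt (L2_inner \<gamma> g g)"

text \<open>Unconditional convergence of a series in the weighted space.\<close>

definition L2_has_sum ::
    "real \<Rightarrow> ('i \<Rightarrow> real^2 \<Rightarrow> 'b::euclidean_space) \<Rightarrow> 'i set \<Rightarrow> (real^2 \<Rightarrow> 'b) \<Rightarrow> bool" where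
  "L2_has_sum \<gamma> f J g \<longleftrightarrow>
     (\<forall>i\<in>J. f i \<in> L2 \<gamma>) \<and> g \<in> L2 \<gamma> \<and>
     ((\<lambda>S. L2_norm \<gamma> (\<lambda>x. g x - (\<Sum>i\<in>S. f i x))) \<longlongrightarrow> 0) (finite_subsets_at_top J)"

definition jacobi :: "nat \<Rightarrow> real \<Rightarrow> real \<Rightarrow> real \<Rightarrow> real" where
  "jacobi n a b t =
     (\<Sum>k\<le>n. ((real n + a) gchoose (n - k)) * ((real n + b) gchoose k)
             * ((t - 1) / 2) ^ k * ((t + 1) / 2) ^ (n - k))"

definition polar_angle :: "real^2 \<Rightarrow> real" where
  "polar_angle x = Arg (Complex (x $ 1) (x $ 2))"

definition harmonic :: "nat \<Rightarrow> int \<Rightarrow> real^2 \<Rightarrow> real" where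
  "harmonic l \<mu> x =
     (if l = 0 then 1 / 2
      else if \<mu> = 1 then norm x ^ l * cos (real l * polar_angle x)
      else norm x ^ l * sin (real l * polar_angle x))"

type_synonym index = "nat \<times> nat \<times> int"

definition indices :: "index set" where
  "indices = {(l, n, \<mu>). \<mu> \<in> {1, -1} \<and> (l, \<mu>) \<noteq> (0, -1)}"

definition basis :: "real \<Rightarrow> index \<Rightarrow> real^2 \<Rightarrow> real" where
  "basis \<gamma> = (\<lambda>(l, n, \<mu>) x. harmonic l \<mu> x * jacobi n \<gamma> (real l) (2 * (norm x)\<^sup>2 - 1))"

text \<open>
  For arbitrary real \<open>s\<close>, the elements of the space of order \<open>s\<close> are (formal) series in the
  basis functions, represented by their coefficient families.
\<close>

definition series :: "(index \<Rightarrow> real) set" where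
  "series = {a. \<forall>i. i \<notin> indices \<longrightarrow> a i = 0}"

definition H_term :: "real \<Rightarrow> real \<Rightarrow> (index \<Rightarrow> real) \<Rightarrow> index \<Rightarrow> real" where
  "H_term \<gamma> s a = (\<lambda>(l, n, \<mu>). (real n + 1) powr s * (real n + real l + 1) powr s
                      * (a (l, n, \<mu>))\<^sup>2 * (L2_norm \<gamma> (basis \<gamma> (l, n, \<mu>)))\<^sup>2)"

definition H_series :: "real \<Rightarrow> real \<Rightarrow> (index \<Rightarrow> real) set" where
  "H_series \<gamma> s = {a \<in> series. H_term \<gamma> s a summable_on indices}"

definition H_norm :: "real \<Rightarrow> real \<Rightarrow> (index \<Rightarrow> real) \<Rightarrow> real" where
  "H_norm \<gamma> s a = sqrt (\<Sum>\<^sub>\<infinity>i\<in>indices. H_term \<gamma> s a i)"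

definition pairing :: "real \<Rightarrow> (index \<Rightarrow> real) \<Rightarrow> (index \<Rightarrow> real) \<Rightarrow> real" where
  "pairing \<gamma> a b = (\<Sum>\<^sub>\<infinity>i\<in>indices. a i * b i * (L2_norm \<gamma> (basis \<gamma> i))\<^sup>2)"

text \<open>
  For \<open>s \<ge> 0\<close> the series converge in \<open>L2 \<gamma>\<close>, and the following spaces consist of their sums
  (respectively of the sums multiplied by the weight).
\<close>

definition expansion :: "real \<Rightarrow> (index \<Rightarrow> real) \<Rightarrow> (real^2 \<Rightarrow> real) \<Rightarrow> bool" where
  "expansion \<gamma> a v \<longleftrightarrow> a \<in> series \<and> L2_has_sum \<gamma> (\<lambda>i x. a i * basis \<gamma> i x) indices v"

definition H_space :: "real \<Rightarrow> real \<Rightarrow> (real^2 \<Rightarrow> real) set" where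
  "H_space \<gamma> s = {v. \<exists>a \<in> H_series \<gamma> s. expansion \<gamma> a v}"

definition wH_space :: "real \<Rightarrow> real \<Rightarrow> (real^2 \<Rightarrow> real) set" where
  "wH_space \<beta> s = (\<lambda>v x. weight \<beta> x * v x) ` H_space \<beta> s"

text \<open>The coefficients of \<open>v\<close>, where \<open>u = weight \<beta> * v\<close>.\<close>

definition coeffs :: "real \<Rightarrow> (real^2 \<Rightarrow> real) \<Rightarrow> index \<Rightarrow> real" where
  "coeffs \<beta> u = (THE a. expansion \<beta> a (\<lambda>x. u x / weight \<beta> x))"

definition wH_norm :: "real \<Rightarrow> real \<Rightarrow> (real^2 \<Rightarrow> real) \<Rightarrow> real" where
  "wH_norm \<beta> s u = H_norm \<beta> s (coeffs \<beta> u)"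

definition gradient :: "(real^2 \<Rightarrow> real) \<Rightarrow> real^2 \<Rightarrow> real^2" where
  "gradient g x = (THE D. GDERIV g x :> D)"

definition riesz_potential :: "real \<Rightarrow> (real^2 \<Rightarrow> real) \<Rightarrow> real^2 \<Rightarrow> real" where
  "riesz_potential \<sigma> g x =
     1 / (2 powr \<sigma> * pi * Gamma (\<sigma> / 2) / Gamma ((2 - \<sigma>) / 2))
     * (LINT y|lebesgue. g (x - y) / norm y powr (2 - \<sigma>))"

definition riesz_potential_vec :: "real \<Rightarrow> (real^2 \<Rightarrow> real^2) \<Rightarrow> real^2 \<Rightarrow> real^2" where
  "riesz_potential_vec \<sigma> G x = (\<chi> j. riesz_potential \<sigma> (\<lambda>y. G y $ j) x)"

definition grad_wbasis :: "real \<Rightarrow> index \<Rightarrow> real^2 \<Rightarrow> real^2" where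
  "grad_wbasis \<beta> i x =
     (if x \<in> disk then gradient (\<lambda>y. weight \<beta> y * basis \<beta> i y) x else 0)"

text \<open>
  With \<open>\<beta> = \<alpha> / 2\<close>, the fields \<open>U\<close> (where the gradient of \<open>u\<close> is \<open>weight (\<beta> - 1) * U\<close>) and
  \<open>V\<close> (the Riesz potential of order \<open>2 - \<alpha>\<close> of the gradient of \<open>v\<close>), obtained term by term
  from the basis series.  The sums are taken in \<open>L2 (\<beta> - 1)\<close>, hence determined only up to
  null sets, which does not affect the bilinear form.
\<close>

definition grad_field :: "real \<Rightarrow> (real^2 \<Rightarrow> real) \<Rightarrow> real^2 \<Rightarrow> real^2" where
  "grad_field \<alpha> u = (SOME U. L2_has_sum (\<alpha> / 2 - 1)
     (\<lambda>i x. coeffs (\<alpha> / 2) u i *\<^sub>R (grad_wbasis (\<alpha> / 2) i x /\<^sub>R weight (\<alpha> / 2 - 1) x))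
     indices U)"

definition riesz_grad_field :: "real \<Rightarrow> (real^2 \<Rightarrow> real) \<Rightarrow> real^2 \<Rightarrow> real^2" where
  "riesz_grad_field \<alpha> v = (SOME V. L2_has_sum (\<alpha> / 2 - 1)
     (\<lambda>i x. coeffs (\<alpha> / 2) v i *\<^sub>R riesz_potential_vec (2 - \<alpha>) (grad_wbasis (\<alpha> / 2) i) x)
     indices V)"

definition B_form ::
    "real \<Rightarrow> (real^2 \<Rightarrow> real^2^2) \<Rightarrow> (real^2 \<Rightarrow> real) \<Rightarrow> (real^2 \<Rightarrow> real) \<Rightarrow> real" where
  "B_form \<alpha> K u v =
     L2_inner (\<alpha> / 2 - 1) (\<lambda>x. K x *v grad_field \<alpha> u x) (riesz_grad_field \<alpha> v)"

definition F_form :: "real \<Rightarrow> (index \<Rightarrow> real) \<Rightarrow> (real^2 \<Rightarrow> real) \<Rightarrow> real" where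
  "F_form \<alpha> f v = pairing (\<alpha> / 2) f (coeffs (\<alpha> / 2) v)"

text \<open>The supremum is taken in the extended reals, so that no boundedness is presupposed.\<close>

definition inf_sup_constant :: "real \<Rightarrow> (real^2 \<Rightarrow> real^2^2) \<Rightarrow> real \<Rightarrow> bool" where
  "inf_sup_constant \<alpha> K C \<longleftrightarrow> C > 0 \<and>
     (\<forall>w \<in> wH_space (\<alpha> / 2) 1.
        (SUP z \<in> {z \<in> wH_space (\<alpha> / 2) (\<alpha> - 1). \<not> (AE x in lebesgue_on disk. z x = 0)}.
           ereal (\<bar>B_form \<alpha> K w z\<bar> / wH_norm (\<alpha> / 2) (\<alpha> - 1) z))
        \<ge> ereal (C * wH_norm (\<alpha> / 2) 1 w))"

end

theory Submission
  imports Defs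
begin

text \<open>
  Put \<open>\<beta> = \<alpha> / 2\<close>.  In complex notation the gradient of a weighted basis function, divided by
  \<open>weight (\<beta> - 1)\<close>, is the sum of two Zernike type fields, with angular factors \<open>exp (i (l + 1) \<phi>)\<close>
  and \<open>exp (- i (l - 1) \<phi>)\<close>; all these fields are orthogonal in \<open>L2 (\<beta> - 1)\<close>.  The Riesz potential
  multiplies each of them by a positive number, and the two multipliers that belong to one basis
  function have a ratio between \<open>\<beta>\<close> and \<open>1\<close>.  So the potential of the gradient \<open>G\<^sub>i\<close> of the \<open>i\<close>-th basis
  function is \<open>\<lambda>\<^sub>i (G\<^sub>i + W\<^sub>i)\<close>, where the \<open>W\<^sub>i\<close> are orthogonal and
  \<open>\<parallel>W\<^sub>i\<parallel> \<le> (1 - \<beta>) / (1 + \<beta>) \<parallel>G\<^sub>i\<parallel>\<close>.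
  
  After the coefficients of the test function are rescaled by the \<open>\<lambda>\<^sub>i\<close>, the form \<open>B\<close> becomes a bounded
  bilinear form on \<open>\<ell>\<^sup>2\<close> that is coercive with constant \<open>lam_m - lam_M (1 - \<beta>) / (1 + \<beta>)\<close>.  It is
  positive because \<open>sqrt (\<alpha> (2 + \<alpha>)) \<le> 2 + \<alpha>\<close>, and the Lax-Milgram lemma applies.  The size of \<open>\<lambda>\<^sub>i\<close>
  explains why \<open>B\<close> pairs the orders \<open>1\<close> and \<open>\<alpha> - 1\<close>.
\<close>

section \<open>Square integrable functions and orthogonal series\<close>

text \<open>The multipliers come from an explicit factorisation. In polar coordinates the m-th
  angular Fourier coefficient of the Riesz kernel is the kernel of a composition of two Abel
  transforms. One turns (1 - t)^(\<beta> - 1 + j) into (1 - \<tau>)^j, the other turns \<tau>^(m +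
  \<beta> - 1 + k) into R^(m + k), each up to a Pochhammer ratio. These ratios move the parameters
  in the endpoint expansions of Jacobi polynomials in such a way that the original polynomial
  reappears. The weight exponent for which this works, \<beta> - 1, is the one that differentiating
  \<open>weight \<beta>\<close> produces.

  The two fields of a gradient have degree n, frequency l + 1 and degree n + 1, frequency l - 1. Up
  to a common factor their multipliers are (\<beta> + n + l) / (n + l + 1) and (\<beta> + n) / (n +
  1), with values in [\<beta>, 1); hence the constant (1 - \<beta>) / (1 + \<beta>). For l = 0 the
  fields coincide and no perturbation arises.

  Relative to the basis function, the squared norm of a gradient grows like (n + 1) (n + l + 1), and
  \<open>lam\<close> like the power \<beta> - 1 of this; the test norm thus has exponent 2 (\<beta>
  - 1) + 1 = \<alpha> - 1.\<close>

definition sq_int :: "'a measure \<Rightarrow> ('a \<Rightarrow> 'b::euclidean_space) set" where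
  "sq_int M = {f \<in> borel_measurable M. integrable M (\<lambda>x. f x \<bullet> f x)}"

definition sq_inner :: "'a measure \<Rightarrow> ('a \<Rightarrow> 'b::euclidean_space) \<Rightarrow> ('a \<Rightarrow> 'b) \<Rightarrow> real" where
  "sq_inner M f g = (LINT x|M. f x \<bullet> g x)"

definition sq_norm :: "'a measure \<Rightarrow> ('a \<Rightarrow> 'b::euclidean_space) \<Rightarrow> real" where
  "sq_norm M f = sqrt (sq_inner M f f)"

lemma sq_int_measurable: "f \<in> sq_int M \<Longrightarrow> f \<in> borel_measurable M"
  by (simp add: sq_int_def)

lemma sq_int_integrable:
  assumes "f \<in> sq_int M" "g \<in> sq_int M"
  shows "integrable M (\<lambda>x. f x \<bullet> g x)"
proof (rule Bochner_Integration.integrable_bound)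
  have [measurable]: "f \<in> borel_measurable M" "g \<in> borel_measurable M" using assms by (auto simp: sq_int_def)
  show "integrable M (\<lambda>x. f x \<bullet> f x + g x \<bullet> g x)" using assms by (auto simp: sq_int_def)
  show "(\<lambda>x. f x \<bullet> g x) \<in> borel_measurable M" by measurable
  show "AE x in M. norm (f x \<bullet> g x) \<le> norm (f x \<bullet> f x + g x \<bullet> g x)"
  proof (rule AE_I2)
    fix x
    have "\<bar>f x \<bullet> g x\<bar> \<le> norm (f x) * norm (g x)" by (rule Cauchy_Schwarz_ineq2)
    also have "\<dots> \<le> (norm (f x))\<^sup>2 + (norm (g x))\<^sup>2"
      using sum_squares_bound [of "norm (f x)" "norm (g x)"] mult_nonneg_nonneg [OF norm_ge_zero [of "f x"] norm_ge_zero [of "g x"]]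
      by linarith
    finally show "norm (f x \<bullet> g x) \<le> norm (f x \<bullet> f x + g x \<bullet> g x)" by (simp add: power2_norm_eq_inner)
  qed
qed

lemma sq_int_add: "f \<in> sq_int M \<Longrightarrow> g \<in> sq_int M \<Longrightarrow> (\<lambda>x. f x + g x) \<in> sq_int M"
  using sq_int_integrable [of f M g] sq_int_integrable [of g M f]
  by (auto simp: sq_int_def inner_add_left inner_add_right)

lemma sq_int_scaleR: "f \<in> sq_int M \<Longrightarrow> (\<lambda>x. c *\<^sub>R f x) \<in> sq_int M"
  by (auto simp: sq_int_def)

lemma sq_int_zero: "(\<lambda>x. 0) \<in> sq_int M"
  by (simp add: sq_int_def)

lemma sq_int_diff: "f \<in> sq_int M \<Longrightarrow> g \<in> sq_int M \<Longrightarrow> (\<lambda>x. f x - g x) \<in> sq_int M"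
  using sq_int_add [of f M "\<lambda>x. (-1) *\<^sub>R g x"] sq_int_scaleR [of g M "-1"] by simp

lemma sq_int_sum: "(\<And>i. i \<in> S \<Longrightarrow> f i \<in> sq_int M) \<Longrightarrow> (\<lambda>x. \<Sum>i\<in>S. f i x) \<in> sq_int M"
  by (induction S rule: infinite_finite_induct) (auto simp: sq_int_zero sq_int_add)

lemma sq_inner_commute: "sq_inner M f g = sq_inner M g f"
  by (simp add: sq_inner_def inner_commute)

lemma sq_inner_add_left:
  "f \<in> sq_int M \<Longrightarrow> g \<in> sq_int M \<Longrightarrow> h \<in> sq_int M \<Longrightarrow> sq_inner M (\<lambda>x. f x + g x) h = sq_inner M f h + sq_inner M g h"
  by (simp add: sq_inner_def inner_add_left sq_int_integrable)

lemma sq_inner_add_right: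
  "f \<in> sq_int M \<Longrightarrow> g \<in> sq_int M \<Longrightarrow> h \<in> sq_int M \<Longrightarrow> sq_inner M h (\<lambda>x. f x + g x) = sq_inner M h f + sq_inner M h g"
  by (simp add: sq_inner_def inner_add_right sq_int_integrable)

lemma sq_inner_diff_right:
  "f \<in> sq_int M \<Longrightarrow> g \<in> sq_int M \<Longrightarrow> h \<in> sq_int M \<Longrightarrow> sq_inner M h (\<lambda>x. f x - g x) = sq_inner M h f - sq_inner M h g"
  by (simp add: sq_inner_def inner_diff_right sq_int_integrable)

lemma sq_inner_diff_left:
  "f \<in> sq_int M \<Longrightarrow> g \<in> sq_int M \<Longrightarrow> h \<in> sq_int M \<Longrightarrow> sq_inner M (\<lambda>x. f x - g x) h = sq_inner M f h - sq_inner M g h"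
  by (simp add: sq_inner_def inner_diff_left sq_int_integrable)

lemma sq_inner_scaleR_left: "sq_inner M (\<lambda>x. c *\<^sub>R f x) g = c * sq_inner M f g"
  by (simp add: sq_inner_def)

lemma sq_inner_scaleR_right: "sq_inner M f (\<lambda>x. c *\<^sub>R g x) = c * sq_inner M f g"
  by (simp add: sq_inner_def)

lemma sq_inner_sum_right:
  assumes "\<And>i. i \<in> S \<Longrightarrow> f i \<in> sq_int M" "h \<in> sq_int M"
  shows "sq_inner M h (\<lambda>x. \<Sum>i\<in>S. f i x) = (\<Sum>i\<in>S. sq_inner M h (f i))"
  unfolding sq_inner_def inner_sum_right
  using assms by (intro Bochner_Integration.integral_sum sq_int_integrable)

lemma sq_inner_self_nonneg: "sq_inner M f f \<ge> 0"
  by (simp add: sq_inner_def integral_nonneg_AE)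

lemma sq_norm_nonneg: "sq_norm M f \<ge> 0"
  by (simp add: sq_norm_def sq_inner_self_nonneg)

lemma sq_norm_power2: "(sq_norm M f)\<^sup>2 = sq_inner M f f"
  by (simp add: sq_norm_def sq_inner_self_nonneg)

lemma sq_norm_scaleR: "sq_norm M (\<lambda>x. c *\<^sub>R f x) = \<bar>c\<bar> * sq_norm M f"
  by (simp add: sq_norm_def sq_inner_scaleR_left sq_inner_scaleR_right real_sqrt_mult)

lemma sq_norm_minus_commute: "sq_norm M (\<lambda>x. f x - g x) = sq_norm M (\<lambda>x. g x - f x)"
  using sq_norm_scaleR [of M "-1" "\<lambda>x. f x - g x"] by simp

text \<open>The quadratic polynomial t |-> ||f - t g||^2 is nonnegative. Its minimum gives the
  inequality; if its leading coefficient vanishes, the linear one must vanish as well.\<close>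

lemma sq_inner_Cauchy_Schwarz:
  assumes f: "f \<in> sq_int M" and g: "g \<in> sq_int M"
  shows "\<bar>sq_inner M f g\<bar> \<le> sq_norm M f * sq_norm M g"
proof -
  let ?A = "sq_inner M g g" and ?B = "sq_inner M f g" and ?C = "sq_inner M f f"
  have q: "0 \<le> ?C - 2 * t * ?B + t\<^sup>2 * ?A" for t
  proof -
    have g': "(\<lambda>x. t *\<^sub>R g x) \<in> sq_int M" using g by (rule sq_int_scaleR)
    have "0 \<le> sq_inner M (\<lambda>x. f x - t *\<^sub>R g x) (\<lambda>x. f x - t *\<^sub>R g x)" by (rule sq_inner_self_nonneg)
    also have "\<dots> = ?C - t * ?B - (t * sq_inner M g f - t * (t * ?A))"
      using f g g' by (simp add: sq_inner_diff_left sq_inner_diff_right sq_int_diff sq_inner_scaleR_left sq_inner_scaleR_right algebra_simps)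
    finally show ?thesis by (simp add: sq_inner_commute [of M g f] power2_eq_square algebra_simps)
  qed
  have "?B\<^sup>2 \<le> ?C * ?A"
  proof (cases "?A = 0")
    case True
    have "?B = 0"
    proof (rule ccontr)
      assume "?B \<noteq> 0"
      \<comment> \<open>At this t the expression in \<open>q\<close> equals - \<open>?C\<close> - 2,
        which is negative.\<close>
      then show False using q [of "(?C + 1) / ?B"] True sq_inner_self_nonneg [of M f] by simp
    qed
    then show ?thesis using True by simp
  next
    case False
    then have "?A > 0" using sq_inner_self_nonneg [of M g] by simp
    then show ?thesis using q [of "?B / ?A"] by (simp add: power2_eq_square field_simps)
  qed
  also have "\<dots> = (sq_norm M f * sq_norm M g)\<^sup>2" by (simp add: power_mult_distrib sq_norm_power2)
  finally show ?thesis
    by (metis abs_le_square_iff abs_of_nonneg mult_nonneg_nonneg sq_norm_nonneg)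
qed

lemma sq_norm_triangle:
  assumes f: "f \<in> sq_int M" and g: "g \<in> sq_int M"
  shows "sq_norm M (\<lambda>x. f x + g x) \<le> sq_norm M f + sq_norm M g"
proof (rule power2_le_imp_le)
  have "(sq_norm M (\<lambda>x. f x + g x))\<^sup>2 = sq_inner M f f + 2 * sq_inner M f g + sq_inner M g g"
    using f g by (simp add: sq_norm_power2 sq_inner_add_left sq_inner_add_right sq_int_add sq_inner_commute [of M g f])
  also have "\<dots> \<le> (sq_norm M f)\<^sup>2 + 2 * (sq_norm M f * sq_norm M g) + (sq_norm M g)\<^sup>2"
    using sq_inner_Cauchy_Schwarz [OF f g] by (simp add: sq_norm_power2)
  also have "\<dots> = (sq_norm M f + sq_norm M g)\<^sup>2" by (simp add: power2_eq_square algebra_simps)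
  finally show "(sq_norm M (\<lambda>x. f x + g x))\<^sup>2 \<le> (sq_norm M f + sq_norm M g)\<^sup>2" .
qed (simp add: sq_norm_nonneg)

lemma sq_norm_triangle_diff:
  assumes "f \<in> sq_int M" "g \<in> sq_int M" "h \<in> sq_int M"
  shows "sq_norm M (\<lambda>x. f x - h x) \<le> sq_norm M (\<lambda>x. f x - g x) + sq_norm M (\<lambda>x. g x - h x)"
  using sq_norm_triangle [of "\<lambda>x. f x - g x" M "\<lambda>x. g x - h x"] assms by (simp add: sq_int_diff)

lemma sq_norm_eq_0_AE:
  assumes f: "f \<in> sq_int M" and "sq_norm M f = 0"
  shows "AE x in M. f x = 0"
proof -
  have "(LINT x|M. f x \<bullet> f x) = 0"
    using assms(2) sq_norm_power2 [of M f] by (simp add: sq_inner_def)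
  then have "AE x in M. f x \<bullet> f x = 0"
    using sq_int_integrable [OF f f] by (subst (asm) integral_nonneg_eq_0_iff_AE) auto
  then show ?thesis by simp
qed

section \<open>Completeness in mean square\<close>

lemma nn_integral_sq_norm:
  assumes "f \<in> sq_int M"
  shows "(\<integral>\<^sup>+x. ennreal (f x \<bullet> f x) \<partial>M) = ennreal ((sq_norm M f)\<^sup>2)"
  unfolding sq_norm_power2 sq_inner_def
  using sq_int_integrable [OF assms assms] by (intro nn_integral_eq_integral) auto

text \<open>Riesz-Fischer for geometrically small steps: the steps are summable almost everywhere,
  the pointwise limit exists there, and Fatou's lemma transfers the tail bound to it.\<close>

lemma sq_int_complete:
  fixes f :: "nat \<Rightarrow> 'a \<Rightarrow> 'b::euclidean_space"
  assumes f: "\<And>n. f n \<in> sq_int M"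
    and diff: "\<And>n. sq_norm M (\<lambda>x. f (Suc n) x - f n x) \<le> (1 / 2) ^ n"
  shows "\<exists>g \<in> sq_int M. \<forall>n. sq_norm M (\<lambda>x. g x - f n x) \<le> 2 * (1 / 2) ^ n"
proof -
  have [measurable]: "f n \<in> borel_measurable M" for n using f by (rule sq_int_measurable)
  define d where "d n x = f (Suc n) x - f n x" for n x
  have d: "d n \<in> sq_int M" for n unfolding d_def by (intro sq_int_diff f)
  have [measurable]: "d n \<in> borel_measurable M" for n unfolding d_def by measurable
  \<comment> \<open>The factor 2^n leaves a convergent series, since the squared steps decay like
    4^(-n). Finiteness then yields the pointwise rate \<open>sqrt (1 / 2) ^ n\<close>, which is
    summable.\<close>
  have "(\<integral>\<^sup>+x. (\<Sum>n. ennreal (2 ^ n * (d n x \<bullet> d n x))) \<partial>M) = (\<Sum>n. \<integral>\<^sup>+x. ennreal (2 ^ n * (d n x \<bullet> d n x)) \<partial>M)"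
    by (rule nn_integral_suminf) measurable
  also have "\<dots> \<le> (\<Sum>n. ennreal ((1 / 2) ^ n))"
  proof (rule suminf_le)
    fix n
    have "(\<integral>\<^sup>+x. ennreal (2 ^ n * (d n x \<bullet> d n x)) \<partial>M) = ennreal (2 ^ n) * (\<integral>\<^sup>+x. ennreal (d n x \<bullet> d n x) \<partial>M)"
      by (subst nn_integral_cmult [symmetric]) (auto simp: ennreal_mult)
    also have "\<dots> = ennreal (2 ^ n * (sq_norm M (d n))\<^sup>2)"
      by (simp add: nn_integral_sq_norm [OF d] ennreal_mult)
    also have "\<dots> \<le> ennreal (2 ^ n * ((1 / 2) ^ n)\<^sup>2)"
      using diff [of n] unfolding d_def by (intro ennreal_leI mult_left_mono power_mono) (auto simp: sq_norm_nonneg)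
    also have "2 ^ n * ((1 / 2) ^ n)\<^sup>2 = ((1 / 2) ^ n :: real)"
      by (simp add: power2_eq_square flip: power_mult_distrib)
    finally show "(\<integral>\<^sup>+x. ennreal (2 ^ n * (d n x \<bullet> d n x)) \<partial>M) \<le> ennreal ((1 / 2) ^ n)" .
  qed auto
  also have "\<dots> = ennreal (\<Sum>n. (1 / 2) ^ n)"
    by (intro suminf_ennreal2 summable_geometric) auto
  also have "\<dots> < \<infinity>" by simp
  finally have "(\<integral>\<^sup>+x. (\<Sum>n. ennreal (2 ^ n * (d n x \<bullet> d n x))) \<partial>M) \<noteq> \<infinity>" by simp
  then have "AE x in M. (\<Sum>n. ennreal (2 ^ n * (d n x \<bullet> d n x))) \<noteq> \<infinity>"
    by (intro nn_integral_PInf_AE) auto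
  then have conv: "AE x in M. convergent (\<lambda>n. f n x)"
  proof eventually_elim
    case (elim x)
    define E where "E n = ennreal (2 ^ n * (d n x \<bullet> d n x))" for n
    define C where "C = enn2real (suminf E)"
    have fin: "suminf E < top" using elim by (simp only: E_def [abs_def] less_top infinity_ennreal_def)
    have bound: "norm (d n x) \<le> sqrt C * sqrt (1 / 2) ^ n" for n
    proof -
      have "E n \<le> suminf E"
        using sum_le_suminf [OF summableI, of "{n}" E] by simp
      also have "\<dots> = ennreal C" unfolding C_def using fin by simp
      finally have "ennreal (2 ^ n * (d n x \<bullet> d n x)) \<le> ennreal C" unfolding E_def .
      then have "2 ^ n * (norm (d n x))\<^sup>2 \<le> C"
        unfolding power2_norm_eq_inner by (subst (asm) ennreal_le_iff) (simp_all add: C_def)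
      then have "(norm (d n x))\<^sup>2 \<le> C * (1 / 2) ^ n" by (simp add: field_simps power_divide)
      then have "norm (d n x) \<le> sqrt (C * (1 / 2) ^ n)" by (rule real_le_rsqrt)
      then show ?thesis by (simp add: real_sqrt_mult real_sqrt_power)
    qed
    have "summable (\<lambda>n. d n x)"
      by (rule summable_comparison_test' [OF summable_mult [OF summable_geometric [of "sqrt (1 / 2)"]] bound])
         (simp add: real_sqrt_divide)
    then have "(\<lambda>n. (\<Sum>k<n. d k x) + f 0 x) \<longlonglongrightarrow> suminf (\<lambda>n. d n x) + f 0 x"
      by (intro tendsto_intros summable_LIMSEQ)
    moreover have "(\<Sum>k<n. d k x) + f 0 x = f n x" for n
      unfolding d_def by (subst sum_lessThan_telescope) simp
    ultimately show ?case by (auto simp: convergent_def)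
  qed
  define g where "g x = lim (\<lambda>n. f n x)" for x
  have g_meas [measurable]: "g \<in> borel_measurable M" unfolding g_def by measurable
  have lim: "AE x in M. (\<lambda>n. f n x) \<longlonglongrightarrow> g x"
    using conv by eventually_elim (simp add: g_def convergent_LIMSEQ_iff)
  have tail: "sq_norm M (\<lambda>x. f (n + k) x - f n x) \<le> 2 * (1 / 2) ^ n" for n k
  proof -
    have "sq_norm M (\<lambda>x. f (n + k) x - f n x) \<le> (\<Sum>j<k. (1 / 2) ^ (n + j))"
    proof (induction k)
      case 0
      then show ?case by (simp add: sq_norm_def sq_inner_def)
    next
      case (Suc k)
      have "sq_norm M (\<lambda>x. f (n + Suc k) x - f n x) \<le> sq_norm M (\<lambda>x. f (Suc (n + k)) x - f (n + k) x) + sq_norm M (\<lambda>x. f (n + k) x - f n x)"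
        using sq_norm_triangle_diff [OF f f f] by simp
      also have "\<dots> \<le> (1 / 2) ^ (n + k) + (\<Sum>j<k. (1 / 2) ^ (n + j))" by (intro add_mono diff Suc)
      finally show ?case by simp
    qed
    also have "\<dots> = (1 / 2) ^ n * (\<Sum>j<k. (1 / 2) ^ j)" by (simp add: sum_distrib_left power_add)
    also have "\<dots> \<le> (1 / 2) ^ n * (\<Sum>j. (1 / 2) ^ j)"
      by (intro mult_left_mono sum_le_suminf summable_geometric) auto
    also have "(\<Sum>j. (1 / 2) ^ j) = (2::real)" by (subst suminf_geometric) auto
    finally show ?thesis by simp
  qed
  \<comment> \<open>Fatou's lemma along f (n + k) for growing k. The bound is stated for the
    nonnegative integral because integrability of g - f n is only deduced from it.\<close>
  have nn: "(\<integral>\<^sup>+x. ennreal ((g x - f n x) \<bullet> (g x - f n x)) \<partial>M) \<le> ennreal ((2 * (1 / 2) ^ n)\<^sup>2)" for n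
  proof -
    have "(\<integral>\<^sup>+x. ennreal ((g x - f n x) \<bullet> (g x - f n x)) \<partial>M) = (\<integral>\<^sup>+x. liminf (\<lambda>k. ennreal ((f (n + k) x - f n x) \<bullet> (f (n + k) x - f n x))) \<partial>M)"
    proof (rule nn_integral_cong_AE)
      show "AE x in M. ennreal ((g x - f n x) \<bullet> (g x - f n x)) = liminf (\<lambda>k. ennreal ((f (n + k) x - f n x) \<bullet> (f (n + k) x - f n x)))"
        using lim
      proof eventually_elim
        case (elim x)
        from LIMSEQ_ignore_initial_segment [OF this, of n] have "(\<lambda>k. f (n + k) x) \<longlonglongrightarrow> g x" by (simp add: add.commute)
        then have "(\<lambda>k. ennreal ((f (n + k) x - f n x) \<bullet> (f (n + k) x - f n x))) \<longlonglongrightarrow> ennreal ((g x - f n x) \<bullet> (g x - f n x))"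
          by (intro tendsto_intros)
        then show ?case by (intro lim_imp_Liminf [symmetric]) auto
      qed
    qed
    also have "\<dots> \<le> liminf (\<lambda>k. \<integral>\<^sup>+x. ennreal ((f (n + k) x - f n x) \<bullet> (f (n + k) x - f n x)) \<partial>M)"
      by (rule nn_integral_liminf) measurable
    also have "\<dots> \<le> liminf (\<lambda>k::nat. ennreal ((2 * (1 / 2) ^ n)\<^sup>2))"
    proof (intro Liminf_mono always_eventually allI)
      fix k
      have "(\<integral>\<^sup>+x. ennreal ((f (n + k) x - f n x) \<bullet> (f (n + k) x - f n x)) \<partial>M) = ennreal ((sq_norm M (\<lambda>x. f (n + k) x - f n x))\<^sup>2)"
        by (intro nn_integral_sq_norm sq_int_diff f)
      also have "\<dots> \<le> ennreal ((2 * (1 / 2) ^ n)\<^sup>2)"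
        by (intro ennreal_leI power_mono tail sq_norm_nonneg)
      finally show "(\<integral>\<^sup>+x. ennreal ((f (n + k) x - f n x) \<bullet> (f (n + k) x - f n x)) \<partial>M) \<le> ennreal ((2 * (1 / 2) ^ n)\<^sup>2)" .
    qed
    also have "\<dots> = ennreal ((2 * (1 / 2) ^ n)\<^sup>2)" by (simp add: Liminf_const)
    finally show ?thesis .
  qed
  have gf: "(\<lambda>x. g x - f n x) \<in> sq_int M" for n
  proof -
    have "(\<integral>\<^sup>+x. ennreal (norm ((g x - f n x) \<bullet> (g x - f n x))) \<partial>M) < \<infinity>"
      using nn [of n] by (simp add: le_less_trans)
    then show ?thesis
      unfolding sq_int_def by (auto intro!: integrableI_bounded)
  qed
  have "g \<in> sq_int M"
    using sq_int_add [OF gf [of 0] f [of 0]] by simp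
  moreover have "sq_norm M (\<lambda>x. g x - f n x) \<le> 2 * (1 / 2) ^ n" for n
  proof (rule power2_le_imp_le)
    have "ennreal ((sq_norm M (\<lambda>x. g x - f n x))\<^sup>2) \<le> ennreal ((2 * (1 / 2) ^ n)\<^sup>2)"
      using nn [of n] by (simp only: nn_integral_sq_norm [OF gf])
    then show "(sq_norm M (\<lambda>x. g x - f n x))\<^sup>2 \<le> (2 * (1 / 2) ^ n)\<^sup>2"
      by (subst (asm) ennreal_le_iff) auto
  qed simp
  ultimately show ?thesis by blast
qed

section \<open>Unconditionally convergent series in mean square\<close>

definition sq_has_sum :: "'a measure \<Rightarrow> ('i \<Rightarrow> 'a \<Rightarrow> 'b::euclidean_space) \<Rightarrow> 'i set \<Rightarrow> ('a \<Rightarrow> 'b) \<Rightarrow> bool" where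
  "sq_has_sum M f J g \<longleftrightarrow> (\<forall>i\<in>J. f i \<in> sq_int M) \<and> g \<in> sq_int M \<and>
     ((\<lambda>S. sq_norm M (\<lambda>x. g x - (\<Sum>i\<in>S. f i x))) \<longlongrightarrow> 0) (finite_subsets_at_top J)"

text \<open>Cauchy-Schwarz makes the pairing with a fixed h continuous, so it may be applied term by
  term.\<close>

lemma sq_has_sum_inner:
  assumes g: "sq_has_sum M f J g" and h: "h \<in> sq_int M"
  shows "((\<lambda>i. sq_inner M h (f i)) has_sum sq_inner M h g) J"
proof -
  have f: "f i \<in> sq_int M" if "i \<in> J" for i using g that by (simp add: sq_has_sum_def)
  have g': "g \<in> sq_int M" and lim: "((\<lambda>S. sq_norm M (\<lambda>x. g x - (\<Sum>i\<in>S. f i x))) \<longlongrightarrow> 0) (finite_subsets_at_top J)"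
    using g by (auto simp: sq_has_sum_def)
  have "((\<lambda>S. (\<Sum>i\<in>S. sq_inner M h (f i)) - sq_inner M h g) \<longlongrightarrow> 0) (finite_subsets_at_top J)"
  proof (rule Lim_null_comparison)
    show "((\<lambda>S. sq_norm M h * sq_norm M (\<lambda>x. g x - (\<Sum>i\<in>S. f i x))) \<longlongrightarrow> 0) (finite_subsets_at_top J)"
      using tendsto_mult_right_zero [OF lim] .
    show "\<forall>\<^sub>F S in finite_subsets_at_top J. norm ((\<Sum>i\<in>S. sq_inner M h (f i)) - sq_inner M h g) \<le> sq_norm M h * sq_norm M (\<lambda>x. g x - (\<Sum>i\<in>S. f i x))"
    proof (rule eventually_finite_subsets_at_top_weakI)
      fix S assume S: "finite S" "S \<subseteq> J"
      have s: "(\<lambda>x. \<Sum>i\<in>S. f i x) \<in> sq_int M" using S f by (intro sq_int_sum) auto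
      have "(\<Sum>i\<in>S. sq_inner M h (f i)) - sq_inner M h g = - sq_inner M h (\<lambda>x. g x - (\<Sum>i\<in>S. f i x))"
        using S f h g' s by (simp add: sq_inner_diff_right sq_inner_sum_right subset_iff)
      then show "norm ((\<Sum>i\<in>S. sq_inner M h (f i)) - sq_inner M h g) \<le> sq_norm M h * sq_norm M (\<lambda>x. g x - (\<Sum>i\<in>S. f i x))"
        using sq_inner_Cauchy_Schwarz [OF h sq_int_diff [OF g' s]] by simp
    qed
  qed
  then show ?thesis unfolding has_sum_def by (subst (asm) LIM_zero_iff)
qed

lemma sq_has_sum_scaleR:
  assumes "sq_has_sum M f J g"
  shows "sq_has_sum M (\<lambda>i x. c *\<^sub>R f i x) J (\<lambda>x. c *\<^sub>R g x)"
proof -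
  have "((\<lambda>S. \<bar>c\<bar> * sq_norm M (\<lambda>x. g x - (\<Sum>i\<in>S. f i x))) \<longlongrightarrow> 0) (finite_subsets_at_top J)"
    using assms by (intro tendsto_mult_right_zero) (simp add: sq_has_sum_def)
  then show ?thesis
    using assms by (simp add: sq_has_sum_def sq_int_scaleR scaleR_diff_right [symmetric] scaleR_sum_right [symmetric] sq_norm_scaleR)
qed

lemma sq_has_sum_add:
  assumes f: "sq_has_sum M f J g" and f': "sq_has_sum M f' J g'"
  shows "sq_has_sum M (\<lambda>i x. f i x + f' i x) J (\<lambda>x. g x + g' x)"
proof -
  have "((\<lambda>S. sq_norm M (\<lambda>x. (g x + g' x) - (\<Sum>i\<in>S. f i x + f' i x))) \<longlongrightarrow> 0) (finite_subsets_at_top J)"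
  proof (rule Lim_null_comparison)
    show "((\<lambda>S. sq_norm M (\<lambda>x. g x - (\<Sum>i\<in>S. f i x)) + sq_norm M (\<lambda>x. g' x - (\<Sum>i\<in>S. f' i x))) \<longlongrightarrow> 0) (finite_subsets_at_top J)"
      using f f' by (intro tendsto_add_zero) (auto simp: sq_has_sum_def)
    show "\<forall>\<^sub>F S in finite_subsets_at_top J. norm (sq_norm M (\<lambda>x. (g x + g' x) - (\<Sum>i\<in>S. f i x + f' i x)))
        \<le> sq_norm M (\<lambda>x. g x - (\<Sum>i\<in>S. f i x)) + sq_norm M (\<lambda>x. g' x - (\<Sum>i\<in>S. f' i x))"
    proof (rule eventually_finite_subsets_at_top_weakI)
      fix S assume S: "finite S" "S \<subseteq> J"
      have "(\<lambda>x. g x - (\<Sum>i\<in>S. f i x)) \<in> sq_int M" "(\<lambda>x. g' x - (\<Sum>i\<in>S. f' i x)) \<in> sq_int M"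
        using S f f' by (auto simp: sq_has_sum_def subset_iff intro!: sq_int_diff sq_int_sum)
      from sq_norm_triangle [OF this] show "norm (sq_norm M (\<lambda>x. (g x + g' x) - (\<Sum>i\<in>S. f i x + f' i x)))
        \<le> sq_norm M (\<lambda>x. g x - (\<Sum>i\<in>S. f i x)) + sq_norm M (\<lambda>x. g' x - (\<Sum>i\<in>S. f' i x))"
        by (simp add: sum.distrib add_diff_add sq_norm_nonneg)
    qed
  qed
  then show ?thesis using f f' by (auto simp: sq_has_sum_def sq_int_add)
qed

text \<open>Both sums have the same inner product with every h, in particular with their
  difference.\<close>

lemma sq_has_sum_unique:
  assumes g: "sq_has_sum M f J g" and g': "sq_has_sum M f J g'"
  shows "AE x in M. g x = g' x"
proof -
  have m: "g \<in> sq_int M" "g' \<in> sq_int M" using assms by (auto simp: sq_has_sum_def)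
  have "((\<lambda>i. sq_inner M h (f i)) has_sum sq_inner M h g) J" "((\<lambda>i. sq_inner M h (f i)) has_sum sq_inner M h g') J"
    if "h \<in> sq_int M" for h using sq_has_sum_inner [OF g that] sq_has_sum_inner [OF g' that] by auto
  then have "sq_inner M h g = sq_inner M h g'" if "h \<in> sq_int M" for h
    using that has_sum_unique by blast
  from this [OF sq_int_diff [OF m]] have "(sq_norm M (\<lambda>x. g x - g' x))\<^sup>2 = 0"
    using m by (simp add: sq_norm_power2 sq_inner_diff_right sq_int_diff)
  then show ?thesis
    using sq_norm_eq_0_AE [OF sq_int_diff [OF m]] by auto
qed

text \<open>Pairing the sum with one of its orthogonal terms isolates that term; pairing it with
  itself is then Parseval's identity.\<close>

lemma sq_has_sum_orthogonal_norm:
  assumes g: "sq_has_sum M f J g" and orth: "\<And>i j. i \<in> J \<Longrightarrow> j \<in> J \<Longrightarrow> i \<noteq> j \<Longrightarrow> sq_inner M (f i) (f j) = 0"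
  shows "((\<lambda>i. sq_inner M (f i) (f i)) has_sum sq_inner M g g) J"
    and "\<And>j. j \<in> J \<Longrightarrow> sq_inner M (f j) g = sq_inner M (f j) (f j)"
proof -
  have f: "f i \<in> sq_int M" if "i \<in> J" for i using g that by (simp add: sq_has_sum_def)
  have g': "g \<in> sq_int M" using g by (simp add: sq_has_sum_def)
  show j: "sq_inner M (f j) g = sq_inner M (f j) (f j)" if "j \<in> J" for j
  proof -
    have "((\<lambda>i. sq_inner M (f j) (f i)) has_sum sq_inner M (f j) g) J"
      by (rule sq_has_sum_inner [OF g f [OF that]])
    moreover have "((\<lambda>i. sq_inner M (f j) (f i)) has_sum sq_inner M (f j) (f j)) J"
      using has_sum_finite_neutralI [of "{j}" J "\<lambda>i. sq_inner M (f j) (f i)" "sq_inner M (f j) (f j)"] that orth by auto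
    ultimately show ?thesis by (rule has_sum_unique)
  qed
  have "((\<lambda>i. sq_inner M g (f i)) has_sum sq_inner M g g) J" by (rule sq_has_sum_inner [OF g g'])
  then show "((\<lambda>i. sq_inner M (f i) (f i)) has_sum sq_inner M g g) J"
    by (rule has_sum_cong [THEN iffD1, rotated]) (simp add: j sq_inner_commute [of M g])
qed

lemma sq_norm_sum_orthogonal:
  assumes f: "\<And>i. i \<in> S \<Longrightarrow> f i \<in> sq_int M" and S: "finite S"
    and orth: "\<And>i j. i \<in> S \<Longrightarrow> j \<in> S \<Longrightarrow> i \<noteq> j \<Longrightarrow> sq_inner M (f i) (f j) = 0"
  shows "(sq_norm M (\<lambda>x. \<Sum>i\<in>S. f i x))\<^sup>2 = (\<Sum>i\<in>S. sq_inner M (f i) (f i))"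
proof -
  let ?g = "\<lambda>x. \<Sum>i\<in>S. f i x"
  have g: "?g \<in> sq_int M" using f by (rule sq_int_sum)
  have "sq_inner M ?g ?g = (\<Sum>i\<in>S. sq_inner M (f i) ?g)"
    using sq_inner_sum_right [of S f M ?g] f g by (simp add: sq_inner_commute)
  also have "\<dots> = (\<Sum>i\<in>S. \<Sum>j\<in>S. sq_inner M (f i) (f j))"
    using f by (intro sum.cong refl sq_inner_sum_right)
  also have "\<dots> = (\<Sum>i\<in>S. \<Sum>j\<in>S. if j = i then sq_inner M (f i) (f i) else 0)"
    using orth by (intro sum.cong refl) auto
  finally show ?thesis using S by (simp add: sq_norm_power2)
qed

text \<open>\<open>sq_int_complete\<close> concerns sequences, so the net of finite partial sums is
  thinned: beyond the finite set S n the remaining squared norms add up to less than 4^(-n). The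
  limit along S n is then shown to be the limit of the whole net.\<close>

lemma sq_has_sum_orthogonal_exists:
  fixes f :: "'i \<Rightarrow> 'a \<Rightarrow> 'b::euclidean_space"
  assumes f: "\<And>i. i \<in> J \<Longrightarrow> f i \<in> sq_int M"
    and orth: "\<And>i j. i \<in> J \<Longrightarrow> j \<in> J \<Longrightarrow> i \<noteq> j \<Longrightarrow> sq_inner M (f i) (f j) = 0"
    and sum: "(\<lambda>i. sq_inner M (f i) (f i)) summable_on J"
  shows "\<exists>g. sq_has_sum M f J g"
proof -
  let ?s = "\<lambda>S x. \<Sum>i\<in>S. f i x"
  let ?n = "\<lambda>i. sq_inner M (f i) (f i)"
  define A where "A = infsum ?n J"
  have sumA: "(?n has_sum A) J" unfolding A_def using sum by (rule has_sum_infsum)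
  have s: "?s S \<in> sq_int M" if "S \<subseteq> J" for S using that f by (intro sq_int_sum) auto
  have tail: "(sq_norm M (\<lambda>x. ?s T x - ?s S x))\<^sup>2 \<le> A - sum ?n S" if "S \<subseteq> T" "T \<subseteq> J" "finite T" for S T
  proof -
    have "(\<lambda>x. ?s T x - ?s S x) = ?s (T - S)"
      using that by (auto simp: sum_diff finite_subset)
    then have "(sq_norm M (\<lambda>x. ?s T x - ?s S x))\<^sup>2 = (sq_norm M (?s (T - S)))\<^sup>2"
      by simp
    also have "\<dots> = sum ?n (T - S)"
      using that by (intro sq_norm_sum_orthogonal f orth) auto
    also have "\<dots> = sum ?n T - sum ?n S" using that by (simp add: sum_diff finite_subset)
    also have "sum ?n T \<le> A"
      using that by (intro has_sum_mono_neutral [OF has_sum_finite sumA]) (auto simp: sq_inner_self_nonneg)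
    finally show ?thesis by simp
  qed
  have "\<exists>S. finite S \<and> S \<subseteq> J \<and> (\<forall>T. finite T \<longrightarrow> S \<subseteq> T \<longrightarrow> T \<subseteq> J \<longrightarrow> A - sum ?n T < e)" if "e > 0" for e
  proof -
    have "\<forall>\<^sub>F S in finite_subsets_at_top J. dist (sum ?n S) A < e"
      using sumA that unfolding has_sum_def by (rule tendstoD)
    then have "\<exists>S. finite S \<and> S \<subseteq> J \<and> (\<forall>T. finite T \<and> S \<subseteq> T \<and> T \<subseteq> J \<longrightarrow> dist (sum ?n T) A < e)"
      by (simp only: eventually_finite_subsets_at_top)
    then obtain S where S: "finite S \<and> S \<subseteq> J \<and> (\<forall>T. finite T \<and> S \<subseteq> T \<and> T \<subseteq> J \<longrightarrow> dist (sum ?n T) A < e)" ..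
    show ?thesis
    proof (intro exI [of _ S] conjI allI impI)
      fix T assume "finite T" "S \<subseteq> T" "T \<subseteq> J"
      then have "dist (sum ?n T) A < e" using S by simp
      then show "A - sum ?n T < e" by (simp add: dist_real_def)
    qed (use S in simp_all)
  qed
  note small = this
  define D where "D n S \<longleftrightarrow> finite S \<and> S \<subseteq> J \<and> (\<forall>T. finite T \<longrightarrow> S \<subseteq> T \<longrightarrow> T \<subseteq> J \<longrightarrow> A - sum ?n T < ((1 / 2) ^ n)\<^sup>2)" for n S
  have "\<forall>n. \<exists>S. D n S"
    unfolding D_def by (intro allI small) simp
  then obtain S0 where S0': "\<forall>n. D n (S0 n)" using choice [of D] by blast
  have S0: "finite (S0 n)" "S0 n \<subseteq> J" for n using S0' by (simp_all add: D_def)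
  have S0_small: "A - sum ?n T < ((1 / 2) ^ n)\<^sup>2" if "finite T" "S0 n \<subseteq> T" "T \<subseteq> J" for n T
    using S0' that unfolding D_def by blast
  \<comment> \<open>The unions make the sets increasing, so that consecutive partial sums differ by
    at most (1 / 2)^n.\<close>
  define S where "S n = (\<Union>k\<le>n. S0 k)" for n
  have S: "finite (S n)" "S n \<subseteq> J" "S0 n \<subseteq> S n" "S n \<subseteq> S (Suc n)" for n
    using S0 by (auto simp: S_def atMost_Suc)
  have close: "sq_norm M (\<lambda>x. ?s T x - ?s (S n) x) \<le> (1 / 2) ^ n" if "finite T" "S n \<subseteq> T" "T \<subseteq> J" for T n
  proof (rule power2_le_imp_le)
    show "(sq_norm M (\<lambda>x. ?s T x - ?s (S n) x))\<^sup>2 \<le> ((1 / 2) ^ n)\<^sup>2"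
      using tail [OF that(2,3,1)] S0_small [of "S n" n] S [of n] by simp
  qed simp
  have "\<exists>g \<in> sq_int M. \<forall>n. sq_norm M (\<lambda>x. g x - ?s (S n) x) \<le> 2 * (1 / 2) ^ n"
    using S by (intro sq_int_complete s close) auto
  then obtain g where g: "g \<in> sq_int M" "\<And>n. sq_norm M (\<lambda>x. g x - ?s (S n) x) \<le> 2 * (1 / 2) ^ n" by auto
  have "((\<lambda>T. sq_norm M (\<lambda>x. g x - ?s T x)) \<longlongrightarrow> 0) (finite_subsets_at_top J)"
  proof (rule tendstoI)
    fix e :: real assume "e > 0"
    then obtain n where n: "(1 / 2) ^ n < e / 3"
      using real_arch_pow_inv [of "e / 3" "1 / 2"] by auto
    have "dist (sq_norm M (\<lambda>x. g x - ?s T x)) 0 < e" if T: "finite T" "S n \<subseteq> T" "T \<subseteq> J" for T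
    proof -
      have "sq_norm M (\<lambda>x. g x - ?s T x) \<le> sq_norm M (\<lambda>x. g x - ?s (S n) x) + sq_norm M (\<lambda>x. ?s (S n) x - ?s T x)"
        using g s S T by (intro sq_norm_triangle_diff) auto
      also have "\<dots> \<le> 2 * (1 / 2) ^ n + (1 / 2) ^ n"
        using g(2) [of n] close [OF T] by (intro add_mono) (simp_all only: sq_norm_minus_commute)
      finally show ?thesis using n by (simp add: sq_norm_nonneg)
    qed
    then show "\<forall>\<^sub>F T in finite_subsets_at_top J. dist (sq_norm M (\<lambda>x. g x - ?s T x)) 0 < e"
      unfolding eventually_finite_subsets_at_top using S by (intro exI [of _ "S n"]) simp
  qed
  then show ?thesis using g f by (auto simp: sq_has_sum_def)
qed

section \<open>The space of square summable families and the Lax-Milgram lemma\<close>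

text \<open>A type of its own, so that the classes \<open>real_inner\<close> and
  \<open>complete_space\<close>, and with them \<open>banach_fix_type\<close>, apply to square
  summable families.\<close>

typedef 'i ell2 = "{f :: 'i \<Rightarrow> real. (\<lambda>i. (f i)\<^sup>2) summable_on UNIV}"
  by (intro exI [of _ "\<lambda>_. 0"]) simp

setup_lifting type_definition_ell2

lemma summable_on_mult_squares:
  fixes f g :: "'i \<Rightarrow> real"
  assumes "(\<lambda>i. (f i)\<^sup>2) summable_on A" "(\<lambda>i. (g i)\<^sup>2) summable_on A"
  shows "(\<lambda>i. f i * g i) summable_on A"
proof -
  have "(\<lambda>i. \<bar>f i * g i\<bar>) summable_on A"
  proof (rule summable_on_comparison_test)
    show "(\<lambda>i. (f i)\<^sup>2 + (g i)\<^sup>2) summable_on A" using assms by (rule summable_on_add)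
    show "\<bar>f i * g i\<bar> \<le> (f i)\<^sup>2 + (g i)\<^sup>2" for i
    proof -
      have "2 * (\<bar>f i\<bar> * \<bar>g i\<bar>) \<le> (f i)\<^sup>2 + (g i)\<^sup>2"
        using sum_squares_bound [of "\<bar>f i\<bar>" "\<bar>g i\<bar>"] by (simp add: mult.assoc)
      moreover have "0 \<le> \<bar>f i\<bar> * \<bar>g i\<bar>" by simp
      ultimately show ?thesis unfolding abs_mult by linarith
    qed
  qed auto
  then show ?thesis using abs_summable_summable [of "\<lambda>i. f i * g i" A] by simp
qed

lemma summable_on_add_squares:
  fixes f g :: "'i \<Rightarrow> real"
  assumes "(\<lambda>i. (f i)\<^sup>2) summable_on A" "(\<lambda>i. (g i)\<^sup>2) summable_on A"
  shows "(\<lambda>i. (f i + g i)\<^sup>2) summable_on A"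
proof -
  have "(\<lambda>i. (f i)\<^sup>2 + (2 * (f i * g i) + (g i)\<^sup>2)) summable_on A"
    by (intro summable_on_add assms summable_on_cmult_right summable_on_mult_squares)
  then show ?thesis by (simp add: power2_sum algebra_simps)
qed

instantiation ell2 :: (type) real_vector
begin

lift_definition zero_ell2 :: "'a ell2" is "\<lambda>_. 0" by simp
lift_definition plus_ell2 :: "'a ell2 \<Rightarrow> 'a ell2 \<Rightarrow> 'a ell2" is "\<lambda>f g i. f i + g i"
  by (rule summable_on_add_squares)
lift_definition uminus_ell2 :: "'a ell2 \<Rightarrow> 'a ell2" is "\<lambda>f i. - f i" by simp
lift_definition minus_ell2 :: "'a ell2 \<Rightarrow> 'a ell2 \<Rightarrow> 'a ell2" is "\<lambda>f g i. f i - g i"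
  subgoal for f g using summable_on_add_squares [of f UNIV "\<lambda>i. - g i"] by simp
  done
lift_definition scaleR_ell2 :: "real \<Rightarrow> 'a ell2 \<Rightarrow> 'a ell2" is "\<lambda>c f i. c * f i"
  by (simp add: power_mult_distrib summable_on_cmult_right)

instance
proof
  fix x y z :: "'a ell2" and a b :: real
  show "x + y + z = x + (y + z)" by transfer (simp add: algebra_simps)
  show "x + y = y + x" by transfer (simp add: algebra_simps)
  show "0 + x = x" by transfer simp
  show "- x + x = 0" by transfer simp
  show "x - y = x + - y" by transfer simp
  show "a *\<^sub>R (x + y) = a *\<^sub>R x + a *\<^sub>R y" by transfer (simp add: algebra_simps)
  show "(a + b) *\<^sub>R x = a *\<^sub>R x + b *\<^sub>R x" by transfer (simp add: algebra_simps)
  show "a *\<^sub>R b *\<^sub>R x = (a * b) *\<^sub>R x" by transfer (simp add: algebra_simps)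
  show "1 *\<^sub>R x = x" by transfer simp
qed

end

instantiation ell2 :: (type) real_inner
begin

lift_definition inner_ell2 :: "'a ell2 \<Rightarrow> 'a ell2 \<Rightarrow> real" is "\<lambda>f g. \<Sum>\<^sub>\<infinity>i. f i * g i" .
definition norm_ell2 :: "'a ell2 \<Rightarrow> real" where "norm_ell2 x = sqrt (inner x x)"
definition dist_ell2 :: "'a ell2 \<Rightarrow> 'a ell2 \<Rightarrow> real" where "dist_ell2 x y = norm (x - y)"
definition sgn_ell2 :: "'a ell2 \<Rightarrow> 'a ell2" where "sgn_ell2 x = x /\<^sub>R norm x"
definition uniformity_ell2 :: "('a ell2 \<times> 'a ell2) filter" where
  "uniformity_ell2 = (INF e\<in>{0 <..}. principal {(x, y). dist x y < e})"
definition open_ell2 :: "'a ell2 set \<Rightarrow> bool" where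
  "open_ell2 U = (\<forall>x\<in>U. \<forall>\<^sub>F (x', y) in uniformity. x' = x \<longrightarrow> y \<in> U)"

instance
proof
  fix x y z :: "'a ell2" and a b :: real
  show "dist x y = norm (x - y)" by (rule dist_ell2_def)
  show "sgn x = inverse (norm x) *\<^sub>R x" by (rule sgn_ell2_def)
  show "uniformity = (INF e\<in>{0 <..}. principal {(x, y :: 'a ell2). dist x y < e})" by (rule uniformity_ell2_def)
  show "open U = (\<forall>x\<in>U. \<forall>\<^sub>F (x', y) in uniformity. x' = x \<longrightarrow> y \<in> U)" for U :: "'a ell2 set" by (rule open_ell2_def)
  show "inner x y = inner y x" by transfer (simp add: mult.commute)
  show "inner (x + y) z = inner x z + inner y z"
    by transfer (simp add: distrib_right infsum_add summable_on_mult_squares)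
  show "inner (a *\<^sub>R x) y = a * inner x y"
    by transfer (simp add: mult.assoc infsum_cmult_right')
  show "0 \<le> inner x x" by transfer (simp add: infsum_nonneg)
  show "inner x x = 0 \<longleftrightarrow> x = 0"
  proof (transfer, safe)
    fix f :: "'a \<Rightarrow> real"
    assume f: "(\<lambda>i. (f i)\<^sup>2) summable_on UNIV" "(\<Sum>\<^sub>\<infinity>i. f i * f i) = 0"
    show "f = (\<lambda>_. 0)"
    proof
      fix i
      have "(f i)\<^sup>2 = 0"
        by (rule nonneg_infsum_le_0D [OF _ f(1)]) (use f(2) in \<open>auto simp: power2_eq_square\<close>)
      then show "f i = 0" by simp
    qed
  qed simp
  show "norm x = sqrt (inner x x)" by (rule norm_ell2_def)
qed

end


lemma ell2_summable: "(\<lambda>i. (Rep_ell2 x i)\<^sup>2) summable_on UNIV"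
  using Rep_ell2 [of x] by simp

lemma ell2_norm_power2: "(norm x)\<^sup>2 = (\<Sum>\<^sub>\<infinity>i. (Rep_ell2 x i)\<^sup>2)"
  by (simp only: power2_norm_eq_inner inner_ell2.rep_eq) (simp add: power2_eq_square)

lemma ell2_sum_le: "finite F \<Longrightarrow> (\<Sum>i\<in>F. (Rep_ell2 x i)\<^sup>2) \<le> (norm x)\<^sup>2"
  unfolding ell2_norm_power2 by (intro finite_sum_le_infsum ell2_summable) auto

lemma ell2_coord_le: "\<bar>Rep_ell2 x i\<bar> \<le> norm x"
  using ell2_sum_le [of "{i}" x] abs_le_square_iff [of "Rep_ell2 x i" "norm x"] by simp

text \<open>Coordinates are bounded by the norm, so coordinatewise limits exist. The Cauchy bound
  passes to the limit on each finite set of coordinates, and these bounds, uniform in the set,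
  control the norm.\<close>

instance ell2 :: (type) complete_space
proof
  fix X :: "nat \<Rightarrow> 'a ell2"
  assume X: "Cauchy X"
  have "Cauchy (\<lambda>n. Rep_ell2 (X n) i)" for i
  proof (rule metric_CauchyI)
    fix e :: real assume "e > 0"
    with X obtain N where "\<And>m n. m \<ge> N \<Longrightarrow> n \<ge> N \<Longrightarrow> dist (X m) (X n) < e"
      unfolding Cauchy_def by blast
    moreover have "dist (Rep_ell2 (X m) i) (Rep_ell2 (X n) i) \<le> dist (X m) (X n)" for m n
      using ell2_coord_le [of "X m - X n" i] by (simp add: dist_norm minus_ell2.rep_eq)
    ultimately show "\<exists>N. \<forall>m\<ge>N. \<forall>n\<ge>N. dist (Rep_ell2 (X m) i) (Rep_ell2 (X n) i) < e"
      by (meson le_less_trans)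
  qed
  then have "\<forall>i. \<exists>l. (\<lambda>n. Rep_ell2 (X n) i) \<longlonglongrightarrow> l"
    by (simp add: Cauchy_convergent convergent_def [symmetric])
  then obtain L where L: "\<And>i. (\<lambda>n. Rep_ell2 (X n) i) \<longlonglongrightarrow> L i" by metis
  have fin: "\<exists>N. \<forall>n\<ge>N. \<forall>F. finite F \<longrightarrow> (\<Sum>i\<in>F. (Rep_ell2 (X n) i - L i)\<^sup>2) \<le> e\<^sup>2" if e: "e > 0" for e
  proof -
    obtain N where N: "\<And>m n. m \<ge> N \<Longrightarrow> n \<ge> N \<Longrightarrow> dist (X m) (X n) < e"
      using X e unfolding Cauchy_def by blast
    have "(\<Sum>i\<in>F. (Rep_ell2 (X n) i - L i)\<^sup>2) \<le> e\<^sup>2" if n: "n \<ge> N" and F: "finite F" for n F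
    proof (rule tendsto_upperbound)
      show "(\<lambda>m. \<Sum>i\<in>F. (Rep_ell2 (X n) i - Rep_ell2 (X m) i)\<^sup>2) \<longlonglongrightarrow> (\<Sum>i\<in>F. (Rep_ell2 (X n) i - L i)\<^sup>2)"
        by (intro tendsto_intros L)
      show "\<forall>\<^sub>F m in sequentially. (\<Sum>i\<in>F. (Rep_ell2 (X n) i - Rep_ell2 (X m) i)\<^sup>2) \<le> e\<^sup>2"
        using eventually_ge_at_top [of N]
      proof eventually_elim
        case (elim m)
        have "(\<Sum>i\<in>F. (Rep_ell2 (X n) i - Rep_ell2 (X m) i)\<^sup>2) \<le> (norm (X n - X m))\<^sup>2"
          using ell2_sum_le [OF F, of "X n - X m"] by (simp add: minus_ell2.rep_eq)
        also have "\<dots> \<le> e\<^sup>2" using N [OF n elim] by (intro power_mono) (auto simp: dist_norm)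
        finally show ?case .
      qed
    qed simp
    then show ?thesis by blast
  qed
  have sq: "(\<lambda>i. (L i)\<^sup>2) summable_on UNIV"
  proof -
    obtain N where N: "\<And>F. finite F \<Longrightarrow> (\<Sum>i\<in>F. (Rep_ell2 (X N) i - L i)\<^sup>2) \<le> 1\<^sup>2"
      using fin [of 1] by auto
    have "(\<lambda>i. (Rep_ell2 (X N) i - L i)\<^sup>2) summable_on UNIV"
      by (rule nonneg_bdd_above_summable_on) (use N in \<open>auto intro!: bdd_aboveI2\<close>)
    then have "(\<lambda>i. (L i - Rep_ell2 (X N) i)\<^sup>2) summable_on UNIV" by (subst power2_commute)
    from summable_on_add_squares [OF ell2_summable [of "X N"] this] show ?thesis by simp
  qed
  define x where "x = Abs_ell2 L"
  have x: "Rep_ell2 x = L" unfolding x_def using sq by (simp add: Abs_ell2_inverse)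
  have "X \<longlonglongrightarrow> x"
  proof (rule metric_LIMSEQ_I)
    fix e :: real assume e: "e > 0"
    then obtain N where N: "\<And>n F. n \<ge> N \<Longrightarrow> finite F \<Longrightarrow> (\<Sum>i\<in>F. (Rep_ell2 (X n) i - L i)\<^sup>2) \<le> (e / 2)\<^sup>2"
      using fin [of "e / 2"] by auto
    have "dist (X n) x < e" if "n \<ge> N" for n
    proof -
      have "(norm (X n - x))\<^sup>2 \<le> (e / 2)\<^sup>2"
        unfolding ell2_norm_power2 using N [OF that]
        by (intro infsum_le_finite_sums ell2_summable) (simp add: minus_ell2.rep_eq x)
      then have "norm (X n - x) \<le> e / 2" by (rule power2_le_imp_le) (use e in simp)
      then show ?thesis using e by (simp add: dist_norm)
    qed
    then show "\<exists>N. \<forall>n\<ge>N. dist (X n) x < e" by blast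
  qed
  then show "convergent X" by (auto simp: convergent_def)
qed

section \<open>Unit vectors, Riesz representation and the Lax-Milgram lemma\<close>

lift_definition ell2_delta :: "'i \<Rightarrow> 'i ell2" is "\<lambda>i j. of_bool (j = i)"
  subgoal for i
    using summable_on_cong_neutral [of "{i}" UNIV "\<lambda>j. (of_bool (j = i) :: real)\<^sup>2" "\<lambda>j. (of_bool (j = i) :: real)\<^sup>2"] by auto
  done

lemma Rep_ell2_sum: "Rep_ell2 (\<Sum>i\<in>F. c i *\<^sub>R x i) j = (\<Sum>i\<in>F. c i * Rep_ell2 (x i) j)"
  by (induction F rule: infinite_finite_induct) (auto simp: zero_ell2.rep_eq plus_ell2.rep_eq scaleR_ell2.rep_eq)

lemma Rep_ell2_sum_delta: "finite F \<Longrightarrow> Rep_ell2 (\<Sum>i\<in>F. c i *\<^sub>R ell2_delta i) j = (if j \<in> F then c j else 0)"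
proof -
  assume F: "finite F"
  have "(\<Sum>i\<in>F. c i * of_bool (j = i)) = (\<Sum>i\<in>F. if i = j then c j else 0)" by (intro sum.cong) auto
  then show ?thesis unfolding Rep_ell2_sum ell2_delta.rep_eq using F by simp
qed

lemma norm_sum_delta: "finite F \<Longrightarrow> (norm (\<Sum>i\<in>F. c i *\<^sub>R ell2_delta i))\<^sup>2 = (\<Sum>i\<in>F. (c i)\<^sup>2)"
proof -
  assume F: "finite F"
  have "(norm (\<Sum>i\<in>F. c i *\<^sub>R ell2_delta i))\<^sup>2 = (\<Sum>\<^sub>\<infinity>i. (if i \<in> F then c i else 0)\<^sup>2)"
    unfolding ell2_norm_power2 Rep_ell2_sum_delta [OF F] ..
  also have "\<dots> = (\<Sum>\<^sub>\<infinity>i\<in>F. (c i)\<^sup>2)" by (rule infsum_cong_neutral) auto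
  finally show ?thesis using F by simp
qed

text \<open>Expanding the square shows that the squared distance of x from a finite section is a
  tail of the series for its squared norm.\<close>

lemma ell2_sum_delta_tendsto:
  "((\<lambda>F. \<Sum>i\<in>F. Rep_ell2 x i *\<^sub>R ell2_delta i) \<longlongrightarrow> x) (finite_subsets_at_top UNIV)"
proof -
  let ?s = "\<lambda>F. \<Sum>i\<in>F. Rep_ell2 x i *\<^sub>R ell2_delta i"
  have sum: "((\<lambda>F. (\<Sum>i\<in>F. (Rep_ell2 x i)\<^sup>2)) \<longlongrightarrow> (norm x)\<^sup>2) (finite_subsets_at_top UNIV)"
    using has_sum_infsum [OF ell2_summable [of x]] unfolding has_sum_def ell2_norm_power2 .
  have eq: "(norm (?s F - x))\<^sup>2 = (norm x)\<^sup>2 - (\<Sum>i\<in>F. (Rep_ell2 x i)\<^sup>2)" if F: "finite F" for F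
  proof -
    have "inner (?s F) x = (\<Sum>i\<in>F. (Rep_ell2 x i)\<^sup>2)"
    proof -
      have "inner (?s F) x = (\<Sum>\<^sub>\<infinity>i. (if i \<in> F then Rep_ell2 x i else 0) * Rep_ell2 x i)"
        unfolding inner_ell2.rep_eq Rep_ell2_sum_delta [OF F] ..
      also have "\<dots> = (\<Sum>\<^sub>\<infinity>i\<in>F. (Rep_ell2 x i)\<^sup>2)"
        by (rule infsum_cong_neutral) (auto simp: power2_eq_square)
      finally show ?thesis using F by simp
    qed
    then have "(norm (?s F - x))\<^sup>2 = (norm (?s F))\<^sup>2 + (norm x)\<^sup>2 - 2 * (\<Sum>i\<in>F. (Rep_ell2 x i)\<^sup>2)"
      by (simp add: power2_norm_eq_inner inner_diff_left inner_diff_right inner_commute)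
    then show ?thesis using norm_sum_delta [OF F, of "Rep_ell2 x"] by simp
  qed
  have lim0: "((\<lambda>F. (norm x)\<^sup>2 - (\<Sum>i\<in>F. (Rep_ell2 x i)\<^sup>2)) \<longlongrightarrow> 0) (finite_subsets_at_top UNIV)"
    using tendsto_diff [OF tendsto_const sum, of "(norm x)\<^sup>2"] by simp
  have "((\<lambda>F. (norm (?s F - x))\<^sup>2) \<longlongrightarrow> 0) (finite_subsets_at_top UNIV)"
    by (rule Lim_transform_eventually [OF lim0])
       (auto intro!: eventually_finite_subsets_at_top_weakI simp: eq)
  then have "((\<lambda>F. sqrt ((norm (?s F - x))\<^sup>2)) \<longlongrightarrow> sqrt 0) (finite_subsets_at_top UNIV)"
    by (rule tendsto_real_sqrt)
  then show ?thesis by (simp add: tendsto_norm_zero_iff LIM_zero_iff)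
qed

text \<open>The representing vector has the coordinates \<open>\<phi> (ell2_delta i)\<close>.
  Applying \<phi> to a finite section of this family bounds its squared norm S by K sqrt S, hence by
  K^2, so the family is square summable.\<close>

lemma ell2_riesz:
  fixes \<phi> :: "'i ell2 \<Rightarrow> real"
  assumes \<phi>: "bounded_linear \<phi>"
  shows "\<exists>r. \<forall>x. \<phi> x = inner x r"
proof -
  interpret bounded_linear \<phi> by fact
  obtain K where K: "K > 0" "\<And>x. norm (\<phi> x) \<le> norm x * K" using pos_bounded by blast
  define c where "c i = \<phi> (ell2_delta i)" for i
  have \<phi>_sum: "\<phi> (\<Sum>i\<in>F. a i *\<^sub>R ell2_delta i) = (\<Sum>i\<in>F. a i * c i)" for F a
    by (simp add: sum scale c_def)
  have bound: "(\<Sum>i\<in>F. (c i)\<^sup>2) \<le> K\<^sup>2" if F: "finite F" for F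
  proof -
    let ?S = "\<Sum>i\<in>F. (c i)\<^sup>2"
    have S0: "?S \<ge> 0" by (intro sum_nonneg) auto
    have "?S = \<phi> (\<Sum>i\<in>F. c i *\<^sub>R ell2_delta i)" unfolding \<phi>_sum by (simp add: power2_eq_square)
    also have "\<dots> \<le> norm (\<Sum>i\<in>F. c i *\<^sub>R ell2_delta i) * K" using K(2) [of "\<Sum>i\<in>F. c i *\<^sub>R ell2_delta i"] by simp
    finally have "?S\<^sup>2 \<le> (norm (\<Sum>i\<in>F. c i *\<^sub>R ell2_delta i) * K)\<^sup>2" using S0 by (intro power_mono) auto
    also have "\<dots> = ?S * K\<^sup>2" unfolding power_mult_distrib norm_sum_delta [OF F] ..
    finally have "?S * ?S \<le> ?S * K\<^sup>2" by (simp only: power2_eq_square)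
    then show ?thesis using S0 by (cases "?S = 0") auto
  qed
  have "(\<lambda>i. (c i)\<^sup>2) summable_on UNIV"
    by (rule nonneg_bdd_above_summable_on) (use bound in \<open>auto intro!: bdd_aboveI2\<close>)
  then have r: "Rep_ell2 (Abs_ell2 c) = c" by (simp add: Abs_ell2_inverse)
  have "\<phi> x = inner x (Abs_ell2 c)" for x
  proof (rule tendsto_unique)
    show "((\<lambda>F. \<phi> (\<Sum>i\<in>F. Rep_ell2 x i *\<^sub>R ell2_delta i)) \<longlongrightarrow> \<phi> x) (finite_subsets_at_top UNIV)"
      by (rule tendsto [OF ell2_sum_delta_tendsto])
    show "((\<lambda>F. \<phi> (\<Sum>i\<in>F. Rep_ell2 x i *\<^sub>R ell2_delta i)) \<longlongrightarrow> inner x (Abs_ell2 c)) (finite_subsets_at_top UNIV)"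
      unfolding \<phi>_sum inner_ell2.rep_eq r has_sum_def [symmetric]
      using summable_on_mult_squares [OF ell2_summable [of x] ell2_summable [of "Abs_ell2 c"]] unfolding r
      by (rule has_sum_infsum)
  qed simp
  then show ?thesis by blast
qed

text \<open>With A representing b and r representing \<phi>, the equation A x = r says that x is a
  fixed point of x |-> x - \<tau> (A x - r). Coercivity makes this map a contraction for small
  \<tau> > 0, which handles nonsymmetric forms.\<close>

lemma ell2_Lax_Milgram:
  fixes b :: "'i ell2 \<Rightarrow> 'i ell2 \<Rightarrow> real"
  assumes b: "bounded_bilinear b" and c: "c > 0" and coercive: "\<And>x. c * (norm x)\<^sup>2 \<le> b x x"
    and \<phi>: "bounded_linear \<phi>"
  shows "\<exists>x. \<forall>y. b x y = \<phi> y"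
proof -
  interpret bounded_bilinear b by fact
  obtain K where K: "K > 0" "\<And>x y. norm (b x y) \<le> norm x * norm y * K" using pos_bounded by blast
  \<comment> \<open>Enlarging the bound to at least c keeps 1 - (c / M)^2 nonnegative under the
    square root in \<open>q\<close>.\<close>
  define M where "M = max K c"
  have M: "M > 0" "M \<ge> c" "K \<le> M" using K(1) by (auto simp: M_def)
  have "\<forall>x. \<exists>r. \<forall>y. b x y = inner y r" using ell2_riesz [OF bounded_linear_right] by blast
  then obtain A where A: "\<And>x y. b x y = inner y (A x)" by metis
  obtain r where r: "\<And>y. \<phi> y = inner y r" using ell2_riesz [OF \<phi>] by blast
  have A_diff: "A (x - y) = A x - A y" for x y
  proof -
    have "inner z (A (x - y) - (A x - A y)) = 0" for z
      unfolding inner_diff_right A [symmetric] by (simp add: diff_left)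
    from this [of "A (x - y) - (A x - A y)"] show ?thesis by simp
  qed
  have A_norm: "norm (A x) \<le> M * norm x" for x
  proof (cases "A x = 0")
    case False
    have "(norm (A x))\<^sup>2 = b x (A x)" by (simp add: A power2_norm_eq_inner)
    also have "\<dots> \<le> norm x * norm (A x) * K" using K(2) [of x "A x"] by simp
    also have "\<dots> \<le> norm x * norm (A x) * M" using M by (intro mult_left_mono) auto
    finally have "norm (A x) * norm (A x) \<le> norm (A x) * (M * norm x)"
      by (simp add: power2_eq_square mult_ac)
    then show ?thesis using False by simp
  qed (use M in simp)
  \<comment> \<open>The minimiser of 1 - 2 \<tau> c + \<tau>^2 M^2; the minimum is 1 - (c /
    M)^2.\<close>
  define \<tau> where "\<tau> = c / M\<^sup>2"
  define T where "T x = x - \<tau> *\<^sub>R (A x - r)" for x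
  define q where "q = sqrt (1 - (c / M)\<^sup>2)"
  have cM: "0 < c / M" "c / M \<le> 1" using c M by auto
  have cM2: "0 < (c / M)\<^sup>2" "(c / M)\<^sup>2 \<le> 1" using cM by (auto simp: power_le_one)
  have q: "0 \<le> q" "q < 1" using cM2 by (auto simp: q_def real_sqrt_lt_1_iff)
  have contr: "dist (T x) (T y) \<le> q * dist x y" for x y
  proof -
    define d where "d = x - y"
    have "T x - T y = d - \<tau> *\<^sub>R A d" by (simp add: T_def d_def A_diff algebra_simps)
    then have "(norm (T x - T y))\<^sup>2 = inner (d - \<tau> *\<^sub>R A d) (d - \<tau> *\<^sub>R A d)"
      by (simp add: power2_norm_eq_inner)
    also have "\<dots> = (norm d)\<^sup>2 - 2 * \<tau> * b d d + \<tau>\<^sup>2 * (norm (A d))\<^sup>2"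
      unfolding A power2_norm_eq_inner
      by (simp add: inner_diff_left inner_diff_right inner_commute power2_eq_square algebra_simps)
    also have "\<dots> \<le> (norm d)\<^sup>2 - 2 * \<tau> * (c * (norm d)\<^sup>2) + \<tau>\<^sup>2 * (M * norm d)\<^sup>2"
      using coercive [of d] A_norm [of d] c M
      by (intro add_mono diff_mono mult_left_mono power_mono) (auto simp: \<tau>_def)
    also have "\<dots> = (1 - (c / M)\<^sup>2) * (norm d)\<^sup>2"
      using M by (simp add: \<tau>_def power2_eq_square field_simps)
    also have "\<dots> = (q * norm d)\<^sup>2"
      using cM2 by (simp add: q_def power_mult_distrib)
    finally have "norm (T x - T y) \<le> q * norm d"
      using q by (intro power2_le_imp_le [of "norm (T x - T y)"]) auto
    then show ?thesis by (simp add: dist_norm d_def)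
  qed
  have "\<exists>!x. T x = x"
    using banach_fix_type [OF q] contr by blast
  then obtain x where "T x = x" by blast
  moreover have "\<tau> \<noteq> 0" using c M by (simp add: \<tau>_def)
  ultimately have "A x = r" by (simp add: T_def)
  then show ?thesis using A r by auto
qed

section \<open>Polar coordinates\<close>

definition cpx :: "real^2 \<Rightarrow> complex" where
  "cpx x = Complex (x $ 1) (x $ 2)"

definition vec_of :: "complex \<Rightarrow> real^2" where
  "vec_of z = vector [Re z, Im z]"

lemma cpx_vec_of [simp]: "cpx (vec_of z) = z"
  by (simp add: cpx_def vec_of_def)

lemma vec_of_cpx [simp]: "vec_of (cpx x) = x"
  by (simp add: cpx_def vec_of_def vec_eq_iff forall_2)

lemma vec_of_nth [simp]: "vec_of z $ 1 = Re z" "vec_of z $ 2 = Im z"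
  by (simp_all add: vec_of_def)

lemma norm_cpx [simp]: "norm (cpx x) = norm x"
  by (simp add: cpx_def norm_vec_def L2_set_def sum_2 cmod_def)

lemma norm_vec_of [simp]: "norm (vec_of z) = norm z"
  using norm_cpx [of "vec_of z"] by simp

lemma bounded_linear_cpx: "bounded_linear cpx"
  by (rule bounded_linear_intro [where K = 1]) (simp_all add: complex_eq_iff cpx_def flip: norm_cpx)

lemma bounded_linear_vec_of: "bounded_linear vec_of"
  by (rule bounded_linear_intro [where K = 1]) (simp_all add: vec_eq_iff forall_2)

lemmas cpx_simps = linear_simps [OF bounded_linear_cpx]
lemmas vec_of_simps = linear_simps [OF bounded_linear_vec_of]

lemma continuous_on_cpx [continuous_intros]: "continuous_on S f \<Longrightarrow> continuous_on S (\<lambda>x. cpx (f x))"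
  by (rule bounded_linear.continuous_on [OF bounded_linear_cpx])

lemma continuous_on_vec_of [continuous_intros]: "continuous_on S f \<Longrightarrow> continuous_on S (\<lambda>x. vec_of (f x))"
  by (rule bounded_linear.continuous_on [OF bounded_linear_vec_of])

lemma borel_measurable_cpx [measurable]: "cpx \<in> borel_measurable borel"
  by (intro borel_measurable_continuous_onI continuous_intros)

lemma borel_measurable_vec_of [measurable]: "vec_of \<in> borel_measurable borel"
  by (intro borel_measurable_continuous_onI continuous_intros)

lemma inner_vec_of: "vec_of w \<bullet> vec_of z = Re (w * cnj z)"
  by (simp add: inner_vec_def sum_2)

text \<open>
  The first coordinate is the squared radius, which makes the Jacobian constant and turns
  \<open>2 r\<^sup>2 - 1\<close> into \<open>2 t - 1\<close>.
\<close>

definition polar :: "real \<times> real \<Rightarrow> real^2" where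
  "polar = (\<lambda>(t, \<theta>). vec_of (of_real (sqrt t) * cis \<theta>))"

lemma polar_measurable [measurable]: "polar \<in> borel_measurable borel"
  unfolding polar_def case_prod_beta cis_conv_exp
  by (intro borel_measurable_continuous_onI continuous_intros)

lemma inj_on_polar: "inj_on polar ({0<..} \<times> {-pi<..<pi})"
proof (rule inj_onI, clarify)
  fix s t a b :: real
  assume *: "0 < s" "0 < t" "a \<in> {-pi<..<pi}" "b \<in> {-pi<..<pi}" and "polar (s, a) = polar (t, b)"
  then have eq: "of_real (sqrt s) * cis a = of_real (sqrt t) * cis b"
    by (metis polar_def case_prod_conv cpx_vec_of)
  from arg_cong [OF eq, of norm] have "s = t"
    using * by (simp add: norm_mult)
  moreover from eq have "Arg (rcis (sqrt s) a) = Arg (rcis (sqrt t) b)"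
    by (simp add: rcis_def)
  then have "a = b"
    using * by (subst (asm) (1 2) Arg_rcis) auto
  ultimately show "s = t \<and> a = b" by simp
qed

text \<open>Angles strictly between -pi and pi give an injective map on an open set, at the price of
  a slit along the negative half-axis, which is a null set.\<close>

lemma polar_image: "polar ` ({0<..} \<times> {-pi<..<pi}) = - {x. x $ 2 = 0 \<and> x $ 1 \<le> 0}"
proof (intro equalityI subsetI)
  fix x assume x: "x \<in> - {x::real^2. x $ 2 = 0 \<and> x $ 1 \<le> 0}"
  let ?z = "cpx x"
  have "x \<noteq> 0" using x by auto
  moreover have "Arg ?z \<noteq> pi" using x by (auto simp: Arg_eq_pi cpx_def)
  then have "Arg ?z \<in> {-pi<..<pi}" using Arg_bounded [of ?z] by auto
  moreover have "x = polar ((norm ?z)\<^sup>2, Arg ?z)"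
    using rcis_cmod_Arg [of ?z] by (simp add: polar_def rcis_def del: norm_cpx)
  ultimately show "x \<in> polar ` ({0<..} \<times> {-pi<..<pi})" by (intro image_eqI [of _ _ "((norm ?z)\<^sup>2, Arg ?z)"]) auto
next
  fix x assume "x \<in> polar ` ({0<..} \<times> {-pi<..<pi})"
  then obtain t \<theta> where t: "t > 0" "\<theta> \<in> {-pi<..<pi}" "x = polar (t, \<theta>)" by auto
  show "x \<in> - {x. x $ 2 = 0 \<and> x $ 1 \<le> 0}"
  proof (rule ccontr)
    assume "\<not> ?thesis"
    then have "sin \<theta> = 0" "cos \<theta> \<le> 0" using t by (auto simp: polar_def mult_le_0_iff)
    moreover from this have "Arg (cis \<theta>) = pi"
      using sin_cos_squared_add [of \<theta>] by (auto simp: Arg_eq_pi power2_eq_1_iff)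
    ultimately show False using t by (subst (asm) Arg_cis) auto
  qed
qed

text \<open>Links the two models of the plane: the change of variables theorem concerns
  \<open>real^2\<close>, whereas iterated integrals concern pairs.\<close>

lemma distr_lborel_vector2:
  "distr lborel borel (\<lambda>(a, b). vector [a, b] :: real^2) = lborel"
proof (rule lborel_eqI [symmetric])
  fix l u :: "real^2" assume le: "\<And>b. b \<in> Basis \<Longrightarrow> l \<bullet> b \<le> u \<bullet> b"
  have le': "l $ 1 \<le> u $ 1" "l $ 2 \<le> u $ 2"
    using le [of "axis 1 1"] le [of "axis 2 1"] by (auto simp: inner_axis)
  have B: "(Basis :: (real^2) set) = {axis 1 1, axis 2 1}"
    by (auto simp: Basis_vec_def UNIV_2)
  have [measurable]: "(\<lambda>(a, b). vector [a, b] :: real^2) \<in> borel_measurable borel"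
  proof -
    have "(\<lambda>(a, b). vector [a, b] :: real^2) = (\<lambda>p. vec_of (Complex (fst p) (snd p)))"
      by (auto simp: vec_of_def)
    also have "\<dots> \<in> borel_measurable borel"
      unfolding Complex_eq by (intro borel_measurable_continuous_onI continuous_intros)
    finally show ?thesis .
  qed
  have "(\<lambda>(a, b). vector [a, b]) -` box l u \<inter> space lborel = box (l $ 1, l $ 2) (u $ 1, u $ 2)"
    by (auto simp: mem_box B inner_axis Basis_prod_def)
  then have "emeasure (distr lborel borel (\<lambda>(a, b). vector [a, b] :: real^2)) (box l u) =
      emeasure lborel (box (l $ 1, l $ 2) (u $ 1, u $ 2))"
    by (subst emeasure_distr) auto
  also have "\<dots> = ennreal ((u $ 1 - l $ 1) * (u $ 2 - l $ 2))"
    using le' by (subst emeasure_lborel_box) (auto simp: Basis_prod_def)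
  also have "(u $ 1 - l $ 1) * (u $ 2 - l $ 2) = (\<Prod>b\<in>Basis. (u - l) \<bullet> b)"
    by (simp add: B inner_axis axis_eq_axis)
  finally show "emeasure (distr lborel borel (\<lambda>(a, b). vector [a, b] :: real^2)) (box l u) = (\<Prod>b\<in>Basis. (u - l) \<bullet> b)" .
qed simp

lemma polar_has_derivative:
  fixes v :: "real^2"
  assumes "v $ 1 > 0"
  shows "((\<lambda>v. polar (v $ 1, v $ 2)) has_derivative (\<lambda>h.
      (cos (v $ 2) / (2 * sqrt (v $ 1)) * h $ 1 - sqrt (v $ 1) * sin (v $ 2) * h $ 2) *\<^sub>R axis 1 1 +
      (sin (v $ 2) / (2 * sqrt (v $ 1)) * h $ 1 + sqrt (v $ 1) * cos (v $ 2) * h $ 2) *\<^sub>R axis 2 1)) (at v within S)"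
proof -
  have eq: "(\<lambda>v::real^2. polar (v $ 1, v $ 2)) =
      (\<lambda>v. (sqrt (v $ 1) * cos (v $ 2)) *\<^sub>R axis 1 1 + (sqrt (v $ 1) * sin (v $ 2)) *\<^sub>R axis 2 1)"
    by (auto simp: polar_def vec_eq_iff forall_2 axis_def)
  have n: "((\<lambda>v::real^2. v $ i) has_derivative (\<lambda>h. h $ i)) (at v within S)" for i
    by (rule bounded_linear.has_derivative [OF bounded_linear_vec_nth has_derivative_ident])
  show ?thesis
    unfolding eq using assms
    by (auto intro!: derivative_eq_intros n simp: field_simps)
qed

text \<open>The Jacobian of (t, \<theta>) |-> sqrt t e^(i \<theta>) is 1/2 everywhere, so the
  preimage of a box has twice the area of the box, and the density 1/2 compensates. Agreement on
  boxes identifies Lebesgue measure.\<close>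

lemma distr_polar:
  "distr (density lborel (\<lambda>p. ennreal (1 / 2) * indicator ({0<..} \<times> {-pi<..<pi}) p)) borel polar = lborel"
proof (rule lborel_eqI [symmetric])
  fix l u :: "real^2" assume le: "\<And>b. b \<in> Basis \<Longrightarrow> l \<bullet> b \<le> u \<bullet> b"
  let ?Q = "{0::real<..} \<times> {-pi<..<pi}"
  let ?m = "\<Prod>b\<in>Basis. (u - l) \<bullet> b"
  let ?g = "\<lambda>v::real^2. polar (v $ 1, v $ 2)"
  let ?T = "\<lambda>(a, b). vector [a, b] :: real^2"
  define S' where "S' = ?Q \<inter> polar -` box l u"
  define S where "S = {v::real^2. (v $ 1, v $ 2) \<in> S'}"
  have S'_borel: "S' \<in> sets borel"
    unfolding S'_def by (intro sets.Int measurable_sets_borel [OF polar_measurable]) (auto intro!: borel_open open_Times)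
  have pair: "(\<lambda>v::real^2. (v $ 1, v $ 2)) \<in> borel_measurable borel"
    by (intro borel_measurable_continuous_onI continuous_intros)
  have S_borel: "S \<in> sets borel"
    using measurable_sets_borel [OF pair S'_borel] by (simp add: S_def vimage_def)
  have T_meas: "?T \<in> borel_measurable borel"
  proof -
    have "(\<lambda>(a, b). vector [a, b] :: real^2) = (\<lambda>p. vec_of (Complex (fst p) (snd p)))"
      by (auto simp: vec_of_def)
    also have "\<dots> \<in> borel_measurable borel"
      unfolding Complex_eq by (intro borel_measurable_continuous_onI continuous_intros)
    finally show ?thesis .
  qed
  have inj: "inj_on ?g S"
  proof (rule inj_onI)
    fix v w assume "v \<in> S" "w \<in> S" "?g v = ?g w"
    then have "(v $ 1, v $ 2) = (w $ 1, w $ 2)"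
      by (intro inj_onD [OF inj_on_polar]) (auto simp: S_def S'_def)
    then show "v = w" by (auto simp: vec_eq_iff forall_2)
  qed
  have img: "?g ` S = box l u - {x. x $ 2 = 0 \<and> x $ 1 \<le> 0}"
  proof -
    have "?g ` S = polar ` S'"
      by (auto simp: S_def image_iff) (metis vector_2)
    also have "\<dots> = box l u \<inter> polar ` ?Q" by (auto simp: S'_def)
    finally show ?thesis unfolding polar_image by auto
  qed
  have null: "{x::real^2. x $ 2 = 0 \<and> x $ 1 \<le> 0} \<in> null_sets lebesgue"
  proof -
    have "negligible {x::real^2. x $ 2 = 0 \<and> x $ 1 \<le> 0}"
      by (rule negligible_subset [OF negligible_standard_hyperplane_cart [where k = 2]]) auto
    then show ?thesis by (simp add: negligible_iff_null_sets)
  qed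
  have em: "emeasure lebesgue (?g ` S) = ennreal ?m"
    unfolding img using le by (subst emeasure_Diff_null_set [OF null]) auto
  have sets_img: "?g ` S \<in> sets lebesgue"
    unfolding img using null by auto
  have m0: "?m \<ge> 0" using le by (intro prod_nonneg) (auto simp: inner_diff_left)
  have "?g ` S \<in> lmeasurable \<and> measure lebesgue (?g ` S) = ?m"
    using em sets_img m0 by (auto simp: fmeasurable_def measure_def)
  \<comment> \<open>The change of variables theorem is read backwards: the area of the image is
    known, and this yields the integral of the Jacobian over \<open>S\<close>.\<close>
  then have "((\<lambda>v. \<bar>det (matrix ((\<lambda>v h.
      (cos (v $ 2) / (2 * sqrt (v $ 1)) * h $ 1 - sqrt (v $ 1) * sin (v $ 2) * h $ 2) *\<^sub>R axis 1 1 +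
      (sin (v $ 2) / (2 * sqrt (v $ 1)) * h $ 1 + sqrt (v $ 1) * cos (v $ 2) * h $ 2) *\<^sub>R axis 2 1) v :: real^2 \<Rightarrow> real^2))\<bar>) has_integral ?m) S"
    using S_borel
    by (subst (asm) has_measure_differentiable_image [OF _ polar_has_derivative inj]) (auto simp: S_def S'_def)
  then have "((\<lambda>v. 1 / 2 :: real) has_integral ?m) S"
  proof (rule has_integral_eq [rotated])
    fix v assume "v \<in> S"
    then have v: "v $ 1 > 0" by (auto simp: S_def S'_def)
    have "cos (v $ 2) / (2 * sqrt (v $ 1)) * (sqrt (v $ 1) * cos (v $ 2)) + sqrt (v $ 1) * sin (v $ 2) * (sin (v $ 2) / (2 * sqrt (v $ 1)))
       = ((cos (v $ 2))\<^sup>2 + (sin (v $ 2))\<^sup>2) / 2"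
      using v by (simp add: field_simps power2_eq_square)
    also have "\<dots> = 1 / 2" by simp
    finally show "\<bar>det (matrix ((\<lambda>v h.
      (cos (v $ 2) / (2 * sqrt (v $ 1)) * h $ 1 - sqrt (v $ 1) * sin (v $ 2) * h $ 2) *\<^sub>R axis 1 1 +
      (sin (v $ 2) / (2 * sqrt (v $ 1)) * h $ 1 + sqrt (v $ 1) * cos (v $ 2) * h $ 2) *\<^sub>R axis 2 1) v :: real^2 \<Rightarrow> real^2))\<bar> = 1 / 2"
      by (simp add: det_2 matrix_def axis_def)
  qed
  from has_integral_mult_right [OF this, of 2] have i: "((\<lambda>v. 1 :: real) has_integral 2 * ?m) S" by simp
  have Slm: "S \<in> lmeasurable"
    unfolding lmeasurable_iff_integrable_on by (rule has_integral_integrable [OF i])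
  have "emeasure lborel S = emeasure lebesgue S" using S_borel by simp
  also have "\<dots> = ennreal (measure lebesgue S)" by (rule emeasure_eq_measure2 [OF Slm])
  also have "measure lebesgue S = 2 * ?m"
    unfolding lmeasure_integral [OF Slm] by (rule integral_unique [OF i])
  finally have emS: "emeasure lborel S = ennreal (2 * ?m)" .
  have "emeasure lborel S = emeasure lborel S'"
  proof -
    have "emeasure (distr lborel borel ?T) S = emeasure lborel (?T -` S \<inter> space lborel)"
      using T_meas S_borel by (intro emeasure_distr) auto
    also have "?T -` S \<inter> space lborel = S'" by (auto simp: S_def)
    finally show ?thesis by (simp add: distr_lborel_vector2)
  qed
  with emS have emS': "emeasure lborel S' = ennreal (2 * ?m)" by simp
  have Q: "?Q \<in> sets borel" by (auto intro!: borel_open open_Times)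
  have "emeasure (distr (density lborel (\<lambda>p. ennreal (1 / 2) * indicator ?Q p)) borel polar) (box l u)
     = emeasure (density lborel (\<lambda>p. ennreal (1 / 2) * indicator ?Q p)) (polar -` box l u)"
    by (subst emeasure_distr) auto
  also have "\<dots> = (\<integral>\<^sup>+p. ennreal (1 / 2) * indicator ?Q p * indicator (polar -` box l u) p \<partial>lborel)"
    using Q by (subst emeasure_density) (auto intro!: measurable_sets_borel [OF polar_measurable])
  also have "\<dots> = (\<integral>\<^sup>+p. ennreal (1 / 2) * indicator S' p \<partial>lborel)"
    by (intro nn_integral_cong) (auto simp: S'_def split: split_indicator)
  also have "\<dots> = ennreal (1 / 2) * emeasure lborel S'"
    using S'_borel by (subst nn_integral_cmult_indicator) auto
  also have "\<dots> = ennreal ?m"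
    unfolding emS' by (subst ennreal_mult [symmetric]) (use m0 in auto)
  finally show "emeasure (distr (density lborel (\<lambda>p. ennreal (1 / 2) * indicator ?Q p)) borel polar) (box l u) = ?m" .
qed simp

lemma nn_integral_polar:
  assumes [measurable]: "f \<in> borel_measurable borel"
  shows "(\<integral>\<^sup>+x. f x \<partial>lborel) =
     (\<integral>\<^sup>+t. \<integral>\<^sup>+\<theta>. ennreal (1 / 2) * indicator {0<..} t * indicator {-pi<..<pi} \<theta> * f (polar (t, \<theta>)) \<partial>lborel \<partial>lborel)"
proof -
  have [measurable]: "{0::real<..} \<times> {-pi<..<pi} \<in> sets borel" by (auto intro!: borel_open open_Times)
  have "(\<integral>\<^sup>+x. f x \<partial>lborel) = (\<integral>\<^sup>+p. ennreal (1 / 2) * indicator ({0<..} \<times> {-pi<..<pi}) p * f (polar p) \<partial>lborel)"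
    by (subst distr_polar [symmetric], subst nn_integral_distr, (measurable; fail)+, subst nn_integral_density) auto
  also have "\<dots> = (\<integral>\<^sup>+p. ennreal (1 / 2) * indicator ({0<..} \<times> {-pi<..<pi}) p * f (polar p) \<partial>(lborel \<Otimes>\<^sub>M lborel))"
    by (simp add: lborel_prod)
  also have "\<dots> = (\<integral>\<^sup>+t. \<integral>\<^sup>+\<theta>. ennreal (1 / 2) * indicator ({0<..} \<times> {-pi<..<pi}) (t, \<theta>) * f (polar (t, \<theta>)) \<partial>lborel \<partial>lborel)"
    by (subst lborel.nn_integral_fst [symmetric]) (auto simp: lborel_prod)
  also have "\<dots> = (\<integral>\<^sup>+t. \<integral>\<^sup>+\<theta>. ennreal (1 / 2) * indicator {0<..} t * indicator {-pi<..<pi} \<theta> * f (polar (t, \<theta>)) \<partial>lborel \<partial>lborel)"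
    by (intro nn_integral_cong) (auto split: split_indicator)
  finally show ?thesis .
qed

lemma integral_polar:
  fixes f :: "real^2 \<Rightarrow> 'b::euclidean_space"
  assumes f: "integrable lborel f"
  shows "(LINT x|lborel. f x) =
     (1 / 2) *\<^sub>R (LINT t:{0<..}|lborel. (LINT \<theta>:{-pi<..<pi}|lborel. f (polar (t, \<theta>))))"
proof -
  let ?Q = "{0::real<..} \<times> {-pi<..<pi}"
  let ?d = "\<lambda>p. 1 / 2 * indicator ?Q p :: real"
  have Q [measurable]: "?Q \<in> sets borel" by (auto intro!: borel_open open_Times)
  have [measurable]: "f \<in> borel_measurable borel" using borel_measurable_integrable [OF f] by simp
  have d: "(\<lambda>p. ennreal (1 / 2) * indicator ?Q p) = (\<lambda>p. ennreal (?d p))"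
    by (auto split: split_indicator)
  have "integrable (distr (density lborel (\<lambda>p. ennreal (?d p))) borel polar) f"
    using f distr_polar unfolding d by simp
  then have "integrable (density lborel (\<lambda>p. ennreal (?d p))) (\<lambda>p. f (polar p))"
    by (subst (asm) integrable_distr_eq) auto
  then have int: "integrable (lborel \<Otimes>\<^sub>M lborel) (\<lambda>p. ?d p *\<^sub>R f (polar p))"
    by (subst (asm) integrable_density) (auto simp: lborel_prod)
  have "(LINT x|lborel. f x) = (LINT x|distr (density lborel (\<lambda>p. ennreal (?d p))) borel polar. f x)"
    using distr_polar unfolding d by simp
  also have "\<dots> = (LINT p|density lborel (\<lambda>p. ennreal (?d p)). f (polar p))"
    by (subst integral_distr) auto
  also have "\<dots> = (LINT p|(lborel \<Otimes>\<^sub>M lborel). ?d p *\<^sub>R f (polar p))"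
    by (subst integral_density) (auto simp: lborel_prod)
  also have "\<dots> = (LINT t|lborel. LINT \<theta>|lborel. ?d (t, \<theta>) *\<^sub>R f (polar (t, \<theta>)))"
    using lborel_pair.integral_fst' [OF int] by simp
  also have "\<dots> = (LINT t|lborel. (1 / 2) *\<^sub>R (indicator {0<..} t *\<^sub>R (LINT \<theta>:{-pi<..<pi}|lborel. f (polar (t, \<theta>)))))"
  proof (intro Bochner_Integration.integral_cong refl)
    fix t :: real
    have *: "?d (t, \<theta>) *\<^sub>R f (polar (t, \<theta>)) = (1 / 2 * indicator {0<..} t) *\<^sub>R (indicator {-pi<..<pi} \<theta> *\<^sub>R f (polar (t, \<theta>)))" for \<theta>
      by (auto split: split_indicator)
    show "(LINT \<theta>|lborel. ?d (t, \<theta>) *\<^sub>R f (polar (t, \<theta>))) =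
        (1 / 2) *\<^sub>R (indicator {0<..} t *\<^sub>R (LINT \<theta>:{-pi<..<pi}|lborel. f (polar (t, \<theta>))))"
      unfolding * set_lebesgue_integral_def integral_scaleR_right by simp
  qed
  finally show ?thesis
    unfolding set_lebesgue_integral_def integral_scaleR_right .
qed

section \<open>Shifted Jacobi polynomials\<close>

definition sjac :: "nat \<Rightarrow> real \<Rightarrow> real \<Rightarrow> real \<Rightarrow> real" where
  "sjac n a b t = jacobi n a b (2 * t - 1)"

definition sjac' :: "nat \<Rightarrow> real \<Rightarrow> real \<Rightarrow> real \<Rightarrow> real" where
  "sjac' n a b t = (\<Sum>k\<le>n. ((real n + a) gchoose (n - k)) * ((real n + b) gchoose k)
      * (real k * (t - 1) ^ (k - 1) * t ^ (n - k) + (t - 1) ^ k * (real (n - k) * t ^ (n - k - 1))))"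

text \<open>The hypergeometric coefficients of the polynomial at the endpoint t = 1, that is, with
  respect to powers of 1 - t.\<close>

definition jac_coeff :: "nat \<Rightarrow> real \<Rightarrow> real \<Rightarrow> nat \<Rightarrow> real" where
  "jac_coeff n a b j = (-1) ^ j * ((real n + a) gchoose (n - j)) * ((real n + a + b + real j) gchoose j)"

lemma sjac_altdef:
  "sjac n a b t = (\<Sum>k\<le>n. ((real n + a) gchoose (n - k)) * ((real n + b) gchoose k)
             * (t - 1) ^ k * t ^ (n - k))"
proof -
  have 1: "(2 * t - 1 - 1) / 2 = t - 1" "(2 * t - 1 + 1) / 2 = t" by (auto simp: field_simps)
  show ?thesis unfolding sjac_def jacobi_def 1 ..
qed

lemma sjac_deriv: "(sjac n a b has_real_derivative sjac' n a b t) (at t)"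
  unfolding sjac_altdef [abs_def] sjac'_def
  by (rule derivative_eq_intros refl | (simp add: algebra_simps)[1])+

lemma sjac_0 [simp]: "sjac 0 a b t = 1"
  by (simp add: sjac_altdef)

lemma sjac'_0 [simp]: "sjac' 0 a b t = 0"
  by (simp add: sjac'_def)

lemma continuous_on_sjac [continuous_intros]:
  "continuous_on S f \<Longrightarrow> continuous_on S (\<lambda>x. sjac n a b (f x))"
  unfolding sjac_altdef by (intro continuous_intros)

lemma continuous_on_sjac' [continuous_intros]:
  "continuous_on S f \<Longrightarrow> continuous_on S (\<lambda>x. sjac' n a b (f x))"
  unfolding sjac'_def by (intro continuous_intros)

text \<open>Exchanging k and n - k in the defining sum swaps the two parameters.\<close>

lemma sjac_reflect: "sjac n a b t = (-1) ^ n * sjac n b a (1 - t)"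
proof -
  have "sjac n a b t = (\<Sum>k\<le>n. ((real n + a) gchoose k) * ((real n + b) gchoose (n - k))
             * (t - 1) ^ (n - k) * t ^ k)"
    unfolding sjac_altdef
    by (subst sum.nat_diff_reindex [symmetric, of _ "Suc n", unfolded lessThan_Suc_atMost])
       (auto intro!: sum.cong)
  also have "\<dots> = (-1) ^ n * sjac n b a (1 - t)"
    unfolding sjac_altdef sum_distrib_left
  proof (intro sum.cong refl)
    fix k assume "k \<in> {..n}"
    then obtain m where n: "n = k + m" by (auto simp: le_iff_add)
    have e: "1 - t - 1 = - t" "t - 1 = - (1 - t)" by simp_all
    have p: "(1 - t - 1) ^ k = (-1) ^ k * t ^ k" "(t - 1) ^ m = (-1) ^ m * (1 - t) ^ m"
      using power_minus [of t k] power_minus [of "1 - t" m] by simp_all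
    have q: "(-1) ^ (k + m) * (-1) ^ k = ((-1::real) ^ m)"
      by (simp add: power_add mult.commute mult.left_commute flip: power_mult_distrib)
    show "(real n + a gchoose k) * (real n + b gchoose (n - k)) * (t - 1) ^ (n - k) * t ^ k =
      (- 1) ^ n * ((real n + b gchoose (n - k)) * (real n + a gchoose k) * (1 - t - 1) ^ k * (1 - t) ^ (n - k))"
      unfolding p n add_diff_cancel_left' q [symmetric] by (simp only: ac_simps)
  qed
  finally show ?thesis .
qed

lemma sjac'_reflect: "sjac' n a b t = - ((-1) ^ n * sjac' n b a (1 - t))"
proof -
  have "((\<lambda>t. (-1) ^ n * sjac n b a (1 - t)) has_real_derivative (-1) ^ n * (sjac' n b a (1 - t) * -1)) (at t)"
    by (intro DERIV_cmult DERIV_chain2 [OF sjac_deriv]) (auto intro!: derivative_eq_intros)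
  moreover have "sjac n a b = (\<lambda>t. (-1) ^ n * sjac n b a (1 - t))"
    by (rule ext, rule sjac_reflect)
  ultimately have "(sjac n a b has_real_derivative (-1) ^ n * (sjac' n b a (1 - t) * -1)) (at t)"
    by simp
  from DERIV_unique [OF this sjac_deriv] show ?thesis by simp
qed

text \<open>Writing t = (t - 1) + 1 and collecting powers of t - 1 leaves a sum of products of two
  binomial coefficients, which Vandermonde's identity evaluates.\<close>

lemma sjac_expand: "sjac n a b t = (\<Sum>j\<le>n. jac_coeff n a b j * (1 - t) ^ j)"
proof -
  let ?y = "t - 1"
  let ?c = "\<lambda>k. ((real n + a) gchoose (n - k)) * ((real n + b) gchoose k)"
  have "sjac n a b t = (\<Sum>k\<le>n. \<Sum>i\<le>n - k. ?c k * real ((n - k) choose i) * ?y ^ (i + k))"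
    unfolding sjac_altdef
  proof (intro sum.cong refl)
    fix k assume "k \<in> {..n}"
    have "t ^ (n - k) = (?y + 1) ^ (n - k)" by simp
    also have "\<dots> = (\<Sum>i\<le>n - k. real ((n - k) choose i) * ?y ^ i)"
      by (subst binomial_ring) simp
    finally show "?c k * ?y ^ k * t ^ (n - k) = (\<Sum>i\<le>n - k. ?c k * real ((n - k) choose i) * ?y ^ (i + k))"
      by (simp add: sum_distrib_left power_add mult_ac)
  qed
  also have "\<dots> = (\<Sum>(k, i)\<in>{(k, i). k + i \<le> n}. ?c k * real ((n - k) choose i) * ?y ^ (i + k))"
    by (subst sum.Sigma) (auto intro!: sum.cong)
  also have "\<dots> = (\<Sum>j\<le>n. \<Sum>k\<le>j. ?c k * real ((n - k) choose (j - k)) * ?y ^ (j - k + k))"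
    by (rule sum.triangle_reindex_eq)
  also have "\<dots> = (\<Sum>j\<le>n. jac_coeff n a b j * (1 - t) ^ j)"
  proof (intro sum.cong refl)
    fix j assume "j \<in> {..n}"
    then have j: "j \<le> n" by simp
    have "(\<Sum>k\<le>j. ?c k * real ((n - k) choose (j - k)) * ?y ^ (j - k + k)) =
        (\<Sum>k\<le>j. ((real n + a) gchoose (n - j)) * (((real n + b) gchoose k) * ((a + real j) gchoose (j - k)))) * ?y ^ j"
      unfolding sum_distrib_right
    proof (intro sum.cong refl)
      fix k assume "k \<in> {..j}"
      then have k: "k \<le> j" by simp
      \<comment> \<open>Trinomial revision extracts a factor free of k, so that the remaining sum
        over k has Vandermonde form.\<close>
      have "((real n + a) gchoose (n - k)) * (real (n - k) gchoose (n - j)) =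
          ((real n + a) gchoose (n - j)) * ((real n + a - real (n - j)) gchoose (n - k - (n - j)))"
        using j k by (intro gbinomial_trinomial_revision) auto
      moreover have "(real (n - k) gchoose (n - j)) = real ((n - k) choose (j - k))"
        using j k binomial_symmetric [of "j - k" "n - k"] by (simp add: binomial_gbinomial)
      moreover have "real n + a - real (n - j) = a + real j" "n - k - (n - j) = j - k"
        using j k by (auto simp: of_nat_diff)
      ultimately have *: "((real n + a) gchoose (n - k)) * real ((n - k) choose (j - k)) =
          ((real n + a) gchoose (n - j)) * ((a + real j) gchoose (j - k))" by simp
      have "?c k * real ((n - k) choose (j - k)) * ?y ^ (j - k + k) =
          (((real n + a) gchoose (n - k)) * real ((n - k) choose (j - k))) * ((real n + b) gchoose k) * ?y ^ j"
        using k by simp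
      then show "?c k * real ((n - k) choose (j - k)) * ?y ^ (j - k + k) =
          ((real n + a) gchoose (n - j)) * (((real n + b) gchoose k) * ((a + real j) gchoose (j - k))) * ?y ^ j"
        unfolding * by simp
    qed
    also have "\<dots> = ((real n + a) gchoose (n - j)) * ((real n + b + (a + real j)) gchoose j) * ?y ^ j"
      using gbinomial_Vandermonde [of "real n + b" "a + real j" j]
      by (simp add: sum_distrib_left [symmetric] atMost_atLeast0)
    also have "?y ^ j = (-1) ^ j * (1 - t) ^ j" by (simp flip: power_mult_distrib)
    finally show "(\<Sum>k\<le>j. ?c k * real ((n - k) choose (j - k)) * ?y ^ (j - k + k)) = jac_coeff n a b j * (1 - t) ^ j"
      by (simp add: jac_coeff_def algebra_simps)
  qed
  finally show ?thesis .
qed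

lemma sjac'_expand: "sjac' n a b t = - (\<Sum>j\<le>n. jac_coeff n a b j * (real j * (1 - t) ^ (j - 1)))"
proof -
  have "(sjac n a b has_real_derivative - (\<Sum>j\<le>n. jac_coeff n a b j * (real j * (1 - t) ^ (j - 1)))) (at t)"
    unfolding sjac_expand [abs_def] sum_negf [symmetric]
    by (rule derivative_eq_intros refl | (simp add: algebra_simps)[1])+
  from DERIV_unique [OF sjac_deriv this] show ?thesis .
qed

section \<open>Derivatives and parameter shifts of Jacobi polynomials\<close>

lemma sjac'_Suc: "sjac' (Suc n) a b t = (real n + a + b + 2) * sjac n (a + 1) (b + 1) t"
proof -
  have *: "jac_coeff (Suc n) a b (Suc i) * real (Suc i) = - (real n + a + b + 2) * jac_coeff n (a + 1) (b + 1) i" for i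
  proof -
    let ?N = "real n + a + b + 2"
    have "((?N + real i) gchoose Suc i) * real (Suc i) = ?N * ((?N + real i) gchoose i)"
      by (simp add: gbinomial_pochhammer' pochhammer_rec add_ac del: of_nat_Suc) (simp add: field_simps)
    from arg_cong [OF this, of "\<lambda>x. - ((-1) ^ i * ((1 + (a + real n)) gchoose (n - i)) * x)"] show ?thesis
      by (simp add: jac_coeff_def algebra_simps)
  qed
  have "sjac' (Suc n) a b t = - (\<Sum>j\<le>n. jac_coeff (Suc n) a b (Suc j) * real (Suc j) * (1 - t) ^ j)"
    unfolding sjac'_expand by (subst sum.atMost_Suc_shift) (simp add: mult_ac)
  also have "\<dots> = (\<Sum>j\<le>n. (real n + a + b + 2) * (jac_coeff n (a + 1) (b + 1) j * (1 - t) ^ j))"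
    unfolding * sum_negf [symmetric] by (intro sum.cong refl) (simp add: algebra_simps)
  finally show ?thesis
    unfolding sjac_expand by (simp add: sum_distrib_left)
qed

text \<open>Up to (1 - t)^(a - 1), the left side is the derivative of (1 - t)^a times the
  polynomial. It multiplies the j-th endpoint coefficient by - (j + a), a factor that the binomial
  coefficient absorbs.\<close>

lemma sjac_shift_up:
  "(1 - t) * sjac' n a b t - a * sjac n a b t = - (real n + a) * sjac n (a - 1) (b + 1) t"
proof -
  have *: "jac_coeff n a b j * (real j + a) = (real n + a) * jac_coeff n (a - 1) (b + 1) j" if "j \<le> n" for j
  proof -
    have "(real j + a) * ((real n + a) gchoose (n - j)) = (real n + a) * ((real n + a - 1) gchoose (n - j))"
      using gbinomial_absorb_comp [of "real n + a" "n - j"] that by (simp add: of_nat_diff add_ac)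
    from arg_cong [OF this, of "\<lambda>x. (-1) ^ j * ((real n + a + b + real j) gchoose j) * x"] show ?thesis
      by (simp add: jac_coeff_def algebra_simps)
  qed
  have p: "(1 - t) * (jac_coeff n a b j * (real j * (1 - t) ^ (j - 1))) = jac_coeff n a b j * real j * (1 - t) ^ j" for j
    by (cases j) auto
  have "(1 - t) * sjac' n a b t - a * sjac n a b t = - (\<Sum>j\<le>n. jac_coeff n a b j * (real j + a) * (1 - t) ^ j)"
    unfolding sjac'_expand sjac_expand mult_minus_right sum_distrib_left p
    by (simp add: algebra_simps sum.distrib)
  also have "\<dots> = - (\<Sum>j\<le>n. (real n + a) * jac_coeff n (a - 1) (b + 1) j * (1 - t) ^ j)"
    by (simp add: *)
  finally show ?thesis
    by (simp add: sjac_expand sum_distrib_left mult.assoc minus_mult_left [symmetric] sum_negf del: minus_add_distrib)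
qed

text \<open>The mirror image of \<open>sjac_shift_up\<close> under t |-> 1 - t: up to t^(b - 1), the
  left side is the derivative of t^b times the polynomial.\<close>

lemma sjac_shift_down:
  "t * sjac' n a b t + b * sjac n a b t = (real n + b) * sjac n (a + 1) (b - 1) t"
proof -
  have "t * sjac' n a b t + b * sjac n a b t =
      (-1) ^ n * (- ((1 - (1 - t)) * sjac' n b a (1 - t) - b * sjac n b a (1 - t)))"
    unfolding sjac_reflect [of n a b t] sjac'_reflect [of n a b t] by (simp add: algebra_simps)
  then show ?thesis
    unfolding sjac_shift_up sjac_reflect [of n "a + 1" "b - 1" t] by (simp add: algebra_simps)
qed

text \<open>One step of Rodrigues' formula: up to t^(b - 1) (1 - t)^(a - 1), the left side is the
  derivative of t^b (1 - t)^a times the polynomial. In the form of \<open>sjac_altdef\<close>, each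
  term contributes to two neighbouring terms of degree n + 1.\<close>

lemma sjac_raise:
  "t * (1 - t) * sjac' n a b t + (b * (1 - t) - a * t) * sjac n a b t
     = - (real n + 1) * sjac (Suc n) (a - 1) (b - 1) t"
proof -
  define c where "c k = ((real n + a) gchoose (n - k)) * ((real n + b) gchoose k)" for k
  define d where "d k = ((real n + a) gchoose (Suc n - k)) * ((real n + b) gchoose k)" for k
  define S where "S k = (t - 1) ^ k * t ^ (Suc n - k)" for k
  have up: "(x - real k) * (x gchoose k) = real (Suc k) * (x gchoose (Suc k))" for x k
    using gbinomial_absorb_comp [of x k] gbinomial_absorption [of k "x"] by simp
  have t1: "(real n - real k + b) * c k = real (Suc k) * d (Suc k)" if "k \<le> n" for k
    using arg_cong [OF up [of "real n + b" k], of "\<lambda>x. x * ((real n + a) gchoose (n - k))"]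
    by (simp add: c_def d_def algebra_simps)
  have t2: "(real k + a) * c k = real (Suc n - k) * d k" if "k \<le> n" for k
  proof -
    have "Suc (n - k) = Suc n - k" using that by simp
    then show ?thesis
      using arg_cong [OF up [of "real n + a" "n - k"], of "\<lambda>x. x * ((real n + b) gchoose k)"] that
      by (simp add: c_def d_def algebra_simps)
  qed
  have "t * (1 - t) * sjac' n a b t + (b * (1 - t) - a * t) * sjac n a b t
      = (\<Sum>k\<le>n. - ((real n - real k + b) * c k * S (Suc k) + (real k + a) * c k * S k))"
    unfolding sjac'_def sjac_altdef sum_distrib_left sum.distrib [symmetric]
  proof (intro sum.cong refl)
    fix k assume "k \<in> {..n}"
    then obtain m where n: "n = k + m" by (auto simp: le_iff_add)
    have e1: "t * (1 - t) * (real k * (t - 1) ^ (k - 1) * t ^ m) = - (real k * t * ((t - 1) ^ k * t ^ m))"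
      by (cases k) (auto simp: algebra_simps)
    have e2: "t * (1 - t) * ((t - 1) ^ k * (real m * t ^ (m - 1))) = real m * (1 - t) * ((t - 1) ^ k * t ^ m)"
      by (cases m) (auto simp: algebra_simps)
    define X where "X = (t - 1) ^ k * t ^ m"
    have S1: "S (Suc k) = (t - 1) * X" and S2: "S k = t * X"
      by (simp_all add: S_def n X_def)
    have nk: "n - k = m" "real n - real k = real m" using n by auto
    have "t * (1 - t) * (c k * (real k * (t - 1) ^ (k - 1) * t ^ m + (t - 1) ^ k * (real m * t ^ (m - 1)))) +
         (b * (1 - t) - a * t) * (c k * ((t - 1) ^ k * t ^ m)) =
       c k * (t * (1 - t) * (real k * (t - 1) ^ (k - 1) * t ^ m) + t * (1 - t) * ((t - 1) ^ k * (real m * t ^ (m - 1)))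
        + (b * (1 - t) - a * t) * X)" by (simp only: algebra_simps X_def)
    also have "\<dots> = c k * (- (real k * t * X) + real m * (1 - t) * X + (b * (1 - t) - a * t) * X)"
      by (simp only: e1 e2 X_def)
    also have "\<dots> = - ((real m + b) * c k * S (Suc k) + (real k + a) * c k * S k)"
      unfolding S1 S2 by (simp add: algebra_simps)
    finally show "t * (1 - t) * ((real n + a gchoose (n - k)) * (real n + b gchoose k) *
       (real k * (t - 1) ^ (k - 1) * t ^ (n - k) + (t - 1) ^ k * (real (n - k) * t ^ (n - k - 1)))) +
      (b * (1 - t) - a * t) * ((real n + a gchoose (n - k)) * (real n + b gchoose k) * (t - 1) ^ k * t ^ (n - k)) =
      - ((real n - real k + b) * c k * S (Suc k) + (real k + a) * c k * S k)"
      unfolding nk by (simp add: c_def nk mult.assoc)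
  qed
  also have "\<dots> = - ((\<Sum>k\<le>n. real (Suc k) * d (Suc k) * S (Suc k)) + (\<Sum>k\<le>n. real (Suc n - k) * d k * S k))"
    unfolding sum_negf sum.distrib using t1 t2 by (intro arg_cong [where f = uminus] arg_cong2 [where f = "(+)"] sum.cong) auto
  also have "(\<Sum>k\<le>n. real (Suc k) * d (Suc k) * S (Suc k)) = (\<Sum>k\<le>Suc n. real k * d k * S k)"
    by (simp add: sum.atMost_Suc_shift [of "\<lambda>k. real k * d k * S k"] del: of_nat_Suc sum.atMost_Suc)
  also have "(\<Sum>k\<le>n. real (Suc n - k) * d k * S k) = (\<Sum>k\<le>Suc n. real (Suc n - k) * d k * S k)"
    by simp
  \<comment> \<open>The two contributions to the term k add up to k + (n + 1 - k) = n + 1, whatever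
    k is.\<close>
  also have "(\<Sum>k\<le>Suc n. real k * d k * S k) + (\<Sum>k\<le>Suc n. real (Suc n - k) * d k * S k)
      = (\<Sum>k\<le>Suc n. (real n + 1) * (d k * S k))"
    unfolding sum.distrib [symmetric] by (intro sum.cong refl) (auto simp: of_nat_diff algebra_simps)
  also have "\<dots> = (real n + 1) * sjac (Suc n) (a - 1) (b - 1) t"
    unfolding sjac_altdef sum_distrib_left by (intro sum.cong refl) (simp add: d_def S_def algebra_simps)
  finally show ?thesis by (simp only: mult_minus_left)
qed

section \<open>Orthogonality and norms of Jacobi polynomials\<close>

definition jac_int :: "real \<Rightarrow> nat \<Rightarrow> (real \<Rightarrow> real) \<Rightarrow> real" where
  "jac_int a b q = (LINT t:{0<..<1}|lborel. t ^ b * (1 - t) powr a * q t)"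

lemma jac_integrable:
  fixes q :: "real \<Rightarrow> real"
  assumes "a > -1" "continuous_on {0..1} q"
  shows "set_integrable lborel {0<..<1} (\<lambda>t. t ^ b * (1 - t) powr a * q t)"
proof -
  obtain C where C: "\<And>t. t \<in> {0..1} \<Longrightarrow> \<bar>q t\<bar> \<le> C"
    using compact_imp_bounded [OF compact_continuous_image [OF assms(2) compact_Icc]]
    unfolding bounded_iff by (metis image_eqI real_norm_def)
  have "C \<ge> 0" using C [of 0] by auto
  have "set_integrable lborel {0..1} (\<lambda>t. t powr (1 - 1) * (1 - t) powr (a + 1 - 1))"
    using assms(1) by (intro integrable_Beta) auto
  then have "set_integrable lborel {0<..<1} (\<lambda>t. C * (t powr 0 * (1 - t) powr a))"
    by (intro set_integrable_mult_right) (auto intro: set_integrable_subset)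
  then show ?thesis
  proof (rule set_integrable_bound)
    have "continuous_on {0<..<1} q" by (rule continuous_on_subset [OF assms(2)]) auto
    then have "continuous_on {0<..<1} (\<lambda>t. t ^ b * (1 - t) powr a * q t)"
      by (intro continuous_intros) auto
    then show "set_borel_measurable lborel {0<..<1} (\<lambda>t. t ^ b * (1 - t) powr a * q t)"
      using borel_measurable_continuous_on_indicator [of "{0<..<1}" "\<lambda>t. t ^ b * (1 - t) powr a * q t"]
      by (simp add: set_borel_measurable_def)
    have "\<bar>t ^ b * (1 - t) powr a * q t\<bar> \<le> C * (1 - t) powr a" if "t \<in> {0<..<1}" for t
    proof -
      have "\<bar>t ^ b * (1 - t) powr a * q t\<bar> = t ^ b * ((1 - t) powr a * \<bar>q t\<bar>)"
        using that by (simp add: abs_mult)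
      also have "\<dots> \<le> 1 * ((1 - t) powr a * C)"
        using that C [of t] by (intro mult_mono) (auto simp: power_le_one)
      finally show ?thesis by (simp add: mult.commute)
    qed
    then show "AE t in lborel. t \<in> {0<..<1} \<longrightarrow>
        norm (t ^ b * (1 - t) powr a * q t) \<le> norm (C * (t powr 0 * (1 - t) powr a))"
      using \<open>C \<ge> 0\<close> by (auto simp: abs_mult)
  qed
qed

lemma jac_int_add:
  assumes "a > -1" "continuous_on {0..1} p" "continuous_on {0..1} q"
  shows "jac_int a b (\<lambda>t. p t + q t) = jac_int a b p + jac_int a b q"
  unfolding jac_int_def using assms
  by (subst set_integral_add(2) [symmetric]) (auto intro!: jac_integrable simp: distrib_left)

lemma jac_int_cmult: "jac_int a b (\<lambda>t. c * q t) = c * jac_int a b q"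
proof -
  have *: "t ^ b * (1 - t) powr a * (c * q t) = c * (t ^ b * (1 - t) powr a * q t)" for t by simp
  show ?thesis unfolding jac_int_def * by simp
qed

lemma jac_int_cong:
  assumes "\<And>t. 0 < t \<Longrightarrow> t < 1 \<Longrightarrow> p t = q t"
  shows "jac_int a b p = jac_int a b q"
  unfolding jac_int_def using assms by (intro set_lebesgue_integral_cong) auto

lemma jac_int_shift: "jac_int (a + 1) (Suc b) q = jac_int a b (\<lambda>t. t * (1 - t) * q t)"
  unfolding jac_int_def
  by (intro set_lebesgue_integral_cong) (auto simp: powr_add)

text \<open>Together with its weight the integrand is the derivative of t^(b + 1) (1 - t)^(a + 1) q,
  which vanishes at both ends.\<close>

lemma jac_int_by_parts:
  assumes a: "a > -1" and q: "\<And>t. (q has_real_derivative q' t) (at t)" and q': "continuous_on {0..1} q'"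
  shows "jac_int a b (\<lambda>t. t * (1 - t) * q' t + ((real b + 1) * (1 - t) - (a + 1) * t) * q t) = 0"
proof -
  let ?r = "\<lambda>t. t * (1 - t) * q' t + ((real b + 1) * (1 - t) - (a + 1) * t) * q t"
  let ?F = "\<lambda>t. t ^ Suc b * (1 - t) powr (a + 1) * q t"
  have q_cont: "continuous_on S q" for S
    using q by (meson DERIV_continuous_on has_field_derivative_at_within)
  have "((\<lambda>t. t ^ b * (1 - t) powr a * ?r t) has_integral (?F 1 - ?F 0)) {0..1}"
  proof (rule fundamental_theorem_of_calculus_interior)
    show "continuous_on {0..1} ?F"
      using a by (intro continuous_intros q_cont continuous_on_powr') auto
    fix t :: real assume t: "t \<in> {0<..<1}"
    have p: "(1 - t) powr (a + 1) = (1 - t) * (1 - t) powr a"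
      using t by (simp add: powr_add)
    have d1: "((\<lambda>t. t ^ Suc b) has_real_derivative (real b + 1) * t ^ b) (at t)"
      by (rule DERIV_cong [OF DERIV_pow]) simp
    have d2: "((\<lambda>t. (1 - t) powr (a + 1)) has_real_derivative - ((a + 1) * (1 - t) powr a)) (at t)"
      using t by (auto intro!: derivative_eq_intros)
    have "((\<lambda>t. t ^ Suc b * ((1 - t) powr (a + 1) * q t)) has_real_derivative t ^ b * (1 - t) powr a * ?r t) (at t)"
      by (rule DERIV_cong [OF DERIV_mult [OF d1 DERIV_mult [OF d2 q]]],
          simp only: p power_Suc, simp add: algebra_simps)
    then have "(?F has_real_derivative t ^ b * (1 - t) powr a * ?r t) (at t)"
      by (simp add: mult.assoc)
    then show "(?F has_vector_derivative t ^ b * (1 - t) powr a * ?r t) (at t)"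
      by (simp add: has_real_derivative_iff_has_vector_derivative)
  qed auto
  then have "((\<lambda>t. t ^ b * (1 - t) powr a * ?r t) has_integral 0) {0<..<1}"
    using a by (simp add: has_integral_Icc_iff_Ioo)
  moreover have "set_integrable lborel {0<..<1} (\<lambda>t. t ^ b * (1 - t) powr a * ?r t)"
    using a by (intro jac_integrable continuous_intros q_cont q')
  ultimately show ?thesis
    unfolding jac_int_def by (simp add: set_borel_integral_eq_integral(2) integral_unique)
qed

text \<open>Integration by parts moves the raising operator of \<open>sjac_raise\<close> onto the
  other polynomial as a derivative. By \<open>sjac'_Suc\<close> both degrees drop by one and both
  parameters grow by one; against degree 0 the derivative is zero.\<close>

lemma jac_int_ladder:
  assumes a: "a > -1"
  shows "(real n + 1) * jac_int a b (\<lambda>t. sjac (Suc n) a b t * sjac (Suc k) a b t)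
       = (real k + a + b + 2) * jac_int (a + 1) (Suc b) (\<lambda>t. sjac n (a + 1) (b + 1) t * sjac k (a + 1) (b + 1) t)"
    and "jac_int a b (\<lambda>t. sjac (Suc n) a b t * sjac 0 a b t) = 0"
proof -
  have main: "(real n + 1) * jac_int a b (\<lambda>t. sjac (Suc n) a b t * sjac k a b t)
       = jac_int (a + 1) (Suc b) (\<lambda>t. sjac n (a + 1) (b + 1) t * sjac' k a b t)" for k
  proof -
    have "0 = jac_int a b (\<lambda>t. t * (1 - t) * (sjac' n (a + 1) (b + 1) t * sjac k a b t + sjac' k a b t * sjac n (a + 1) (b + 1) t)
         + ((real b + 1) * (1 - t) - (a + 1) * t) * (sjac n (a + 1) (b + 1) t * sjac k a b t))"
      using a by (intro jac_int_by_parts [symmetric] DERIV_mult sjac_deriv continuous_intros)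
    also have "\<dots> = jac_int a b (\<lambda>t. t * (1 - t) * (sjac n (a + 1) (b + 1) t * sjac' k a b t)
         + - (real n + 1) * (sjac (Suc n) a b t * sjac k a b t))"
    proof (rule jac_int_cong)
      fix t
      have r: "t * (1 - t) * sjac' n (a + 1) (b + 1) t + ((real b + 1) * (1 - t) - (a + 1) * t) * sjac n (a + 1) (b + 1) t
          = - (real n + 1) * sjac (Suc n) a b t"
        using sjac_raise [of t n "a + 1" "b + 1"] by (simp add: add.commute)
      have "- (real n + 1) * (sjac (Suc n) a b t * sjac k a b t) =
        (t * (1 - t) * sjac' n (a + 1) (b + 1) t + ((real b + 1) * (1 - t) - (a + 1) * t) * sjac n (a + 1) (b + 1) t) * sjac k a b t"
        unfolding r by (simp only: mult.assoc)
      then show "t * (1 - t) * (sjac' n (a + 1) (b + 1) t * sjac k a b t + sjac' k a b t * sjac n (a + 1) (b + 1) t)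
         + ((real b + 1) * (1 - t) - (a + 1) * t) * (sjac n (a + 1) (b + 1) t * sjac k a b t)
         = t * (1 - t) * (sjac n (a + 1) (b + 1) t * sjac' k a b t)
         + - (real n + 1) * (sjac (Suc n) a b t * sjac k a b t)"
        by (simp only: algebra_simps)
    qed
    also have "\<dots> = jac_int a b (\<lambda>t. t * (1 - t) * (sjac n (a + 1) (b + 1) t * sjac' k a b t))
        + jac_int a b (\<lambda>t. - (real n + 1) * (sjac (Suc n) a b t * sjac k a b t))"
      using a by (intro jac_int_add continuous_intros)
    finally show ?thesis
      unfolding jac_int_cmult jac_int_shift [symmetric] by (simp only: mult_minus_left)
  qed
  show "(real n + 1) * jac_int a b (\<lambda>t. sjac (Suc n) a b t * sjac (Suc k) a b t)
       = (real k + a + b + 2) * jac_int (a + 1) (Suc b) (\<lambda>t. sjac n (a + 1) (b + 1) t * sjac k (a + 1) (b + 1) t)"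
    unfolding main unfolding jac_int_cmult [symmetric] by (intro jac_int_cong) (simp add: sjac'_Suc add_ac)
  have "jac_int (a + 1) (Suc b) (\<lambda>t. 0) = 0" by (simp add: jac_int_def)
  then show "jac_int a b (\<lambda>t. sjac (Suc n) a b t * sjac 0 a b t) = 0"
    using main [of 0] by simp
qed

definition jac_norm :: "nat \<Rightarrow> real \<Rightarrow> nat \<Rightarrow> real" where
  "jac_norm n a b = jac_int a b (\<lambda>t. (sjac n a b t)\<^sup>2)"

text \<open>Descent along \<open>jac_int_ladder\<close> until the smaller degree is 0.\<close>

lemma jac_int_orthogonal:
  assumes "a > -1"
  shows "jac_int a b (\<lambda>t. sjac n a b t * sjac k a b t) = (if n = k then jac_norm n a b else 0)"
proof -
  have *: "jac_int a b (\<lambda>t. sjac n a b t * sjac k a b t) = 0" if "k < n" "a > -1" for a b n k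
    using that
  proof (induction n arbitrary: a b k)
    case (Suc n)
    show ?case
    proof (cases k)
      case 0
      then show ?thesis using jac_int_ladder(2) Suc.prems by simp
    next
      case k: (Suc k')
      have "jac_int (a + 1) (Suc b) (\<lambda>t. sjac n (a + 1) (b + 1) t * sjac k' (a + 1) (b + 1) t) = 0"
        using Suc.IH [of k' "a + 1" "Suc b"] Suc.prems k by (simp add: add_ac)
      then show ?thesis using jac_int_ladder(1) [of a n b k'] Suc.prems k by simp
    qed
  qed simp
  show ?thesis
    using * [of k n a b] * [of n k a b] assms
    by (cases n k rule: linorder_cases) (auto simp: jac_norm_def power2_eq_square mult_ac)
qed

lemma jac_norm_raise:
  assumes "a > -1"
  shows "(real n + 1) * jac_norm (Suc n) a b = (real n + a + b + 2) * jac_norm n (a + 1) (Suc b)"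
  using jac_int_ladder(1) [OF assms, of n b n] by (simp add: jac_norm_def power2_eq_square add_ac)

text \<open>Integration by parts for the product of the two polynomials whose norms are compared: by
  \<open>sjac_shift_down\<close> and \<open>sjac_shift_up\<close>, each half of the product rule
  turns one factor into the other and so produces a square.\<close>

lemma jac_norm_shift:
  assumes a: "a > 0"
  shows "(real n + a) * jac_norm n (a - 1) (Suc b) = (real n + b + 1) * jac_norm n a b"
proof -
  let ?p = "sjac n (a - 1) (real b + 1)" and ?q = "sjac n a b"
  let ?p' = "sjac' n (a - 1) (real b + 1)" and ?q' = "sjac' n a b"
  have "0 = jac_int (a - 1) b (\<lambda>t. t * (1 - t) * (?p' t * ?q t + ?q' t * ?p t) + ((real b + 1) * (1 - t) - (a - 1 + 1) * t) * (?p t * ?q t))"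
    using a by (intro jac_int_by_parts [symmetric] DERIV_mult sjac_deriv continuous_intros) auto
  also have "\<dots> = jac_int (a - 1) b (\<lambda>t. (real n + b + 1) * ((1 - t) * (?q t)\<^sup>2) + - (real n + a) * (t * (?p t)\<^sup>2))"
  proof (rule jac_int_cong)
    fix t
    have "t * (1 - t) * (?p' t * ?q t + ?q' t * ?p t) + ((real b + 1) * (1 - t) - (a - 1 + 1) * t) * (?p t * ?q t)
      = (1 - t) * ?q t * (t * ?p' t + (real b + 1) * ?p t) + t * ?p t * ((1 - t) * ?q' t - a * ?q t)"
      by (simp add: algebra_simps)
    also have "\<dots> = (real n + b + 1) * ((1 - t) * (?q t)\<^sup>2) + - (real n + a) * (t * (?p t)\<^sup>2)"
      unfolding sjac_shift_down sjac_shift_up by (simp add: algebra_simps power2_eq_square)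
    finally show "t * (1 - t) * (?p' t * ?q t + ?q' t * ?p t) + ((real b + 1) * (1 - t) - (a - 1 + 1) * t) * (?p t * ?q t)
      = (real n + b + 1) * ((1 - t) * (?q t)\<^sup>2) + - (real n + a) * (t * (?p t)\<^sup>2)" .
  qed
  also have "\<dots> = jac_int (a - 1) b (\<lambda>t. (real n + b + 1) * ((1 - t) * (?q t)\<^sup>2))
     + jac_int (a - 1) b (\<lambda>t. - (real n + a) * (t * (?p t)\<^sup>2))"
    using a by (intro jac_int_add continuous_intros) auto
  also have "\<dots> = (real n + b + 1) * jac_int (a - 1) b (\<lambda>t. (1 - t) * (?q t)\<^sup>2)
     - (real n + a) * jac_int (a - 1) b (\<lambda>t. t * (?p t)\<^sup>2)"
    unfolding jac_int_cmult by (simp only: mult_minus_left add_uminus_conv_diff)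
  also have "jac_int (a - 1) b (\<lambda>t. (1 - t) * (?q t)\<^sup>2) = jac_norm n a b"
  proof -
    have "(1 - t) powr (a - 1) * (1 - t) = (1 - t) powr a" if "t < 1" for t
      using that powr_add [of "1 - t" "a - 1" 1] by simp
    then show ?thesis
      unfolding jac_norm_def jac_int_def by (intro set_lebesgue_integral_cong) auto
  qed
  also have "jac_int (a - 1) b (\<lambda>t. t * (?p t)\<^sup>2) = jac_norm n (a - 1) (Suc b)"
    unfolding jac_norm_def jac_int_def
    by (intro set_lebesgue_integral_cong) (auto simp: add_ac)
  finally show ?thesis by simp
qed

text \<open>\<open>jac_norm_raise\<close> lowers the degree, and degree 0 is a Beta
  integral.\<close>

lemma jac_norm_pos: "a > -1 \<Longrightarrow> jac_norm n a b > 0"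
proof (induction n arbitrary: a b)
  case 0
  have "((\<lambda>t. t powr (real b + 1 - 1) * (1 - t) powr (a + 1 - 1)) has_integral Beta (real b + 1) (a + 1)) {0..1}"
    using 0 by (intro has_integral_Beta_real) auto
  then have "((\<lambda>t. t powr real b * (1 - t) powr a) has_integral Beta (real b + 1) (a + 1)) {0<..<1}"
    by (simp add: has_integral_Icc_iff_Ioo)
  then have "((\<lambda>t. t ^ b * (1 - t) powr a) has_integral Beta (real b + 1) (a + 1)) {0<..<1}"
    by (rule has_integral_eq [rotated]) (simp add: powr_realpow)
  moreover have "set_integrable lborel {0<..<1} (\<lambda>t. t ^ b * (1 - t) powr a)"
    using jac_integrable [of a "\<lambda>_. 1" b] 0 by simp
  ultimately have "jac_norm 0 a b = Beta (real b + 1) (a + 1)"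
    by (simp add: jac_norm_def jac_int_def set_borel_integral_eq_integral(2) integral_unique)
  also have "\<dots> > 0" using 0 by (simp add: Beta_def Gamma_real_pos)
  finally show ?case .
next
  case (Suc n)
  have "(real n + a + b + 2) * jac_norm n (a + 1) (Suc b) > 0"
    using Suc by (intro mult_pos_pos) auto
  then show ?case
    using jac_norm_raise [OF Suc.prems, of n b] by (metis add_pos_nonneg of_nat_0_le_iff zero_less_mult_pos zero_less_one add.commute)
qed

section \<open>The Riesz potential of weighted Zernike functions\<close>

text \<open>The coefficients of the binomial series of (1 - w)^(-\<beta>).\<close>

definition poch_ratio :: "real \<Rightarrow> nat \<Rightarrow> real" where
  "poch_ratio \<beta> k = pochhammer \<beta> k / fact k"

lemma poch_ratio_0 [simp]: "poch_ratio \<beta> 0 = 1"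
  by (simp add: poch_ratio_def)

lemma poch_ratio_Suc: "poch_ratio \<beta> (Suc k) = poch_ratio \<beta> k * ((\<beta> + real k) / (real k + 1))"
  by (simp add: poch_ratio_def pochhammer_Suc add.commute)

lemma poch_ratio_pos: "\<beta> > 0 \<Longrightarrow> poch_ratio \<beta> k > 0"
  by (simp add: poch_ratio_def pochhammer_pos)

lemma poch_ratio_le_1: "0 < \<beta> \<Longrightarrow> \<beta> \<le> 1 \<Longrightarrow> poch_ratio \<beta> k \<le> 1"
proof (induction k)
  case (Suc k)
  then have "poch_ratio \<beta> k * ((\<beta> + real k) / (real k + 1)) \<le> 1 * 1"
    using poch_ratio_pos [of \<beta> k] by (intro mult_mono) auto
  then show ?case by (simp add: poch_ratio_Suc)
qed simp

lemma Beta_poch_ratio: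
  assumes "0 < \<beta>" "\<beta> < 1"
  shows "Beta (real k + \<beta>) (1 - \<beta>) = Gamma \<beta> * Gamma (1 - \<beta>) * poch_ratio \<beta> k"
proof -
  have "\<beta> \<notin> \<int>\<^sub>\<le>\<^sub>0" using assms by (auto elim!: nonpos_Ints_cases)
  then have "Gamma (\<beta> + real k) = pochhammer \<beta> k * Gamma \<beta>"
    using pochhammer_Gamma [of \<beta> k] Gamma_real_pos [OF assms(1)] by simp
  moreover have "Gamma (real k + \<beta> + (1 - \<beta>)) = fact k"
    using Gamma_fact [of k, where ?'a = real] by (simp add: add.commute)
  ultimately show ?thesis
    by (simp add: Beta_def poch_ratio_def add.commute)
qed

text \<open>The ratio moves \<beta> - 1 from the first parameter to the second, since the binomial
  coefficient of n + \<beta> - 1 over n - j, times the ratio at j, equals the ratio at n times n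
  over j. The other binomial factor depends on the sum of the parameters only.\<close>

lemma jac_coeff_poch_left:
  assumes "j \<le> n"
  shows "jac_coeff n (\<beta> - 1) m j * poch_ratio \<beta> j = poch_ratio \<beta> n * jac_coeff n 0 (m + (\<beta> - 1)) j"
proof -
  have "((real n + (\<beta> - 1)) gchoose (n - j)) * poch_ratio \<beta> j = pochhammer \<beta> n / (fact (n - j) * fact j)"
    using assms by (simp add: gbinomial_pochhammer' poch_ratio_def of_nat_diff pochhammer_product [OF assms] algebra_simps)
  moreover have "poch_ratio \<beta> n * ((real n + 0) gchoose (n - j)) = pochhammer \<beta> n / (fact (n - j) * fact j)"
    using assms binomial_fact [of "n - j" n, where ?'a = real]
    by (simp add: poch_ratio_def flip: binomial_gbinomial)
  ultimately have "((real n + (\<beta> - 1)) gchoose (n - j)) * poch_ratio \<beta> j = poch_ratio \<beta> n * ((real n + 0) gchoose (n - j))"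
    by simp
  from arg_cong [OF this, of "\<lambda>x. (-1) ^ j * ((real n + (\<beta> - 1) + m + real j) gchoose j) * x"] show ?thesis
    by (simp add: jac_coeff_def algebra_simps)
qed

text \<open>The companion of \<open>jac_coeff_poch_left\<close> for expansions in powers of t: here
  \<beta> - 1 leaves the parameter m + \<beta> - 1 for the other one. The ratio is taken at m + k
  because the Abel weight contains \<tau>^m.\<close>

lemma jac_coeff_poch_right:
  assumes "k \<le> n"
  shows "jac_coeff n (real m + (\<beta> - 1)) 0 k * poch_ratio \<beta> (m + k) = poch_ratio \<beta> (n + m) * jac_coeff n m (\<beta> - 1) k"
proof -
  have 1: "m + k \<le> n + m" using assms by simp
  have 2: "n + m - (m + k) = n - k" using assms by simp
  have 3: "real n + (real m + (\<beta> - 1)) - real (n - k) + 1 = \<beta> + real (m + k)" using assms by simp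
  have "((real n + (real m + (\<beta> - 1))) gchoose (n - k)) * poch_ratio \<beta> (m + k) = pochhammer \<beta> (n + m) / (fact (n - k) * fact (m + k))"
    unfolding gbinomial_pochhammer' poch_ratio_def 3 pochhammer_product [OF 1] 2 by (simp add: mult.commute)
  moreover have "poch_ratio \<beta> (n + m) * (real (n + m) gchoose (n - k)) = pochhammer \<beta> (n + m) / (fact (n - k) * fact (m + k))"
  proof -
    have "n + m - (n - k) = m + k" using assms by simp
    then show ?thesis
      using assms binomial_fact [of "n - k" "n + m", where ?'a = real]
      unfolding poch_ratio_def binomial_gbinomial [symmetric] by simp
  qed
  ultimately have "((real n + (real m + (\<beta> - 1))) gchoose (n - k)) * poch_ratio \<beta> (m + k) = poch_ratio \<beta> (n + m) * ((real n + real m) gchoose (n - k))"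
    by simp
  from arg_cong [OF this, of "\<lambda>x. (-1) ^ k * ((real n + real m + (\<beta> - 1) + real k) gchoose k) * x"] show ?thesis
    by (simp add: jac_coeff_def algebra_simps)
qed

section \<open>Angular integrals of the kernel\<close>

lemma set_integrable_continuous_Ioo:
  fixes f :: "real \<Rightarrow> 'b::{banach, second_countable_topology}"
  assumes "continuous_on {a..b} f"
  shows "set_integrable lborel {a<..<b} f"
  by (rule set_integrable_subset [OF borel_integrable_atLeastAtMost' [OF assms]]) auto

lemma integral_cis:
  "(LINT \<theta>:{-pi<..<pi}|lborel. cis (of_int n * \<theta>)) = (if n = 0 then of_real (2 * pi) else 0)"
proof -
  have Icc: "(LINT \<theta>:{-pi<..<pi}|lborel. cis (of_int n * \<theta>)) = (LINT \<theta>:{-pi..pi}|lborel. cis (of_int n * \<theta>))"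
    by (rule set_integral_discrete_difference [where X = "{-pi, pi}"]) auto
  show ?thesis
  proof (cases "n = 0")
    case True
    then show ?thesis by (simp add: set_integral_const scaleR_conv_of_real)
  next
    case False
    have c: "continuous_on {-pi..pi} (\<lambda>\<theta>. cis (of_int n * \<theta>))"
      unfolding cis_conv_exp by (intro continuous_intros)
    have "(LINT \<theta>:{-pi..pi}|lborel. cis (of_int n * \<theta>)) =
        cis (of_int n * pi) / (\<i> * of_int n) - cis (of_int n * (-pi)) / (\<i> * of_int n)"
      unfolding set_lebesgue_integral_def
    proof (rule integral_FTC_atLeastAtMost)
      fix x :: real
      have "((\<lambda>z. exp (\<i> * of_int n * z) / (\<i> * of_int n)) has_field_derivative exp (\<i> * of_int n * of_real x)) (at (of_real x))"
        using False by (auto intro!: derivative_eq_intros)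
      from field_vector_diff_chain_at [OF has_vector_derivative_of_real [OF DERIV_ident] this]
      show "((\<lambda>\<theta>. cis (of_int n * \<theta>) / (\<i> * of_int n)) has_vector_derivative cis (of_int n * x)) (at x within {-pi..pi})"
        by (auto simp: o_def cis_conv_exp mult.assoc intro: has_vector_derivative_at_within)
    qed (use c in auto)
    also have "cis (of_int n * pi) = cis (of_int n * (-pi))"
      by (simp add: complex_eq_iff)
         (metis sin_npi_int mult.commute minus_zero)
    finally show ?thesis using False Icc by simp
  qed
qed

lemma binomial_series_neg:
  assumes "norm (w::complex) < 1"
  shows "(\<lambda>k. of_real (poch_ratio \<beta> k) * w ^ k) sums (1 - w) powr (- of_real \<beta>)"
proof -
  have "((- of_real \<beta>) gchoose k) * (- w) ^ k = of_real (poch_ratio \<beta> k) * w ^ k" for k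
  proof -
    have "((- of_real \<beta>) gchoose k) * (- w) ^ k = ((-1) ^ k * (-1) ^ k) * (of_real (poch_ratio \<beta> k) * w ^ k)"
      unfolding gbinomial_pochhammer power_minus [of w k] by (simp add: poch_ratio_def pochhammer_of_real)
    also have "(-1) ^ k * (-1) ^ k = (1::complex)" by (simp flip: power_add)
    finally show ?thesis by simp
  qed
  with gen_binomial_complex [of "- w" "- of_real \<beta>"] assms show ?thesis by simp
qed

text \<open>Up to normalisation and a power of \<zeta> or its conjugate, the m-th Fourier
  coefficient of |1 - \<zeta> e^(i \<theta>)|^(-2 \<beta>), as a function of y = |\<zeta>|^2; the
  series is of hypergeometric type.\<close>

definition poch_conv :: "real \<Rightarrow> nat \<Rightarrow> real \<Rightarrow> real" where
  "poch_conv \<beta> m y = (\<Sum>k. poch_ratio \<beta> k * poch_ratio \<beta> (k + m) * y ^ k)"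

lemma poch_conv_summable:
  assumes "0 < \<beta>" "\<beta> \<le> 1" "\<bar>y\<bar> < 1"
  shows "summable (\<lambda>k. poch_ratio \<beta> k * poch_ratio \<beta> (k + m) * y ^ k)"
proof (rule summable_comparison_test')
  show "summable (\<lambda>k. \<bar>y\<bar> ^ k)" using assms by (intro summable_geometric) auto
  show "norm (poch_ratio \<beta> k * poch_ratio \<beta> (k + m) * y ^ k) \<le> \<bar>y\<bar> ^ k" for k
  proof -
    have "\<bar>poch_ratio \<beta> k\<bar> * \<bar>poch_ratio \<beta> (k + m)\<bar> * \<bar>y\<bar> ^ k \<le> 1 * 1 * \<bar>y\<bar> ^ k"
      using assms poch_ratio_pos [of \<beta> k] poch_ratio_pos [of \<beta> "k + m"]
      by (intro mult_mono) (auto simp: poch_ratio_le_1)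
    then show ?thesis by (simp add: abs_mult power_abs)
  qed
qed

text \<open>
  Multiply the binomial series of \<open>(1 - \<zeta> e\<^sup>i\<^sup>\<theta>)\<^sup>-\<^sup>\<beta>\<close> and its conjugate and integrate term by term.
\<close>

lemma integral_angular:
  fixes \<zeta> :: complex
  assumes \<beta>: "0 < \<beta>" "\<beta> \<le> 1" and \<zeta>: "norm \<zeta> < 1"
  shows "(LINT \<theta>:{-pi<..<pi}|lborel. cis (real m * \<theta>) * of_real (norm (1 - \<zeta> * cis \<theta>) powr (- 2 * \<beta>)))
       = of_real (2 * pi * poch_conv \<beta> m ((norm \<zeta>)\<^sup>2)) * cnj \<zeta> ^ m"
proof -
  let ?I = "{-pi<..<pi}"
  let ?a = "poch_ratio \<beta>"
  define S where "S M \<theta> = (\<Sum>k<M. of_real (?a k) * (\<zeta> * cis \<theta>) ^ k)" for M \<theta>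
  \<comment> \<open>The conjugated partial sum is longer by m terms, so that every k < M finds its
    resonant partner j = k + m. The angular integral annihilates all other pairs.\<close>
  define G where "G M \<theta> = cis (real m * \<theta>) * (S M \<theta> * cnj (S (M + m) \<theta>))" for M \<theta>
  have a: "0 < ?a k" "?a k \<le> 1" for k using \<beta> by (auto simp: poch_ratio_pos poch_ratio_le_1)
  have geo: "summable (\<lambda>k. norm \<zeta> ^ k)" using \<zeta> by (intro summable_geometric) auto
  define C where "C = (\<Sum>k. norm \<zeta> ^ k)"
  have "C \<ge> 0" unfolding C_def by (intro suminf_nonneg geo) auto
  have S_bound: "norm (S M \<theta>) \<le> C" for M \<theta>
  proof -
    have "norm (S M \<theta>) \<le> (\<Sum>k<M. norm (of_real (?a k) * (\<zeta> * cis \<theta>) ^ k))"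
      unfolding S_def by (rule norm_sum)
    also have "\<dots> \<le> (\<Sum>k<M. norm \<zeta> ^ k)"
    proof (rule sum_mono)
      fix k
      have "\<bar>?a k\<bar> * norm \<zeta> ^ k \<le> 1 * norm \<zeta> ^ k" using a [of k] by (intro mult_right_mono) auto
      then show "norm (of_real (?a k) * (\<zeta> * cis \<theta>) ^ k) \<le> norm \<zeta> ^ k" by (simp add: norm_mult norm_power)
    qed
    also have "\<dots> \<le> C" unfolding C_def by (rule sum_le_suminf [OF geo]) auto
    finally show ?thesis .
  qed
  have S_lim: "(\<lambda>M. S M \<theta>) \<longlonglongrightarrow> (1 - \<zeta> * cis \<theta>) powr (- of_real \<beta>)" for \<theta>
    using binomial_series_neg [of "\<zeta> * cis \<theta>" \<beta>] \<zeta> by (simp add: S_def sums_def norm_mult)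
  have G_lim: "(\<lambda>M. G M \<theta>) \<longlonglongrightarrow> cis (real m * \<theta>) * of_real (norm (1 - \<zeta> * cis \<theta>) powr (- 2 * \<beta>))" for \<theta>
  proof -
    let ?p = "(1 - \<zeta> * cis \<theta>) powr (- of_real \<beta>)"
    have "(\<lambda>M. G M \<theta>) \<longlonglongrightarrow> cis (real m * \<theta>) * (?p * cnj ?p)"
      unfolding G_def by (intro tendsto_intros S_lim LIMSEQ_ignore_initial_segment)
    also have "?p * cnj ?p = of_real ((norm ?p)\<^sup>2)" by (simp only: complex_norm_square)
    also have "norm ?p = norm (1 - \<zeta> * cis \<theta>) powr (- \<beta>)"
      by (subst norm_powr_real_powr') auto
    also have "(norm (1 - \<zeta> * cis \<theta>) powr (- \<beta>))\<^sup>2 = norm (1 - \<zeta> * cis \<theta>) powr (- 2 * \<beta>)"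
      by (simp add: power2_eq_square flip: powr_add)
    finally show ?thesis .
  qed
  have G_cont: "continuous_on A (G M)" for A M
    unfolding G_def S_def cis_conv_exp by (intro continuous_intros)
  have G_bound: "norm (G M \<theta>) \<le> C * C" for M \<theta>
    unfolding G_def norm_mult using S_bound [of M \<theta>] S_bound [of "M + m" \<theta>] \<open>C \<ge> 0\<close>
    by (simp add: mult_mono)
  have "(\<lambda>M. LINT \<theta>|lborel. indicator ?I \<theta> *\<^sub>R G M \<theta>) \<longlonglongrightarrow>
     (LINT \<theta>|lborel. indicator ?I \<theta> *\<^sub>R (cis (real m * \<theta>) * of_real (norm (1 - \<zeta> * cis \<theta>) powr (- 2 * \<beta>))))"
  proof (rule integral_dominated_convergence [where w = "\<lambda>\<theta>. indicator ?I \<theta> *\<^sub>R (C * C)"])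
    show "(\<lambda>\<theta>. indicat_real ?I \<theta> *\<^sub>R G M \<theta>) \<in> borel_measurable lborel" for M
      using borel_measurable_continuous_on_indicator [OF _ G_cont, of ?I M] by simp
    show "(\<lambda>\<theta>. indicat_real ?I \<theta> *\<^sub>R (cis (real m * \<theta>) * of_real (norm (1 - \<zeta> * cis \<theta>) powr (- 2 * \<beta>)))) \<in> borel_measurable lborel"
      unfolding cis_conv_exp by measurable
    show "integrable lborel (\<lambda>\<theta>. indicat_real ?I \<theta> *\<^sub>R (C * C))"
      using set_integrable_continuous_Ioo [of "-pi" pi "\<lambda>_. C * C"] by (simp add: set_integrable_def)
    show "AE \<theta> in lborel. (\<lambda>M. indicat_real ?I \<theta> *\<^sub>R G M \<theta>) \<longlonglongrightarrow>
        indicat_real ?I \<theta> *\<^sub>R (cis (real m * \<theta>) * of_real (norm (1 - \<zeta> * cis \<theta>) powr (- 2 * \<beta>)))"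
      by (intro AE_I2 tendsto_intros G_lim)
    show "AE \<theta> in lborel. norm (indicat_real ?I \<theta> *\<^sub>R G M \<theta>) \<le> indicat_real ?I \<theta> *\<^sub>R (C * C)" for M
      by (intro AE_I2) (auto simp: G_bound split: split_indicator)
  qed
  moreover have "(LINT \<theta>|lborel. indicator ?I \<theta> *\<^sub>R G M \<theta>) =
      of_real (2 * pi) * (\<Sum>k<M. of_real (?a k * ?a (k + m) * ((norm \<zeta>)\<^sup>2) ^ k)) * cnj \<zeta> ^ m" for M
  proof -
    let ?c = "\<lambda>k j. of_real (?a k * ?a j) * (\<zeta> ^ k * cnj \<zeta> ^ j)"
    have G_sum: "G M \<theta> = (\<Sum>k<M. \<Sum>j<M+m. ?c k j * cis (of_int (int m + int k - int j) * \<theta>))" for \<theta>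
    proof -
      have arg: "of_int (int m + int k - int j) * \<theta> = real m * \<theta> + (real k * \<theta> + real j * (- \<theta>))" for k j
        by (simp add: algebra_simps)
      have cis_eq: "cis (of_int (int m + int k - int j) * \<theta>) = cis (real m * \<theta>) * (cis \<theta> ^ k * cnj (cis \<theta>) ^ j)" for k j
        by (simp only: arg cis_cnj Complex.DeMoivre cis_mult)
      have "G M \<theta> = (\<Sum>k<M. \<Sum>j<M+m. cis (real m * \<theta>) * (of_real (?a k) * (\<zeta> * cis \<theta>) ^ k * cnj (of_real (?a j) * (\<zeta> * cis \<theta>) ^ j)))"
        unfolding G_def S_def cnj_sum sum_product unfolding sum_distrib_left ..
      also have "\<dots> = (\<Sum>k<M. \<Sum>j<M+m. ?c k j * cis (of_int (int m + int k - int j) * \<theta>))"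
        unfolding cis_eq by (intro sum.cong refl) (simp add: power_mult_distrib mult_ac)
      finally show ?thesis .
    qed
    have int: "set_integrable lborel ?I (\<lambda>\<theta>. ?c k j * cis (of_int (int m + int k - int j) * \<theta>))" for k j
      by (intro set_integrable_continuous_Ioo) (auto simp: cis_conv_exp intro!: continuous_intros)
    have "(LINT \<theta>|lborel. indicator ?I \<theta> *\<^sub>R G M \<theta>) =
        (\<Sum>k<M. \<Sum>j<M+m. (LINT \<theta>:?I|lborel. ?c k j * cis (of_int (int m + int k - int j) * \<theta>)))"
      unfolding G_sum scaleR_sum_right set_lebesgue_integral_def
      by (subst Bochner_Integration.integral_sum,
          intro Bochner_Integration.integrable_sum int [unfolded set_integrable_def],
          intro sum.cong refl, rule Bochner_Integration.integral_sum,
          rule int [unfolded set_integrable_def])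
    also have "\<dots> = (\<Sum>k<M. \<Sum>j<M+m. if j = k + m then ?c k j * of_real (2 * pi) else 0)"
      by (intro sum.cong refl) (auto simp: set_integral_mult_right integral_cis simp del: of_int_add of_int_diff)
    also have "\<dots> = (\<Sum>k<M. ?c k (k + m) * of_real (2 * pi))"
      by (intro sum.cong refl) (simp add: sum.delta')
    also have "\<dots> = of_real (2 * pi) * (\<Sum>k<M. of_real (?a k * ?a (k + m) * ((norm \<zeta>)\<^sup>2) ^ k)) * cnj \<zeta> ^ m"
      unfolding sum_distrib_left sum_distrib_right
    proof (intro sum.cong refl)
      fix k
      have "of_real (((norm \<zeta>)\<^sup>2) ^ k) = \<zeta> ^ k * cnj \<zeta> ^ k"
        by (subst of_real_power, subst complex_norm_square, rule power_mult_distrib)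
      then show "?c k (k + m) * of_real (2 * pi) = of_real (2 * pi) * of_real (?a k * ?a (k + m) * ((norm \<zeta>)\<^sup>2) ^ k) * cnj \<zeta> ^ m"
        by (simp only: of_real_mult power_add mult_ac)
    qed
    finally show ?thesis .
  qed
  moreover have "(\<lambda>M. of_real (2 * pi) * (\<Sum>k<M. of_real (?a k * ?a (k + m) * ((norm \<zeta>)\<^sup>2) ^ k)) * cnj \<zeta> ^ m)
      \<longlonglongrightarrow> of_real (2 * pi) * of_real (poch_conv \<beta> m ((norm \<zeta>)\<^sup>2)) * cnj \<zeta> ^ m"
    unfolding of_real_sum [symmetric] poch_conv_def
    using \<zeta> by (intro tendsto_intros summable_LIMSEQ poch_conv_summable \<beta>) (auto simp: power_less_one_iff abs_square_less_1)
  ultimately show ?thesis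
    unfolding set_lebesgue_integral_def by (simp add: LIMSEQ_unique)
qed

section \<open>Beta integrals and Copson's kernel\<close>

lemma nn_integral_Beta:
  assumes p: "p > 0" and q: "q > 0" and u: "u > (0::real)"
  shows "(\<integral>\<^sup>+\<tau>. indicator {0<..<u} \<tau> * ennreal (\<tau> powr (p - 1) * (u - \<tau>) powr (q - 1)) \<partial>lborel)
     = ennreal (u powr (p + q - 1) * Beta p q)"
proof -
  have 1: "(\<integral>\<^sup>+\<tau>. ennreal (indicator {0<..<1} \<tau> * (\<tau> powr (p - 1) * (1 - \<tau>) powr (q - 1))) \<partial>lborel) = ennreal (Beta p q)"
  proof (rule nn_integral_has_integral_lborel)
    have "((\<lambda>t. t powr (p - 1) * (1 - t) powr (q - 1)) has_integral Beta p q) {0<..<1}"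
      using has_integral_Beta_real [OF p q] by (simp add: has_integral_Icc_iff_Ioo)
    then have "((\<lambda>t. if t \<in> {0<..<1} then t powr (p - 1) * (1 - t) powr (q - 1) else 0) has_integral Beta p q) UNIV"
      by (simp only: has_integral_restrict_UNIV)
    then show "((\<lambda>t. indicator {0<..<1} t * (t powr (p - 1) * (1 - t) powr (q - 1))) has_integral Beta p q) UNIV"
      by (rule has_integral_eq [rotated]) (auto split: split_indicator)
  qed auto
  have "(\<integral>\<^sup>+\<tau>. indicator {0<..<u} \<tau> * ennreal (\<tau> powr (p - 1) * (u - \<tau>) powr (q - 1)) \<partial>lborel) =
     ennreal u * (\<integral>\<^sup>+\<tau>. indicator {0<..<u} (0 + u * \<tau>) * ennreal ((0 + u * \<tau>) powr (p - 1) * (u - (0 + u * \<tau>)) powr (q - 1)) \<partial>lborel)"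
    using u by (subst nn_integral_real_affine [where c = u and t = 0]) auto
  also have "\<dots> = ennreal u * (\<integral>\<^sup>+\<tau>. ennreal (u powr (p + q - 2)) * ennreal (indicator {0<..<1} \<tau> * (\<tau> powr (p - 1) * (1 - \<tau>) powr (q - 1))) \<partial>lborel)"
  proof (rule arg_cong [where f = "\<lambda>I. ennreal u * I"], rule nn_integral_cong)
    fix \<tau> :: real
    have "(u * \<tau>) powr (p - 1) * (u - u * \<tau>) powr (q - 1) = u powr (p + q - 2) * (\<tau> powr (p - 1) * (1 - \<tau>) powr (q - 1))"
      if "0 < \<tau>" "\<tau> < 1"
    proof -
      have "u - u * \<tau> = u * (1 - \<tau>)" by (simp add: algebra_simps)
      then have "(u * \<tau>) powr (p - 1) * (u - u * \<tau>) powr (q - 1) = (u powr (p - 1) * u powr (q - 1)) * (\<tau> powr (p - 1) * (1 - \<tau>) powr (q - 1))"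
        using that u by (simp add: powr_mult)
      also have "u powr (p - 1) * u powr (q - 1) = u powr (p + q - 2)"
        by (simp flip: powr_add)
      finally show ?thesis .
    qed
    then show "indicator {0<..<u} (0 + u * \<tau>) * ennreal ((0 + u * \<tau>) powr (p - 1) * (u - (0 + u * \<tau>)) powr (q - 1)) =
      ennreal (u powr (p + q - 2)) * ennreal (indicator {0<..<1} \<tau> * (\<tau> powr (p - 1) * (1 - \<tau>) powr (q - 1)))"
      using u by (auto simp: ennreal_mult [symmetric] zero_less_mult_iff split: split_indicator)
  qed
  also have "\<dots> = ennreal u * (ennreal (u powr (p + q - 2)) * ennreal (Beta p q))"
    by (subst nn_integral_cmult) (auto simp: 1)
  also have "\<dots> = ennreal (u powr 1 * u powr (p + q - 2) * Beta p q)"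
    using u by (simp add: ennreal_mult' mult.assoc)
  also have "u powr 1 * u powr (p + q - 2) = u powr (p + q - 1)"
    unfolding powr_add [symmetric] by simp
  finally show ?thesis .
qed

lemma nn_integral_Beta_reflect:
  assumes p: "p > 0" and q: "q > 0" and \<tau>: "\<tau> < (1::real)"
  shows "(\<integral>\<^sup>+t. indicator {\<tau><..<1} t * ennreal ((1 - t) powr (p - 1) * (t - \<tau>) powr (q - 1)) \<partial>lborel)
     = ennreal ((1 - \<tau>) powr (p + q - 1) * Beta p q)"
proof -
  have "(\<integral>\<^sup>+t. indicator {\<tau><..<1} t * ennreal ((1 - t) powr (p - 1) * (t - \<tau>) powr (q - 1)) \<partial>lborel)
    = (\<integral>\<^sup>+s. indicator {\<tau><..<1} (1 + (-1) * s) * ennreal ((1 - (1 + (-1) * s)) powr (p - 1) * ((1 + (-1) * s) - \<tau>) powr (q - 1)) \<partial>lborel)"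
    by (subst nn_integral_real_affine [where c = "-1" and t = 1]) auto
  also have "\<dots> = (\<integral>\<^sup>+s. indicator {0<..<1 - \<tau>} s * ennreal (s powr (p - 1) * (1 - \<tau> - s) powr (q - 1)) \<partial>lborel)"
    by (intro nn_integral_cong) (auto split: split_indicator simp: algebra_simps)
  also have "\<dots> = ennreal ((1 - \<tau>) powr (p + q - 1) * Beta p q)"
    using assms by (intro nn_integral_Beta) auto
  finally show ?thesis .
qed

lemma binomial_series_neg_real:
  assumes "\<bar>w::real\<bar> < 1"
  shows "(\<lambda>k. poch_ratio \<beta> k * w ^ k) sums (1 - w) powr (- \<beta>)"
proof -
  have "((- \<beta>) gchoose k) * (- w) ^ k = poch_ratio \<beta> k * w ^ k" for k
  proof -
    have "((- \<beta>) gchoose k) * (- w) ^ k = ((-1) ^ k * (-1) ^ k) * (poch_ratio \<beta> k * w ^ k)"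
      unfolding gbinomial_pochhammer power_minus [of w k] by (simp add: poch_ratio_def)
    also have "(-1) ^ k * (-1) ^ k = (1::real)" by (simp flip: power_add)
    finally show ?thesis by simp
  qed
  with gen_binomial_real [of "- w" "- \<beta>"] assms show ?thesis by simp
qed

text \<open>
  Copson's kernel: the angular integral of the Riesz kernel between the circles of squared radii
  \<open>R\<close> and \<open>t\<close> is a superposition of products of two Abel kernels.  The radial part of the potential
  thus becomes a composition of two Abel transforms, each of which can be evaluated on powers.
\<close>

definition copson :: "real \<Rightarrow> nat \<Rightarrow> real \<Rightarrow> real \<Rightarrow> ennreal" where
  "copson \<beta> m R t = (\<integral>\<^sup>+\<tau>. indicator {0<..<min R t} \<tau> *
     ennreal (\<tau> powr (real m + \<beta> - 1) * (R - \<tau>) powr (- \<beta>) * (t - \<tau>) powr (- \<beta>)) \<partial>lborel)"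

lemma copson_commute: "copson \<beta> m R t = copson \<beta> m t R"
  by (simp add: copson_def min.commute mult_ac)

lemma copson_measurable [measurable]: "copson \<beta> m R \<in> borel_measurable borel"
proof -
  have "copson \<beta> m R = (\<lambda>t. \<integral>\<^sup>+\<tau>. indicator {0<..<R} \<tau> * indicator {p. snd p < fst p} (t, \<tau>) *
   ennreal (\<tau> powr (real m + \<beta> - 1) * (R - \<tau>) powr (- \<beta>) * (t - \<tau>) powr (- \<beta>)) \<partial>lborel)"
    unfolding copson_def [abs_def] by (intro ext nn_integral_cong) (auto split: split_indicator)
  also have "\<dots> \<in> borel_measurable borel" by measurable
  finally show ?thesis .
qed

text \<open>For t < R only (R - \<tau>)^(-\<beta>) is expanded, in powers of \<tau> / R. The terms
  are nonnegative Beta integrals, so sum and integral exchange, and the result is the same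
  \<open>poch_conv\<close> as in \<open>integral_angular\<close>.\<close>

lemma copson_less:
  assumes \<beta>: "0 < \<beta>" "\<beta> < 1" and t: "0 < t" "t < R"
  shows "copson \<beta> m R t = ennreal (Gamma \<beta> * Gamma (1 - \<beta>) * (t ^ m * R powr (- \<beta>) * poch_conv \<beta> m (t / R)))"
proof -
  let ?a = "poch_ratio \<beta>" and ?GG = "Gamma \<beta> * Gamma (1 - \<beta>)"
  have G: "Gamma \<beta> > 0" "Gamma (1 - \<beta>) > 0" using \<beta> by (auto simp: Gamma_real_pos)
  then have GG: "?GG > 0" by simp
  have a: "0 < ?a k" for k using \<beta> by (simp add: poch_ratio_pos)
  define c where "c k = R powr (- \<beta>) * ?a k / R ^ k" for k
  have c0: "c k \<ge> 0" for k using a [of k] t by (simp add: c_def)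
  have "copson \<beta> m R t = (\<integral>\<^sup>+\<tau>. (\<Sum>k. ennreal (c k) * (indicator {0<..<t} \<tau> *
      ennreal (\<tau> powr ((real (k + m) + \<beta>) - 1) * (t - \<tau>) powr ((1 - \<beta>) - 1)))) \<partial>lborel)"
    unfolding copson_def
  proof (intro nn_integral_cong)
    fix \<tau> :: real
    let ?r = "\<lambda>k. c k * (\<tau> powr ((real (k + m) + \<beta>) - 1) * (t - \<tau>) powr ((1 - \<beta>) - 1))"
    show "indicator {0<..<min R t} \<tau> * ennreal (\<tau> powr (real m + \<beta> - 1) * (R - \<tau>) powr (- \<beta>) * (t - \<tau>) powr (- \<beta>)) =
       (\<Sum>k. ennreal (c k) * (indicator {0<..<t} \<tau> *
          ennreal (\<tau> powr ((real (k + m) + \<beta>) - 1) * (t - \<tau>) powr ((1 - \<beta>) - 1))))"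
    proof (cases "\<tau> \<in> {0<..<t}")
      case True
      then have \<tau>: "0 < \<tau>" "\<tau> < t" by auto
      have "R - \<tau> = R * (1 - \<tau> / R)" using t by (simp add: field_simps)
      then have R: "(R - \<tau>) powr (- \<beta>) = R powr (- \<beta>) * (1 - \<tau> / R) powr (- \<beta>)"
        using t \<tau> by (simp add: powr_mult)
      have "(\<lambda>k. ?a k * (\<tau> / R) ^ k) sums (1 - \<tau> / R) powr (- \<beta>)"
        using t \<tau> by (intro binomial_series_neg_real) auto
      from sums_mult [OF this, of "\<tau> powr (real m + \<beta> - 1) * R powr (- \<beta>) * (t - \<tau>) powr (- \<beta>)"]
      have "(\<lambda>k. \<tau> powr (real m + \<beta> - 1) * R powr (- \<beta>) * (t - \<tau>) powr (- \<beta>) * (?a k * (\<tau> / R) ^ k))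
         sums (\<tau> powr (real m + \<beta> - 1) * (R - \<tau>) powr (- \<beta>) * (t - \<tau>) powr (- \<beta>))"
        unfolding R by (simp only: mult_ac)
      also have "(\<lambda>k. \<tau> powr (real m + \<beta> - 1) * R powr (- \<beta>) * (t - \<tau>) powr (- \<beta>) * (?a k * (\<tau> / R) ^ k)) = ?r"
      proof
        fix k
        have "\<tau> powr (real (k + m) + \<beta> - 1) = \<tau> powr (real m + \<beta> - 1) * \<tau> ^ k"
          using \<tau> by (simp add: powr_add [symmetric] algebra_simps flip: powr_realpow)
        then show "\<tau> powr (real m + \<beta> - 1) * R powr (- \<beta>) * (t - \<tau>) powr (- \<beta>) * (?a k * (\<tau> / R) ^ k) = ?r k"
          by (simp add: c_def power_divide)
      qed
      finally have sums: "?r sums (\<tau> powr (real m + \<beta> - 1) * (R - \<tau>) powr (- \<beta>) * (t - \<tau>) powr (- \<beta>))" .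
      have "(\<Sum>k. ennreal (?r k)) = ennreal (\<Sum>k. ?r k)"
        using sums c0 by (intro suminf_ennreal2) (auto simp: sums_iff)
      then show ?thesis
        using True t sums c0 by (simp add: sums_iff ennreal_mult)
    qed (use t in auto)
  qed
  also have "\<dots> = (\<Sum>k. ennreal (c k) * ennreal (t powr ((real (k + m) + \<beta>) + (1 - \<beta>) - 1) * Beta (real (k + m) + \<beta>) (1 - \<beta>)))"
    using \<beta> t
    by (subst nn_integral_suminf, (measurable; fail), intro suminf_cong,
        subst nn_integral_cmult, (measurable; fail), subst nn_integral_Beta) auto
  also have "\<dots> = (\<Sum>k. ennreal (?GG * (t ^ m * R powr (- \<beta>)) * (?a k * ?a (k + m) * (t / R) ^ k)))"
  proof (intro suminf_cong)
    fix k
    have "t powr ((real (k + m) + \<beta>) + (1 - \<beta>) - 1) = t ^ (k + m)"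
      using t by (simp flip: powr_realpow)
    then show "ennreal (c k) * ennreal (t powr ((real (k + m) + \<beta>) + (1 - \<beta>) - 1) * Beta (real (k + m) + \<beta>) (1 - \<beta>)) =
       ennreal (?GG * (t ^ m * R powr (- \<beta>)) * (?a k * ?a (k + m) * (t / R) ^ k))"
      unfolding Beta_poch_ratio [OF \<beta>]
      by (subst ennreal_mult' [symmetric, OF c0]) (simp add: c_def power_divide power_add mult_ac)
  qed
  also have "\<dots> = ennreal (\<Sum>k. ?GG * (t ^ m * R powr (- \<beta>)) * (?a k * ?a (k + m) * (t / R) ^ k))"
  proof (rule suminf_ennreal2)
    show "summable (\<lambda>k. ?GG * (t ^ m * R powr (- \<beta>)) * (?a k * ?a (k + m) * (t / R) ^ k))"
      using \<beta> t by (intro summable_mult poch_conv_summable) auto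
    show "0 \<le> ?GG * (t ^ m * R powr (- \<beta>)) * (?a k * ?a (k + m) * (t / R) ^ k)" for k
      using \<beta> less_imp_le [OF Gamma_real_pos [of \<beta>]] less_imp_le [OF Gamma_real_pos [of "1 - \<beta>"]] a [of k] a [of "k + m"] t
      by (intro mult_nonneg_nonneg) auto
  qed
  also have "(\<Sum>k. ?GG * (t ^ m * R powr (- \<beta>)) * (?a k * ?a (k + m) * (t / R) ^ k)) =
      ?GG * (t ^ m * R powr (- \<beta>)) * poch_conv \<beta> m (t / R)"
    unfolding poch_conv_def using \<beta> t by (intro suminf_mult poch_conv_summable) auto
  finally show ?thesis by (simp add: mult.assoc)
qed

lemma poch_conv_nonneg: "0 < \<beta> \<Longrightarrow> \<beta> \<le> 1 \<Longrightarrow> 0 \<le> y \<Longrightarrow> y < 1 \<Longrightarrow> poch_conv \<beta> m y \<ge> 0"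
  unfolding poch_conv_def
  by (intro suminf_nonneg poch_conv_summable mult_nonneg_nonneg less_imp_le [OF poch_ratio_pos]) auto

lemma copson_finite:
  assumes "0 < \<beta>" "\<beta> < 1" "0 < t" "0 < R" "t \<noteq> R"
  shows "copson \<beta> m R t < top"
proof (cases "t < R")
  case True
  then show ?thesis using assms by (simp add: copson_less)
next
  case False
  then have "copson \<beta> m t R < top" using assms by (subst copson_less) auto
  then show ?thesis by (simp add: copson_commute)
qed

text \<open>The larger of |x| and sqrt t is factored out, which leaves
  \<open>integral_angular\<close> with |\<zeta>| < 1. As \<open>copson\<close> is symmetric in R and
  t, both cases end in the same formula, and later lemmas need not distinguish them.\<close>

lemma integral_angular_point:
  fixes x :: complex
  assumes \<beta>: "0 < \<beta>" "\<beta> < 1" and x: "x \<noteq> 0" and R: "R = (norm x)\<^sup>2" and t: "0 < t" "t \<noteq> R"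
  shows "of_real (sqrt t ^ m) * (LINT \<theta>:{-pi<..<pi}|lborel. cis (real m * \<theta>) * of_real (norm (x - of_real (sqrt t) * cis \<theta>) powr (- 2 * \<beta>)))
     = of_real (2 * pi / (Gamma \<beta> * Gamma (1 - \<beta>) * R ^ m) * enn2real (copson \<beta> m R t)) * x ^ m"
proof -
  let ?GG = "Gamma \<beta> * Gamma (1 - \<beta>)"
  have G: "Gamma \<beta> > 0" "Gamma (1 - \<beta>) > 0" using \<beta> by (auto simp: Gamma_real_pos)
  then have GG: "?GG > 0" by simp
  have R0: "R > 0" using x R by simp
  have normx: "norm x = sqrt R" using R by simp
  have sqrt_powr: "sqrt y powr (- (2 * \<beta>)) = y powr (- \<beta>)" if "y > 0" for y
    using that by (simp add: powr_def ln_sqrt)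
  have scale: "(LINT \<theta>:{-pi<..<pi}|lborel. cis (real m * \<theta>) * of_real (norm (x - of_real (sqrt t) * cis \<theta>) powr (- 2 * \<beta>))) =
     of_real (s powr (- \<beta>)) * (of_real (2 * pi * poch_conv \<beta> m ((norm \<zeta>)\<^sup>2)) * cnj \<zeta> ^ m)"
    if s: "s > 0" and \<zeta>: "norm \<zeta> < 1"
      and eq: "\<And>\<theta>. norm (x - of_real (sqrt t) * cis \<theta>) = sqrt s * norm (1 - \<zeta> * cis \<theta>)" for s \<zeta>
  proof -
    have "(LINT \<theta>:{-pi<..<pi}|lborel. cis (real m * \<theta>) * of_real (norm (x - of_real (sqrt t) * cis \<theta>) powr (- 2 * \<beta>))) =
      (LINT \<theta>:{-pi<..<pi}|lborel. of_real (s powr (- \<beta>)) * (cis (real m * \<theta>) * of_real (norm (1 - \<zeta> * cis \<theta>) powr (- 2 * \<beta>))))"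
      using s by (intro set_lebesgue_integral_cong) (auto simp: eq powr_mult sqrt_powr)
    then show ?thesis using integral_angular [of \<beta> \<zeta> m] \<beta> \<zeta> by simp
  qed
  show ?thesis
  proof (cases "t < R")
    case True
    define \<zeta> where "\<zeta> = of_real (sqrt t) / x"
    have nz: "(norm \<zeta>)\<^sup>2 = t / R" using t R0 by (simp add: \<zeta>_def norm_divide normx power_divide)
    have "norm \<zeta> < 1" using True t R0 by (simp add: \<zeta>_def norm_divide normx)
    moreover have "norm (x - of_real (sqrt t) * cis \<theta>) = sqrt R * norm (1 - \<zeta> * cis \<theta>)" for \<theta>
    proof -
      have "x - of_real (sqrt t) * cis \<theta> = x * (1 - \<zeta> * cis \<theta>)" using x by (simp add: \<zeta>_def field_simps)
      then show ?thesis by (simp add: norm_mult normx)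
    qed
    ultimately have *: "(LINT \<theta>:{-pi<..<pi}|lborel. cis (real m * \<theta>) * of_real (norm (x - of_real (sqrt t) * cis \<theta>) powr (- 2 * \<beta>))) =
       of_real (R powr (- \<beta>)) * (of_real (2 * pi * poch_conv \<beta> m (t / R)) * cnj \<zeta> ^ m)"
      using scale [OF R0] nz by simp
    have "cnj \<zeta> = of_real (sqrt t / R) * x"
    proof -
      have "x * cnj x = of_real R" using complex_norm_square [of x] R by simp
      then show ?thesis using x R0 by (simp add: \<zeta>_def field_simps)
    qed
    then have "of_real (sqrt t ^ m) * cnj \<zeta> ^ m = (of_real (sqrt t * (sqrt t / R)) * x) ^ m"
      by (simp only: of_real_mult of_real_power power_mult_distrib mult_ac)
    also have "sqrt t * (sqrt t / R) = t / R" using t by simp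
    also have "(of_real (t / R) * x) ^ m = of_real (t ^ m / R ^ m) * x ^ m"
      by (simp add: power_mult_distrib power_divide)
    finally have z: "of_real (sqrt t ^ m) * cnj \<zeta> ^ m = of_real (t ^ m / R ^ m) * x ^ m" .
    have c: "enn2real (copson \<beta> m R t) = ?GG * (t ^ m * R powr (- \<beta>) * poch_conv \<beta> m (t / R))"
      unfolding copson_less [OF \<beta> t(1) True] using G t R0 True \<beta>
      by (intro enn2real_ennreal mult_nonneg_nonneg poch_conv_nonneg) auto
    have "of_real (sqrt t ^ m) * (of_real (R powr (- \<beta>)) * (of_real (2 * pi * poch_conv \<beta> m (t / R)) * cnj \<zeta> ^ m))
       = of_real (R powr (- \<beta>) * (2 * pi * poch_conv \<beta> m (t / R))) * (of_real (sqrt t ^ m) * cnj \<zeta> ^ m)"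
      by (simp add: mult_ac)
    also have "\<dots> = of_real (R powr (- \<beta>) * (2 * pi * poch_conv \<beta> m (t / R)) * (t ^ m / R ^ m)) * x ^ m"
      unfolding z by simp
    also have "R powr (- \<beta>) * (2 * pi * poch_conv \<beta> m (t / R)) * (t ^ m / R ^ m) = 2 * pi / (?GG * R ^ m) * enn2real (copson \<beta> m R t)"
      unfolding c using G R0 by (simp add: field_simps)
    finally show ?thesis unfolding * .
  next
    case False
    then have True: "R < t" using t by simp
    \<comment> \<open>Now sqrt t e^(i \<theta>) is factored out. This conjugates the remaining
      factor, which accounts for the conjugate of x.\<close>
    define \<zeta> where "\<zeta> = cnj x / of_real (sqrt t)"
    have nz: "(norm \<zeta>)\<^sup>2 = R / t" using t R0 by (simp add: \<zeta>_def norm_divide normx power_divide)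
    have "norm \<zeta> < 1" using True t R0 by (simp add: \<zeta>_def norm_divide normx)
    moreover have "norm (x - of_real (sqrt t) * cis \<theta>) = sqrt t * norm (1 - \<zeta> * cis \<theta>)" for \<theta>
    proof -
      have "cis (- \<theta>) * cis \<theta> = 1" by (simp add: cis_mult)
      then have "x - of_real (sqrt t) * cis \<theta> = - of_real (sqrt t) * cis \<theta> * cnj (1 - \<zeta> * cis \<theta>)"
        using t by (simp add: \<zeta>_def cis_cnj field_simps)
      then show ?thesis using t by (simp only: norm_mult norm_minus_cancel norm_cis complex_mod_cnj norm_of_real) simp
    qed
    ultimately have *: "(LINT \<theta>:{-pi<..<pi}|lborel. cis (real m * \<theta>) * of_real (norm (x - of_real (sqrt t) * cis \<theta>) powr (- 2 * \<beta>))) =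
       of_real (t powr (- \<beta>)) * (of_real (2 * pi * poch_conv \<beta> m (R / t)) * cnj \<zeta> ^ m)"
      using scale [OF t(1)] nz by simp
    have z: "of_real (sqrt t ^ m) * cnj \<zeta> ^ m = x ^ m"
      using t by (simp add: \<zeta>_def power_divide)
    have c: "enn2real (copson \<beta> m R t) = ?GG * (R ^ m * t powr (- \<beta>) * poch_conv \<beta> m (R / t))"
      unfolding copson_commute [of \<beta> m R] copson_less [OF \<beta> R0 True] using G t R0 True \<beta>
      by (intro enn2real_ennreal mult_nonneg_nonneg poch_conv_nonneg) auto
    have "of_real (sqrt t ^ m) * (of_real (t powr (- \<beta>)) * (of_real (2 * pi * poch_conv \<beta> m (R / t)) * cnj \<zeta> ^ m))
       = of_real (t powr (- \<beta>) * (2 * pi * poch_conv \<beta> m (R / t))) * (of_real (sqrt t ^ m) * cnj \<zeta> ^ m)"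
      by (simp add: mult_ac)
    also have "\<dots> = of_real (t powr (- \<beta>) * (2 * pi * poch_conv \<beta> m (R / t))) * x ^ m"
      unfolding z by simp
    also have "t powr (- \<beta>) * (2 * pi * poch_conv \<beta> m (R / t)) = 2 * pi / (?GG * R ^ m) * enn2real (copson \<beta> m R t)"
      unfolding c using G R0 by (simp add: field_simps)
    finally show ?thesis unfolding * .
  qed
qed

text \<open>After Tonelli, the inner integral over t is an Abel transform of (1 - t)^(\<beta> - 1 +
  j). This is a Beta integral, equal to (1 - \<tau>)^j times a Pochhammer ratio and Gamma \<beta>
  Gamma (1 - \<beta>).\<close>

lemma nn_integral_copson:
  assumes \<beta>: "0 < \<beta>" "\<beta> < 1" and R: "0 < R" "R < 1"
  shows "(\<integral>\<^sup>+t. indicator {0<..<1} t * ennreal ((1 - t) powr (\<beta> - 1 + real j)) * copson \<beta> m R t \<partial>lborel) =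
    ennreal (Gamma \<beta> * Gamma (1 - \<beta>) * poch_ratio \<beta> j) *
     (\<integral>\<^sup>+\<tau>. indicator {0<..<R} \<tau> * ennreal (\<tau> powr (real m + \<beta> - 1) * (R - \<tau>) powr (- \<beta>) * (1 - \<tau>) ^ j) \<partial>lborel)"
proof -
  let ?h = "\<lambda>\<tau>. \<tau> powr (real m + \<beta> - 1) * (R - \<tau>) powr (- \<beta>)"
  define F where "F t \<tau> = indicator {0<..<1} t * ennreal ((1 - t) powr (\<beta> - 1 + real j)) * (indicator {0<..<R} \<tau> * indicator {\<tau><..} t *
     ennreal (?h \<tau> * (t - \<tau>) powr (- \<beta>)))" for t \<tau> :: real
  have [measurable]: "case_prod F \<in> borel_measurable (lborel \<Otimes>\<^sub>M lborel)"
  proof -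
    have "(\<lambda>p. indicator {0<..<1} (fst p) * ennreal ((1 - fst p) powr (\<beta> - 1 + real j)) * (indicator {0<..<R} (snd p) * indicator {p. snd p < fst p} p *
     ennreal (?h (snd p) * (fst p - snd p) powr (- \<beta>)))) \<in> borel_measurable (lborel \<Otimes>\<^sub>M lborel)"
      by measurable
    also have "(\<lambda>p. indicator {0<..<1} (fst p) * ennreal ((1 - fst p) powr (\<beta> - 1 + real j)) * (indicator {0<..<R} (snd p) * indicator {p. snd p < fst p} p *
     ennreal (?h (snd p) * (fst p - snd p) powr (- \<beta>)))) = case_prod F"
      by (auto simp: fun_eq_iff F_def split: split_indicator)
    finally show ?thesis .
  qed
  have "(\<integral>\<^sup>+t. indicator {0<..<1} t * ennreal ((1 - t) powr (\<beta> - 1 + real j)) * copson \<beta> m R t \<partial>lborel) =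
     (\<integral>\<^sup>+t. \<integral>\<^sup>+\<tau>. F t \<tau> \<partial>lborel \<partial>lborel)"
    unfolding copson_def
  proof (intro nn_integral_cong, subst nn_integral_cmult [symmetric])
    fix t :: real
    show "(\<integral>\<^sup>+\<tau>. indicator {0<..<1} t * ennreal ((1 - t) powr (\<beta> - 1 + real j)) * (indicator {0<..<min R t} \<tau> *
     ennreal (\<tau> powr (real m + \<beta> - 1) * (R - \<tau>) powr (- \<beta>) * (t - \<tau>) powr (- \<beta>))) \<partial>lborel) = (\<integral>\<^sup>+\<tau>. F t \<tau> \<partial>lborel)"
      by (intro nn_integral_cong) (auto simp: F_def split: split_indicator)
  qed measurable
  also have "\<dots> = (\<integral>\<^sup>+\<tau>. \<integral>\<^sup>+t. F t \<tau> \<partial>lborel \<partial>lborel)"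
    by (rule lborel_pair.Fubini' [symmetric]) measurable
  also have "\<dots> = (\<integral>\<^sup>+\<tau>. ennreal (Gamma \<beta> * Gamma (1 - \<beta>) * poch_ratio \<beta> j) *
      (indicator {0<..<R} \<tau> * ennreal (?h \<tau> * (1 - \<tau>) ^ j)) \<partial>lborel)"
  proof (intro nn_integral_cong)
    fix \<tau> :: real
    show "(\<integral>\<^sup>+t. F t \<tau> \<partial>lborel) = ennreal (Gamma \<beta> * Gamma (1 - \<beta>) * poch_ratio \<beta> j) *
      (indicator {0<..<R} \<tau> * ennreal (?h \<tau> * (1 - \<tau>) ^ j))"
    proof (cases "\<tau> \<in> {0<..<R}")
      case True
      then have \<tau>: "0 < \<tau>" "\<tau> < R" "\<tau> < 1" using R by auto
      have "(\<integral>\<^sup>+t. F t \<tau> \<partial>lborel) = (\<integral>\<^sup>+t. ennreal (?h \<tau>) * (indicator {\<tau><..<1} t *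
          ennreal ((1 - t) powr (real j + \<beta> - 1) * (t - \<tau>) powr ((1 - \<beta>) - 1))) \<partial>lborel)"
        using \<tau> by (intro nn_integral_cong) (auto simp: F_def ennreal_mult' algebra_simps split: split_indicator)
      also have "\<dots> = ennreal (?h \<tau>) * ennreal ((1 - \<tau>) powr (real j + \<beta> + (1 - \<beta>) - 1) * Beta (real j + \<beta>) (1 - \<beta>))"
        using \<tau> \<beta> by (subst nn_integral_cmult, (measurable; fail), subst nn_integral_Beta_reflect) auto
      also have "(1 - \<tau>) powr (real j + \<beta> + (1 - \<beta>) - 1) = (1 - \<tau>) ^ j"
        using \<tau> by (simp flip: powr_realpow)
      finally show ?thesis
        using True \<tau> \<beta> poch_ratio_pos [of \<beta> j]
        by (simp add: Beta_poch_ratio ennreal_mult [symmetric] Gamma_real_pos less_imp_le mult_ac)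
    qed (simp add: F_def)
  qed
  also have "\<dots> = ennreal (Gamma \<beta> * Gamma (1 - \<beta>) * poch_ratio \<beta> j) *
     (\<integral>\<^sup>+\<tau>. indicator {0<..<R} \<tau> * ennreal (?h \<tau> * (1 - \<tau>) ^ j) \<partial>lborel)"
    by (rule nn_integral_cmult) measurable
  finally show ?thesis .
qed

section \<open>The second Abel transform\<close>

definition abel_int :: "real \<Rightarrow> nat \<Rightarrow> real \<Rightarrow> (real \<Rightarrow> real) \<Rightarrow> real" where
  "abel_int \<beta> m R q = (LINT \<tau>:{0<..<R}|lborel. \<tau> powr (real m + \<beta> - 1) * (R - \<tau>) powr (- \<beta>) * q \<tau>)"

lemma abel_integrable:
  assumes \<beta>: "0 < \<beta>" "\<beta> < 1" and R: "0 < R" and q: "continuous_on {0..R} q"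
  shows "set_integrable lborel {0<..<R} (\<lambda>\<tau>. \<tau> powr (real m + \<beta> - 1) * (R - \<tau>) powr (- \<beta>) * q \<tau>)"
proof -
  obtain C where C: "\<And>t. t \<in> {0..R} \<Longrightarrow> \<bar>q t\<bar> \<le> C"
    using compact_imp_bounded [OF compact_continuous_image [OF q compact_Icc]]
    unfolding bounded_iff by (metis image_eqI real_norm_def)
  have "C \<ge> 0" using C [of 0] R by auto
  have "(\<integral>\<^sup>+\<tau>. indicator {0<..<R} \<tau> * ennreal (\<tau> powr ((real m + \<beta>) - 1) * (R - \<tau>) powr ((1 - \<beta>) - 1)) \<partial>lborel) < \<infinity>"
    using assms by (subst nn_integral_Beta) auto
  then have "set_integrable lborel {0<..<R} (\<lambda>\<tau>. \<tau> powr (real m + \<beta> - 1) * (R - \<tau>) powr (- \<beta>))"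
    unfolding set_integrable_def
    by (intro integrableI_bounded) (auto simp: ennreal_mult' ennreal_indicator)
  then have "set_integrable lborel {0<..<R} (\<lambda>\<tau>. C * (\<tau> powr (real m + \<beta> - 1) * (R - \<tau>) powr (- \<beta>)))"
    by (intro set_integrable_mult_right) auto
  then show ?thesis
  proof (rule set_integrable_bound)
    have "continuous_on {0<..<R} q" by (rule continuous_on_subset [OF q]) auto
    then have c: "continuous_on {0<..<R} (\<lambda>\<tau>. \<tau> powr (real m + \<beta> - 1) * (R - \<tau>) powr (- \<beta>) * q \<tau>)"
      by (intro continuous_intros) auto
    show "set_borel_measurable lborel {0<..<R} (\<lambda>\<tau>. \<tau> powr (real m + \<beta> - 1) * (R - \<tau>) powr (- \<beta>) * q \<tau>)"
      unfolding set_borel_measurable_def measurable_lborel2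
      by (rule borel_measurable_continuous_on_indicator [OF _ c]) auto
    have "\<bar>\<tau> powr (real m + \<beta> - 1) * (R - \<tau>) powr (- \<beta>) * q \<tau>\<bar> \<le> C * (\<tau> powr (real m + \<beta> - 1) * (R - \<tau>) powr (- \<beta>))"
      if "\<tau> \<in> {0<..<R}" for \<tau>
    proof -
      have "\<bar>\<tau> powr (real m + \<beta> - 1) * (R - \<tau>) powr (- \<beta>) * q \<tau>\<bar> = \<bar>q \<tau>\<bar> * (\<tau> powr (real m + \<beta> - 1) * (R - \<tau>) powr (- \<beta>))"
        by (simp add: abs_mult)
      also have "\<dots> \<le> C * (\<tau> powr (real m + \<beta> - 1) * (R - \<tau>) powr (- \<beta>))"
        using that C [of \<tau>] by (intro mult_right_mono) auto
      finally show ?thesis .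
    qed
    then show "AE \<tau> in lborel. \<tau> \<in> {0<..<R} \<longrightarrow> norm (\<tau> powr (real m + \<beta> - 1) * (R - \<tau>) powr (- \<beta>) * q \<tau>)
        \<le> norm (C * (\<tau> powr (real m + \<beta> - 1) * (R - \<tau>) powr (- \<beta>)))"
      using \<open>C \<ge> 0\<close> by (auto simp: abs_mult)
  qed
qed

lemma abel_int_sum:
  assumes \<beta>: "0 < \<beta>" "\<beta> < 1" and R: "0 < R" and q: "\<And>j. j \<in> J \<Longrightarrow> continuous_on {0..R} (q j)"
  shows "abel_int \<beta> m R (\<lambda>\<tau>. \<Sum>j\<in>J. c j * q j \<tau>) = (\<Sum>j\<in>J. c j * abel_int \<beta> m R (q j))"
proof -
  have i: "integrable lborel (\<lambda>\<tau>. indicator {0<..<R} \<tau> *\<^sub>R (\<tau> powr (real m + \<beta> - 1) * (R - \<tau>) powr (- \<beta>) * q j \<tau>))" if "j \<in> J" for j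
    using abel_integrable [OF \<beta> R q [OF that]] unfolding set_integrable_def .
  have "abel_int \<beta> m R (\<lambda>\<tau>. \<Sum>j\<in>J. c j * q j \<tau>) =
     (LINT \<tau>|lborel. (\<Sum>j\<in>J. c j * (indicator {0<..<R} \<tau> *\<^sub>R (\<tau> powr (real m + \<beta> - 1) * (R - \<tau>) powr (- \<beta>) * q j \<tau>))))"
    unfolding abel_int_def set_lebesgue_integral_def
    by (intro Bochner_Integration.integral_cong refl) (simp add: sum_distrib_left mult_ac)
  also have "\<dots> = (\<Sum>j\<in>J. LINT \<tau>|lborel. c j * (indicator {0<..<R} \<tau> *\<^sub>R (\<tau> powr (real m + \<beta> - 1) * (R - \<tau>) powr (- \<beta>) * q j \<tau>)))"
    using i by (intro Bochner_Integration.integral_sum integrable_mult_right)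
  also have "\<dots> = (\<Sum>j\<in>J. c j * abel_int \<beta> m R (q j))"
    unfolding abel_int_def set_lebesgue_integral_def integral_mult_right_zero ..
  finally show ?thesis .
qed

text \<open>A Beta integral again. The factor R^m will cancel the 1 / R^m of
  \<open>integral_angular_point\<close>.\<close>

lemma abel_int_power:
  assumes \<beta>: "0 < \<beta>" "\<beta> < 1" and R: "0 < R"
  shows "abel_int \<beta> m R (\<lambda>\<tau>. \<tau> ^ k) = R ^ (m + k) * (Gamma \<beta> * Gamma (1 - \<beta>) * poch_ratio \<beta> (m + k))"
proof -
  let ?I = "R powr ((real (m + k) + \<beta>) + (1 - \<beta>) - 1) * Beta (real (m + k) + \<beta>) (1 - \<beta>)"
  have B: "?I = R ^ (m + k) * (Gamma \<beta> * Gamma (1 - \<beta>) * poch_ratio \<beta> (m + k))"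
    using R by (subst Beta_poch_ratio [OF \<beta>]) (simp flip: powr_realpow)
  have "has_bochner_integral lborel (\<lambda>\<tau>. indicator {0<..<R} \<tau> *\<^sub>R (\<tau> powr (real m + \<beta> - 1) * (R - \<tau>) powr (- \<beta>) * \<tau> ^ k)) ?I"
  proof (rule has_bochner_integral_nn_integral)
    have "(\<integral>\<^sup>+\<tau>. ennreal (indicator {0<..<R} \<tau> *\<^sub>R (\<tau> powr (real m + \<beta> - 1) * (R - \<tau>) powr (- \<beta>) * \<tau> ^ k)) \<partial>lborel)
      = (\<integral>\<^sup>+\<tau>. indicator {0<..<R} \<tau> * ennreal (\<tau> powr ((real (m + k) + \<beta>) - 1) * (R - \<tau>) powr ((1 - \<beta>) - 1)) \<partial>lborel)"
    proof (intro nn_integral_cong)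
      fix \<tau> :: real
      have "\<tau> powr ((real (m + k) + \<beta>) - 1) = \<tau> powr (real m + \<beta> - 1) * \<tau> ^ k" if "\<tau> > 0"
        using that by (simp add: powr_add [symmetric] algebra_simps flip: powr_realpow)
      then show "ennreal (indicator {0<..<R} \<tau> *\<^sub>R (\<tau> powr (real m + \<beta> - 1) * (R - \<tau>) powr (- \<beta>) * \<tau> ^ k)) =
         indicator {0<..<R} \<tau> * ennreal (\<tau> powr ((real (m + k) + \<beta>) - 1) * (R - \<tau>) powr ((1 - \<beta>) - 1))"
        by (auto split: split_indicator simp: mult_ac simp del: of_nat_add)
    qed
    also have "\<dots> = ennreal ?I"
      using \<beta> R by (intro nn_integral_Beta) auto
    finally show "(\<integral>\<^sup>+\<tau>. ennreal (indicator {0<..<R} \<tau> *\<^sub>R (\<tau> powr (real m + \<beta> - 1) * (R - \<tau>) powr (- \<beta>) * \<tau> ^ k)) \<partial>lborel) = ennreal ?I" .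
    show "0 \<le> ?I"
      unfolding B using R \<beta> poch_ratio_pos [of \<beta> "m + k"] by (intro mult_nonneg_nonneg less_imp_le [OF Gamma_real_pos]) auto
  qed (auto intro!: AE_I2 split: split_indicator)
  then have "abel_int \<beta> m R (\<lambda>\<tau>. \<tau> ^ k) = ?I"
    unfolding abel_int_def set_lebesgue_integral_def by (rule has_bochner_integral_integral_eq)
  with B show ?thesis by simp
qed

text \<open>One endpoint power at a time: by \<open>sjac_expand\<close>, a weighted Zernike function
  is a linear combination of these. With \<sigma> = 2 - 2 \<beta> the Riesz kernel has exponent
  \<sigma> - 2 = -2 \<beta>.\<close>

definition riesz_integrand :: "real \<Rightarrow> nat \<Rightarrow> nat \<Rightarrow> real^2 \<Rightarrow> real^2 \<Rightarrow> complex" where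
  "riesz_integrand \<beta> j m x y = of_real (indicator disk y * (1 - (norm y)\<^sup>2) powr (\<beta> - 1 + real j) * norm (x - y) powr (- 2 * \<beta>)) * cpx y ^ m"

lemma riesz_integrand_measurable [measurable]: "riesz_integrand \<beta> j m x \<in> borel_measurable borel"
proof -
  have [measurable]: "disk \<in> sets borel" by (simp add: disk_def)
  show ?thesis unfolding riesz_integrand_def by measurable
qed

lemma riesz_integrand_polar:
  assumes "t > 0"
  shows "riesz_integrand \<beta> j m x (polar (t, \<theta>)) =
    of_real (indicator {0<..<1} t * (1 - t) powr (\<beta> - 1 + real j)) *
    (of_real (sqrt t ^ m) * (cis (real m * \<theta>) * of_real (norm (cpx x - of_real (sqrt t) * cis \<theta>) powr (- 2 * \<beta>))))"
proof -
  have n: "norm (polar (t, \<theta>)) = sqrt t" using assms by (simp add: polar_def norm_mult)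
  have c: "cpx (polar (t, \<theta>)) = of_real (sqrt t) * cis \<theta>" by (simp add: polar_def)
  have "indicator disk (polar (t, \<theta>)) = (indicator {0<..<1} t :: real)"
    using assms by (simp add: disk_def n split: split_indicator)
  moreover have "norm (x - polar (t, \<theta>)) = norm (cpx x - of_real (sqrt t) * cis \<theta>)"
    by (simp add: c cpx_simps flip: norm_cpx)
  ultimately show ?thesis
    using assms by (simp add: riesz_integrand_def n c power_mult_distrib Complex.DeMoivre)
qed

lemma nn_integral_abel_less_top:
  assumes \<beta>: "0 < \<beta>" "\<beta> < 1" and R: "0 < R" "R < 1"
  shows "(\<integral>\<^sup>+\<tau>. indicator {0<..<R} \<tau> * ennreal (\<tau> powr (real m + \<beta> - 1) * (R - \<tau>) powr (- \<beta>) * (1 - \<tau>) ^ j) \<partial>lborel)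
     = ennreal (abel_int \<beta> m R (\<lambda>\<tau>. (1 - \<tau>) ^ j))"
proof -
  have "(\<integral>\<^sup>+\<tau>. indicator {0<..<R} \<tau> * ennreal (\<tau> powr (real m + \<beta> - 1) * (R - \<tau>) powr (- \<beta>) * (1 - \<tau>) ^ j) \<partial>lborel)
    = (\<integral>\<^sup>+\<tau>. ennreal (indicator {0<..<R} \<tau> *\<^sub>R (\<tau> powr (real m + \<beta> - 1) * (R - \<tau>) powr (- \<beta>) * (1 - \<tau>) ^ j)) \<partial>lborel)"
    by (intro nn_integral_cong) (auto split: split_indicator)
  also have "\<dots> = ennreal (abel_int \<beta> m R (\<lambda>\<tau>. (1 - \<tau>) ^ j))"
    unfolding abel_int_def set_lebesgue_integral_def
  proof (rule nn_integral_eq_integral)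
    show "integrable lborel (\<lambda>\<tau>. indicator {0<..<R} \<tau> *\<^sub>R (\<tau> powr (real m + \<beta> - 1) * (R - \<tau>) powr (- \<beta>) * (1 - \<tau>) ^ j))"
      using abel_integrable [OF \<beta> R(1), of "\<lambda>\<tau>. (1 - \<tau>) ^ j" m]
      by (simp add: set_integrable_def continuous_intros)
  qed (use R in \<open>auto intro!: AE_I2 split: split_indicator\<close>)
  finally show ?thesis .
qed

text \<open>On the disk (1 - t)^j and sqrt t^m are at most 1, so the absolute value is dominated by
  the case j = m = 0, whose angular and radial integrals are already evaluated.\<close>

lemma riesz_integrand_integrable:
  assumes \<beta>: "0 < \<beta>" "\<beta> < 1" and x: "x \<in> disk" "x \<noteq> 0"
  shows "integrable lborel (riesz_integrand \<beta> j m x)"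
proof (rule integrableI_bounded)
  let ?GG = "Gamma \<beta> * Gamma (1 - \<beta>)"
  have G: "Gamma \<beta> > 0" "Gamma (1 - \<beta>) > 0" using \<beta> by (auto simp: Gamma_real_pos)
  then have GG: "?GG > 0" by simp
  define R where "R = (norm (cpx x))\<^sup>2"
  have R: "0 < R" "R < 1" using x by (auto simp: R_def disk_def abs_square_less_1)
  have x0: "cpx x \<noteq> 0" using x by (metis norm_cpx norm_eq_zero)
  let ?I = "{-pi<..<pi}"
  let ?N = "\<lambda>t \<theta>. norm (cpx x - of_real (sqrt t) * cis \<theta>) powr (- 2 * \<beta>)"
  have ang: "(\<integral>\<^sup>+\<theta>. indicator ?I \<theta> * ennreal (?N t \<theta>) \<partial>lborel) = ennreal (2 * pi / ?GG) * copson \<beta> 0 R t"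
    if t: "0 < t" "t \<noteq> R" for t
  proof -
    have nz: "cpx x - of_real (sqrt t) * cis \<theta> \<noteq> 0" for \<theta>
    proof
      assume "cpx x - of_real (sqrt t) * cis \<theta> = 0"
      then have "norm (cpx x) = norm (of_real (sqrt t) * cis \<theta>)" by simp
      then show False using t by (simp add: R_def norm_mult del: norm_cpx)
    qed
    have cont: "continuous_on A (?N t)" for A
      unfolding cis_conv_exp using nz by (intro continuous_intros) (auto simp: cis_conv_exp)
    have "(\<integral>\<^sup>+\<theta>. indicator ?I \<theta> * ennreal (?N t \<theta>) \<partial>lborel) = (\<integral>\<^sup>+\<theta>. ennreal (indicator ?I \<theta> *\<^sub>R ?N t \<theta>) \<partial>lborel)"
      by (intro nn_integral_cong) (auto split: split_indicator)
    also have "\<dots> = ennreal (LINT \<theta>:?I|lborel. ?N t \<theta>)"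
      unfolding set_lebesgue_integral_def
      using set_integrable_continuous_Ioo [OF cont] by (intro nn_integral_eq_integral) (auto simp: set_integrable_def)
    also have "(LINT \<theta>:?I|lborel. ?N t \<theta>) = 2 * pi / ?GG * enn2real (copson \<beta> 0 R t)"
    proof -
      have "of_real (LINT \<theta>:?I|lborel. ?N t \<theta>) = (LINT \<theta>:?I|lborel. of_real (?N t \<theta>) :: complex)"
        unfolding set_lebesgue_integral_def by (simp add: scaleR_conv_of_real flip: integral_of_real of_real_mult)
      also have "\<dots> = of_real (2 * pi / ?GG * enn2real (copson \<beta> 0 R t))"
        using integral_angular_point [OF \<beta> x0 R_def t, of 0] by simp
      finally show ?thesis by (simp only: of_real_eq_iff)
    qed
    also have "ennreal (2 * pi / ?GG * enn2real (copson \<beta> 0 R t)) = ennreal (2 * pi / ?GG) * ennreal (enn2real (copson \<beta> 0 R t))"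
      using GG by (intro ennreal_mult') auto
    also have "ennreal (enn2real (copson \<beta> 0 R t)) = copson \<beta> 0 R t"
      using copson_finite [OF \<beta> t(1) R(1) t(2), of 0] by simp
    finally show ?thesis .
  qed
  have "(\<integral>\<^sup>+y. ennreal (norm (riesz_integrand \<beta> j m x y)) \<partial>lborel) =
     (\<integral>\<^sup>+t. \<integral>\<^sup>+\<theta>. ennreal (1 / 2) * indicator {0<..} t * indicator ?I \<theta> * ennreal (norm (riesz_integrand \<beta> j m x (polar (t, \<theta>)))) \<partial>lborel \<partial>lborel)"
    by (rule nn_integral_polar) measurable
  also have "\<dots> \<le> (\<integral>\<^sup>+t. ennreal (2 * pi / ?GG) * (indicator {0<..<1} t * ennreal ((1 - t) powr (\<beta> - 1 + real 0)) * copson \<beta> 0 R t) \<partial>lborel)"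
  proof (rule nn_integral_mono_AE)
    \<comment> \<open>The circle through x, on which the kernel is singular, is discarded.\<close>
    have "AE t in lborel. t \<noteq> R" by (rule AE_lborel_singleton)
    then show "AE t in lborel. (\<integral>\<^sup>+\<theta>. ennreal (1 / 2) * indicator {0<..} t * indicator ?I \<theta> * ennreal (norm (riesz_integrand \<beta> j m x (polar (t, \<theta>)))) \<partial>lborel)
       \<le> ennreal (2 * pi / ?GG) * (indicator {0<..<1} t * ennreal ((1 - t) powr (\<beta> - 1 + real 0)) * copson \<beta> 0 R t)"
    proof eventually_elim
      fix t assume "t \<noteq> R"
      show "(\<integral>\<^sup>+\<theta>. ennreal (1 / 2) * indicator {0<..} t * indicator ?I \<theta> * ennreal (norm (riesz_integrand \<beta> j m x (polar (t, \<theta>)))) \<partial>lborel)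
       \<le> ennreal (2 * pi / ?GG) * (indicator {0<..<1} t * ennreal ((1 - t) powr (\<beta> - 1 + real 0)) * copson \<beta> 0 R t)"
      proof (cases "t \<in> {0<..<1}")
        case True
        then have t: "0 < t" "t < 1" by auto
        have "(\<integral>\<^sup>+\<theta>. ennreal (1 / 2) * indicator {0<..} t * indicator ?I \<theta> * ennreal (norm (riesz_integrand \<beta> j m x (polar (t, \<theta>)))) \<partial>lborel)
          \<le> (\<integral>\<^sup>+\<theta>. ennreal ((1 - t) powr (\<beta> - 1 + real 0)) * (indicator ?I \<theta> * ennreal (?N t \<theta>)) \<partial>lborel)"
        proof (rule nn_integral_mono)
          fix \<theta>
          have "norm (riesz_integrand \<beta> j m x (polar (t, \<theta>))) = (1 - t) powr (\<beta> - 1 + real j) * (sqrt t ^ m * ?N t \<theta>)"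
            unfolding riesz_integrand_polar [OF t(1)] using t by (simp add: norm_mult norm_power)
          also have "\<dots> \<le> (1 - t) powr (\<beta> - 1 + real 0) * (1 * ?N t \<theta>)"
          proof (rule mult_mono)
            show "(1 - t) powr (\<beta> - 1 + real j) \<le> (1 - t) powr (\<beta> - 1 + real 0)"
              using t by (intro powr_mono') auto
            show "sqrt t ^ m * ?N t \<theta> \<le> 1 * ?N t \<theta>"
              using t by (intro mult_right_mono power_le_one) auto
          qed (use t in auto)
          finally have "1 / 2 * norm (riesz_integrand \<beta> j m x (polar (t, \<theta>))) \<le> (1 - t) powr (\<beta> - 1 + real 0) * ?N t \<theta>"
            using norm_ge_zero [of "riesz_integrand \<beta> j m x (polar (t, \<theta>))"] by linarith
          then have "ennreal (1 / 2) * ennreal (norm (riesz_integrand \<beta> j m x (polar (t, \<theta>)))) \<le> ennreal ((1 - t) powr (\<beta> - 1 + real 0)) * ennreal (?N t \<theta>)"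
            by (subst (1 2) ennreal_mult [symmetric]) (auto intro!: ennreal_leI)
          then show "ennreal (1 / 2) * indicator {0<..} t * indicator ?I \<theta> * ennreal (norm (riesz_integrand \<beta> j m x (polar (t, \<theta>))))
             \<le> ennreal ((1 - t) powr (\<beta> - 1 + real 0)) * (indicator ?I \<theta> * ennreal (?N t \<theta>))"
            using t by (auto split: split_indicator)
        qed
        also have "\<dots> = ennreal ((1 - t) powr (\<beta> - 1 + real 0)) * (ennreal (2 * pi / ?GG) * copson \<beta> 0 R t)"
          unfolding ang [OF t(1) \<open>t \<noteq> R\<close>, symmetric] cis_conv_exp by (rule nn_integral_cmult) measurable
        finally show ?thesis using True by (simp add: mult_ac)
      qed (auto simp: riesz_integrand_polar)
    qed
  qed
  also have "\<dots> = ennreal (2 * pi / ?GG) * (\<integral>\<^sup>+t. indicator {0<..<1} t * ennreal ((1 - t) powr (\<beta> - 1 + real 0)) * copson \<beta> 0 R t \<partial>lborel)"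
    by (rule nn_integral_cmult) measurable
  also have "\<dots> < \<infinity>"
    unfolding nn_integral_copson [OF \<beta> R] nn_integral_abel_less_top [OF \<beta> R] by (simp add: ennreal_mult_less_top)
  finally show "(\<integral>\<^sup>+y. ennreal (norm (riesz_integrand \<beta> j m x y)) \<partial>lborel) < \<infinity>" .
qed measurable

text \<open>The angular integral gives \<open>copson\<close>, and the radial integral against
  \<open>copson\<close> is the composition of the two Abel transforms. Its integrand is real and
  nonnegative, so the value can be read off the nonnegative integral.\<close>

lemma riesz_integrand_integral:
  assumes \<beta>: "0 < \<beta>" "\<beta> < 1" and x: "x \<in> disk" "x \<noteq> 0" and R: "R = (norm x)\<^sup>2"
  shows "(LINT y|lborel. riesz_integrand \<beta> j m x y) =
    of_real (pi * poch_ratio \<beta> j / R ^ m * abel_int \<beta> m R (\<lambda>\<tau>. (1 - \<tau>) ^ j)) * cpx x ^ m"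
proof -
  let ?GG = "Gamma \<beta> * Gamma (1 - \<beta>)"
  have G: "Gamma \<beta> > 0" "Gamma (1 - \<beta>) > 0" using \<beta> by (auto simp: Gamma_real_pos)
  then have GG: "?GG > 0" by simp
  have R': "R = (norm (cpx x))\<^sup>2" by (simp add: R)
  have R01: "0 < R" "R < 1" using x by (auto simp: R disk_def abs_square_less_1)
  have x0: "cpx x \<noteq> 0" using x by (metis norm_cpx norm_eq_zero)
  let ?I = "{-pi<..<pi}"
  let ?w = "\<lambda>t. indicator {0<..<1} t * (1 - t) powr (\<beta> - 1 + real j)"
  let ?c = "of_real (2 * pi / (?GG * R ^ m)) * cpx x ^ m"
  have "(LINT t:{0<..}|lborel. (LINT \<theta>:?I|lborel. riesz_integrand \<beta> j m x (polar (t, \<theta>)))) =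
     (LINT t|lborel. ?c * of_real (?w t * enn2real (copson \<beta> m R t)))"
    unfolding set_lebesgue_integral_def [of lborel "{0<..}"]
  proof (rule integral_cong_AE)
    show "(\<lambda>t. indicat_real {0<..} t *\<^sub>R (LINT \<theta>:?I|lborel. riesz_integrand \<beta> j m x (polar (t, \<theta>)))) \<in> borel_measurable lborel"
      unfolding set_lebesgue_integral_def
      by measurable
    show "(\<lambda>t. ?c * of_real (?w t * enn2real (copson \<beta> m R t))) \<in> borel_measurable lborel" by measurable
    have "AE t in lborel. t \<noteq> R" by (rule AE_lborel_singleton)
    then show "AE t in lborel. indicat_real {0<..} t *\<^sub>R (LINT \<theta>:?I|lborel. riesz_integrand \<beta> j m x (polar (t, \<theta>))) =
      ?c * of_real (?w t * enn2real (copson \<beta> m R t))"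
    proof eventually_elim
      fix t assume tR: "t \<noteq> R"
      show "indicat_real {0<..} t *\<^sub>R (LINT \<theta>:?I|lborel. riesz_integrand \<beta> j m x (polar (t, \<theta>))) =
        ?c * of_real (?w t * enn2real (copson \<beta> m R t))"
      proof (cases "t > 0")
        case True
        have "(LINT \<theta>:?I|lborel. riesz_integrand \<beta> j m x (polar (t, \<theta>))) =
          of_real (?w t) * (of_real (sqrt t ^ m) * (LINT \<theta>:?I|lborel. cis (real m * \<theta>) * of_real (norm (cpx x - of_real (sqrt t) * cis \<theta>) powr (- 2 * \<beta>))))"
          unfolding riesz_integrand_polar [OF True] set_integral_mult_right ..
        also have "\<dots> = ?c * of_real (?w t * enn2real (copson \<beta> m R t))"
          unfolding integral_angular_point [OF \<beta> x0 R' True tR] by simp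
        finally show ?thesis using True by simp
      qed simp
    qed
  qed
  also have "\<dots> = ?c * of_real (LINT t|lborel. ?w t * enn2real (copson \<beta> m R t))"
    by (simp only: integral_mult_right_zero integral_complex_of_real)
  also have "(LINT t|lborel. ?w t * enn2real (copson \<beta> m R t)) = ?GG * poch_ratio \<beta> j * abel_int \<beta> m R (\<lambda>\<tau>. (1 - \<tau>) ^ j)"
  proof -
    have "(LINT t|lborel. ?w t * enn2real (copson \<beta> m R t)) = enn2real (\<integral>\<^sup>+t. ennreal (?w t * enn2real (copson \<beta> m R t)) \<partial>lborel)"
      by (rule integral_eq_nn_integral) auto
    also have "(\<integral>\<^sup>+t. ennreal (?w t * enn2real (copson \<beta> m R t)) \<partial>lborel) =
       (\<integral>\<^sup>+t. indicator {0<..<1} t * ennreal ((1 - t) powr (\<beta> - 1 + real j)) * copson \<beta> m R t \<partial>lborel)"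
    proof (rule nn_integral_cong_AE)
      have "AE t in lborel. t \<noteq> R" by (rule AE_lborel_singleton)
      then show "AE t in lborel. ennreal (?w t * enn2real (copson \<beta> m R t)) = indicator {0<..<1} t * ennreal ((1 - t) powr (\<beta> - 1 + real j)) * copson \<beta> m R t"
      proof eventually_elim
        case (elim t)
        then show ?case
          using copson_finite [OF \<beta>, of t R m] R01
          by (cases "t \<in> {0<..<1}") (auto simp: ennreal_mult')
      qed
    qed
    also have "\<dots> = ennreal (?GG * poch_ratio \<beta> j * abel_int \<beta> m R (\<lambda>\<tau>. (1 - \<tau>) ^ j))"
      unfolding nn_integral_copson [OF \<beta> R01] nn_integral_abel_less_top [OF \<beta> R01]
      using GG poch_ratio_pos [OF \<beta>(1), of j] by (intro ennreal_mult' [symmetric]) auto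
    also have "enn2real \<dots> = ?GG * poch_ratio \<beta> j * abel_int \<beta> m R (\<lambda>\<tau>. (1 - \<tau>) ^ j)"
    proof (rule enn2real_ennreal)
      have "abel_int \<beta> m R (\<lambda>\<tau>. (1 - \<tau>) ^ j) \<ge> 0"
        unfolding abel_int_def set_lebesgue_integral_def
        using R01 by (intro integral_nonneg_AE AE_I2) (auto split: split_indicator)
      then show "0 \<le> ?GG * poch_ratio \<beta> j * abel_int \<beta> m R (\<lambda>\<tau>. (1 - \<tau>) ^ j)"
        using GG poch_ratio_pos [OF \<beta>(1), of j] by simp
    qed
    finally show ?thesis .
  qed
  finally have *: "(LINT t:{0<..}|lborel. (LINT \<theta>:?I|lborel. riesz_integrand \<beta> j m x (polar (t, \<theta>)))) =
    ?c * of_real (?GG * poch_ratio \<beta> j * abel_int \<beta> m R (\<lambda>\<tau>. (1 - \<tau>) ^ j))" .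
  show ?thesis
    unfolding integral_polar [OF riesz_integrand_integrable [OF \<beta> x]] *
    using G by (simp add: scaleR_conv_of_real field_simps)
qed

text \<open>
  One Abel transform acts diagonally on the expansion of the Jacobi polynomial in powers of \<open>1 - t\<close>,
  the other one on its expansion in powers of \<open>t\<close>.
\<close>

lemma riesz_jacobi:
  fixes m n :: nat
  assumes \<beta>: "0 < \<beta>" "\<beta> < 1" and x: "x \<in> disk" "x \<noteq> 0"
  defines "f \<equiv> \<lambda>y. of_real (weight (\<beta> - 1) y * sjac n (\<beta> - 1) m ((norm y)\<^sup>2) * norm (x - y) powr (- 2 * \<beta>)) * cpx y ^ m"
  shows "integrable lborel f"
    and "(LINT y|lborel. f y) = of_real (pi * (Gamma \<beta> * Gamma (1 - \<beta>)) * poch_ratio \<beta> n * poch_ratio \<beta> (n + m) * sjac n (\<beta> - 1) m ((norm x)\<^sup>2)) * cpx x ^ m"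
proof -
  let ?GG = "Gamma \<beta> * Gamma (1 - \<beta>)"
  let ?c = "jac_coeff n (\<beta> - 1) m"
  define R where "R = (norm x)\<^sup>2"
  have R01: "0 < R" "R < 1" using x by (auto simp: R_def disk_def abs_square_less_1)
  have f: "f = (\<lambda>y. \<Sum>j\<le>n. of_real (?c j) * riesz_integrand \<beta> j m x y)"
  proof
    fix y
    show "f y = (\<Sum>j\<le>n. of_real (?c j) * riesz_integrand \<beta> j m x y)"
    proof (cases "y \<in> disk")
      case True
      then have y: "1 - (norm y)\<^sup>2 > 0" by (auto simp: disk_def abs_square_less_1)
      have "riesz_integrand \<beta> j m x y = of_real ((1 - (norm y)\<^sup>2) ^ j * ((1 - (norm y)\<^sup>2) powr (\<beta> - 1) * norm (x - y) powr (- 2 * \<beta>))) * cpx y ^ m" for j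
        using True y by (simp add: riesz_integrand_def powr_add powr_realpow mult_ac)
      then have "(\<Sum>j\<le>n. of_real (?c j) * riesz_integrand \<beta> j m x y) =
         (\<Sum>j\<le>n. of_real (?c j * (1 - (norm y)\<^sup>2) ^ j * ((1 - (norm y)\<^sup>2) powr (\<beta> - 1) * norm (x - y) powr (- 2 * \<beta>))) * cpx y ^ m)"
        by (intro sum.cong refl) (simp only: of_real_mult mult_ac)
      also have "\<dots> = of_real ((\<Sum>j\<le>n. ?c j * (1 - (norm y)\<^sup>2) ^ j) * ((1 - (norm y)\<^sup>2) powr (\<beta> - 1) * norm (x - y) powr (- 2 * \<beta>))) * cpx y ^ m"
        by (simp only: of_real_sum sum_distrib_right)
      finally show ?thesis
        using True by (simp only: f_def weight_def sjac_expand if_True mult_ac)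
    qed (simp add: f_def riesz_integrand_def weight_def)
  qed
  note int = riesz_integrand_integrable [OF \<beta> x, of _ m]
  show "integrable lborel f" unfolding f by (intro Bochner_Integration.integrable_sum integrable_mult_right int)
  have "(LINT y|lborel. f y) = (\<Sum>j\<le>n. of_real (?c j) * (LINT y|lborel. riesz_integrand \<beta> j m x y))"
    unfolding f using int by (simp add: Bochner_Integration.integral_sum)
  also have "\<dots> = of_real (pi / R ^ m * (\<Sum>j\<le>n. (?c j * poch_ratio \<beta> j) * abel_int \<beta> m R (\<lambda>\<tau>. (1 - \<tau>) ^ j))) * cpx x ^ m"
    unfolding riesz_integrand_integral [OF \<beta> x R_def] of_real_mult of_real_sum by (simp add: sum_distrib_left sum_distrib_right mult_ac)
  also have "(\<Sum>j\<le>n. (?c j * poch_ratio \<beta> j) * abel_int \<beta> m R (\<lambda>\<tau>. (1 - \<tau>) ^ j)) =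
      abel_int \<beta> m R (\<lambda>\<tau>. \<Sum>j\<le>n. (?c j * poch_ratio \<beta> j) * (1 - \<tau>) ^ j)"
    by (rule abel_int_sum [symmetric]) (use \<beta> R01 in \<open>auto intro!: continuous_intros\<close>)
  \<comment> \<open>The ratios of the first transform turn the coefficients into those for the
    parameters (0, m + \<beta> - 1). Reflection rewrites this polynomial in powers of \<tau>, as the
    second transform requires.\<close>
  also have "(\<lambda>\<tau>. \<Sum>j\<le>n. (?c j * poch_ratio \<beta> j) * (1 - \<tau>) ^ j) =
      (\<lambda>\<tau>. \<Sum>k\<le>n. (poch_ratio \<beta> n * (-1) ^ n * jac_coeff n (real m + (\<beta> - 1)) 0 k) * \<tau> ^ k)"
  proof
    fix \<tau> :: real
    have "(\<Sum>j\<le>n. (?c j * poch_ratio \<beta> j) * (1 - \<tau>) ^ j) = poch_ratio \<beta> n * sjac n 0 (real m + (\<beta> - 1)) \<tau>"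
      unfolding sjac_expand sum_distrib_left by (intro sum.cong refl) (simp add: jac_coeff_poch_left)
    also have "\<dots> = (\<Sum>k\<le>n. (poch_ratio \<beta> n * (-1) ^ n * jac_coeff n (real m + (\<beta> - 1)) 0 k) * \<tau> ^ k)"
      unfolding sjac_reflect [of n 0 "real m + (\<beta> - 1)" \<tau>] unfolding sjac_expand by (simp add: sum_distrib_left mult_ac)
    finally show "(\<Sum>j\<le>n. (?c j * poch_ratio \<beta> j) * (1 - \<tau>) ^ j) =
      (\<Sum>k\<le>n. (poch_ratio \<beta> n * (-1) ^ n * jac_coeff n (real m + (\<beta> - 1)) 0 k) * \<tau> ^ k)" .
  qed
  also have "abel_int \<beta> m R (\<lambda>\<tau>. \<Sum>k\<le>n. (poch_ratio \<beta> n * (-1) ^ n * jac_coeff n (real m + (\<beta> - 1)) 0 k) * \<tau> ^ k)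
     = (\<Sum>k\<le>n. (poch_ratio \<beta> n * (-1) ^ n * jac_coeff n (real m + (\<beta> - 1)) 0 k) * abel_int \<beta> m R (\<lambda>\<tau>. \<tau> ^ k))"
    by (rule abel_int_sum) (use \<beta> R01 in \<open>auto intro!: continuous_intros\<close>)
  also have "\<dots> = (\<Sum>k\<le>n. (?GG * poch_ratio \<beta> n * poch_ratio \<beta> (n + m) * R ^ m * (-1) ^ n) * (jac_coeff n m (\<beta> - 1) k * R ^ k))"
  proof (intro sum.cong refl)
    fix k assume "k \<in> {..n}"
    then have "jac_coeff n (real m + (\<beta> - 1)) 0 k * poch_ratio \<beta> (m + k) = poch_ratio \<beta> (n + m) * jac_coeff n m (\<beta> - 1) k"
      by (intro jac_coeff_poch_right) simp
    from arg_cong [OF this, of "\<lambda>y. ?GG * poch_ratio \<beta> n * R ^ m * (-1) ^ n * R ^ k * y"]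
    show "(poch_ratio \<beta> n * (-1) ^ n * jac_coeff n (real m + (\<beta> - 1)) 0 k) * abel_int \<beta> m R (\<lambda>\<tau>. \<tau> ^ k) =
       (?GG * poch_ratio \<beta> n * poch_ratio \<beta> (n + m) * R ^ m * (-1) ^ n) * (jac_coeff n m (\<beta> - 1) k * R ^ k)"
      unfolding abel_int_power [OF \<beta> R01(1)] power_add by (simp only: mult_ac)
  qed
  \<comment> \<open>The second set of ratios has led to the parameters (m, \<beta> - 1). Another
    reflection restores the original polynomial, and the signs of the two reflections
    cancel.\<close>
  also have "\<dots> = ?GG * poch_ratio \<beta> n * poch_ratio \<beta> (n + m) * R ^ m * sjac n (\<beta> - 1) m R"
    unfolding sjac_reflect [of n "\<beta> - 1" m R] sjac_expand [of n m] sum_distrib_left [symmetric] by simp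
  finally show "(LINT y|lborel. f y) = of_real (pi * ?GG * poch_ratio \<beta> n * poch_ratio \<beta> (n + m) * sjac n (\<beta> - 1) m ((norm x)\<^sup>2)) * cpx x ^ m"
    using R01 by (simp add: R_def [symmetric] mult_ac)
qed

section \<open>Orthogonality of the basis\<close>

lemma disk_borel [measurable]: "disk \<in> sets borel"
  by (simp add: disk_def)

lemma weight_measurable [measurable]: "weight \<gamma> \<in> borel_measurable borel"
  unfolding weight_def by measurable

lemma weight_nonneg: "weight \<gamma> x \<ge> 0"
  by (simp add: weight_def)

lemma weight_pos: "x \<in> disk \<Longrightarrow> weight \<gamma> x > 0"
proof -
  assume x: "x \<in> disk"
  then have "(norm x)\<^sup>2 < 1" by (simp add: disk_def abs_square_less_1)
  with x show ?thesis by (simp add: weight_def)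
qed

text \<open>The polar formulas are stated over \<open>lborel\<close>, the weighted spaces over
  \<open>lebesgue_on disk\<close>; this passes from one to the other.\<close>

lemma integrable_lebesgue_on_disk:
  fixes f :: "real^2 \<Rightarrow> 'b::euclidean_space"
  assumes "f \<in> borel_measurable borel" "\<And>x. x \<notin> disk \<Longrightarrow> f x = 0"
  shows "integrable (lebesgue_on disk) f \<longleftrightarrow> integrable lborel f"
    and "(LINT x|lebesgue_on disk. f x) = (LINT x|lborel. f x)"
proof -
  have eq: "indicat_real disk x *\<^sub>R f x = f x" for x using assms(2) by (auto split: split_indicator)
  have f: "f \<in> borel_measurable lborel" using assms(1) by simp
  show "integrable (lebesgue_on disk) f \<longleftrightarrow> integrable lborel f"
    by (subst integrable_restrict_space) (auto simp: eq integrable_completion [OF f])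
  show "(LINT x|lebesgue_on disk. f x) = (LINT x|lborel. f x)"
    by (subst integral_restrict_space) (auto simp: eq integral_completion [OF f])
qed

lemma weight_polar: "t > 0 \<Longrightarrow> weight \<gamma> (polar (t, \<theta>)) = indicator {0<..<1} t * (1 - t) powr \<gamma>"
  by (auto simp: weight_def disk_def polar_def norm_mult split: split_indicator)

lemma weight_integrable:
  assumes "\<gamma> > -1"
  shows "integrable lborel (weight \<gamma>)"
proof (rule integrableI_bounded)
  have "(\<integral>\<^sup>+x. ennreal (norm (weight \<gamma> x)) \<partial>lborel) =
     (\<integral>\<^sup>+t. \<integral>\<^sup>+\<theta>. ennreal (1 / 2) * indicator {0<..} t * indicator {-pi<..<pi} \<theta> * ennreal (norm (weight \<gamma> (polar (t, \<theta>)))) \<partial>lborel \<partial>lborel)"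
    by (rule nn_integral_polar) measurable
  also have "\<dots> = (\<integral>\<^sup>+t. ennreal (1 / 2) * ennreal (2 * pi) * (indicator {0<..<1} t * ennreal ((1 - t) powr (\<gamma> + 1 - 1) * (t - 0) powr (1 - 1))) \<partial>lborel)"
  proof (intro nn_integral_cong)
    fix t :: real
    show "(\<integral>\<^sup>+\<theta>. ennreal (1 / 2) * indicator {0<..} t * indicator {-pi<..<pi} \<theta> * ennreal (norm (weight \<gamma> (polar (t, \<theta>)))) \<partial>lborel) =
      ennreal (1 / 2) * ennreal (2 * pi) * (indicator {0<..<1} t * ennreal ((1 - t) powr (\<gamma> + 1 - 1) * (t - 0) powr (1 - 1)))"
    proof (cases "t > 0")
      case True
      then have "(\<integral>\<^sup>+\<theta>. ennreal (1 / 2) * indicator {0<..} t * indicator {-pi<..<pi} \<theta> * ennreal (norm (weight \<gamma> (polar (t, \<theta>)))) \<partial>lborel) =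
        (\<integral>\<^sup>+\<theta>. ennreal (1 / 2) * (indicator {0<..<1} t * ennreal ((1 - t) powr \<gamma>)) * indicator {-pi<..<pi} \<theta> \<partial>lborel)"
        by (intro nn_integral_cong) (auto simp: weight_polar split: split_indicator)
      also have "\<dots> = ennreal (1 / 2) * (indicator {0<..<1} t * ennreal ((1 - t) powr \<gamma>)) * ennreal (2 * pi)"
        by (subst nn_integral_cmult_indicator) auto
      finally show ?thesis using True by (simp add: mult_ac)
    qed simp
  qed
  also have "\<dots> = ennreal (1 / 2) * ennreal (2 * pi) * ennreal ((1 - 0) powr (\<gamma> + 1 + 1 - 1) * Beta (\<gamma> + 1) 1)"
    using assms by (subst nn_integral_cmult, (measurable; fail), subst nn_integral_Beta_reflect) auto
  also have "\<dots> < \<infinity>"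
    by (simp only: ennreal_mult_less_top ennreal_less_top infinity_ennreal_def) simp
  finally show "(\<integral>\<^sup>+x. ennreal (norm (weight \<gamma> x)) \<partial>lborel) < \<infinity>" .
qed measurable

text \<open>A continuous function is bounded on the closed disk, so the integrable weight
  dominates.\<close>

lemma weight_integrable_continuous:
  fixes \<phi> :: "real^2 \<Rightarrow> 'b::euclidean_space"
  assumes \<gamma>: "\<gamma> > -1" and \<phi>: "continuous_on UNIV \<phi>"
  shows "integrable lborel (\<lambda>x. weight \<gamma> x *\<^sub>R \<phi> x)"
proof -
  have "continuous_on (cball 0 1) \<phi>" using \<phi> by (rule continuous_on_subset) auto
  from compact_imp_bounded [OF compact_continuous_image [OF this compact_cball]]
  obtain C where C: "\<And>x. norm x \<le> 1 \<Longrightarrow> norm (\<phi> x) \<le> C"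
    unfolding bounded_iff by (metis image_eqI mem_cball_0)
  have m [measurable]: "\<phi> \<in> borel_measurable borel" using \<phi> by (rule borel_measurable_continuous_onI)
  show ?thesis
  proof (rule Bochner_Integration.integrable_bound)
    show "integrable lborel (\<lambda>x. C * weight \<gamma> x)" using weight_integrable [OF \<gamma>] by simp
    show "AE x in lborel. norm (weight \<gamma> x *\<^sub>R \<phi> x) \<le> norm (C * weight \<gamma> x)"
    proof (rule AE_I2)
      fix x :: "real^2"
      show "norm (weight \<gamma> x *\<^sub>R \<phi> x) \<le> norm (C * weight \<gamma> x)"
      proof (cases "x \<in> disk")
        case True
        then have "norm (\<phi> x) \<le> C" by (intro C) (auto simp: disk_def)
        then have "norm (\<phi> x) \<le> \<bar>C\<bar>" by simp
        then have "weight \<gamma> x * norm (\<phi> x) \<le> weight \<gamma> x * \<bar>C\<bar>" by (intro mult_left_mono weight_nonneg)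
        then show ?thesis by (simp add: abs_mult weight_nonneg mult.commute)
      qed (simp add: weight_def)
    qed
  qed measurable
qed

lemma weight_integral_polar:
  fixes \<phi> :: "real^2 \<Rightarrow> complex"
  assumes \<gamma>: "\<gamma> > -1" and \<phi>: "continuous_on UNIV \<phi>"
  shows "(LINT x|lborel. weight \<gamma> x *\<^sub>R \<phi> x) =
    (1 / 2) *\<^sub>R (LINT t:{0<..<1}|lborel. (1 - t) powr \<gamma> *\<^sub>R (LINT \<theta>:{-pi<..<pi}|lborel. \<phi> (polar (t, \<theta>))))"
  unfolding integral_polar [OF weight_integrable_continuous [OF assms]] set_lebesgue_integral_def
proof (intro arg_cong [where f = "\<lambda>I. (1 / 2) *\<^sub>R I"] Bochner_Integration.integral_cong refl)
  fix t :: real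
  show "indicator {0<..} t *\<^sub>R (LINT \<theta>|lborel. indicator {-pi<..<pi} \<theta> *\<^sub>R (weight \<gamma> (polar (t, \<theta>)) *\<^sub>R \<phi> (polar (t, \<theta>)))) =
     indicator {0<..<1} t *\<^sub>R (1 - t) powr \<gamma> *\<^sub>R (LINT \<theta>|lborel. indicator {-pi<..<pi} \<theta> *\<^sub>R \<phi> (polar (t, \<theta>)))"
  proof (cases "t > 0")
    case True
    have "indicator {-pi<..<pi} \<theta> *\<^sub>R (weight \<gamma> (polar (t, \<theta>)) *\<^sub>R \<phi> (polar (t, \<theta>))) =
       (indicator {0<..<1} t * (1 - t) powr \<gamma>) *\<^sub>R (indicator {-pi<..<pi} \<theta> *\<^sub>R \<phi> (polar (t, \<theta>)))" for \<theta>
      unfolding weight_polar [OF True] by simp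
    then have "(LINT \<theta>|lborel. indicator {-pi<..<pi} \<theta> *\<^sub>R (weight \<gamma> (polar (t, \<theta>)) *\<^sub>R \<phi> (polar (t, \<theta>)))) =
        (indicator {0<..<1} t * (1 - t) powr \<gamma>) *\<^sub>R (LINT \<theta>|lborel. indicator {-pi<..<pi} \<theta> *\<^sub>R \<phi> (polar (t, \<theta>)))"
      by (simp only: integral_scaleR_right)
    then show ?thesis using True by simp
  qed simp
qed

text \<open>Zernike functions in complex form, with a signed angular frequency a. Negative
  frequencies use powers of the conjugate, so that conjugation becomes a |-> -a.\<close>

definition zern :: "real \<Rightarrow> int \<Rightarrow> nat \<Rightarrow> real^2 \<Rightarrow> complex" where
  "zern \<gamma> a n x = (if a \<ge> 0 then cpx x ^ nat a else cnj (cpx x) ^ nat (- a)) * of_real (sjac n \<gamma> (real (nat \<bar>a\<bar>)) ((norm x)\<^sup>2))"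

lemma cnj_zern: "cnj (zern \<gamma> a n x) = zern \<gamma> (- a) n x"
  by (auto simp: zern_def)

lemma continuous_on_cpx_id [continuous_intros]: "continuous_on S (\<lambda>x. cpx x)"
  by (intro continuous_intros)

lemma continuous_on_zern [continuous_intros]: "continuous_on S (zern \<gamma> a n)"
  unfolding zern_def by (cases "a \<ge> 0") (auto intro!: continuous_intros)

lemma zern_polar:
  assumes "t > 0"
  shows "zern \<gamma> a n (polar (t, \<theta>)) = of_real (sqrt t ^ nat \<bar>a\<bar> * sjac n \<gamma> (real (nat \<bar>a\<bar>)) t) * cis (of_int a * \<theta>)"
proof -
  have n: "(norm (polar (t, \<theta>)))\<^sup>2 = t" using assms by (simp add: polar_def norm_mult)
  have c: "cpx (polar (t, \<theta>)) = of_real (sqrt t) * cis \<theta>" by (simp add: polar_def)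
  show ?thesis
    unfolding zern_def n c
    by (auto simp: power_mult_distrib Complex.DeMoivre cis_cnj)
qed

text \<open>The angle selects equal frequencies, and the radial integral is then Jacobi
  orthogonality with second parameter |a|. The factor pi is 2 pi from the angle times the Jacobian
  1/2.\<close>

lemma zern_inner:
  assumes \<gamma>: "\<gamma> > -1"
  shows "(LINT x|lborel. weight \<gamma> x *\<^sub>R (zern \<gamma> a n x * cnj (zern \<gamma> b k x))) =
     (if a = b \<and> n = k then of_real (pi * jac_norm n \<gamma> (nat \<bar>a\<bar>)) else 0)"
proof -
  let ?A = "nat \<bar>a\<bar>" and ?B = "nat \<bar>b\<bar>"
  let ?p = "\<lambda>t. sqrt t ^ ?A * sjac n \<gamma> ?A t * (sqrt t ^ ?B * sjac k \<gamma> ?B t)"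
  have "(LINT x|lborel. weight \<gamma> x *\<^sub>R (zern \<gamma> a n x * cnj (zern \<gamma> b k x))) =
    (1 / 2) *\<^sub>R (LINT t:{0<..<1}|lborel. (1 - t) powr \<gamma> *\<^sub>R (LINT \<theta>:{-pi<..<pi}|lborel. zern \<gamma> a n (polar (t, \<theta>)) * cnj (zern \<gamma> b k (polar (t, \<theta>)))))"
    by (intro weight_integral_polar \<gamma> continuous_intros)
  also have "(LINT t:{0<..<1}|lborel. (1 - t) powr \<gamma> *\<^sub>R (LINT \<theta>:{-pi<..<pi}|lborel. zern \<gamma> a n (polar (t, \<theta>)) * cnj (zern \<gamma> b k (polar (t, \<theta>))))) =
     (LINT t:{0<..<1}|lborel. (if a = b then of_real (2 * pi) * of_real ((1 - t) powr \<gamma> * ?p t) else (0::complex)))"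
  proof (intro set_lebesgue_integral_cong ballI allI impI)
    fix t :: real assume "t \<in> {0<..<1}"
    then have t: "t > 0" by simp
    have "(LINT \<theta>:{-pi<..<pi}|lborel. zern \<gamma> a n (polar (t, \<theta>)) * cnj (zern \<gamma> b k (polar (t, \<theta>)))) =
       (LINT \<theta>:{-pi<..<pi}|lborel. of_real (?p t) * cis (of_int (a - b) * \<theta>))"
    proof (intro set_lebesgue_integral_cong ballI allI impI)
      fix \<theta> :: real
      have arg: "of_int (a - b) * \<theta> = of_int a * \<theta> + of_int (- b) * \<theta>" by (simp add: algebra_simps)
      show "zern \<gamma> a n (polar (t, \<theta>)) * cnj (zern \<gamma> b k (polar (t, \<theta>))) = of_real (?p t) * cis (of_int (a - b) * \<theta>)"
        unfolding cnj_zern zern_polar [OF t] arg cis_mult [symmetric] by (simp add: cis_cnj)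
    qed auto
    also have "\<dots> = of_real (?p t) * (if a = b then of_real (2 * pi) else 0)"
      by (subst set_integral_mult_right, subst integral_cis) auto
    finally show "(1 - t) powr \<gamma> *\<^sub>R (LINT \<theta>:{-pi<..<pi}|lborel. zern \<gamma> a n (polar (t, \<theta>)) * cnj (zern \<gamma> b k (polar (t, \<theta>)))) =
       (if a = b then of_real (2 * pi) * of_real ((1 - t) powr \<gamma> * ?p t) else 0)"
      by (auto simp: scaleR_conv_of_real)
  qed auto
  also have "\<dots> = (if a = b \<and> n = k then of_real (2 * pi * jac_norm n \<gamma> ?A) else 0)"
  proof (cases "a = b")
    case True
    have "(LINT t:{0<..<1}|lborel. of_real (2 * pi) * of_real ((1 - t) powr \<gamma> * ?p t) :: complex) =
       of_real (2 * pi) * of_real (LINT t:{0<..<1}|lborel. (1 - t) powr \<gamma> * ?p t)"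
      unfolding set_lebesgue_integral_def integral_complex_of_real [symmetric] integral_mult_right_zero [symmetric]
      by (intro Bochner_Integration.integral_cong refl) (simp add: scaleR_conv_of_real)
    also have "(LINT t:{0<..<1}|lborel. (1 - t) powr \<gamma> * ?p t) = jac_int \<gamma> ?A (\<lambda>t. sjac n \<gamma> ?A t * sjac k \<gamma> ?A t)"
      unfolding jac_int_def
    proof (intro set_lebesgue_integral_cong ballI allI impI)
      fix t :: real assume "t \<in> {0<..<1}"
      then have e: "sqrt t ^ ?A * sqrt t ^ ?A = t ^ ?A" by (simp flip: power_mult_distrib)
      show "(1 - t) powr \<gamma> * ?p t = t ^ ?A * (1 - t) powr \<gamma> * (sjac n \<gamma> ?A t * sjac k \<gamma> ?A t)"
        unfolding True [symmetric] e [symmetric] by (simp only: mult_ac)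
    qed auto
    also have "\<dots> = (if n = k then jac_norm n \<gamma> ?A else 0)" by (rule jac_int_orthogonal [OF \<gamma>])
    finally show ?thesis using True by auto
  qed simp
  finally show ?thesis by (auto simp: scaleR_conv_of_real)
qed

lemma L2_iff_continuous:
  fixes f :: "real^2 \<Rightarrow> 'b::euclidean_space"
  assumes "\<gamma> > -1" "continuous_on UNIV f"
  shows "f \<in> L2 \<gamma>"
proof -
  have [measurable]: "f \<in> borel_measurable borel" using assms(2) by (rule borel_measurable_continuous_onI)
  have "integrable lborel (\<lambda>x. weight \<gamma> x *\<^sub>R (f x \<bullet> f x))"
    using assms by (intro weight_integrable_continuous continuous_intros)
  then have "integrable (lebesgue_on disk) (\<lambda>x. weight \<gamma> x * (f x \<bullet> f x))"
    by (subst integrable_lebesgue_on_disk) (auto simp: weight_def)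
  moreover have "f \<in> borel_measurable (lebesgue_on disk)"
    by (intro measurable_restrict_space1 measurable_completion) simp
  ultimately show ?thesis by (simp add: L2_def)
qed

lemma L2_inner_continuous:
  fixes f g :: "real^2 \<Rightarrow> 'b::euclidean_space"
  assumes "continuous_on UNIV f" "continuous_on UNIV g"
  shows "L2_inner \<gamma> f g = (LINT x|lborel. weight \<gamma> x * (f x \<bullet> g x))"
proof -
  have [measurable]: "f \<in> borel_measurable borel" "g \<in> borel_measurable borel"
    using assms by (auto intro: borel_measurable_continuous_onI)
  show ?thesis
    unfolding L2_inner_def by (rule integrable_lebesgue_on_disk) (auto simp: weight_def)
qed

lemma weight_integral_Re:
  assumes \<gamma>: "\<gamma> > -1" and \<phi>: "continuous_on UNIV \<phi>"
  shows "(LINT x|lborel. weight \<gamma> x * Re (\<phi> x)) = Re (LINT x|lborel. weight \<gamma> x *\<^sub>R \<phi> x)"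
  using weight_integrable_continuous [OF assms] by (simp flip: integral_Re)

text \<open>
  For \<open>\<mu> = -1\<close>, the harmonic is the imaginary part of \<open>z\<^sup>l\<close>, i.e. the real part of \<open>- i z\<^sup>l\<close>.
\<close>

definition hcoeff :: "nat \<Rightarrow> int \<Rightarrow> complex" where
  "hcoeff l \<mu> = (if l = 0 then 1 / 2 else if \<mu> = 1 then 1 else - \<i>)"

lemma harmonic_eq: "harmonic l \<mu> x = Re (hcoeff l \<mu> * cpx x ^ l)"
proof (cases "l = 0")
  case False
  have "cpx x = rcis (norm x) (polar_angle x)"
    using rcis_cmod_Arg [of "cpx x"] by (simp add: polar_angle_def cpx_def [symmetric])
  then have "cpx x ^ l = rcis (norm x ^ l) (real l * polar_angle x)" by (simp add: DeMoivre2)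
  then show ?thesis using False by (simp add: harmonic_def hcoeff_def rcis_def)
qed (simp add: harmonic_def hcoeff_def)

lemma basis_eq: "basis \<gamma> (l, n, \<mu>) x = Re (hcoeff l \<mu> * zern \<gamma> (int l) n x)"
  by (simp add: basis_def harmonic_eq zern_def sjac_def mult.assoc [symmetric])

lemma continuous_on_basis [continuous_intros]: "continuous_on S (basis \<gamma> i)"
  unfolding basis_eq [abs_def] by (cases i) (auto simp: basis_eq [abs_def] intro!: continuous_intros)

text \<open>The closed form of the squared norm, see \<open>basis_inner\<close>. Taking the real
  part halves it for l > 0; for l = 0 both halves survive, and \<open>hcoeff\<close> contributes
  1/4.\<close>

definition basis_norm2 :: "real \<Rightarrow> index \<Rightarrow> real" where
  "basis_norm2 \<gamma> = (\<lambda>(l, n, \<mu>). (if l = 0 then 1 / 4 else 1 / 2) * (pi * jac_norm n \<gamma> l))"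

lemma basis_norm2_pos: "\<gamma> > -1 \<Longrightarrow> basis_norm2 \<gamma> i > 0"
  by (cases i) (auto simp: basis_norm2_def jac_norm_pos)

text \<open>Re z Re w is the real part of (z cnj w + z w) / 2. The second product has total
  frequency l + l' and matters only for l = l' = 0; for equal l > 0 and different \<mu> the first
  one has an imaginary coefficient.\<close>

lemma basis_inner:
  assumes \<gamma>: "\<gamma> > -1" and i: "i \<in> indices" "j \<in> indices"
  shows "L2_inner \<gamma> (basis \<gamma> i) (basis \<gamma> j) = (if i = j then basis_norm2 \<gamma> i else 0)"
proof -
  obtain l n \<mu> where i_eq: "i = (l, n, \<mu>)" by (cases i)
  obtain l' n' \<mu>' where j_eq: "j = (l', n', \<mu>')" by (cases j)
  let ?h = "hcoeff l \<mu>" and ?h' = "hcoeff l' \<mu>'"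
  let ?F = "\<lambda>x. ?h * cnj ?h' * (zern \<gamma> (int l) n x * cnj (zern \<gamma> (int l') n' x))"
  let ?G = "\<lambda>x. ?h * ?h' * (zern \<gamma> (int l) n x * cnj (zern \<gamma> (- int l') n' x))"
  have cF: "continuous_on UNIV ?F" and cG: "continuous_on UNIV ?G" by (intro continuous_intros)+
  have prod: "basis \<gamma> i x * basis \<gamma> j x = Re ((1 / 2) * (?F x + ?G x))" for x
  proof -
    have "Re z * Re w = Re ((1 / 2) * (z * cnj w + z * w))" for z w by simp
    from this [of "?h * zern \<gamma> (int l) n x" "?h' * zern \<gamma> (int l') n' x"] show ?thesis
      by (simp add: i_eq j_eq basis_eq cnj_zern mult_ac)
  qed
  have "L2_inner \<gamma> (basis \<gamma> i) (basis \<gamma> j) = (LINT x|lborel. weight \<gamma> x * Re ((1 / 2) * (?F x + ?G x)))"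
    by (simp only: L2_inner_continuous [OF continuous_on_basis continuous_on_basis] inner_real_def prod)
  also have "\<dots> = Re (LINT x|lborel. weight \<gamma> x *\<^sub>R ((1 / 2) * (?F x + ?G x)))"
    by (intro weight_integral_Re \<gamma> continuous_intros cF cG)
  also have "(LINT x|lborel. weight \<gamma> x *\<^sub>R ((1 / 2) * (?F x + ?G x))) =
      (1 / 2) * ((LINT x|lborel. weight \<gamma> x *\<^sub>R ?F x) + (LINT x|lborel. weight \<gamma> x *\<^sub>R ?G x))"
  proof -
    have eq: "weight \<gamma> x *\<^sub>R ((1 / 2) * (?F x + ?G x)) = (1 / 2) * (weight \<gamma> x *\<^sub>R ?F x + weight \<gamma> x *\<^sub>R ?G x)" for x
      unfolding scaleR_conv_of_real by (simp only: algebra_simps)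
    show ?thesis
      unfolding eq integral_mult_right_zero
      by (simp only: Bochner_Integration.integral_add [OF weight_integrable_continuous [OF \<gamma> cF] weight_integrable_continuous [OF \<gamma> cG]])
  qed
  also have "(LINT x|lborel. weight \<gamma> x *\<^sub>R ?F x) = ?h * cnj ?h' * (if int l = int l' \<and> n = n' then of_real (pi * jac_norm n \<gamma> l) else 0)"
    unfolding mult_scaleR_right [of "?h * cnj ?h'", symmetric] integral_mult_right_zero
    using zern_inner [OF \<gamma>, of "int l" n "int l'" n'] by simp
  also have "(LINT x|lborel. weight \<gamma> x *\<^sub>R ?G x) = ?h * ?h' * (if int l = - int l' \<and> n = n' then of_real (pi * jac_norm n \<gamma> l) else 0)"
    unfolding mult_scaleR_right [of "?h * ?h'", symmetric] integral_mult_right_zero zern_inner [OF \<gamma>] abs_of_nat nat_int ..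
  also have "Re ((1 / 2) * (?h * cnj ?h' * (if int l = int l' \<and> n = n' then of_real (pi * jac_norm n \<gamma> l) else 0) +
      ?h * ?h' * (if int l = - int l' \<and> n = n' then of_real (pi * jac_norm n \<gamma> l) else 0))) = (if i = j then basis_norm2 \<gamma> i else 0)"
    using i by (auto simp: i_eq j_eq indices_def hcoeff_def basis_norm2_def)
  finally show ?thesis .
qed

section \<open>Gradients of the weighted basis functions and their potentials\<close>

lemma GDERIV_unique:
  assumes "GDERIV f x :> D" "GDERIV f x :> D'"
  shows "D = D'"
proof -
  have "(\<lambda>h. h \<bullet> D) = (\<lambda>h. h \<bullet> D')"
    using assms unfolding gderiv_def by (rule has_derivative_unique)
  from fun_cong [OF this, of "D - D'"] have "(D - D') \<bullet> (D - D') = 0" by (simp add: inner_diff_right)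
  then show ?thesis by simp
qed

lemma gradient_eqI: "GDERIV f x :> D \<Longrightarrow> gradient f x = D"
  unfolding gradient_def by (rule the_equality) (auto intro: GDERIV_unique)

text \<open>In complex notation the gradient is twice the derivative with respect to the conjugate
  variable: a radial factor g contributes 2 g' z, and the real part of a holomorphic F contributes
  the conjugate of F'.\<close>

lemma GDERIV_Re_power:
  assumes g: "(g has_real_derivative g') (at ((norm x)\<^sup>2))"
  shows "GDERIV (\<lambda>y. g ((norm y)\<^sup>2) * Re (c * cpx y ^ l)) x :>
     vec_of (of_real (2 * g' * Re (c * cpx x ^ l)) * cpx x + of_real (g ((norm x)\<^sup>2)) * cnj (c * of_nat l * cpx x ^ (l - 1)))"
proof -
  have n: "((\<lambda>y. (norm y)\<^sup>2) has_derivative (\<lambda>h. 2 * (x \<bullet> h))) (at x)"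
    unfolding power2_norm_eq_inner by (auto intro!: derivative_eq_intros simp: inner_commute)
  have 1: "((\<lambda>y. g ((norm y)\<^sup>2)) has_derivative (\<lambda>h. g' * (2 * (x \<bullet> h)))) (at x)"
    using has_derivative_compose [OF n, of g "\<lambda>h. g' * h"] g
    by (simp add: has_field_derivative_def)
  have z: "(cpx has_derivative cpx) (at x)"
    by (rule bounded_linear.has_derivative [OF bounded_linear_cpx has_derivative_ident])
  have "((\<lambda>y. c * cpx y ^ l) has_derivative (\<lambda>h. c * of_nat l * cpx x ^ (l - 1) * cpx h)) (at x)"
    by (rule has_derivative_eq_rhs, rule derivative_eq_intros z refl)+ (auto simp: fun_eq_iff)
  from bounded_linear.has_derivative [OF bounded_linear_Re this]
  have 2: "((\<lambda>y. Re (c * cpx y ^ l)) has_derivative (\<lambda>h. Re (c * of_nat l * cpx x ^ (l - 1) * cpx h))) (at x)" .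
  have inner: "h \<bullet> vec_of w = Re (cpx h * cnj w)" for h w
    using inner_vec_of [of "cpx h" w] by simp
  show ?thesis
    unfolding gderiv_def
  proof (rule has_derivative_eq_rhs [OF has_derivative_mult [OF 1 2]], rule ext)
    fix h
    have "x \<bullet> h = Re (cpx h * cnj (cpx x))" using inner [of h "cpx x"] by (simp add: inner_commute)
    then show "g ((norm x)\<^sup>2) * Re (c * of_nat l * cpx x ^ (l - 1) * cpx h) + g' * (2 * (x \<bullet> h)) * Re (c * cpx x ^ l) =
      h \<bullet> vec_of (of_real (2 * g' * Re (c * cpx x ^ l)) * cpx x + of_real (g ((norm x)\<^sup>2)) * cnj (c * of_nat l * cpx x ^ (l - 1)))"
      unfolding inner by (simp add: algebra_simps)
  qed
qed

text \<open>
  The two summands of the gradient; for \<open>l = 0\<close> they coincide.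
\<close>

definition field_hol :: "real \<Rightarrow> index \<Rightarrow> real^2 \<Rightarrow> complex" where
  "field_hol \<beta> = (\<lambda>(l, n, \<mu>) x. - of_real (real n + \<beta>) * hcoeff l \<mu> * zern (\<beta> - 1) (int l + 1) n x)"

definition field_anti :: "real \<Rightarrow> index \<Rightarrow> real^2 \<Rightarrow> complex" where
  "field_anti \<beta> = (\<lambda>(l, n, \<mu>) x. if l = 0 then field_hol \<beta> (l, n, \<mu>) x
     else - of_real (real n + 1) * cnj (hcoeff l \<mu>) * zern (\<beta> - 1) (1 - int l) (n + 1) x)"

lemma continuous_on_field [continuous_intros]:
  "continuous_on S (field_hol \<beta> i)" "continuous_on S (field_anti \<beta> i)"
proof -
  obtain l n \<mu> where i: "i = (l, n, \<mu>)" by (cases i)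
  show "continuous_on S (field_hol \<beta> i)"
    unfolding i field_hol_def by (auto intro!: continuous_intros)
  show "continuous_on S (field_anti \<beta> i)"
    unfolding i field_anti_def field_hol_def by (cases "l = 0") (auto intro!: continuous_intros)
qed

text \<open>With F = c z^l, the radial derivative produces 2 Re F = F + cnj F. The part F z has
  frequency l + 1 and is identified by \<open>sjac_shift_up\<close>. The part cnj F z loses a power
  through z cnj z = t and joins the derivative of the harmonic; \<open>sjac_raise\<close> identifies
  their sum, in degree n + 1 and frequency 1 - l.\<close>

lemma grad_wbasis_eq:
  "grad_wbasis \<beta> i x = weight (\<beta> - 1) x *\<^sub>R vec_of (field_hol \<beta> i x + field_anti \<beta> i x)"
proof (cases "x \<in> disk")
  case True
  obtain l n \<mu> where i: "i = (l, n, \<mu>)" by (cases i)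
  define t where "t = (norm x)\<^sup>2"
  have t: "t < 1" using True by (simp add: t_def disk_def abs_square_less_1)
  define w where "w = (1 - t) powr (\<beta> - 1)"
  define p where "p = sjac n \<beta> l"
  define p' where "p' = sjac' n \<beta> l"
  define g where "g s = (1 - s) powr \<beta> * p s" for s
  define g' where "g' = w * ((1 - t) * p' t - \<beta> * p t)"
  let ?z = "cpx x" and ?c = "hcoeff l \<mu>"
  have pw: "(1 - t) powr \<beta> = w * (1 - t)"
    using t powr_add [of "1 - t" "\<beta> - 1" 1] by (simp add: w_def)
  have "((\<lambda>s. (1 - s) powr \<beta>) has_real_derivative - (\<beta> * w)) (at t)"
    using t by (auto intro!: derivative_eq_intros simp: w_def)
  from DERIV_mult [OF this sjac_deriv [of n \<beta> l t]]
  have g: "(g has_real_derivative g') (at ((norm x)\<^sup>2))"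
    unfolding g_def [abs_def] p_def [symmetric] p'_def [symmetric] t_def [symmetric] g'_def pw
    by (rule DERIV_cong) (simp add: algebra_simps)
  have g'_eq: "g' = - (real n + \<beta>) * (w * sjac n (\<beta> - 1) (real l + 1) t)"
    unfolding g'_def p_def p'_def sjac_shift_up by simp
  have "GDERIV (\<lambda>y. g ((norm y)\<^sup>2) * Re (?c * cpx y ^ l)) x :>
     vec_of (of_real (2 * g' * Re (?c * ?z ^ l)) * ?z + of_real (g t) * cnj (?c * of_nat l * ?z ^ (l - 1)))"
    using GDERIV_Re_power [OF g] by (simp add: t_def)
  then have "GDERIV (\<lambda>y. weight \<beta> y * basis \<beta> i y) x :>
     vec_of (of_real (2 * g' * Re (?c * ?z ^ l)) * ?z + of_real (g t) * cnj (?c * of_nat l * ?z ^ (l - 1)))"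
    unfolding gderiv_def
  proof (rule has_derivative_transform_within_open)
    show "open disk" by (simp add: disk_def)
    show "g ((norm y)\<^sup>2) * Re (?c * cpx y ^ l) = weight \<beta> y * basis \<beta> i y" if "y \<in> disk" for y
      using that by (simp add: g_def p_def weight_def i basis_eq zern_def mult.assoc [symmetric])
  qed (use True in auto)
  then have grad: "grad_wbasis \<beta> i x = vec_of (of_real (2 * g' * Re (?c * ?z ^ l)) * ?z + of_real (g t) * cnj (?c * of_nat l * ?z ^ (l - 1)))"
    using True by (simp add: grad_wbasis_def gradient_eqI)
  have w: "weight (\<beta> - 1) x = w" using True by (simp add: weight_def w_def t_def)
  have hol: "field_hol \<beta> i x * of_real w = ?c * of_real g' * ?z ^ Suc l"
    unfolding g'_eq by (simp add: i field_hol_def zern_def t_def nat_add_distrib add.commute)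
  have re2: "of_real (2 * g' * Re (?c * ?z ^ l)) * ?z = ?c * of_real g' * ?z ^ Suc l + of_real g' * cnj (?c * ?z ^ l) * ?z"
  proof -
    have "of_real (2 * g' * Re (?c * ?z ^ l)) = of_real g' * (?c * ?z ^ l + cnj (?c * ?z ^ l))"
      unfolding complex_add_cnj by simp
    then show ?thesis by (simp only: distrib_left distrib_right power_Suc mult_ac)
  qed
  have zz: "cnj ?z * ?z = of_real t" using complex_norm_square [of ?z] by (simp add: t_def mult.commute)
  have "of_real (2 * g' * Re (?c * ?z ^ l)) * ?z + of_real (g t) * cnj (?c * of_nat l * ?z ^ (l - 1)) =
     of_real w * (field_hol \<beta> i x + field_anti \<beta> i x)"
  proof (cases "l = 0")
    \<comment> \<open>Here the harmonic is constant and c is real, so the two halves of 2 Re F agree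
      and nothing is added to them.\<close>
    case l: True
    then show ?thesis
      using hol unfolding re2 by (simp add: i field_anti_def hcoeff_def algebra_simps)
  next
    case False
    then obtain m where l: "l = Suc m" by (cases l) auto
    have "of_real g' * cnj (?c * ?z ^ l) * ?z + of_real (g t) * cnj (?c * of_nat l * ?z ^ (l - 1)) =
       of_real g' * cnj (?c * ?z ^ m) * (cnj ?z * ?z) + of_real (g t) * (of_nat l * cnj (?c * ?z ^ m))"
      by (simp add: l)
    also have "\<dots> = of_real (t * g' + real l * g t) * cnj (?c * ?z ^ m)"
      unfolding zz by (simp add: algebra_simps)
    also have "t * g' + real l * g t = w * (t * (1 - t) * p' t + (real l * (1 - t) - \<beta> * t) * p t)"
      unfolding g'_def g_def pw by (simp add: algebra_simps)
    also have "\<dots> = - (real n + 1) * (w * sjac (Suc n) (\<beta> - 1) (real l - 1) t)"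
      unfolding p_def p'_def sjac_raise by simp
    also have "of_real (- (real n + 1) * (w * sjac (Suc n) (\<beta> - 1) (real l - 1) t)) * cnj (?c * ?z ^ m) = of_real w * field_anti \<beta> i x"
    proof -
      have "zern (\<beta> - 1) (1 - int l) (n + 1) x = cnj ?z ^ m * of_real (sjac (Suc n) (\<beta> - 1) (real l - 1) t)"
        by (cases "m = 0") (auto simp: zern_def l t_def)
      then show ?thesis by (simp add: i field_anti_def l mult_ac)
    qed
    finally show ?thesis unfolding re2 using hol by (simp add: algebra_simps)
  qed
  then show ?thesis
    unfolding grad w by (simp add: vec_of_simps scaleR_conv_of_real [symmetric])
qed (simp add: grad_wbasis_def weight_def vec_of_simps)

section \<open>Potentials of the two fields\<close>

lemma lborel_integral_reflect:
  fixes f :: "'a::euclidean_space \<Rightarrow> 'b::euclidean_space"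
  assumes [measurable]: "f \<in> borel_measurable borel"
  shows "(LINT y|lborel. f (x - y)) = (LINT y|lborel. f y)"
proof -
  have "lborel = distr lborel borel (\<lambda>y. x - y)"
    using lborel_affine [of "-1" x] by (simp add: density_1)
  then have "(LINT y|lborel. f y) = (LINT y|distr lborel borel (\<lambda>y. x - y). f y)" by simp
  also have "\<dots> = (LINT y|lborel. f (x - y))" by (rule integral_distr) measurable
  finally show ?thesis by simp
qed

lemma vec_of_of_real: "vec_of (of_real r * w) = r *\<^sub>R vec_of w"
  by (simp add: vec_eq_iff forall_2)

text \<open>The substitution of x - y for y puts the singularity into the kernel, and taking
  components commutes with the integral of a complex function as a bounded linear map.\<close>

lemma riesz_potential_vec_eq:
  fixes H :: "real^2 \<Rightarrow> complex"
  assumes [measurable]: "H \<in> borel_measurable borel"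
    and int: "integrable lborel (\<lambda>y. of_real (norm (x - y) powr (- \<alpha>)) * H y)"
  shows "riesz_potential_vec (2 - \<alpha>) (\<lambda>y. vec_of (H y)) x =
    vec_of (of_real (1 / (2 powr (2 - \<alpha>) * pi * Gamma ((2 - \<alpha>) / 2) / Gamma (\<alpha> / 2))) *
      (LINT y|lborel. of_real (norm (x - y) powr (- \<alpha>)) * H y))"
proof -
  let ?C = "1 / (2 powr (2 - \<alpha>) * pi * Gamma ((2 - \<alpha>) / 2) / Gamma (\<alpha> / 2))"
  let ?J = "LINT y|lborel. of_real (norm (x - y) powr (- \<alpha>)) * H y"
  have main: "riesz_potential (2 - \<alpha>) (\<lambda>y. vec_of (H y) $ k) x = ?C * vec_of ?J $ k" for k :: 2
  proof -
    have nth: "(\<lambda>v::real^2. v $ k) \<in> borel_measurable borel"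
      by (intro borel_measurable_continuous_onI continuous_intros)
    have [measurable]: "(\<lambda>y. vec_of (H y) $ k) \<in> borel_measurable borel"
      by (rule measurable_compose [OF _ nth]) measurable
    have "(LINT y|lebesgue. vec_of (H (x - y)) $ k / norm y powr \<alpha>) = (LINT y|lborel. vec_of (H (x - y)) $ k / norm y powr \<alpha>)"
      by (intro integral_completion) measurable
    also have "\<dots> = (LINT y|lborel. (\<lambda>y. vec_of (H y) $ k / norm (x - y) powr \<alpha>) (x - y))"
      by simp
    also have "\<dots> = (LINT y|lborel. vec_of (H y) $ k / norm (x - y) powr \<alpha>)"
      by (rule lborel_integral_reflect) measurable
    also have "\<dots> = (LINT y|lborel. vec_of (of_real (norm (x - y) powr (- \<alpha>)) * H y) $ k)"
      by (intro Bochner_Integration.integral_cong refl, simp only: vec_of_of_real)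
         (simp add: powr_minus divide_inverse mult.commute)
    also have "\<dots> = vec_of ?J $ k"
      using integral_bounded_linear [OF bounded_linear_compose [OF bounded_linear_vec_nth bounded_linear_vec_of] int, of k]
      by (simp add: o_def)
    finally show ?thesis by (simp add: riesz_potential_def)
  qed
  show ?thesis
    unfolding riesz_potential_vec_def main vec_of_of_real by (simp add: vec_eq_iff)
qed

text \<open>The normalisation of the potential times pi Gamma \<beta> Gamma (1 - \<beta>) and the
  ratios from \<open>riesz_jacobi\<close>; pi and Gamma (1 - \<beta>) cancel.\<close>

definition riesz_mult :: "real \<Rightarrow> nat \<Rightarrow> nat \<Rightarrow> real" where
  "riesz_mult \<beta> n m = 2 powr (2 * \<beta> - 2) * (Gamma \<beta>)\<^sup>2 * (poch_ratio \<beta> n * poch_ratio \<beta> (n + m))"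

text \<open>Nonnegative frequencies are \<open>riesz_jacobi\<close>. Negative ones follow by
  conjugation, because weight, kernel and radial polynomial are real.\<close>

lemma zern_riesz:
  fixes a :: int and n :: nat
  assumes \<beta>: "0 < \<beta>" "\<beta> < 1" and x: "x \<in> disk" "x \<noteq> 0"
  defines "f \<equiv> \<lambda>y. of_real (norm (x - y) powr (- 2 * \<beta>)) * (of_real (weight (\<beta> - 1) y) * zern (\<beta> - 1) a n y)"
  shows "integrable lborel f"
    and "of_real (1 / (2 powr (2 - 2 * \<beta>) * pi * Gamma ((2 - 2 * \<beta>) / 2) / Gamma (2 * \<beta> / 2))) * (LINT y|lborel. f y)
       = of_real (riesz_mult \<beta> n (nat \<bar>a\<bar>)) * zern (\<beta> - 1) a n x"
proof -
  let ?m = "nat \<bar>a\<bar>"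
  let ?C = "1 / (2 powr (2 - 2 * \<beta>) * pi * Gamma ((2 - 2 * \<beta>) / 2) / Gamma (2 * \<beta> / 2))"
  define h where "h y = of_real (weight (\<beta> - 1) y * sjac n (\<beta> - 1) ?m ((norm y)\<^sup>2) * norm (x - y) powr (- 2 * \<beta>)) * cpx y ^ ?m" for y
  have int: "integrable lborel h"
    unfolding h_def using riesz_jacobi(1) [OF \<beta> x] .
  have G: "Gamma \<beta> > 0" "Gamma (1 - \<beta>) > 0" using \<beta> by (auto simp: Gamma_real_pos)
  have two: "2 powr (2 - 2 * \<beta>) * 2 powr (2 * \<beta> - 2) = (1::real)" by (simp flip: powr_add)
  have args: "(2 - 2 * \<beta>) / 2 = 1 - \<beta>" "2 * \<beta> / 2 = \<beta>" by auto
  have "?C * (pi * (Gamma \<beta> * Gamma (1 - \<beta>)) * P) = 2 powr (2 * \<beta> - 2) * (Gamma \<beta>)\<^sup>2 * P" for P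
  proof -
    have "?C = Gamma \<beta> / (2 powr (2 - 2 * \<beta>) * pi * Gamma (1 - \<beta>))" unfolding args by simp
    also have "\<dots> * (pi * (Gamma \<beta> * Gamma (1 - \<beta>)) * P) = (1 / 2 powr (2 - 2 * \<beta>)) * (Gamma \<beta>)\<^sup>2 * P"
      using G by (simp add: power2_eq_square)
    also have "1 / 2 powr (2 - 2 * \<beta>) = 2 powr (2 * \<beta> - 2)" using two by (simp add: field_simps)
    finally show ?thesis .
  qed
  from this [of "poch_ratio \<beta> n * poch_ratio \<beta> (n + ?m)"]
  have val: "of_real ?C * (LINT y|lborel. h y) = of_real (riesz_mult \<beta> n ?m * sjac n (\<beta> - 1) ?m ((norm x)\<^sup>2)) * cpx x ^ ?m"
    unfolding h_def riesz_jacobi(2) [OF \<beta> x] riesz_mult_def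
    by (simp only: mult.assoc [symmetric] of_real_mult [symmetric])
  have "integrable lborel f \<and> of_real ?C * (LINT y|lborel. f y) = of_real (riesz_mult \<beta> n ?m) * zern (\<beta> - 1) a n x"
  proof (cases "a \<ge> 0")
    case True
    then have "f = h" by (auto simp: f_def h_def zern_def mult_ac)
    with int val True show ?thesis by (simp add: zern_def mult_ac)
  next
    case False
    then have f: "f = (\<lambda>y. cnj (h y))" by (auto simp: f_def h_def zern_def mult_ac)
    have "of_real ?C * (LINT y|lborel. f y) = cnj (of_real ?C * (LINT y|lborel. h y))"
      unfolding f integral_cnj by simp
    also have "\<dots> = of_real (riesz_mult \<beta> n ?m) * zern (\<beta> - 1) a n x"
      unfolding val using False by (simp add: zern_def mult_ac)
    finally show ?thesis using int by (simp add: f)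
  qed
  then show "integrable lborel f" "of_real ?C * (LINT y|lborel. f y) = of_real (riesz_mult \<beta> n ?m) * zern (\<beta> - 1) a n x"
    by auto
qed

definition mult_hol :: "real \<Rightarrow> index \<Rightarrow> real" where
  "mult_hol \<beta> = (\<lambda>(l, n, \<mu>). riesz_mult \<beta> n (l + 1))"

text \<open>\<open>field_anti\<close> has degree n + 1 and frequency of modulus l - 1 for l > 0. For
  l = 0 it is \<open>field_hol\<close> by convention and takes the multiplier of the latter.\<close>

definition mult_anti :: "real \<Rightarrow> index \<Rightarrow> real" where
  "mult_anti \<beta> = (\<lambda>(l, n, \<mu>). if l = 0 then riesz_mult \<beta> n (l + 1) else riesz_mult \<beta> (n + 1) (l - 1))"

lemma field_riesz:
  assumes \<beta>: "0 < \<beta>" "\<beta> < 1" and x: "x \<in> disk" "x \<noteq> 0"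
  shows "riesz_potential_vec (2 - 2 * \<beta>) (grad_wbasis \<beta> i) x =
     vec_of (of_real (mult_hol \<beta> i) * field_hol \<beta> i x + of_real (mult_anti \<beta> i) * field_anti \<beta> i x)"
proof -
  obtain l n \<mu> where i: "i = (l, n, \<mu>)" by (cases i)
  define C where "C = 1 / (2 powr (2 - 2 * \<beta>) * pi * Gamma ((2 - 2 * \<beta>) / 2) / Gamma (2 * \<beta> / 2))"
  let ?k = "\<lambda>y. of_real (norm (x - y) powr (- (2 * \<beta>))) * of_real (weight (\<beta> - 1) y) :: complex"
  have z: "integrable lborel (\<lambda>y. ?k y * zern (\<beta> - 1) a n y)"
      "of_real C * (LINT y|lborel. ?k y * zern (\<beta> - 1) a n y) = of_real (riesz_mult \<beta> n (nat \<bar>a\<bar>)) * zern (\<beta> - 1) a n x" for a n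
    using zern_riesz [OF \<beta> x, of a n] unfolding C_def by (simp_all add: mult.assoc)
  have scale: "integrable lborel (\<lambda>y. ?k y * (c * zern (\<beta> - 1) a n y)) \<and>
      of_real C * (LINT y|lborel. ?k y * (c * zern (\<beta> - 1) a n y)) = of_real (riesz_mult \<beta> n (nat \<bar>a\<bar>)) * (c * zern (\<beta> - 1) a n x)" for a n c
  proof -
    have eq: "(\<lambda>y. ?k y * (c * zern (\<beta> - 1) a n y)) = (\<lambda>y. c * (?k y * zern (\<beta> - 1) a n y))" by (auto simp: mult_ac)
    show ?thesis unfolding eq using z [of a n] by (simp add: mult.left_commute)
  qed
  have hol: "integrable lborel (\<lambda>y. ?k y * field_hol \<beta> i y)"
      "of_real C * (LINT y|lborel. ?k y * field_hol \<beta> i y) = of_real (mult_hol \<beta> i) * field_hol \<beta> i x"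
    using scale [of "- of_real (real n + \<beta>) * hcoeff l \<mu>" "int l + 1" n]
    by (simp_all add: i field_hol_def mult_hol_def nat_add_distrib)
  have anti: "integrable lborel (\<lambda>y. ?k y * field_anti \<beta> i y)"
      "of_real C * (LINT y|lborel. ?k y * field_anti \<beta> i y) = of_real (mult_anti \<beta> i) * field_anti \<beta> i x"
  proof -
    have "integrable lborel (\<lambda>y. ?k y * field_anti \<beta> i y) \<and>
      of_real C * (LINT y|lborel. ?k y * field_anti \<beta> i y) = of_real (mult_anti \<beta> i) * field_anti \<beta> i x"
    proof (cases "l = 0")
      case True
      then show ?thesis using hol by (simp add: i field_anti_def mult_anti_def mult_hol_def)
    next
      case False
      then have "nat \<bar>1 - int l\<bar> = l - 1" by simp
      then show ?thesis
        using False scale [of "- of_real (real n + 1) * cnj (hcoeff l \<mu>)" "1 - int l" "n + 1"]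
        by (simp add: i field_anti_def mult_anti_def)
    qed
    then show "integrable lborel (\<lambda>y. ?k y * field_anti \<beta> i y)"
      "of_real C * (LINT y|lborel. ?k y * field_anti \<beta> i y) = of_real (mult_anti \<beta> i) * field_anti \<beta> i x" by auto
  qed
  define H where "H y = of_real (weight (\<beta> - 1) y) * (field_hol \<beta> i y + field_anti \<beta> i y)" for y
  have Hk: "(\<lambda>y. of_real (norm (x - y) powr (- (2 * \<beta>))) * H y) = (\<lambda>y. ?k y * field_hol \<beta> i y + ?k y * field_anti \<beta> i y)"
    by (auto simp: H_def algebra_simps)
  have [measurable]: "field_hol \<beta> i \<in> borel_measurable borel" "field_anti \<beta> i \<in> borel_measurable borel"
    by (intro borel_measurable_continuous_onI continuous_intros)+
  have [measurable]: "H \<in> borel_measurable borel"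
    unfolding H_def by measurable
  have "grad_wbasis \<beta> i = (\<lambda>y. vec_of (H y))"
    by (auto simp only: grad_wbasis_eq H_def vec_of_of_real)
  then have "riesz_potential_vec (2 - 2 * \<beta>) (grad_wbasis \<beta> i) x =
     vec_of (of_real C * (LINT y|lborel. of_real (norm (x - y) powr (- (2 * \<beta>))) * H y))"
    using riesz_potential_vec_eq [of H x "2 * \<beta>"] hol(1) anti(1) unfolding Hk C_def by simp
  also have "(LINT y|lborel. of_real (norm (x - y) powr (- (2 * \<beta>))) * H y) =
      (LINT y|lborel. ?k y * field_hol \<beta> i y) + (LINT y|lborel. ?k y * field_anti \<beta> i y)"
    unfolding Hk by (rule Bochner_Integration.integral_add [OF hol(1) anti(1)])
  finally show ?thesis by (simp only: distrib_left hol(2) anti(2))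
qed

section \<open>Inner products of combinations of the two fields\<close>

definition comb_field :: "real \<Rightarrow> (index \<Rightarrow> real) \<Rightarrow> (index \<Rightarrow> real) \<Rightarrow> index \<Rightarrow> real^2 \<Rightarrow> real^2" where
  "comb_field \<beta> s t i x = vec_of (of_real (s i) * field_hol \<beta> i x + of_real (t i) * field_anti \<beta> i x)"

lemma continuous_on_comb_field [continuous_intros]: "continuous_on S (comb_field \<beta> s t i)"
  unfolding comb_field_def by (intro continuous_intros)

lemma Re_of_real_mult_left: "Re z = 0 \<Longrightarrow> Re (of_real r * z) = 0"
  by simp

text \<open>The summands are the squared norms of the two fields, expressed through
  \<open>basis_norm2\<close> by \<open>jac_norm_shift\<close> and \<open>jac_norm_raise\<close>. The
  factor 2 undoes the 1/2 in \<open>basis_norm2\<close>. For l = 0 the fields coincide, so the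
  coefficients are added before squaring.\<close>

definition comb_norm2 :: "real \<Rightarrow> (index \<Rightarrow> real) \<Rightarrow> (index \<Rightarrow> real) \<Rightarrow> index \<Rightarrow> real" where
  "comb_norm2 \<beta> s t = (\<lambda>(l, n, \<mu>). (let i = (l, n, \<mu>) in
     (if l = 0 then (s i + t i)\<^sup>2 * ((real n + \<beta>) * (real n + 1))
      else 2 * ((s i)\<^sup>2 * ((real n + \<beta>) * (real n + real l + 1)) + (t i)\<^sup>2 * ((real n + 1) * (real n + real l + \<beta>))))
     * basis_norm2 \<beta> i))"

text \<open>Four complex products are evaluated. A frequency l + 1 \<ge> 1 never equals 1 - l' \<le>
  0 with l' > 0, so the mixed products survive only where \<open>field_anti\<close> is
  \<open>field_hol\<close> by convention. For equal l and n but different \<mu>, the coefficients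
  \<open>hcoeff\<close> make the products imaginary.\<close>

lemma comb_field_inner:
  assumes \<beta>: "0 < \<beta>" and i: "i \<in> indices" "j \<in> indices"
  shows "L2_inner (\<beta> - 1) (comb_field \<beta> s t i) (comb_field \<beta> s' t' j) =
    (if i = j then comb_norm2 \<beta> (\<lambda>i. 1) (\<lambda>i. 0) i * (s i * s' i) + comb_norm2 \<beta> (\<lambda>i. 0) (\<lambda>i. 1) i * (t i * t' i)
       + (if fst i = 0 then comb_norm2 \<beta> (\<lambda>i. 1) (\<lambda>i. 0) i * (s i * t' i + t i * s' i) else 0) else 0)"
proof -
  let ?\<gamma> = "\<beta> - 1"
  have \<gamma>: "?\<gamma> > -1" using \<beta> by simp
  obtain l n \<mu> where i_eq: "i = (l, n, \<mu>)" by (cases i)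
  obtain l' n' \<mu>' where j_eq: "j = (l', n', \<mu>')" by (cases j)
  define P where "P F G = (LINT x|lborel. weight ?\<gamma> x *\<^sub>R (F x * cnj (G x)))" for F G :: "real^2 \<Rightarrow> complex"
  let ?h = "hcoeff l \<mu>" and ?h' = "hcoeff l' \<mu>'"
  have P_scale: "P (\<lambda>x. c * F x) (\<lambda>x. d * G x) = c * cnj d * P F G" for c d F G
  proof -
    have eq: "weight ?\<gamma> x *\<^sub>R (c * F x * cnj (d * G x)) = (c * cnj d) * (weight ?\<gamma> x *\<^sub>R (F x * cnj (G x)))" for x
      by (simp add: mult_ac)
    show ?thesis unfolding P_def eq integral_mult_right_zero ..
  qed
  have zz: "P (zern ?\<gamma> a n) (zern ?\<gamma> b k) = (if a = b \<and> n = k then of_real (pi * jac_norm n ?\<gamma> (nat \<bar>a\<bar>)) else 0)" for a n b k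
    unfolding P_def by (rule zern_inner [OF \<gamma>])
  have int: "integrable lborel (\<lambda>x. weight ?\<gamma> x *\<^sub>R (F x * cnj (G x)))"
    if "continuous_on UNIV F" "continuous_on UNIV G" for F G
    using that by (intro weight_integrable_continuous \<gamma> continuous_intros)
  let ?F = "\<lambda>x. of_real (s i) * field_hol \<beta> i x + of_real (t i) * field_anti \<beta> i x"
  let ?G = "\<lambda>x. of_real (s' j) * field_hol \<beta> j x + of_real (t' j) * field_anti \<beta> j x"
  have "L2_inner ?\<gamma> (comb_field \<beta> s t i) (comb_field \<beta> s' t' j) = (LINT x|lborel. weight ?\<gamma> x * Re (?F x * cnj (?G x)))"
    by (subst L2_inner_continuous) (auto intro!: continuous_intros simp: comb_field_def inner_vec_of simp del: cpx_vec_of)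
  also have "\<dots> = Re (P ?F ?G)"
    unfolding P_def by (intro weight_integral_Re \<gamma> continuous_intros)
  also have "P ?F ?G = of_real (s i * s' j) * P (field_hol \<beta> i) (field_hol \<beta> j) + of_real (s i * t' j) * P (field_hol \<beta> i) (field_anti \<beta> j)
     + (of_real (t i * s' j) * P (field_anti \<beta> i) (field_hol \<beta> j) + of_real (t i * t' j) * P (field_anti \<beta> i) (field_anti \<beta> j))"
  proof -
    have "weight ?\<gamma> x *\<^sub>R (?F x * cnj (?G x)) =
        (of_real (s i * s' j) * (weight ?\<gamma> x *\<^sub>R (field_hol \<beta> i x * cnj (field_hol \<beta> j x))) + of_real (s i * t' j) * (weight ?\<gamma> x *\<^sub>R (field_hol \<beta> i x * cnj (field_anti \<beta> j x))))
      + (of_real (t i * s' j) * (weight ?\<gamma> x *\<^sub>R (field_anti \<beta> i x * cnj (field_hol \<beta> j x))) + of_real (t i * t' j) * (weight ?\<gamma> x *\<^sub>R (field_anti \<beta> i x * cnj (field_anti \<beta> j x))))" for x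
      by (simp add: scaleR_conv_of_real algebra_simps)
    then show ?thesis
      unfolding P_def
      by (simp only: Bochner_Integration.integral_add Bochner_Integration.integrable_add integral_mult_right_zero integrable_mult_right int continuous_on_field)
  qed
  finally have main: "L2_inner ?\<gamma> (comb_field \<beta> s t i) (comb_field \<beta> s' t' j) =
     s i * s' j * Re (P (field_hol \<beta> i) (field_hol \<beta> j)) + s i * t' j * Re (P (field_hol \<beta> i) (field_anti \<beta> j))
     + (t i * s' j * Re (P (field_anti \<beta> i) (field_hol \<beta> j)) + t i * t' j * Re (P (field_anti \<beta> i) (field_anti \<beta> j)))"
    by simp
  let ?HH = "(real n + \<beta>) * (real n' + \<beta>)"
  have P_scale': "P (\<lambda>x. - of_real r * h * F x) (\<lambda>x. - of_real r' * h' * G x) = of_real (r * r') * (h * cnj h') * P F G" for r r' :: real and h h' F G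
    by (simp only: P_scale complex_cnj_mult complex_cnj_minus complex_cnj_complex_of_real)
       (simp add: mult_ac)
  have nat0: "nat \<bar>int l + 1\<bar> = l + 1" by simp
  have nat1: "nat \<bar>1 - int l\<bar> = l - 1" if "l \<noteq> 0" using that by simp
  have hh: "P (field_hol \<beta> i) (field_hol \<beta> j) = of_real ?HH * (?h * cnj ?h') * (if l = l' \<and> n = n' then of_real (pi * jac_norm n ?\<gamma> (l + 1)) else 0)"
    unfolding i_eq j_eq field_hol_def prod.case P_scale' zz nat0 by simp
  have ha: "P (field_hol \<beta> i) (field_anti \<beta> j) = (if l' = 0 then P (field_hol \<beta> i) (field_hol \<beta> j) else 0)"
  proof (cases "l' = 0")
    case False
    then show ?thesis
      unfolding i_eq j_eq field_hol_def field_anti_def prod.case if_not_P [OF False] P_scale' zz by simp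
  qed (simp add: j_eq field_anti_def)
  have ah: "P (field_anti \<beta> i) (field_hol \<beta> j) = (if l = 0 then P (field_hol \<beta> i) (field_hol \<beta> j) else 0)"
  proof (cases "l = 0")
    case False
    then show ?thesis
      unfolding i_eq j_eq field_hol_def field_anti_def prod.case if_not_P [OF False] P_scale' zz by simp
  qed (simp add: i_eq field_anti_def)
  have aa0: "P (field_anti \<beta> i) (field_anti \<beta> j) = P (field_hol \<beta> i) (field_anti \<beta> j)" if "l = 0"
    using that by (simp add: i_eq field_anti_def)
  have aa0': "P (field_anti \<beta> i) (field_anti \<beta> j) = P (field_anti \<beta> i) (field_hol \<beta> j)" if "l' = 0"
    using that by (simp add: j_eq field_anti_def)
  have aa: "P (field_anti \<beta> i) (field_anti \<beta> j) =
      of_real ((real n + 1) * (real n' + 1)) * (cnj ?h * ?h') * (if l = l' \<and> n = n' then of_real (pi * jac_norm (n + 1) ?\<gamma> (l - 1)) else 0)"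
    if l: "l \<noteq> 0" "l' \<noteq> 0"
    using l unfolding i_eq j_eq field_anti_def prod.case if_not_P [OF l(1)] if_not_P [OF l(2)] P_scale' zz nat1 [OF l(1)]
    by auto
  have norm_hol: "(real n + \<beta>) * jac_norm n ?\<gamma> (l + 1) = (real n + real l + 1) * jac_norm n \<beta> l"
    using jac_norm_shift [OF \<beta>, of n l] by simp
  have norm_anti: "(real n + 1) * jac_norm (n + 1) ?\<gamma> (l - 1) = (real n + real l + \<beta>) * jac_norm n \<beta> l" if "l \<noteq> 0"
    using jac_norm_raise [OF \<gamma>, of n "l - 1"] that by (simp add: of_nat_diff algebra_simps)
  have HH: "(real n + \<beta>) * (real n + \<beta>) * (pi * jac_norm n ?\<gamma> (l + 1)) = (real n + \<beta>) * (real n + real l + 1) * (pi * jac_norm n \<beta> l)"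
    using norm_hol by simp
  have AA: "(real n + 1) * (real n + 1) * (pi * jac_norm (n + 1) ?\<gamma> (l - 1)) = (real n + 1) * (real n + real l + \<beta>) * (pi * jac_norm n \<beta> l)" if "l \<noteq> 0"
    using norm_anti [OF that] by simp
  have h_orth: "Re (?h * cnj ?h') = 0" "Re (cnj ?h * ?h') = 0" if "l = l'" "n = n'" "i \<noteq> j"
    using i that by (auto simp: i_eq j_eq indices_def hcoeff_def)
  have h_same: "?h * cnj ?h = of_real (if l = 0 then 1 / 4 else 1)" "cnj ?h * ?h = of_real (if l = 0 then 1 / 4 else 1)"
    by (auto simp: hcoeff_def)
  show ?thesis
  proof (cases "i = j")
    case False
    have 1: "Re (P (field_hol \<beta> i) (field_hol \<beta> j)) = 0"
    proof (cases "l = l' \<and> n = n'")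
      case True
      have e: "P (field_hol \<beta> i) (field_hol \<beta> j) = of_real (?HH * (pi * jac_norm n ?\<gamma> (l + 1))) * (?h * cnj ?h')"
        unfolding hh using True by simp
      show ?thesis unfolding e by (intro Re_of_real_mult_left h_orth(1)) (use True False in auto)
    qed (auto simp: hh)
    have 2: "Re (P (field_anti \<beta> i) (field_anti \<beta> j)) = 0" if l: "l \<noteq> 0" "l' \<noteq> 0"
    proof (cases "l = l' \<and> n = n'")
      case True
      have e: "P (field_anti \<beta> i) (field_anti \<beta> j) = of_real ((real n + 1) * (real n' + 1) * (pi * jac_norm (n + 1) ?\<gamma> (l - 1))) * (cnj ?h * ?h')"
        unfolding aa [OF l] using True by simp
      show ?thesis unfolding e by (intro Re_of_real_mult_left h_orth(2)) (use True False in auto)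
    qed (auto simp: aa [OF l])
    have "Re (P (field_anti \<beta> i) (field_anti \<beta> j)) = 0"
      using 1 2 by (cases "l = 0"; cases "l' = 0") (simp_all add: aa0 aa0' ha ah)
    then show ?thesis
      using False 1 unfolding main ha ah by simp
  next
    case True
    then have eqs: "l' = l" "n' = n" "\<mu>' = \<mu>" using i_eq j_eq by auto
    have R1: "Re (P (field_hol \<beta> i) (field_hol \<beta> j)) = comb_norm2 \<beta> (\<lambda>i. 1) (\<lambda>i. 0) i"
    proof -
      have "Re (P (field_hol \<beta> i) (field_hol \<beta> j)) = (if l = 0 then 1 / 4 else 1) * ((real n + \<beta>) * (real n + \<beta>) * (pi * jac_norm n ?\<gamma> (l + 1)))"
        unfolding hh eqs h_same by simp
      then show ?thesis unfolding HH by (simp add: comb_norm2_def i_eq basis_norm2_def Let_def)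
    qed
    have R2: "Re (P (field_anti \<beta> i) (field_anti \<beta> j)) = comb_norm2 \<beta> (\<lambda>i. 0) (\<lambda>i. 1) i" if l: "l \<noteq> 0"
    proof -
      have l': "l' \<noteq> 0" using l eqs by simp
      have "Re (P (field_anti \<beta> i) (field_anti \<beta> j)) = (real n + 1) * (real n + 1) * (pi * jac_norm (n + 1) ?\<gamma> (l - 1))"
        unfolding aa [OF l l'] eqs h_same using l by simp
      then show ?thesis unfolding AA [OF l] using l by (simp add: comb_norm2_def i_eq basis_norm2_def Let_def)
    qed
    have R3: "comb_norm2 \<beta> (\<lambda>i. 0) (\<lambda>i. 1) i = comb_norm2 \<beta> (\<lambda>i. 1) (\<lambda>i. 0) i" if "l = 0"
      using that by (simp add: comb_norm2_def i_eq Let_def)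
    show ?thesis
    proof (cases "l = 0")
      case l: True
      then have l': "l' = 0" using eqs by simp
      have fst: "fst i = 0" by (simp add: i_eq l)
      show ?thesis
        unfolding main aa0 [OF l] ha ah if_P [OF l] if_P [OF l'] R1 R3 [OF l] if_P [OF True] if_P [OF fst]
        using True by (simp add: algebra_simps)
    next
      case l: False
      then have l': "l' \<noteq> 0" using eqs by simp
      have fst: "fst i \<noteq> 0" by (simp add: i_eq l)
      show ?thesis
        using True l l' fst unfolding main ha ah R2 [OF l] R1 by simp
    qed
  qed
qed

section \<open>Expansions in the weighted spaces\<close>

text \<open>Absorbing the weight into the measure makes \<open>L2\<close> an instance of
  \<open>sq_int\<close>. The weight is positive on the disk, so the null sets stay the same.\<close>

definition disk_measure :: "real \<Rightarrow> (real^2) measure" where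
  "disk_measure \<gamma> = density (lebesgue_on disk) (\<lambda>x. ennreal (weight \<gamma> x))"

lemma space_lebesgue_on_disk [simp]: "space (lebesgue_on disk) = disk"
  by (simp add: space_restrict_space)

lemma weight_measurable_disk [measurable]: "weight \<gamma> \<in> borel_measurable (lebesgue_on disk)"
  by (intro measurable_restrict_space1 measurable_completion) simp

lemma measurable_disk_measure [simp]: "borel_measurable (disk_measure \<gamma>) = borel_measurable (lebesgue_on disk)"
  by (intro measurable_cong_sets) (auto simp: disk_measure_def)

lemma AE_disk_measure: "(AE x in disk_measure \<gamma>. P x) \<longleftrightarrow> (AE x in lebesgue_on disk. P x)"
  unfolding disk_measure_def
  by (subst AE_density) (auto intro!: AE_cong simp: weight_pos)

lemma AE_disk_measureI: "(\<And>x. x \<in> disk \<Longrightarrow> P x) \<Longrightarrow> AE x in disk_measure \<gamma>. P x"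
  unfolding AE_disk_measure by (intro AE_I2) simp

lemma L2_eq: "L2 \<gamma> = sq_int (disk_measure \<gamma>)"
  unfolding L2_def sq_int_def measurable_disk_measure
proof (intro Collect_cong conj_cong refl)
  fix g :: "real^2 \<Rightarrow> 'b::euclidean_space" assume [measurable]: "g \<in> borel_measurable (lebesgue_on disk)"
  show "integrable (lebesgue_on disk) (\<lambda>x. weight \<gamma> x * (g x \<bullet> g x)) \<longleftrightarrow> integrable (disk_measure \<gamma>) (\<lambda>x. g x \<bullet> g x)"
    unfolding disk_measure_def by (subst integrable_density) (auto simp: weight_nonneg)
qed

lemma L2_inner_eq:
  assumes [measurable]: "f \<in> borel_measurable (lebesgue_on disk)" "g \<in> borel_measurable (lebesgue_on disk)"
  shows "L2_inner \<gamma> f g = sq_inner (disk_measure \<gamma>) f g"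
  unfolding L2_inner_def sq_inner_def disk_measure_def
  by (subst integral_density) (auto simp: weight_nonneg)

lemma L2_has_sum_eq: "L2_has_sum \<gamma> f J g \<longleftrightarrow> sq_has_sum (disk_measure \<gamma>) f J g"
  unfolding L2_has_sum_def sq_has_sum_def L2_eq
proof (intro conj_cong refl)
  assume f: "\<forall>i\<in>J. f i \<in> sq_int (disk_measure \<gamma>)" and g: "g \<in> sq_int (disk_measure \<gamma>)"
  have "\<forall>\<^sub>F S in finite_subsets_at_top J. L2_norm \<gamma> (\<lambda>x. g x - (\<Sum>i\<in>S. f i x)) = sq_norm (disk_measure \<gamma>) (\<lambda>x. g x - (\<Sum>i\<in>S. f i x))"
  proof (rule eventually_finite_subsets_at_top_weakI)
    fix S assume "S \<subseteq> J"
    then have "(\<lambda>x. g x - (\<Sum>i\<in>S. f i x)) \<in> sq_int (disk_measure \<gamma>)"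
      using f g by (intro sq_int_diff sq_int_sum) auto
    from sq_int_measurable [OF this] show "L2_norm \<gamma> (\<lambda>x. g x - (\<Sum>i\<in>S. f i x)) = sq_norm (disk_measure \<gamma>) (\<lambda>x. g x - (\<Sum>i\<in>S. f i x))"
      by (simp add: L2_norm_def sq_norm_def L2_inner_eq)
  qed
  then show "((\<lambda>S. L2_norm \<gamma> (\<lambda>x. g x - (\<Sum>i\<in>S. f i x))) \<longlongrightarrow> 0) (finite_subsets_at_top J) =
      ((\<lambda>S. sq_norm (disk_measure \<gamma>) (\<lambda>x. g x - (\<Sum>i\<in>S. f i x))) \<longlongrightarrow> 0) (finite_subsets_at_top J)"
    by (rule tendsto_cong)
qed

lemma sq_int_cong_AE:
  assumes "f \<in> sq_int M" "g \<in> borel_measurable M" "AE x in M. f x = g x"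
  shows "g \<in> sq_int M"
proof -
  have "integrable M (\<lambda>x. g x \<bullet> g x) \<longleftrightarrow> integrable M (\<lambda>x. f x \<bullet> f x)"
    using assms by (intro integrable_cong_AE) (auto simp: sq_int_def)
  then show ?thesis using assms by (simp add: sq_int_def)
qed

lemma sq_inner_cong_AE:
  assumes "f \<in> borel_measurable M" "f' \<in> borel_measurable M" "AE x in M. f x = f' x"
    and "g \<in> borel_measurable M" "g' \<in> borel_measurable M" "AE x in M. g x = g' x"
  shows "sq_inner M f g = sq_inner M f' g'"
  unfolding sq_inner_def
proof (rule integral_cong_AE)
  show "AE x in M. f x \<bullet> g x = f' x \<bullet> g' x" using assms(3,6) by eventually_elim simp
qed (use assms in measurable)

text \<open>The terms of the gradient and potential series are known explicitly only on the disk or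
  off the origin, so sums must tolerate changes on null sets.\<close>

lemma sq_has_sum_cong_AE:
  assumes f: "sq_has_sum M f J g"
    and f': "\<And>i. i \<in> J \<Longrightarrow> f' i \<in> borel_measurable M" "\<And>i. i \<in> J \<Longrightarrow> AE x in M. f i x = f' i x"
    and g': "g' \<in> borel_measurable M" "AE x in M. g x = g' x"
  shows "sq_has_sum M f' J g'"
proof -
  have sf: "f i \<in> sq_int M" if "i \<in> J" for i using f that by (simp add: sq_has_sum_def)
  have sg: "g \<in> sq_int M" using f by (simp add: sq_has_sum_def)
  have sf': "f' i \<in> sq_int M" if "i \<in> J" for i using sq_int_cong_AE [OF sf f'] that by blast
  have sg': "g' \<in> sq_int M" using sq_int_cong_AE [OF sg g'] .
  have "((\<lambda>S. sq_norm M (\<lambda>x. g' x - (\<Sum>i\<in>S. f' i x))) \<longlongrightarrow> 0) (finite_subsets_at_top J)"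
  proof (rule Lim_transform_eventually)
    show "((\<lambda>S. sq_norm M (\<lambda>x. g x - (\<Sum>i\<in>S. f i x))) \<longlongrightarrow> 0) (finite_subsets_at_top J)"
      using f by (simp add: sq_has_sum_def)
    show "\<forall>\<^sub>F S in finite_subsets_at_top J. sq_norm M (\<lambda>x. g x - (\<Sum>i\<in>S. f i x)) = sq_norm M (\<lambda>x. g' x - (\<Sum>i\<in>S. f' i x))"
    proof (rule eventually_finite_subsets_at_top_weakI)
      fix S assume S: "finite S" "S \<subseteq> J"
      have "AE x in M. \<forall>i\<in>S. f i x = f' i x"
        using S f'(2) by (subst AE_finite_all) auto
      with g'(2) have ae: "AE x in M. g x - (\<Sum>i\<in>S. f i x) = g' x - (\<Sum>i\<in>S. f' i x)"
        by eventually_elim simp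
      have "(\<lambda>x. g x - (\<Sum>i\<in>S. f i x)) \<in> borel_measurable M" "(\<lambda>x. g' x - (\<Sum>i\<in>S. f' i x)) \<in> borel_measurable M"
        using S sf sg sf' sg' by (auto intro!: sq_int_measurable [OF sq_int_diff] sq_int_sum)
      then show "sq_norm M (\<lambda>x. g x - (\<Sum>i\<in>S. f i x)) = sq_norm M (\<lambda>x. g' x - (\<Sum>i\<in>S. f' i x))"
        unfolding sq_norm_def using ae by (intro arg_cong [where f = sqrt] sq_inner_cong_AE)
    qed
  qed
  then show ?thesis using sf' sg' by (simp add: sq_has_sum_def)
qed

lemma sq_inner_continuous:
  fixes f g :: "real^2 \<Rightarrow> 'b::euclidean_space"
  assumes "continuous_on UNIV f" "continuous_on UNIV g"
  shows "sq_inner (disk_measure \<gamma>) f g = L2_inner \<gamma> f g"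
  using assms by (intro L2_inner_eq [symmetric] measurable_restrict_space1 measurable_completion)
     (simp_all add: borel_measurable_continuous_onI)

lemma sq_int_continuous:
  fixes f :: "real^2 \<Rightarrow> 'b::euclidean_space"
  assumes "\<gamma> > -1" "continuous_on UNIV f"
  shows "f \<in> sq_int (disk_measure \<gamma>)"
  using L2_iff_continuous [OF assms] by (simp add: L2_eq)

text \<open>Extension by zero embeds both families into \<open>ell2\<close>, where the inequality is
  that of an inner product space.\<close>

lemma infsum_Cauchy_Schwarz:
  fixes f g :: "'i \<Rightarrow> real"
  assumes f: "(\<lambda>i. (f i)\<^sup>2) summable_on A" and g: "(\<lambda>i. (g i)\<^sup>2) summable_on A"
  shows "\<bar>\<Sum>\<^sub>\<infinity>i\<in>A. f i * g i\<bar> \<le> sqrt (\<Sum>\<^sub>\<infinity>i\<in>A. (f i)\<^sup>2) * sqrt (\<Sum>\<^sub>\<infinity>i\<in>A. (g i)\<^sup>2)"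
proof -
  define ext where "ext h = (\<lambda>i. if i \<in> A then h i else 0 :: real)" for h
  have s: "(\<lambda>i. (ext h i)\<^sup>2) summable_on UNIV" if "(\<lambda>i. (h i)\<^sup>2) summable_on A" for h
    using that by (rule summable_on_cong_neutral [THEN iffD1, rotated -1]) (auto simp: ext_def)
  have e: "(\<Sum>\<^sub>\<infinity>i. ext h i * ext k i) = (\<Sum>\<^sub>\<infinity>i\<in>A. h i * k i)" for h k
    by (rule infsum_cong_neutral) (auto simp: ext_def)
  have R: "Rep_ell2 (Abs_ell2 (ext f)) = ext f" "Rep_ell2 (Abs_ell2 (ext g)) = ext g"
    using s [OF f] s [OF g] by (simp_all add: Abs_ell2_inverse)
  show ?thesis
    using Cauchy_Schwarz_ineq2 [of "Abs_ell2 (ext f)" "Abs_ell2 (ext g)"]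
    unfolding norm_eq_sqrt_inner inner_ell2.rep_eq R e by (simp add: power2_eq_square)
qed

section \<open>Sobolev norms and coefficient families\<close>

definition ind_weight :: "index \<Rightarrow> real" where
  "ind_weight = (\<lambda>(l, n, \<mu>). (real n + 1) * (real n + real l + 1))"

lemma ind_weight_ge_1: "ind_weight i \<ge> 1"
proof (cases i)
  case (fields l n \<mu>)
  have "1 * 1 \<le> (real n + 1) * (real n + real l + 1)" by (intro mult_mono) auto
  then show ?thesis by (simp add: ind_weight_def fields)
qed

lemma ind_weight_pos: "ind_weight i > 0"
  using ind_weight_ge_1 [of i] by linarith

lemma basis_sq_norm:
  assumes "\<gamma> > -1" "i \<in> indices"
  shows "(L2_norm \<gamma> (basis \<gamma> i))\<^sup>2 = basis_norm2 \<gamma> i"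
  using basis_inner [OF assms(1) assms(2) assms(2)] basis_norm2_pos [OF assms(1), of i] by (simp add: L2_norm_def)

lemma H_term_eq:
  assumes "\<gamma> > -1" "i \<in> indices"
  shows "H_term \<gamma> s a i = ind_weight i powr s * (a i)\<^sup>2 * basis_norm2 \<gamma> i"
  using basis_sq_norm [OF assms] by (cases i) (simp add: H_term_def ind_weight_def powr_mult)

lemma H_series_iff:
  assumes "\<gamma> > -1"
  shows "a \<in> H_series \<gamma> s \<longleftrightarrow> a \<in> series \<and> (\<lambda>i. ind_weight i powr s * (a i)\<^sup>2 * basis_norm2 \<gamma> i) summable_on indices"
  unfolding H_series_def using summable_on_cong [of indices "H_term \<gamma> s a" "\<lambda>i. ind_weight i powr s * (a i)\<^sup>2 * basis_norm2 \<gamma> i"]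
  by (auto simp: H_term_eq [OF assms])

lemma H_norm_eq:
  assumes "\<gamma> > -1"
  shows "H_norm \<gamma> s a = sqrt (\<Sum>\<^sub>\<infinity>i\<in>indices. ind_weight i powr s * (a i)\<^sup>2 * basis_norm2 \<gamma> i)"
  unfolding H_norm_def by (intro arg_cong [where f = sqrt] infsum_cong) (simp add: H_term_eq [OF assms])

lemma expansion_iff:
  "expansion \<gamma> a v \<longleftrightarrow> a \<in> series \<and> sq_has_sum (disk_measure \<gamma>) (\<lambda>i x. a i *\<^sub>R basis \<gamma> i x) indices v"
  by (simp add: expansion_def L2_has_sum_eq)

lemma expansion_series: "expansion \<gamma> a v \<Longrightarrow> a \<in> series"
  by (simp add: expansion_def)

lemma series_zero: "a \<in> series \<Longrightarrow> i \<notin> indices \<Longrightarrow> a i = 0"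
  by (cases i) (simp add: series_def)

text \<open>Orthogonality of the basis isolates one coefficient; this makes expansions
  unique.\<close>

lemma expansion_coeff:
  assumes \<gamma>: "\<gamma> > -1" and v: "expansion \<gamma> a v" and j: "j \<in> indices"
  shows "sq_inner (disk_measure \<gamma>) (basis \<gamma> j) v = a j * basis_norm2 \<gamma> j"
proof -
  let ?D = "disk_measure \<gamma>"
  have e: "basis \<gamma> i \<in> sq_int ?D" for i by (intro sq_int_continuous \<gamma> continuous_intros)
  have ip: "sq_inner ?D (basis \<gamma> j) (\<lambda>x. a i *\<^sub>R basis \<gamma> i x) = (if i = j then a j * basis_norm2 \<gamma> j else 0)" if "i \<in> indices" for i
    using basis_inner [OF \<gamma> j that]
    by (auto simp: sq_inner_scaleR_right sq_inner_continuous continuous_intros simp del: real_scaleR_def)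
  have "((\<lambda>i. sq_inner ?D (basis \<gamma> j) (\<lambda>x. a i *\<^sub>R basis \<gamma> i x)) has_sum sq_inner ?D (basis \<gamma> j) v) indices"
    using v e by (intro sq_has_sum_inner) (auto simp: expansion_iff)
  moreover have "((\<lambda>i. sq_inner ?D (basis \<gamma> j) (\<lambda>x. a i *\<^sub>R basis \<gamma> i x)) has_sum (a j * basis_norm2 \<gamma> j)) indices"
    by (rule has_sum_finite_neutralI [of "{j}"]) (use j in \<open>auto simp: ip simp del: real_scaleR_def\<close>)
  ultimately show ?thesis by (rule has_sum_unique)
qed

lemma expansion_unique:
  assumes \<gamma>: "\<gamma> > -1" and "expansion \<gamma> a v" "expansion \<gamma> b v"
  shows "a = b"
proof
  fix j
  show "a j = b j"
  proof (cases "j \<in> indices")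
    case True
    then show ?thesis
      using expansion_coeff [OF \<gamma> assms(2) True] expansion_coeff [OF \<gamma> assms(3) True] basis_norm2_pos [OF \<gamma>, of j] by simp
  next
    case False
    then show ?thesis
      using series_zero [OF expansion_series] assms(2,3) by metis
  qed
qed

text \<open>\<open>coeffs\<close> divides by the weight, which is zero off the disk, so the quotient
  recovers the original function on the disk only.\<close>

lemma expansion_cong:
  assumes v: "expansion \<gamma> a v" and eq: "\<And>x. x \<in> disk \<Longrightarrow> v x = v' x"
  shows "expansion \<gamma> a v'"
proof -
  have "v \<in> borel_measurable (lebesgue_on disk)"
    using v by (auto simp: expansion_iff sq_has_sum_def dest: sq_int_measurable)
  then have "v' \<in> borel_measurable (lebesgue_on disk)"
    by (subst measurable_cong [of _ _ v]) (auto simp: eq)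
  moreover have s: "sq_has_sum (disk_measure \<gamma>) (\<lambda>i x. a i *\<^sub>R basis \<gamma> i x) indices v"
    using v unfolding expansion_iff by blast
  moreover have "(\<lambda>x. a i *\<^sub>R basis \<gamma> i x) \<in> borel_measurable (disk_measure \<gamma>)" if "i \<in> indices" for i
    using s that sq_int_measurable unfolding sq_has_sum_def by blast
  ultimately have "sq_has_sum (disk_measure \<gamma>) (\<lambda>i x. a i *\<^sub>R basis \<gamma> i x) indices v'"
    by (intro sq_has_sum_cong_AE [OF s] AE_disk_measureI) (simp_all only: eq measurable_disk_measure)
  then show ?thesis using v unfolding expansion_iff by blast
qed

lemma expansion_exists:
  assumes \<gamma>: "\<gamma> > -1" and s: "s \<ge> 0" and a: "a \<in> H_series \<gamma> s"
  shows "\<exists>v. expansion \<gamma> a v"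
proof -
  let ?D = "disk_measure \<gamma>"
  have e: "basis \<gamma> i \<in> sq_int ?D" for i by (intro sq_int_continuous \<gamma> continuous_intros)
  have ip: "sq_inner ?D (\<lambda>x. a i *\<^sub>R basis \<gamma> i x) (\<lambda>x. a j *\<^sub>R basis \<gamma> j x) = (if i = j then (a i)\<^sup>2 * basis_norm2 \<gamma> i else 0)"
    if "i \<in> indices" "j \<in> indices" for i j
    using basis_inner [OF \<gamma> that]
    by (auto simp: sq_inner_scaleR_right sq_inner_scaleR_left sq_inner_continuous continuous_intros power2_eq_square simp del: real_scaleR_def)
  have "(\<lambda>i. (a i)\<^sup>2 * basis_norm2 \<gamma> i) summable_on indices"
  proof (rule summable_on_comparison_test)
    show "(\<lambda>i. ind_weight i powr s * (a i)\<^sup>2 * basis_norm2 \<gamma> i) summable_on indices"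
      using a by (simp add: H_series_iff [OF \<gamma>])
    show "(a i)\<^sup>2 * basis_norm2 \<gamma> i \<le> ind_weight i powr s * (a i)\<^sup>2 * basis_norm2 \<gamma> i" for i
    proof -
      have "1 * ((a i)\<^sup>2 * basis_norm2 \<gamma> i) \<le> ind_weight i powr s * ((a i)\<^sup>2 * basis_norm2 \<gamma> i)"
        using ind_weight_ge_1 [of i] s basis_norm2_pos [OF \<gamma>, of i] by (intro mult_right_mono ge_one_powr_ge_zero) auto
      then show ?thesis by (simp add: mult.assoc)
    qed
    show "0 \<le> (a i)\<^sup>2 * basis_norm2 \<gamma> i" for i using basis_norm2_pos [OF \<gamma>, of i] by simp
  qed
  then have "(\<lambda>i. sq_inner ?D (\<lambda>x. a i *\<^sub>R basis \<gamma> i x) (\<lambda>x. a i *\<^sub>R basis \<gamma> i x)) summable_on indices"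
    by (rule summable_on_cong [THEN iffD1, rotated]) (simp add: ip del: real_scaleR_def)
  then have "\<exists>v. sq_has_sum ?D (\<lambda>i x. a i *\<^sub>R basis \<gamma> i x) indices v"
    by (intro sq_has_sum_orthogonal_exists sq_int_scaleR e) (auto simp: ip simp del: real_scaleR_def)
  then show ?thesis using a by (auto simp: expansion_iff H_series_def)
qed

text \<open>Uniqueness of expansions justifies the definite description in
  \<open>coeffs\<close>.\<close>

lemma wH_space_coeffs:
  assumes \<beta>: "\<beta> > -1" and u: "u \<in> wH_space \<beta> s"
  shows "coeffs \<beta> u \<in> H_series \<beta> s" and "expansion \<beta> (coeffs \<beta> u) (\<lambda>x. u x / weight \<beta> x)"
proof -
  obtain v a where va: "u = (\<lambda>x. weight \<beta> x * v x)" "a \<in> H_series \<beta> s" "expansion \<beta> a v"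
    using u by (auto simp: wH_space_def H_space_def)
  have e: "expansion \<beta> a (\<lambda>x. u x / weight \<beta> x)"
    by (rule expansion_cong [OF va(3)]) (use weight_pos in \<open>auto simp: va(1) less_imp_neq [THEN not_sym]\<close>)
  then have "coeffs \<beta> u = a"
    unfolding coeffs_def by (intro the_equality) (auto intro: expansion_unique [OF \<beta>])
  then show "coeffs \<beta> u \<in> H_series \<beta> s" "expansion \<beta> (coeffs \<beta> u) (\<lambda>x. u x / weight \<beta> x)"
    using va e by auto
qed

lemma wH_space_exists:
  assumes \<beta>: "\<beta> > -1" and s: "s \<ge> 0" and a: "a \<in> H_series \<beta> s"
  shows "\<exists>u \<in> wH_space \<beta> s. coeffs \<beta> u = a"
proof -
  obtain v where v: "expansion \<beta> a v" using expansion_exists [OF assms] by blast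
  define u where "u = (\<lambda>x. weight \<beta> x * v x)"
  have u: "u \<in> wH_space \<beta> s" using v a unfolding wH_space_def H_space_def u_def by blast
  have "expansion \<beta> a (\<lambda>x. u x / weight \<beta> x)"
    by (rule expansion_cong [OF v]) (use weight_pos in \<open>auto simp: u_def less_imp_neq [THEN not_sym]\<close>)
  then have "coeffs \<beta> u = a" using wH_space_coeffs(2) [OF \<beta> u] expansion_unique [OF \<beta>] by blast
  then show ?thesis using u by blast
qed

lemma wH_space_eq_AE:
  assumes \<beta>: "\<beta> > -1" and u: "u \<in> wH_space \<beta> s" and w: "w \<in> wH_space \<beta> s'" and eq: "coeffs \<beta> u = coeffs \<beta> w"
  shows "AE x in lebesgue_on disk. u x = w x"
proof -
  have "AE x in disk_measure \<beta>. u x / weight \<beta> x = w x / weight \<beta> x"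
    using wH_space_coeffs(2) [OF \<beta> u] wH_space_coeffs(2) [OF \<beta> w]
    unfolding expansion_iff eq by (elim conjE) (rule sq_has_sum_unique)
  then have "AE x in lebesgue_on disk. u x / weight \<beta> x = w x / weight \<beta> x" by (simp add: AE_disk_measure)
  moreover have "AE x in lebesgue_on disk. x \<in> disk" by (intro AE_I2) simp
  ultimately show ?thesis
  proof eventually_elim
    case (elim x)
    then show ?case using weight_pos [of x \<beta>] by simp
  qed
qed

lemma wH_space_coeffs_0:
  assumes \<beta>: "\<beta> > -1" and u: "u \<in> wH_space \<beta> s" and ae: "AE x in lebesgue_on disk. u x = 0"
  shows "coeffs \<beta> u = (\<lambda>_. 0)"
proof
  fix j
  let ?D = "disk_measure \<beta>"
  note e = wH_space_coeffs(2) [OF \<beta> u]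
  show "coeffs \<beta> u j = 0"
  proof (cases "j \<in> indices")
    case True
    have "AE x in ?D. u x / weight \<beta> x = 0" using ae unfolding AE_disk_measure by eventually_elim simp
    then have "sq_inner ?D (basis \<beta> j) (\<lambda>x. u x / weight \<beta> x) = sq_inner ?D (basis \<beta> j) (\<lambda>x. 0)"
      using e sq_int_measurable [OF sq_int_continuous [OF \<beta> continuous_on_basis [of UNIV \<beta> j]]]
      by (intro sq_inner_cong_AE) (auto simp: expansion_iff sq_has_sum_def dest: sq_int_measurable)
    then have "coeffs \<beta> u j * basis_norm2 \<beta> j = 0"
      using expansion_coeff [OF \<beta> e True] by (simp add: sq_inner_def)
    then show ?thesis using basis_norm2_pos [OF \<beta>, of j] by simp
  next
    case False
    then show ?thesis by (intro series_zero [OF expansion_series [OF e]])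
  qed
qed

section \<open>The multipliers of the potential\<close>

text \<open>With x = k + 1, weighted arithmetic and geometric means give (x + 1)^(1 - \<beta>)
  x^\<beta> \<le> x + 1 - \<beta>. The identity (x + 1 - \<beta>) (x - 1 + \<beta>) = x^2 - (1 -
  \<beta>)^2 then closes the induction.\<close>

lemma poch_ratio_upper:
  assumes \<beta>: "0 < \<beta>" "\<beta> < 1"
  shows "poch_ratio \<beta> k \<le> (real k + 1) powr (\<beta> - 1)"
proof (induction k)
  case (Suc k)
  let ?x = "real k + 1"
  have y: "(?x + 1) powr (1 - \<beta>) * ?x powr \<beta> \<le> (1 - \<beta>) * (?x + 1) + \<beta> * ?x"
    using \<beta> by (intro Youngs_inequality_0) auto
  have "(?x + 1) powr (1 - \<beta>) * ?x powr \<beta> * (\<beta> + real k) \<le> ((1 - \<beta>) * (?x + 1) + \<beta> * ?x) * (\<beta> + real k)"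
    using y \<beta> by (intro mult_right_mono) auto
  also have "\<dots> \<le> ?x * ?x"
  proof -
    have "?x * ?x - ((1 - \<beta>) * (?x + 1) + \<beta> * ?x) * (\<beta> + real k) = (1 - \<beta>)\<^sup>2" by (simp add: power2_eq_square algebra_simps)
    then show ?thesis by (smt (verit) zero_le_power2)
  qed
  finally have le: "(?x + 1) powr (1 - \<beta>) * ?x powr \<beta> * (\<beta> + real k) \<le> ?x * ?x" .
  have "?x powr (\<beta> - 1) * ((\<beta> + real k) / ?x) \<le> (?x + 1) powr (\<beta> - 1)"
  proof -
    have 1: "?x powr (\<beta> - 1) = ?x powr \<beta> / ?x" by (simp add: powr_diff)
    have 2: "(?x + 1) powr (\<beta> - 1) = 1 / (?x + 1) powr (1 - \<beta>)" by (simp flip: powr_minus_divide)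
    have P: "(?x + 1) powr (1 - \<beta>) > 0" by simp
    have "?x powr \<beta> / ?x * ((\<beta> + real k) / ?x) * (?x + 1) powr (1 - \<beta>)
        = (?x + 1) powr (1 - \<beta>) * ?x powr \<beta> * (\<beta> + real k) / (?x * ?x)"
      by simp
    also have "\<dots> \<le> 1" using le by (subst divide_le_eq_1_pos) auto
    finally show ?thesis unfolding 1 2 using P by (subst pos_le_divide_eq) auto
  qed
  moreover have "poch_ratio \<beta> (Suc k) \<le> ?x powr (\<beta> - 1) * ((\<beta> + real k) / ?x)"
    unfolding poch_ratio_Suc using Suc \<beta> by (intro mult_right_mono) auto
  ultimately show ?case by (simp add: add_ac)
qed simp

text \<open>The mean inequality with exchanged exponents, (x + 1)^\<beta> x^(1 - \<beta>) \<le> x +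
  \<beta>, carries the induction.\<close>

lemma poch_ratio_lower:
  assumes \<beta>: "0 < \<beta>" "\<beta> < 1"
  shows "\<beta> * (real k + 1) powr (\<beta> - 1) \<le> poch_ratio \<beta> k"
proof (cases k)
  case (Suc m)
  \<comment> \<open>A sharper bound, with m + 1 in place of m + 2, which is an equality at m = 0. It
    implies the required one since the exponent is negative.\<close>
  have main: "\<beta> * (real m + 1) powr (\<beta> - 1) \<le> poch_ratio \<beta> (Suc m)" for m
  proof (induction m)
    case (Suc m)
    let ?x = "real m + 1"
    have y: "(?x + 1) powr \<beta> * ?x powr (1 - \<beta>) \<le> \<beta> * (?x + 1) + (1 - \<beta>) * ?x"
      using \<beta> by (intro Youngs_inequality_0) auto
    have "\<beta> * (?x + 1) powr (\<beta> - 1) \<le> \<beta> * ?x powr (\<beta> - 1) * ((\<beta> + ?x) / (?x + 1))"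
    proof -
      have 1: "(?x + 1) powr (\<beta> - 1) = (?x + 1) powr \<beta> / (?x + 1)" by (simp add: powr_diff)
      have 2: "?x powr (\<beta> - 1) = 1 / ?x powr (1 - \<beta>)" by (simp flip: powr_minus_divide)
      have "(?x + 1) powr \<beta> \<le> (\<beta> + ?x) / ?x powr (1 - \<beta>)" using y by (simp add: field_simps)
      then have "\<beta> * ((?x + 1) powr \<beta> / (?x + 1)) \<le> \<beta> * (((\<beta> + ?x) / ?x powr (1 - \<beta>)) / (?x + 1))"
        using \<beta> by (intro mult_left_mono divide_right_mono) auto
      then show ?thesis unfolding 1 2 by simp
    qed
    also have "\<dots> \<le> poch_ratio \<beta> (Suc m) * ((\<beta> + ?x) / (?x + 1))"
      using Suc \<beta> by (intro mult_right_mono) auto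
    also have "\<dots> = poch_ratio \<beta> (Suc (Suc m))" by (subst (2) poch_ratio_Suc) (simp add: add_ac)
    finally show ?case by (simp add: add_ac)
  qed (simp add: poch_ratio_Suc)
  have "\<beta> * (real k + 1) powr (\<beta> - 1) \<le> \<beta> * (real m + 1) powr (\<beta> - 1)"
    using \<beta> Suc by (intro mult_left_mono powr_mono2') auto
  with main [of m] Suc show ?thesis by simp
qed (use \<beta> in simp)

section \<open>Mean and relative difference of the two multipliers\<close>

definition lam :: "real \<Rightarrow> index \<Rightarrow> real" where
  "lam \<beta> i = (mult_hol \<beta> i + mult_anti \<beta> i) / 2"

definition skew :: "real \<Rightarrow> index \<Rightarrow> real" where
  "skew \<beta> i = (mult_hol \<beta> i - mult_anti \<beta> i) / (mult_hol \<beta> i + mult_anti \<beta> i)"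

lemma Gamma_real_nonzero: "0 < x \<Longrightarrow> Gamma x \<noteq> (0::real)"
  using Gamma_real_pos [of x] by linarith

lemma mult_hol_pos: "0 < \<beta> \<Longrightarrow> mult_hol \<beta> i > 0"
  using Gamma_real_nonzero [of \<beta>]
  by (cases i) (auto simp: mult_hol_def riesz_mult_def intro!: mult_pos_pos poch_ratio_pos)

lemma mult_anti_pos: "0 < \<beta> \<Longrightarrow> mult_anti \<beta> i > 0"
  using Gamma_real_nonzero [of \<beta>]
  by (cases i) (auto simp: mult_anti_def riesz_mult_def intro!: mult_pos_pos poch_ratio_pos)

text \<open>After removal of a common factor, the multipliers are the values of the increasing
  function k |-> (\<beta> + k) / (k + 1) at n + l and at n, and this function has values in
  [\<beta>, 1).\<close>

lemma mult_anti_bounds: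
  assumes \<beta>: "0 < \<beta>" "\<beta> < 1"
  shows "\<beta> * mult_hol \<beta> i \<le> mult_anti \<beta> i" and "mult_anti \<beta> i \<le> mult_hol \<beta> i"
proof -
  obtain l n \<mu> where i: "i = (l, n, \<mu>)" by (cases i)
  have "\<beta> * mult_hol \<beta> i \<le> mult_anti \<beta> i \<and> mult_anti \<beta> i \<le> mult_hol \<beta> i"
  proof (cases "l = 0")
    case True
    then have "mult_anti \<beta> i = mult_hol \<beta> i" by (simp add: i mult_hol_def mult_anti_def)
    then show ?thesis using \<beta> mult_hol_pos [OF \<beta>(1), of i] by simp
  next
    case False
    define A where "A = 2 powr (2 * \<beta> - 2) * (Gamma \<beta>)\<^sup>2 * (poch_ratio \<beta> n * poch_ratio \<beta> (n + l))"
    have A: "A > 0" using \<beta> Gamma_real_nonzero [of \<beta>] by (auto simp: A_def intro!: mult_pos_pos poch_ratio_pos)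
    have nl: "n + 1 + (l - 1) = n + l" using False by simp
    have hol: "mult_hol \<beta> i = A * ((\<beta> + real (n + l)) / (real (n + l) + 1))"
      by (simp add: i mult_hol_def riesz_mult_def A_def poch_ratio_Suc)
    have anti: "mult_anti \<beta> i = A * ((\<beta> + real n) / (real n + 1))"
      using False by (simp add: i mult_anti_def riesz_mult_def nl A_def poch_ratio_Suc del: add_Suc)
    have "\<beta> * ((\<beta> + real (n + l)) / (real (n + l) + 1)) \<le> \<beta> * 1"
      using \<beta> by (intro mult_left_mono) (auto simp: field_simps)
    also have "\<dots> \<le> (\<beta> + real n) / (real n + 1)"
    proof -
      have "\<beta> * real n \<le> 1 * real n" using \<beta> by (intro mult_right_mono) auto
      then show ?thesis by (simp add: field_simps)
    qed
    finally have 1: "\<beta> * ((\<beta> + real (n + l)) / (real (n + l) + 1)) \<le> (\<beta> + real n) / (real n + 1)" .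
    have 2: "(\<beta> + real n) / (real n + 1) \<le> (\<beta> + real (n + l)) / (real (n + l) + 1)"
    proof -
      have "\<beta> * real l \<le> 1 * real l" using \<beta> by (intro mult_right_mono) auto
      then show ?thesis by (simp add: divide_simps) (simp add: algebra_simps)
    qed
    show ?thesis
      unfolding hol anti using mult_left_mono [OF 1, of A] mult_left_mono [OF 2, of A] A by (simp add: mult_ac)
  qed
  then show "\<beta> * mult_hol \<beta> i \<le> mult_anti \<beta> i" "mult_anti \<beta> i \<le> mult_hol \<beta> i" by auto
qed

text \<open>With q = \<open>mult_anti\<close> / \<open>mult_hol\<close>, \<open>skew\<close> is (1 -
  q) / (1 + q), which decreases on [\<beta>, 1].\<close>

lemma skew_bounds:
  assumes \<beta>: "0 < \<beta>" "\<beta> < 1"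
  shows "0 \<le> skew \<beta> i" and "skew \<beta> i \<le> (1 - \<beta>) / (1 + \<beta>)"
  using mult_anti_bounds [OF \<beta>, of i] mult_hol_pos [OF \<beta>(1), of i] mult_anti_pos [OF \<beta>(1), of i] \<beta>
  by (auto simp: skew_def divide_simps algebra_simps)

lemma lam_skew:
  assumes "0 < \<beta>"
  shows "lam \<beta> i * (1 + skew \<beta> i) = mult_hol \<beta> i" and "lam \<beta> i * (1 - skew \<beta> i) = mult_anti \<beta> i"
  using mult_hol_pos [OF assms, of i] mult_anti_pos [OF assms, of i]
  by (auto simp: lam_def skew_def field_simps)

lemma lam_pos: "0 < \<beta> \<Longrightarrow> lam \<beta> i > 0"
  using mult_hol_pos [of \<beta> i] mult_anti_pos [of \<beta> i] by (simp add: lam_def)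

text \<open>The two Pochhammer ratios in a multiplier behave like powers of n + 1 and n + l + 1 with
  exponent \<beta> - 1, and \<open>lam\<close> lies between half of \<open>mult_hol\<close> and
  \<open>mult_hol\<close>.\<close>

lemma lam_bounds:
  assumes \<beta>: "0 < \<beta>" "\<beta> < 1"
  shows "\<exists>k1 k2. 0 < k1 \<and> 0 < k2 \<and> (\<forall>i. k1 * ind_weight i powr (\<beta> - 1) \<le> lam \<beta> i \<and> lam \<beta> i \<le> k2 * ind_weight i powr (\<beta> - 1))"
proof -
  define \<kappa> where "\<kappa> = 2 powr (2 * \<beta> - 2) * (Gamma \<beta>)\<^sup>2"
  have \<kappa>: "\<kappa> > 0" using \<beta> Gamma_real_nonzero [of \<beta>] by (auto simp: \<kappa>_def intro!: mult_pos_pos)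
  have "\<kappa> * \<beta>\<^sup>2 * 2 powr (\<beta> - 1) / 2 * ind_weight i powr (\<beta> - 1) \<le> lam \<beta> i \<and> lam \<beta> i \<le> \<kappa> * ind_weight i powr (\<beta> - 1)" for i
  proof (cases i)
    case (fields l n \<mu>)
    let ?x = "real n + 1" and ?y = "real n + real l + 1"
    have hol: "mult_hol \<beta> i = \<kappa> * (poch_ratio \<beta> n * poch_ratio \<beta> (n + (l + 1)))"
      by (simp add: fields mult_hol_def riesz_mult_def \<kappa>_def)
    have pw: "ind_weight i powr (\<beta> - 1) = ?x powr (\<beta> - 1) * ?y powr (\<beta> - 1)"
      by (simp add: ind_weight_def fields powr_mult)
    have e: "real (n + (l + 1)) + 1 = ?y + 1" by simp
    have "lam \<beta> i \<le> mult_hol \<beta> i" using mult_anti_bounds(2) [OF \<beta>, of i] by (simp add: lam_def)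
    also have "\<dots> \<le> \<kappa> * (?x powr (\<beta> - 1) * ?y powr (\<beta> - 1))"
      unfolding hol
    proof (intro mult_left_mono mult_mono)
      show "poch_ratio \<beta> n \<le> ?x powr (\<beta> - 1)" by (rule poch_ratio_upper [OF \<beta>])
      have "poch_ratio \<beta> (n + (l + 1)) \<le> (?y + 1) powr (\<beta> - 1)" using poch_ratio_upper [OF \<beta>, of "n + (l + 1)"] unfolding e .
      also have "\<dots> \<le> ?y powr (\<beta> - 1)" using \<beta> by (intro powr_mono2') auto
      finally show "poch_ratio \<beta> (n + (l + 1)) \<le> ?y powr (\<beta> - 1)" .
    qed (use \<kappa> poch_ratio_pos [OF \<beta>(1)] in \<open>auto intro: less_imp_le\<close>)
    finally have up: "lam \<beta> i \<le> \<kappa> * ind_weight i powr (\<beta> - 1)" unfolding pw .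
    \<comment> \<open>The second ratio is taken at n + l + 1, where its bound involves n + l + 2
      \<le> 2 (n + l + 1); this costs the factor \<open>2 powr (\<beta> - 1)\<close>.\<close>
    have "\<kappa> * ((\<beta> * ?x powr (\<beta> - 1)) * (\<beta> * (2 powr (\<beta> - 1) * ?y powr (\<beta> - 1)))) \<le> mult_hol \<beta> i"
      unfolding hol
    proof (intro mult_left_mono mult_mono)
      show "\<beta> * ?x powr (\<beta> - 1) \<le> poch_ratio \<beta> n" by (rule poch_ratio_lower [OF \<beta>])
      have "2 powr (\<beta> - 1) * ?y powr (\<beta> - 1) = (2 * ?y) powr (\<beta> - 1)" by (subst powr_mult) auto
      also have "\<dots> \<le> (?y + 1) powr (\<beta> - 1)" using \<beta> by (intro powr_mono2') auto
      finally have "\<beta> * (2 powr (\<beta> - 1) * ?y powr (\<beta> - 1)) \<le> \<beta> * (?y + 1) powr (\<beta> - 1)"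
        using \<beta> by (intro mult_left_mono) auto
      also have "\<dots> \<le> poch_ratio \<beta> (n + (l + 1))" using poch_ratio_lower [OF \<beta>, of "n + (l + 1)"] unfolding e .
      finally show "\<beta> * (2 powr (\<beta> - 1) * ?y powr (\<beta> - 1)) \<le> poch_ratio \<beta> (n + (l + 1))" .
    qed (use \<beta> \<kappa> poch_ratio_pos [OF \<beta>(1)] in \<open>auto intro: less_imp_le\<close>)
    also have "mult_hol \<beta> i \<le> 2 * lam \<beta> i" using mult_anti_pos [OF \<beta>(1), of i] by (simp add: lam_def)
    finally have low: "\<kappa> * \<beta>\<^sup>2 * 2 powr (\<beta> - 1) / 2 * ind_weight i powr (\<beta> - 1) \<le> lam \<beta> i"
      unfolding pw by (simp add: power2_eq_square mult_ac)
    show ?thesis using up low by simp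
  qed
  then show ?thesis
    using \<kappa> \<beta> by (intro exI [of _ "\<kappa> * \<beta>\<^sup>2 * 2 powr (\<beta> - 1) / 2"] exI [of _ \<kappa>]) auto
qed

text \<open>The sum of the squared norms of the two fields. For l = 0, where they coincide, doubling
  one field gives the same expression, so one formula serves both cases.\<close>

definition grad_norm2 :: "real \<Rightarrow> index \<Rightarrow> real" where
  "grad_norm2 \<beta> = (\<lambda>(l, n, \<mu>). 2 * ((real n + \<beta>) * (real n + real l + 1) + (real n + 1) * (real n + real l + \<beta>)) * basis_norm2 \<beta> (l, n, \<mu>))"

text \<open>As 1/2 < \<beta> < 1, n + \<beta> lies between (n + 1) / 2 and n + 1, and n + l +
  \<beta> between (n + l + 1) / 2 and n + l + 1. The gradient norm is thus equivalent to the norm of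
  order 1.\<close>

lemma grad_norm2_bounds:
  assumes \<beta>: "1 / 2 < \<beta>" "\<beta> < 1"
  shows "2 * (ind_weight i * basis_norm2 \<beta> i) \<le> grad_norm2 \<beta> i"
    and "grad_norm2 \<beta> i \<le> 4 * (ind_weight i * basis_norm2 \<beta> i)"
proof -
  obtain l n \<mu> where i: "i = (l, n, \<mu>)" by (cases i)
  let ?x = "real n + 1" and ?y = "real n + real l + 1"
  have bn: "basis_norm2 \<beta> i > 0" using \<beta> by (intro basis_norm2_pos) auto
  have a: "?x / 2 * ?y \<le> (real n + \<beta>) * ?y" "(real n + \<beta>) * ?y \<le> ?x * ?y"
    using \<beta> by (intro mult_right_mono; simp)+
  have b: "?x * (?y / 2) \<le> ?x * (real n + real l + \<beta>)" "?x * (real n + real l + \<beta>) \<le> ?x * ?y"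
    using \<beta> by (intro mult_left_mono; simp)+
  have a': "?x * ?y / 2 \<le> (real n + \<beta>) * ?y" using a(1) unfolding times_divide_eq_left .
  have b': "?x * ?y / 2 \<le> ?x * (real n + real l + \<beta>)" using b(1) unfolding times_divide_eq_right .
  have low: "?x * ?y \<le> (real n + \<beta>) * ?y + ?x * (real n + real l + \<beta>)"
    using add_mono [OF a' b'] unfolding field_sum_of_halves .
  have "2 * ((real n + \<beta>) * ?y + ?x * (real n + real l + \<beta>)) \<le> 2 * (?x * ?y + ?x * ?y)"
    using add_mono [OF a(2) b(2)] by (rule mult_left_mono) simp
  also have "\<dots> = 4 * (?x * ?y)" unfolding mult_2 [symmetric] by simp
  finally have up: "2 * ((real n + \<beta>) * ?y + ?x * (real n + real l + \<beta>)) \<le> 4 * (?x * ?y)" .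
  have g: "grad_norm2 \<beta> i = 2 * ((real n + \<beta>) * ?y + ?x * (real n + real l + \<beta>)) * basis_norm2 \<beta> i"
    by (simp add: grad_norm2_def i)
  have w: "ind_weight i = ?x * ?y" by (simp add: ind_weight_def i)
  have "2 * (?x * ?y) * basis_norm2 \<beta> i \<le> grad_norm2 \<beta> i"
    unfolding g using bn by (intro mult_right_mono mult_left_mono low) auto
  then show "2 * (ind_weight i * basis_norm2 \<beta> i) \<le> grad_norm2 \<beta> i" unfolding w by (simp add: mult.assoc)
  have "grad_norm2 \<beta> i \<le> 4 * (?x * ?y) * basis_norm2 \<beta> i"
    unfolding g using bn by (intro mult_right_mono up) auto
  then show "grad_norm2 \<beta> i \<le> 4 * (ind_weight i * basis_norm2 \<beta> i)" unfolding w by (simp add: mult.assoc)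
qed

lemma grad_norm2_pos:
  assumes \<beta>: "1 / 2 < \<beta>" "\<beta> < 1"
  shows "grad_norm2 \<beta> i > 0"
proof -
  have "0 < 2 * (ind_weight i * basis_norm2 \<beta> i)"
    using \<beta> ind_weight_pos [of i] by (simp add: basis_norm2_pos)
  then show ?thesis using grad_norm2_bounds(1) [OF \<beta>, of i] by linarith
qed

text \<open>The word unit refers to the coefficients 1; these fields are not normalised.\<close>

abbreviation grad_unit :: "real \<Rightarrow> index \<Rightarrow> real^2 \<Rightarrow> real^2" where
  "grad_unit \<beta> \<equiv> comb_field \<beta> (\<lambda>_. 1) (\<lambda>_. 1)"

abbreviation skew_unit :: "real \<Rightarrow> index \<Rightarrow> real^2 \<Rightarrow> real^2" where
  "skew_unit \<beta> \<equiv> comb_field \<beta> (skew \<beta>) (\<lambda>i. - skew \<beta> i)"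

lemma grad_unit_inner:
  assumes \<beta>: "0 < \<beta>" and i: "i \<in> indices" "j \<in> indices"
  shows "sq_inner (disk_measure (\<beta> - 1)) (grad_unit \<beta> i) (grad_unit \<beta> j) = (if i = j then grad_norm2 \<beta> i else 0)"
proof -
  obtain l n \<mu> where "i = (l, n, \<mu>)" by (cases i)
  then show ?thesis
    unfolding sq_inner_continuous [OF continuous_on_comb_field continuous_on_comb_field] comb_field_inner [OF \<beta> i]
    by (auto simp: comb_norm2_def grad_norm2_def Let_def algebra_simps)
qed

definition skew_norm2 :: "real \<Rightarrow> index \<Rightarrow> real" where
  "skew_norm2 \<beta> i = (if fst i = 0 then 0 else (skew \<beta> i)\<^sup>2 * grad_norm2 \<beta> i)"

text \<open>Reversing the sign of one of two orthogonal fields keeps the norm, so only the factor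
  \<open>skew\<close> remains. For l = 0 the fields coincide and cancel.\<close>

lemma skew_unit_inner:
  assumes \<beta>: "0 < \<beta>" and i: "i \<in> indices" "j \<in> indices"
  shows "sq_inner (disk_measure (\<beta> - 1)) (skew_unit \<beta> i) (skew_unit \<beta> j) = (if i = j then skew_norm2 \<beta> i else 0)"
proof -
  obtain l n \<mu> where "i = (l, n, \<mu>)" by (cases i)
  then show ?thesis
    unfolding sq_inner_continuous [OF continuous_on_comb_field continuous_on_comb_field] comb_field_inner [OF \<beta> i]
    by (auto simp: comb_norm2_def grad_norm2_def skew_norm2_def Let_def power2_eq_square algebra_simps)
qed

lemma skew_norm2_bounds:
  assumes \<beta>: "1 / 2 < \<beta>" "\<beta> < 1"
  shows "0 \<le> skew_norm2 \<beta> i" and "skew_norm2 \<beta> i \<le> ((1 - \<beta>) / (1 + \<beta>))\<^sup>2 * grad_norm2 \<beta> i"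
proof -
  have b0: "0 < \<beta>" using \<beta> by simp
  note g = grad_norm2_pos [OF \<beta>, of i]
  show "0 \<le> skew_norm2 \<beta> i" using g by (simp add: skew_norm2_def)
  have "(skew \<beta> i)\<^sup>2 * grad_norm2 \<beta> i \<le> ((1 - \<beta>) / (1 + \<beta>))\<^sup>2 * grad_norm2 \<beta> i"
    using skew_bounds [OF b0 \<beta>(2), of i] g by (intro mult_right_mono power_mono) auto
  then show "skew_norm2 \<beta> i \<le> ((1 - \<beta>) / (1 + \<beta>))\<^sup>2 * grad_norm2 \<beta> i"
    using g by (simp add: skew_norm2_def)
qed

lemma grad_wbasis_unit:
  assumes "x \<in> disk"
  shows "grad_wbasis \<beta> i x /\<^sub>R weight (\<beta> - 1) x = grad_unit \<beta> i x"
  using weight_pos [OF assms, of "\<beta> - 1"] by (simp add: grad_wbasis_eq comb_field_def)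

text \<open>The multipliers are \<open>lam\<close> (1 + \<open>skew\<close>) and \<open>lam\<close>
  (1 - \<open>skew\<close>); their common part reproduces the gradient.\<close>

lemma riesz_grad_unit:
  assumes \<beta>: "0 < \<beta>" "\<beta> < 1" and x: "x \<in> disk" "x \<noteq> 0"
  shows "riesz_potential_vec (2 - 2 * \<beta>) (grad_wbasis \<beta> i) x = lam \<beta> i *\<^sub>R (grad_unit \<beta> i x + skew_unit \<beta> i x)"
proof -
  have e: "of_real (mult_hol \<beta> i) * h + of_real (mult_anti \<beta> i) * a =
      of_real (lam \<beta> i) * ((of_real 1 * h + of_real 1 * a) + (of_real (skew \<beta> i) * h + of_real (- skew \<beta> i) * a))" for h a :: complex
    unfolding lam_skew [OF \<beta>(1), of i, symmetric] by (simp add: algebra_simps)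
  show ?thesis
    unfolding field_riesz [OF \<beta> x] comb_field_def e vec_of_of_real vec_of_simps ..
qed

section \<open>Coordinates for trial and test functions\<close>

text \<open>
  The normalisation makes the norm in \<open>\<ell>\<^sup>2\<close> equal to the norm of the gradient field in
  \<open>L2 (\<beta> - 1)\<close>.
\<close>

definition ell_coeff :: "real \<Rightarrow> nat ell2 \<Rightarrow> index \<Rightarrow> real" where
  "ell_coeff \<beta> x i = (if i \<in> indices then Rep_ell2 x (to_nat_on indices i) / sqrt (grad_norm2 \<beta> i) else 0)"

text \<open>\<open>indices\<close> is a proper subset of its type, so it is enumerated by the
  naturals and the Hilbert space becomes \<open>nat ell2\<close>.\<close>

lemma bij_indices: "bij_betw (to_nat_on indices) indices (UNIV :: nat set)"
proof (rule to_nat_on_infinite)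
  have "inj (\<lambda>n::nat. (0::nat, n, 1::int))" by (auto intro: injI)
  then have "infinite (range (\<lambda>n::nat. (0::nat, n, 1::int)))" by (simp add: range_inj_infinite)
  moreover have "range (\<lambda>n::nat. (0::nat, n, 1::int)) \<subseteq> indices" by (auto simp: indices_def)
  ultimately show "infinite indices" using infinite_super by blast
qed auto

lemma ell_coeff_add: "ell_coeff \<beta> (x + y) i = ell_coeff \<beta> x i + ell_coeff \<beta> y i"
  by (simp add: ell_coeff_def plus_ell2.rep_eq add_divide_distrib)

lemma ell_coeff_scaleR: "ell_coeff \<beta> (c *\<^sub>R x) i = c * ell_coeff \<beta> x i"
  by (simp add: ell_coeff_def scaleR_ell2.rep_eq)

lemma ell_coeff_series: "ell_coeff \<beta> x \<in> series"
  unfolding series_def mem_Collect_eq by (intro allI impI) (simp only: ell_coeff_def if_False)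

lemma ell_coeff_inner:
  assumes \<beta>: "1 / 2 < \<beta>" "\<beta> < 1"
  shows "((\<lambda>i. ell_coeff \<beta> x i * ell_coeff \<beta> y i * grad_norm2 \<beta> i) has_sum inner x y) indices"
proof -
  have "((\<lambda>k. Rep_ell2 x k * Rep_ell2 y k) has_sum inner x y) UNIV"
    unfolding inner_ell2.rep_eq by (intro has_sum_infsum summable_on_mult_squares ell2_summable)
  then have "((\<lambda>i. Rep_ell2 x (to_nat_on indices i) * Rep_ell2 y (to_nat_on indices i)) has_sum inner x y) indices"
    using has_sum_reindex_bij_betw [OF bij_indices, of "\<lambda>k. Rep_ell2 x k * Rep_ell2 y k" "inner x y"] by simp
  then show ?thesis
  proof (rule has_sum_cong [THEN iffD1, rotated])
    fix i assume "i \<in> indices"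
    then show "Rep_ell2 x (to_nat_on indices i) * Rep_ell2 y (to_nat_on indices i) = ell_coeff \<beta> x i * ell_coeff \<beta> y i * grad_norm2 \<beta> i"
      using grad_norm2_pos [OF \<beta>, of i] by (simp add: ell_coeff_def)
  qed
qed

lemma ell_coeff_norm:
  assumes \<beta>: "1 / 2 < \<beta>" "\<beta> < 1"
  shows "((\<lambda>i. (ell_coeff \<beta> x i)\<^sup>2 * grad_norm2 \<beta> i) has_sum (norm x)\<^sup>2) indices"
  unfolding power2_norm_eq_inner unfolding power2_eq_square using ell_coeff_inner [OF \<beta>] .

lemma ell_coeff_exists:
  assumes \<beta>: "1 / 2 < \<beta>" "\<beta> < 1" and a: "a \<in> series" and sum: "(\<lambda>i. (a i)\<^sup>2 * grad_norm2 \<beta> i) summable_on indices"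
  shows "\<exists>x. ell_coeff \<beta> x = a"
proof -
  let ?g = "to_nat_on indices"
  let ?h = "inv_into indices ?g"
  define f where "f k = a (?h k) * sqrt (grad_norm2 \<beta> (?h k))" for k
  have hg: "?h (?g i) = i" if "i \<in> indices" for i
    using bij_indices that by (simp add: bij_betw_def)
  have "(\<lambda>i. (f (?g i))\<^sup>2) summable_on indices"
    using sum by (rule summable_on_cong [THEN iffD1, rotated])
       (use grad_norm2_pos [OF \<beta>] in \<open>auto simp: f_def hg power_mult_distrib less_imp_le\<close>)
  then have "(\<lambda>k. (f k)\<^sup>2) summable_on UNIV"
    using summable_on_reindex_bij_betw [OF bij_indices, of "\<lambda>k. (f k)\<^sup>2"] by simp
  then have R: "Rep_ell2 (Abs_ell2 f) = f" by (simp add: Abs_ell2_inverse)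
  have "ell_coeff \<beta> (Abs_ell2 f) i = a i" for i
  proof (cases "i \<in> indices")
    case True
    then show ?thesis using grad_norm2_pos [OF \<beta>, of i] by (simp add: ell_coeff_def R f_def hg)
  next
    case False
    then show ?thesis using series_zero [OF a False] by (simp add: ell_coeff_def)
  qed
  then show ?thesis by blast
qed

lemma ell_coeff_inj:
  assumes \<beta>: "1 / 2 < \<beta>" "\<beta> < 1" and eq: "ell_coeff \<beta> x = ell_coeff \<beta> y"
  shows "x = y"
proof -
  have "ell_coeff \<beta> (x - y) i = 0" for i
    using fun_cong [OF eq, of i] by (auto simp: ell_coeff_def minus_ell2.rep_eq diff_divide_distrib)
  then have "((\<lambda>i. 0) has_sum (norm (x - y))\<^sup>2) indices"
    using ell_coeff_norm [OF \<beta>, of "x - y"] by simp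
  moreover have "((\<lambda>i. 0) has_sum (0 :: real)) indices" by (rule has_sum_0) (rule refl)
  ultimately have "(norm (x - y))\<^sup>2 = 0" by (rule has_sum_unique)
  then show ?thesis by simp
qed

text \<open>Serves both orthogonal families: \<open>grad_unit\<close> with C = 1, and
  \<open>skew_unit\<close> with C the square of (1 - \<beta>) / (1 + \<beta>). The norm is
  Parseval's identity in each case.\<close>

lemma ell_field_exists:
  fixes F :: "index \<Rightarrow> real^2 \<Rightarrow> real^2"
  assumes \<beta>: "1 / 2 < \<beta>" "\<beta> < 1"
    and F: "\<And>i. F i \<in> sq_int M"
    and orth: "\<And>i j. i \<in> indices \<Longrightarrow> j \<in> indices \<Longrightarrow> sq_inner M (F i) (F j) = (if i = j then N i else 0)"
    and N: "\<And>i. 0 \<le> N i" "\<And>i. N i \<le> C * grad_norm2 \<beta> i"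
  shows "\<exists>U. sq_has_sum M (\<lambda>i z. ell_coeff \<beta> x i *\<^sub>R F i z) indices U"
    and "sq_has_sum M (\<lambda>i z. ell_coeff \<beta> x i *\<^sub>R F i z) indices U \<Longrightarrow> ((\<lambda>i. (ell_coeff \<beta> x i)\<^sup>2 * N i) has_sum (sq_norm M U)\<^sup>2) indices"
    and "sq_has_sum M (\<lambda>i z. ell_coeff \<beta> x i *\<^sub>R F i z) indices U \<Longrightarrow> (sq_norm M U)\<^sup>2 \<le> C * (norm x)\<^sup>2"
proof -
  have ip: "sq_inner M (\<lambda>z. ell_coeff \<beta> x i *\<^sub>R F i z) (\<lambda>z. ell_coeff \<beta> x j *\<^sub>R F j z) = (if i = j then (ell_coeff \<beta> x i)\<^sup>2 * N i else 0)"
    if "i \<in> indices" "j \<in> indices" for i j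
    using orth [OF that] by (simp add: sq_inner_scaleR_left sq_inner_scaleR_right power2_eq_square)
  have bound: "(ell_coeff \<beta> x i)\<^sup>2 * N i \<le> C * ((ell_coeff \<beta> x i)\<^sup>2 * grad_norm2 \<beta> i)" for i
    using mult_left_mono [OF N(2) [of i], of "(ell_coeff \<beta> x i)\<^sup>2"] by (simp add: mult_ac)
  have big: "((\<lambda>i. C * ((ell_coeff \<beta> x i)\<^sup>2 * grad_norm2 \<beta> i)) has_sum C * (norm x)\<^sup>2) indices"
    by (rule has_sum_cmult_right [OF ell_coeff_norm [OF \<beta>]])
  have "(\<lambda>i. (ell_coeff \<beta> x i)\<^sup>2 * N i) summable_on indices"
    by (rule summable_on_comparison_test [OF has_sum_imp_summable [OF big] bound]) (simp add: N)
  then have "(\<lambda>i. sq_inner M (\<lambda>z. ell_coeff \<beta> x i *\<^sub>R F i z) (\<lambda>z. ell_coeff \<beta> x i *\<^sub>R F i z)) summable_on indices"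
    by (rule summable_on_cong [THEN iffD1, rotated]) (simp add: ip)
  then show "\<exists>U. sq_has_sum M (\<lambda>i z. ell_coeff \<beta> x i *\<^sub>R F i z) indices U"
    by (intro sq_has_sum_orthogonal_exists sq_int_scaleR F) (auto simp: ip)
  assume U: "sq_has_sum M (\<lambda>i z. ell_coeff \<beta> x i *\<^sub>R F i z) indices U"
  have "((\<lambda>i. sq_inner M (\<lambda>z. ell_coeff \<beta> x i *\<^sub>R F i z) (\<lambda>z. ell_coeff \<beta> x i *\<^sub>R F i z)) has_sum sq_inner M U U) indices"
    by (rule sq_has_sum_orthogonal_norm(1) [OF U]) (simp add: ip)
  then show hs: "((\<lambda>i. (ell_coeff \<beta> x i)\<^sup>2 * N i) has_sum (sq_norm M U)\<^sup>2) indices"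
    unfolding sq_norm_power2 by (rule has_sum_cong [THEN iffD1, rotated]) (simp add: ip)
  show "(sq_norm M U)\<^sup>2 \<le> C * (norm x)\<^sup>2"
    by (rule has_sum_mono [OF hs big bound])
qed

section \<open>Sobolev spaces and the dual pairing in coordinates\<close>

lemma H_series_1_iff:
  assumes \<beta>: "1 / 2 < \<beta>" "\<beta> < 1"
  shows "a \<in> H_series \<beta> 1 \<longleftrightarrow> a \<in> series \<and> (\<lambda>i. (a i)\<^sup>2 * grad_norm2 \<beta> i) summable_on indices"
proof -
  have \<gamma>: "\<beta> > -1" using \<beta> by simp
  have p: "ind_weight i powr 1 * (a i)\<^sup>2 * basis_norm2 \<beta> i = (a i)\<^sup>2 * (ind_weight i * basis_norm2 \<beta> i)" for i
    using ind_weight_pos [of i] by simp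
  have "(\<lambda>i. (a i)\<^sup>2 * (ind_weight i * basis_norm2 \<beta> i)) summable_on indices \<longleftrightarrow> (\<lambda>i. (a i)\<^sup>2 * grad_norm2 \<beta> i) summable_on indices"
  proof
    assume "(\<lambda>i. (a i)\<^sup>2 * (ind_weight i * basis_norm2 \<beta> i)) summable_on indices"
    then have "(\<lambda>i. 4 * ((a i)\<^sup>2 * (ind_weight i * basis_norm2 \<beta> i))) summable_on indices" by (rule summable_on_cmult_right)
    then show "(\<lambda>i. (a i)\<^sup>2 * grad_norm2 \<beta> i) summable_on indices"
    proof (rule summable_on_comparison_test)
      show "(a i)\<^sup>2 * grad_norm2 \<beta> i \<le> 4 * ((a i)\<^sup>2 * (ind_weight i * basis_norm2 \<beta> i))" for i
        using mult_left_mono [OF grad_norm2_bounds(2) [OF \<beta>, of i], of "(a i)\<^sup>2"] by (simp add: mult_ac)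
      show "0 \<le> (a i)\<^sup>2 * grad_norm2 \<beta> i" for i using grad_norm2_pos [OF \<beta>, of i] by simp
    qed
  next
    assume "(\<lambda>i. (a i)\<^sup>2 * grad_norm2 \<beta> i) summable_on indices"
    then show "(\<lambda>i. (a i)\<^sup>2 * (ind_weight i * basis_norm2 \<beta> i)) summable_on indices"
    proof (rule summable_on_comparison_test)
      show nn: "0 \<le> (a i)\<^sup>2 * (ind_weight i * basis_norm2 \<beta> i)" for i
        using ind_weight_pos [of i] basis_norm2_pos [OF \<gamma>, of i] by simp
      show "(a i)\<^sup>2 * (ind_weight i * basis_norm2 \<beta> i) \<le> (a i)\<^sup>2 * grad_norm2 \<beta> i" for i
        using mult_left_mono [OF grad_norm2_bounds(1) [OF \<beta>, of i], of "(a i)\<^sup>2"] nn [of i] by simp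
    qed
  qed
  then show ?thesis unfolding H_series_iff [OF \<gamma>] p by simp
qed

lemma H_norm_1_le:
  assumes \<beta>: "1 / 2 < \<beta>" "\<beta> < 1"
  shows "H_norm \<beta> 1 (ell_coeff \<beta> x) \<le> norm x"
proof -
  let ?a = "ell_coeff \<beta> x"
  have \<gamma>: "\<beta> > -1" using \<beta> by simp
  have s: "?a \<in> H_series \<beta> 1"
    unfolding H_series_1_iff [OF \<beta>] using ell_coeff_series has_sum_imp_summable [OF ell_coeff_norm [OF \<beta>]] by blast
  have "(\<Sum>\<^sub>\<infinity>i\<in>indices. ind_weight i powr 1 * (?a i)\<^sup>2 * basis_norm2 \<beta> i) \<le> (\<Sum>\<^sub>\<infinity>i\<in>indices. (?a i)\<^sup>2 * grad_norm2 \<beta> i)"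
  proof (rule infsum_mono)
    show "(\<lambda>i. ind_weight i powr 1 * (?a i)\<^sup>2 * basis_norm2 \<beta> i) summable_on indices" using s H_series_iff [OF \<gamma>] by blast
    show "(\<lambda>i. (?a i)\<^sup>2 * grad_norm2 \<beta> i) summable_on indices" using s H_series_1_iff [OF \<beta>] by blast
    fix i
    have nn: "0 \<le> (?a i)\<^sup>2 * (ind_weight i * basis_norm2 \<beta> i)"
      using ind_weight_pos [of i] basis_norm2_pos [OF \<gamma>, of i] by simp
    show "ind_weight i powr 1 * (?a i)\<^sup>2 * basis_norm2 \<beta> i \<le> (?a i)\<^sup>2 * grad_norm2 \<beta> i"
      using mult_left_mono [OF grad_norm2_bounds(1) [OF \<beta>, of i], of "(?a i)\<^sup>2"] nn ind_weight_pos [of i] by (simp add: mult_ac)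
  qed
  also have "\<dots> = (norm x)\<^sup>2" using ell_coeff_norm [OF \<beta>, of x] by (simp add: infsumI)
  finally show ?thesis unfolding H_norm_eq [OF \<gamma>] by (intro real_le_lsqrt) auto
qed

text \<open>The square of \<open>lam\<close> contributes the exponent 2 (\<beta> - 1) and
  \<open>grad_norm2\<close> the exponent 1. The total 2 \<beta> - 1 = \<alpha> - 1 is the order of
  the test space.\<close>

lemma lam_grad_norm2_bounds:
  assumes \<beta>: "1 / 2 < \<beta>" "\<beta> < 1"
  shows "\<exists>k1 k2. 0 < k1 \<and> 0 < k2 \<and> (\<forall>i. k1 * (ind_weight i powr (2 * \<beta> - 1) * basis_norm2 \<beta> i) \<le> (lam \<beta> i)\<^sup>2 * grad_norm2 \<beta> i
      \<and> (lam \<beta> i)\<^sup>2 * grad_norm2 \<beta> i \<le> k2 * (ind_weight i powr (2 * \<beta> - 1) * basis_norm2 \<beta> i))"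
proof -
  have b0: "0 < \<beta>" using \<beta> by simp
  obtain k1 k2 where k: "0 < k1" "0 < k2" and "\<forall>i. k1 * ind_weight i powr (\<beta> - 1) \<le> lam \<beta> i \<and> lam \<beta> i \<le> k2 * ind_weight i powr (\<beta> - 1)"
    using lam_bounds [OF b0 \<beta>(2)] by blast
  then have lam: "k1 * ind_weight i powr (\<beta> - 1) \<le> lam \<beta> i" "lam \<beta> i \<le> k2 * ind_weight i powr (\<beta> - 1)" for i by blast+
  have "k1\<^sup>2 * 2 * (ind_weight i powr (2 * \<beta> - 1) * basis_norm2 \<beta> i) \<le> (lam \<beta> i)\<^sup>2 * grad_norm2 \<beta> i
      \<and> (lam \<beta> i)\<^sup>2 * grad_norm2 \<beta> i \<le> k2\<^sup>2 * 4 * (ind_weight i powr (2 * \<beta> - 1) * basis_norm2 \<beta> i)" for i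
  proof -
    let ?w = "ind_weight i" and ?n = "basis_norm2 \<beta> i"
    have w: "?w > 0" and n: "?n > 0" using ind_weight_pos \<beta> by (auto intro: basis_norm2_pos)
    have pw: "?w powr (2 * \<beta> - 1) = (?w powr (\<beta> - 1))\<^sup>2 * ?w"
    proof -
      have "(?w powr (\<beta> - 1))\<^sup>2 * ?w = ?w powr (\<beta> - 1) * ?w powr (\<beta> - 1) * ?w powr 1"
        using w by (simp only: power2_eq_square powr_one)
      also have "\<dots> = ?w powr (2 * \<beta> - 1)" by (simp only: powr_add [symmetric]) simp
      finally show ?thesis by (rule sym)
    qed
    have "(k1 * ?w powr (\<beta> - 1))\<^sup>2 * (2 * (?w * ?n)) \<le> (lam \<beta> i)\<^sup>2 * grad_norm2 \<beta> i"
      using lam(1) [of i] k w n by (intro mult_mono power_mono grad_norm2_bounds \<beta>) auto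
    moreover have "(lam \<beta> i)\<^sup>2 * grad_norm2 \<beta> i \<le> (k2 * ?w powr (\<beta> - 1))\<^sup>2 * (4 * (?w * ?n))"
      using lam(2) [of i] lam_pos [OF b0, of i] grad_norm2_pos [OF \<beta>, of i] k
      by (intro mult_mono power_mono grad_norm2_bounds \<beta>) auto
    ultimately show ?thesis unfolding pw by (simp add: power_mult_distrib mult_ac)
  qed
  then show ?thesis using k by (intro exI [of _ "k1\<^sup>2 * 2"] exI [of _ "k2\<^sup>2 * 4"]) auto
qed

lemma powr_half_sq: "(w powr (s / 2))\<^sup>2 = (w::real) powr s"
  unfolding power2_eq_square powr_add [symmetric] field_sum_of_halves ..

lemma pairing_eq:
  assumes "\<gamma> > -1"
  shows "pairing \<gamma> a b = (\<Sum>\<^sub>\<infinity>i\<in>indices. a i * b i * basis_norm2 \<gamma> i)"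
  unfolding pairing_def using basis_sq_norm [OF assms] by (intro infsum_cong) simp

text \<open>Cauchy-Schwarz, after distributing the powers -s/2 and s/2 of the index weight over the
  two factors.\<close>

lemma pairing_bound:
  assumes \<gamma>: "\<gamma> > -1" and a: "a \<in> H_series \<gamma> (- s)" and b: "b \<in> H_series \<gamma> s"
  shows "\<bar>pairing \<gamma> a b\<bar> \<le> H_norm \<gamma> (- s) a * H_norm \<gamma> s b"
proof -
  define F where "F s a i = ind_weight i powr (s / 2) * a i * sqrt (basis_norm2 \<gamma> i)" for s a i
  have F2: "(F s a i)\<^sup>2 = ind_weight i powr s * (a i)\<^sup>2 * basis_norm2 \<gamma> i" for s a i
    using basis_norm2_pos [OF \<gamma>, of i]
    unfolding F_def power_mult_distrib powr_half_sq by (simp add: less_imp_le)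
  have FF: "F (- s) a i * F s b i = a i * b i * basis_norm2 \<gamma> i" for i
  proof -
    have w: "ind_weight i powr (- s / 2) * ind_weight i powr (s / 2) = 1"
      using ind_weight_pos [of i] by (simp flip: powr_add)
    have n: "sqrt (basis_norm2 \<gamma> i) * sqrt (basis_norm2 \<gamma> i) = basis_norm2 \<gamma> i"
      using basis_norm2_pos [OF \<gamma>, of i] by simp
    have "F (- s) a i * F s b i = (ind_weight i powr (- s / 2) * ind_weight i powr (s / 2))
        * (a i * b i) * (sqrt (basis_norm2 \<gamma> i) * sqrt (basis_norm2 \<gamma> i))"
      unfolding F_def by (simp only: mult_ac)
    then show ?thesis unfolding w n by simp
  qed
  have "(\<lambda>i. (F (- s) a i)\<^sup>2) summable_on indices" "(\<lambda>i. (F s b i)\<^sup>2) summable_on indices"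
    using a b unfolding F2 H_series_iff [OF \<gamma>] by blast+
  from infsum_Cauchy_Schwarz [OF this] show ?thesis
    unfolding F2 FF H_norm_eq [OF \<gamma>] pairing_eq [OF \<gamma>] .
qed

lemma H_norm_nonneg: "H_norm \<gamma> s a \<ge> 0"
proof -
  have "H_term \<gamma> s a i \<ge> 0" for i by (cases i) (simp add: H_term_def)
  then show ?thesis unfolding H_norm_def by (intro real_sqrt_ge_zero infsum_nonneg)
qed

lemma trial_exists:
  assumes \<beta>: "1 / 2 < \<beta>" "\<beta> < 1"
  shows "\<exists>u \<in> wH_space \<beta> 1. coeffs \<beta> u = ell_coeff \<beta> x"
proof (rule wH_space_exists)
  show "ell_coeff \<beta> x \<in> H_series \<beta> 1"
    unfolding H_series_1_iff [OF \<beta>] using ell_coeff_series has_sum_imp_summable [OF ell_coeff_norm [OF \<beta>]] by blast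
qed (use \<beta> in auto)

lemma trial_coord:
  assumes \<beta>: "1 / 2 < \<beta>" "\<beta> < 1" and u: "u \<in> wH_space \<beta> 1"
  shows "\<exists>x. ell_coeff \<beta> x = coeffs \<beta> u"
proof -
  have "\<beta> > -1" using \<beta> by simp
  from wH_space_coeffs(1) [OF this u] show ?thesis
    unfolding H_series_1_iff [OF \<beta>] by (elim conjE) (rule ell_coeff_exists [OF \<beta>])
qed

text \<open>Fixes constants as in \<open>lam_grad_norm2_bounds\<close>, since \<open>k1\<close>
  enters the inf-sup constant.\<close>

locale multiplier_bounds =
  fixes \<beta> k1 k2 :: real
  assumes \<beta>: "1 / 2 < \<beta>" "\<beta> < 1" and k: "0 < k1" "0 < k2"
    and lower: "\<And>i. k1 * (ind_weight i powr (2 * \<beta> - 1) * basis_norm2 \<beta> i) \<le> (lam \<beta> i)\<^sup>2 * grad_norm2 \<beta> i"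
    and upper: "\<And>i. (lam \<beta> i)\<^sup>2 * grad_norm2 \<beta> i \<le> k2 * (ind_weight i powr (2 * \<beta> - 1) * basis_norm2 \<beta> i)"
begin

lemma \<beta>_gt: "\<beta> > -1" "\<beta> > 0" "\<beta> - 1 > -1" using \<beta> by auto

abbreviation term_H :: "(index \<Rightarrow> real) \<Rightarrow> index \<Rightarrow> real" where
  "term_H b i \<equiv> ind_weight i powr (2 * \<beta> - 1) * (b i)\<^sup>2 * basis_norm2 \<beta> i"
abbreviation term_ell :: "(index \<Rightarrow> real) \<Rightarrow> index \<Rightarrow> real" where
  "term_ell b i \<equiv> (b i * lam \<beta> i)\<^sup>2 * grad_norm2 \<beta> i"

lemma term_lower: "k1 * term_H b i \<le> term_ell b i"
  using mult_left_mono [OF lower [of i], of "(b i)\<^sup>2"] by (simp add: power_mult_distrib mult_ac)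

lemma term_upper: "term_ell b i \<le> k2 * term_H b i"
  using mult_left_mono [OF upper [of i], of "(b i)\<^sup>2"] by (simp add: power_mult_distrib mult_ac)

lemma term_nonneg: "0 \<le> term_H b i" "0 \<le> term_ell b i"
  using basis_norm2_pos [OF \<beta>_gt(1), of i] grad_norm2_pos [OF \<beta>, of i] by auto

lemma H_series_test_iff:
  "b \<in> H_series \<beta> (2 * \<beta> - 1) \<longleftrightarrow> b \<in> series \<and> term_ell b summable_on indices"
proof -
  have "term_H b summable_on indices \<longleftrightarrow> term_ell b summable_on indices"
  proof
    assume "term_H b summable_on indices"
    then have "(\<lambda>i. k2 * term_H b i) summable_on indices" by (rule summable_on_cmult_right)
    then show "term_ell b summable_on indices"
      by (rule summable_on_comparison_test) (rule term_upper term_nonneg)+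
  next
    assume "term_ell b summable_on indices"
    then have "(\<lambda>i. (1 / k1) * term_ell b i) summable_on indices" by (rule summable_on_cmult_right)
    then show "term_H b summable_on indices"
    proof (rule summable_on_comparison_test)
      show "term_H b i \<le> 1 / k1 * term_ell b i" for i
        using term_lower [where b = b and i = i] k by (simp add: pos_le_divide_eq mult.commute)
    qed (rule term_nonneg)
  qed
  then show ?thesis unfolding H_series_iff [OF \<beta>_gt(1)] by blast
qed

lemma test_norm:
  assumes y: "\<And>i. b i * lam \<beta> i = ell_coeff \<beta> y i" and b: "b \<in> H_series \<beta> (2 * \<beta> - 1)"
  shows "k1 * (H_norm \<beta> (2 * \<beta> - 1) b)\<^sup>2 \<le> (norm y)\<^sup>2" and "(norm y)\<^sup>2 \<le> k2 * (H_norm \<beta> (2 * \<beta> - 1) b)\<^sup>2"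
proof -
  have s: "term_H b summable_on indices" using b unfolding H_series_iff [OF \<beta>_gt(1)] by blast
  have h: "(term_H b has_sum (H_norm \<beta> (2 * \<beta> - 1) b)\<^sup>2) indices"
    using has_sum_infsum [OF s] infsum_nonneg [of indices "term_H b"] term_nonneg
    unfolding H_norm_eq [OF \<beta>_gt(1)] by simp
  have e: "(term_ell b has_sum (norm y)\<^sup>2) indices"
    unfolding y by (rule ell_coeff_norm [OF \<beta>])
  show "k1 * (H_norm \<beta> (2 * \<beta> - 1) b)\<^sup>2 \<le> (norm y)\<^sup>2"
    by (rule has_sum_mono [OF has_sum_cmult_right [OF h] e]) (rule term_lower)
  show "(norm y)\<^sup>2 \<le> k2 * (H_norm \<beta> (2 * \<beta> - 1) b)\<^sup>2"
    by (rule has_sum_mono [OF e has_sum_cmult_right [OF h]]) (rule term_upper)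
qed

text \<open>
  The coefficients of a test function are divided by the multipliers, so that its potential has
  the same coordinates as the gradient of a trial function.
\<close>

lemma test_exists: "\<exists>v \<in> wH_space \<beta> (2 * \<beta> - 1). \<forall>i. coeffs \<beta> v i * lam \<beta> i = ell_coeff \<beta> y i"
proof -
  define b where "b i = ell_coeff \<beta> y i / lam \<beta> i" for i
  have b: "b i * lam \<beta> i = ell_coeff \<beta> y i" for i
    using lam_pos [OF \<beta>_gt(2), of i] by (simp add: b_def)
  have "b \<in> series" unfolding series_def mem_Collect_eq b_def using series_zero [OF ell_coeff_series, of _ \<beta> y] by simp
  moreover have "term_ell b summable_on indices" unfolding b by (rule has_sum_imp_summable [OF ell_coeff_norm [OF \<beta>]])
  ultimately have "b \<in> H_series \<beta> (2 * \<beta> - 1)" unfolding H_series_test_iff by blast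
  then have "\<exists>v \<in> wH_space \<beta> (2 * \<beta> - 1). coeffs \<beta> v = b" using \<beta> by (intro wH_space_exists) auto
  then show ?thesis using b by metis
qed

lemma test_coord:
  assumes v: "v \<in> wH_space \<beta> (2 * \<beta> - 1)"
  shows "\<exists>y. \<forall>i. coeffs \<beta> v i * lam \<beta> i = ell_coeff \<beta> y i"
proof -
  have b: "coeffs \<beta> v \<in> series" "term_ell (coeffs \<beta> v) summable_on indices"
    using wH_space_coeffs(1) [OF \<beta>_gt(1) v] unfolding H_series_test_iff by blast+
  have "(\<lambda>i. coeffs \<beta> v i * lam \<beta> i) \<in> series"
    unfolding series_def mem_Collect_eq using series_zero [OF b(1)] by simp
  from ell_coeff_exists [OF \<beta> this b(2)] show ?thesis by metis
qed

text \<open>Turns f into a vector of \<open>ell2\<close>. Its square summability combines the lower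
  bound for the multipliers with the negative order of f.\<close>

lemma functional_exists:
  assumes f: "f \<in> H_series \<beta> (- (2 * \<beta> - 1))"
  shows "\<exists>r. \<forall>v y. (\<forall>i. coeffs \<beta> v i * lam \<beta> i = ell_coeff \<beta> y i) \<longrightarrow> F_form (2 * \<beta>) f v = inner y r"
proof -
  \<comment> \<open>Chosen so that, if \<open>ell_coeff \<beta> y i\<close> is the test coefficient
    times \<open>lam \<beta> i\<close>, then
    \<open>ell_coeff \<beta> y i * g i * grad_norm2 \<beta> i\<close> is the i-th term of the
    pairing.\<close>
  define g where "g i = f i * basis_norm2 \<beta> i / (lam \<beta> i * grad_norm2 \<beta> i)" for i
  let ?s = "2 * \<beta> - 1"
  have fs: "f \<in> series" "(\<lambda>i. ind_weight i powr (- ?s) * (f i)\<^sup>2 * basis_norm2 \<beta> i) summable_on indices"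
    using f unfolding H_series_iff [OF \<beta>_gt(1)] by blast+
  have bound: "(g i)\<^sup>2 * grad_norm2 \<beta> i \<le> (1 / k1) * (ind_weight i powr (- ?s) * (f i)\<^sup>2 * basis_norm2 \<beta> i)" for i
  proof -
    define L n w G where "L = lam \<beta> i" and "n = basis_norm2 \<beta> i" and "w = ind_weight i powr ?s" and "G = grad_norm2 \<beta> i"
    have pos: "L > 0" "n > 0" "w > 0" "G > 0"
      using lam_pos [OF \<beta>_gt(2), of i] basis_norm2_pos [OF \<beta>_gt(1), of i] ind_weight_pos [of i] grad_norm2_pos [OF \<beta>, of i]
      by (auto simp: L_def n_def w_def G_def)
    have le: "k1 * (w * n) \<le> L\<^sup>2 * G" using lower [of i] by (simp only: L_def n_def w_def G_def)
    have "(g i)\<^sup>2 * G = (f i)\<^sup>2 * n\<^sup>2 / (L\<^sup>2 * G)"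
      using pos by (simp add: g_def power_divide power_mult_distrib power2_eq_square mult_ac flip: L_def n_def G_def)
    also have "\<dots> \<le> (f i)\<^sup>2 * n\<^sup>2 / (k1 * (w * n))"
      using pos k le by (intro divide_left_mono mult_pos_pos) auto
    also have "\<dots> = (1 / k1) * (1 / w * (f i)\<^sup>2 * n)"
      using pos k by (simp add: power2_eq_square)
    finally show ?thesis unfolding G_def n_def w_def powr_minus_divide .
  qed
  have "(\<lambda>i. (g i)\<^sup>2 * grad_norm2 \<beta> i) summable_on indices"
  proof (rule summable_on_comparison_test)
    show "(\<lambda>i. (1 / k1) * (ind_weight i powr (- ?s) * (f i)\<^sup>2 * basis_norm2 \<beta> i)) summable_on indices"
      using fs(2) by (rule summable_on_cmult_right)
    show "0 \<le> (g i)\<^sup>2 * grad_norm2 \<beta> i" for i using grad_norm2_pos [OF \<beta>, of i] by simp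
  qed (rule bound)
  moreover have "g \<in> series"
    unfolding series_def mem_Collect_eq g_def using series_zero [OF fs(1)] by simp
  ultimately obtain r where r: "ell_coeff \<beta> r = g" using ell_coeff_exists [OF \<beta>] by blast
  have "F_form (2 * \<beta>) f v = inner y r" if y: "\<forall>i. coeffs \<beta> v i * lam \<beta> i = ell_coeff \<beta> y i" for v y
  proof -
    have "((\<lambda>i. ell_coeff \<beta> y i * g i * grad_norm2 \<beta> i) has_sum inner y r) indices"
      using ell_coeff_inner [OF \<beta>, of y r] unfolding r .
    moreover have "ell_coeff \<beta> y i * g i * grad_norm2 \<beta> i = f i * coeffs \<beta> v i * basis_norm2 \<beta> i" for i
      using lam_pos [OF \<beta>_gt(2), of i] grad_norm2_pos [OF \<beta>, of i]
      by (simp add: y [rule_format, symmetric] g_def)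
    ultimately have "((\<lambda>i. f i * coeffs \<beta> v i * basis_norm2 \<beta> i) has_sum inner y r) indices" by (simp only:)
    then show ?thesis by (simp add: F_form_def pairing_eq [OF \<beta>_gt(1)] infsumI)
  qed
  then show ?thesis by blast
qed

end

section \<open>The fields of trial and test functions\<close>

text \<open>A representative chosen separately for each vector, so it depends linearly on the vector
  only up to null sets.\<close>

definition ell_field :: "real \<Rightarrow> (index \<Rightarrow> real^2 \<Rightarrow> real^2) \<Rightarrow> nat ell2 \<Rightarrow> real^2 \<Rightarrow> real^2" where
  "ell_field \<beta> F x = (SOME U. sq_has_sum (disk_measure (\<beta> - 1)) (\<lambda>i z. ell_coeff \<beta> x i *\<^sub>R F i z) indices U)"

lemma comb_sq_int: "0 < \<beta> \<Longrightarrow> comb_field \<beta> s t i \<in> sq_int (disk_measure (\<beta> - 1))"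
  by (intro sq_int_continuous continuous_on_comb_field) auto

lemma ell_field_grad:
  assumes \<beta>: "1 / 2 < \<beta>" "\<beta> < 1"
  shows "sq_has_sum (disk_measure (\<beta> - 1)) (\<lambda>i z. ell_coeff \<beta> x i *\<^sub>R grad_unit \<beta> i z) indices (ell_field \<beta> (grad_unit \<beta>) x)" (is ?S)
    and "(sq_norm (disk_measure (\<beta> - 1)) (ell_field \<beta> (grad_unit \<beta>) x))\<^sup>2 = (norm x)\<^sup>2"
proof -
  have b0: "0 < \<beta>" using \<beta> by simp
  have N: "0 \<le> grad_norm2 \<beta> i" "grad_norm2 \<beta> i \<le> 1 * grad_norm2 \<beta> i" for i
    using grad_norm2_pos [OF \<beta>, of i] by auto
  note E = ell_field_exists [OF \<beta> comb_sq_int [OF b0] grad_unit_inner [OF b0] N]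
  show S: ?S unfolding ell_field_def by (rule someI_ex [OF E(1)])
  show "(sq_norm (disk_measure (\<beta> - 1)) (ell_field \<beta> (grad_unit \<beta>) x))\<^sup>2 = (norm x)\<^sup>2"
    by (rule has_sum_unique [OF E(2) [OF _ _ S] ell_coeff_norm [OF \<beta>]])
qed

lemma ell_field_skew:
  assumes \<beta>: "1 / 2 < \<beta>" "\<beta> < 1"
  shows "sq_has_sum (disk_measure (\<beta> - 1)) (\<lambda>i z. ell_coeff \<beta> x i *\<^sub>R skew_unit \<beta> i z) indices (ell_field \<beta> (skew_unit \<beta>) x)" (is ?S)
    and "sq_norm (disk_measure (\<beta> - 1)) (ell_field \<beta> (skew_unit \<beta>) x) \<le> (1 - \<beta>) / (1 + \<beta>) * norm x"
proof -
  have b0: "0 < \<beta>" using \<beta> by simp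
  note E = ell_field_exists [OF \<beta> comb_sq_int [OF b0] skew_unit_inner [OF b0] skew_norm2_bounds [OF \<beta>]]
  show S: ?S unfolding ell_field_def by (rule someI_ex [OF E(1)])
  show "sq_norm (disk_measure (\<beta> - 1)) (ell_field \<beta> (skew_unit \<beta>) x) \<le> (1 - \<beta>) / (1 + \<beta>) * norm x"
  proof (rule power2_le_imp_le)
    show "(sq_norm (disk_measure (\<beta> - 1)) (ell_field \<beta> (skew_unit \<beta>) x))\<^sup>2 \<le> ((1 - \<beta>) / (1 + \<beta>) * norm x)\<^sup>2"
      unfolding power_mult_distrib by (rule E(3) [OF _ _ S])
  qed (use \<beta> in auto)
qed

lemma ell_field_add:
  assumes S: "\<And>x. sq_has_sum (disk_measure (\<beta> - 1)) (\<lambda>i z. ell_coeff \<beta> x i *\<^sub>R F i z) indices (ell_field \<beta> F x)"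
  shows "AE z in disk_measure (\<beta> - 1). ell_field \<beta> F (x + y) z = ell_field \<beta> F x z + ell_field \<beta> F y z"
  using S [of "x + y"] unfolding ell_coeff_add scaleR_add_left
  by (rule sq_has_sum_unique [OF _ sq_has_sum_add [OF S S]])

lemma ell_field_scaleR:
  assumes S: "\<And>x. sq_has_sum (disk_measure (\<beta> - 1)) (\<lambda>i z. ell_coeff \<beta> x i *\<^sub>R F i z) indices (ell_field \<beta> F x)"
  shows "AE z in disk_measure (\<beta> - 1). ell_field \<beta> F (c *\<^sub>R x) z = c *\<^sub>R ell_field \<beta> F x z"
  using S [of "c *\<^sub>R x"] unfolding ell_coeff_scaleR scaleR_scaleR [symmetric]
  by (rule sq_has_sum_unique [OF _ sq_has_sum_scaleR [OF S]])

text \<open>\<open>grad_field\<close> and \<open>riesz_grad_field\<close> are arbitrary choices of a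
  sum. By uniqueness every choice agrees almost everywhere with a sum that is known.\<close>

lemma L2_has_sum_someI:
  assumes S: "sq_has_sum (disk_measure \<gamma>) f J g"
    and m: "\<And>i. i \<in> J \<Longrightarrow> f' i \<in> borel_measurable (lebesgue_on disk)" "\<And>i. i \<in> J \<Longrightarrow> AE x in lebesgue_on disk. f i x = f' i x"
  shows "(SOME U. L2_has_sum \<gamma> f' J U) \<in> sq_int (disk_measure \<gamma>)"
    and "AE x in disk_measure \<gamma>. (SOME U. L2_has_sum \<gamma> f' J U) x = g x"
proof -
  have "g \<in> sq_int (disk_measure \<gamma>)" using S by (simp add: sq_has_sum_def)
  then have S': "sq_has_sum (disk_measure \<gamma>) f' J g"
    using m by (intro sq_has_sum_cong_AE [OF S]) (auto simp: AE_disk_measure dest: sq_int_measurable)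
  then have "sq_has_sum (disk_measure \<gamma>) f' J (SOME U. L2_has_sum \<gamma> f' J U)"
    unfolding L2_has_sum_eq by (rule someI [of _ g])
  then show "(SOME U. L2_has_sum \<gamma> f' J U) \<in> sq_int (disk_measure \<gamma>)"
    and "AE x in disk_measure \<gamma>. (SOME U. L2_has_sum \<gamma> f' J U) x = g x"
    using sq_has_sum_unique [OF _ S'] by (auto simp: sq_has_sum_def)
qed

lemma comb_field_measurable: "0 < \<beta> \<Longrightarrow> comb_field \<beta> s t i \<in> borel_measurable (lebesgue_on disk)"
  using sq_int_measurable [OF comb_sq_int] by simp

lemma AE_disk: "AE x in lebesgue_on disk. x \<in> disk"
  by (intro AE_I2) simp

lemma AE_disk_nonzero: "AE x in lebesgue_on disk. x \<noteq> 0"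
proof (rule AE_I)
  show "emeasure (lebesgue_on disk) {0} = 0"
    by (subst emeasure_restrict_space) (auto simp: disk_def)
  show "{0} \<in> sets (lebesgue_on disk)" by (auto simp: sets_restrict_space disk_def)
qed auto

lemma grad_field_ell:
  assumes \<beta>: "1 / 2 < \<beta>" "\<beta> < 1" and x: "coeffs \<beta> u = ell_coeff \<beta> x"
  shows "grad_field (2 * \<beta>) u \<in> sq_int (disk_measure (\<beta> - 1))"
    and "AE z in disk_measure (\<beta> - 1). grad_field (2 * \<beta>) u z = ell_field \<beta> (grad_unit \<beta>) x z"
proof -
  have b0: "0 < \<beta>" and half: "2 * \<beta> / 2 = \<beta>" using \<beta> by auto
  let ?f = "\<lambda>i z. ell_coeff \<beta> x i *\<^sub>R (grad_wbasis \<beta> i z /\<^sub>R weight (\<beta> - 1) z)"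
  have m: "?f i \<in> borel_measurable (lebesgue_on disk)" for i
  proof (rule measurable_cong [THEN iffD1])
    show "(\<lambda>z. ell_coeff \<beta> x i *\<^sub>R grad_unit \<beta> i z) \<in> borel_measurable (lebesgue_on disk)"
      using comb_field_measurable [OF b0] by (intro borel_measurable_scaleR) auto
    show "ell_coeff \<beta> x i *\<^sub>R grad_unit \<beta> i z = ?f i z" if "z \<in> space (lebesgue_on disk)" for z
      using grad_wbasis_unit [of z \<beta> i] that by simp
  qed
  have ae: "AE z in lebesgue_on disk. ell_coeff \<beta> x i *\<^sub>R grad_unit \<beta> i z = ?f i z" for i
    using AE_disk by eventually_elim (simp only: grad_wbasis_unit)
  note E = L2_has_sum_someI [OF ell_field_grad(1) [OF \<beta>, of x] m ae]
  show "grad_field (2 * \<beta>) u \<in> sq_int (disk_measure (\<beta> - 1))"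
    unfolding grad_field_def half x by (rule E(1))
  show "AE z in disk_measure (\<beta> - 1). grad_field (2 * \<beta>) u z = ell_field \<beta> (grad_unit \<beta>) x z"
    unfolding grad_field_def half x by (rule E(2))
qed

text \<open>The rescaled coefficients absorb \<open>lam\<close>, so the potential becomes the
  gradient field of the vector y plus a skew perturbation.\<close>

lemma riesz_grad_field_ell:
  assumes \<beta>: "1 / 2 < \<beta>" "\<beta> < 1" and y: "\<And>i. coeffs \<beta> v i * lam \<beta> i = ell_coeff \<beta> y i"
  shows "riesz_grad_field (2 * \<beta>) v \<in> sq_int (disk_measure (\<beta> - 1))"
    and "AE z in disk_measure (\<beta> - 1). riesz_grad_field (2 * \<beta>) v z =
      ell_field \<beta> (grad_unit \<beta>) y z + ell_field \<beta> (skew_unit \<beta>) y z"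
proof -
  have b0: "0 < \<beta>" and half: "2 * \<beta> / 2 = \<beta>" using \<beta> by auto
  let ?f = "\<lambda>i z. coeffs \<beta> v i *\<^sub>R riesz_potential_vec (2 - 2 * \<beta>) (grad_wbasis \<beta> i) z"
  let ?g = "\<lambda>i z. ell_coeff \<beta> y i *\<^sub>R grad_unit \<beta> i z + ell_coeff \<beta> y i *\<^sub>R skew_unit \<beta> i z"
  have eq: "?g i z = ?f i z" if "z \<in> disk" "z \<noteq> 0" for i z
    unfolding riesz_grad_unit [OF b0 \<beta>(2) that] scaleR_scaleR y scaleR_add_right ..
  have gm: "?g i \<in> borel_measurable (lebesgue_on disk)" for i
    using comb_field_measurable [OF b0] by (intro borel_measurable_add borel_measurable_scaleR) auto
  have m: "?f i \<in> borel_measurable (lebesgue_on disk)" for i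
  \<comment> \<open>The potential of a basis gradient is explicit off the origin only; measurability
    survives patching the value at this single point.\<close>
  proof (rule measurable_cong [THEN iffD1])
    have "{z \<in> space (lebesgue_on disk). z = 0} = {0}" by (auto simp: disk_def)
    moreover have "{0} \<in> sets (lebesgue_on disk)" by (auto simp: sets_restrict_space disk_def)
    ultimately show "(\<lambda>z. if z = 0 then ?f i 0 else ?g i z) \<in> borel_measurable (lebesgue_on disk)"
      by (intro measurable_If gm) auto
    show "(if z = 0 then ?f i 0 else ?g i z) = ?f i z" if "z \<in> space (lebesgue_on disk)" for z
      using eq [of z i] that by (cases "z = 0") (simp_all only: if_True if_False refl space_lebesgue_on_disk not_False_eq_True)
  qed
  have ae: "AE z in lebesgue_on disk. ?g i z = ?f i z" for i
    using AE_disk AE_disk_nonzero by eventually_elim (rule eq)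
  note E = L2_has_sum_someI [OF sq_has_sum_add [OF ell_field_grad(1) [OF \<beta>, of y] ell_field_skew(1) [OF \<beta>, of y]] m ae]
  show "riesz_grad_field (2 * \<beta>) v \<in> sq_int (disk_measure (\<beta> - 1))"
    unfolding riesz_grad_field_def half by (rule E(1))
  show "AE z in disk_measure (\<beta> - 1). riesz_grad_field (2 * \<beta>) v z =
      ell_field \<beta> (grad_unit \<beta>) y z + ell_field \<beta> (skew_unit \<beta>) y z"
    unfolding riesz_grad_field_def half by (rule E(2))
qed

section \<open>Coefficient matrices\<close>

lemma borel_measurable_matrix_vector_mult:
  fixes K :: "'a \<Rightarrow> real^'m^'n" and f :: "'a \<Rightarrow> real^'m"
  assumes K: "\<And>i j. (\<lambda>x. K x $ i $ j) \<in> borel_measurable M" and f: "f \<in> borel_measurable M"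
  shows "(\<lambda>x. K x *v f x) \<in> borel_measurable M"
proof (rule borel_measurable_euclidean_space [THEN iffD2], rule ballI)
  fix e :: "real^'n" assume "e \<in> Basis"
  then obtain i where e: "e = axis i 1" by (auto simp: Basis_vec_def)
  have fj: "(\<lambda>x. f x $ j) \<in> borel_measurable M" for j
    unfolding cart_eq_inner_axis using f by (intro borel_measurable_inner) auto
  have "(\<lambda>x. \<Sum>j\<in>UNIV. K x $ i $ j * f x $ j) \<in> borel_measurable M"
    by (intro borel_measurable_sum borel_measurable_times K fj)
  then show "(\<lambda>x. (K x *v f x) \<bullet> e) \<in> borel_measurable M"
    unfolding e cart_eq_inner_axis [symmetric] by (simp add: matrix_vector_mult_def)
qed

lemma inner_symmetric_matrix:
  fixes A :: "real^'n^'n"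
  assumes "transpose A = A"
  shows "x \<bullet> (A *v y) = (A *v x) \<bullet> y"
  using dot_lmul_matrix [of x A y] transpose_matrix_vector [of A x] assms by simp

text \<open>
  Expand the quadratic form of \<open>A\<close> at \<open>M \<xi> - A \<xi>\<close>.
\<close>

lemma norm_symmetric_matrix_le:
  fixes A :: "real^'n^'n"
  assumes A: "transpose A = A" and M: "M > 0"
    and psd: "\<And>\<xi>. 0 \<le> \<xi> \<bullet> (A *v \<xi>)" and up: "\<And>\<xi>. \<xi> \<bullet> (A *v \<xi>) \<le> M * (\<xi> \<bullet> \<xi>)"
  shows "(A *v \<xi>) \<bullet> (A *v \<xi>) \<le> M\<^sup>2 * (\<xi> \<bullet> \<xi>)"
proof -
  define \<eta> where "\<eta> = A *v \<xi>"
  have s: "\<xi> \<bullet> (A *v \<eta>) = \<eta> \<bullet> \<eta>" using inner_symmetric_matrix [OF A, of \<xi> \<eta>] unfolding \<eta>_def .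
  have "0 \<le> (M *\<^sub>R \<xi> - \<eta>) \<bullet> (A *v (M *\<^sub>R \<xi> - \<eta>))" by (rule psd)
  also have "A *v (M *\<^sub>R \<xi> - \<eta>) = M *\<^sub>R \<eta> - A *v \<eta>"
    unfolding \<eta>_def by (simp add: matrix_vector_mult_diff_distrib matrix_vector_mult_scaleR)
  also have "(M *\<^sub>R \<xi> - \<eta>) \<bullet> (M *\<^sub>R \<eta> - A *v \<eta>)
      = M * M * (\<xi> \<bullet> \<eta>) - M * (\<xi> \<bullet> (A *v \<eta>)) - M * (\<eta> \<bullet> \<eta>) + \<eta> \<bullet> (A *v \<eta>)"
    by (simp add: inner_diff_left inner_diff_right algebra_simps)
  also have "\<dots> \<le> M * M * (M * (\<xi> \<bullet> \<xi>)) - M * (\<eta> \<bullet> \<eta>)"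
  proof -
    have "M * M * (\<xi> \<bullet> \<eta>) \<le> M * M * (M * (\<xi> \<bullet> \<xi>))"
      using up [of \<xi>] M unfolding \<eta>_def by (intro mult_left_mono) auto
    then show ?thesis using up [of \<eta>] unfolding s by linarith
  qed
  finally have "M * (\<eta> \<bullet> \<eta>) \<le> M * (M\<^sup>2 * (\<xi> \<bullet> \<xi>))" by (simp add: power2_eq_square mult.assoc)
  then show ?thesis using M unfolding \<eta>_def by simp
qed

section \<open>The elliptic problem\<close>

text \<open>The assumption \<open>contrast\<close> compares the upper bound of K, reduced by the
  relative size of the skew part, with the lower bound; it is what coercivity uses.\<close>

locale elliptic_problem = multiplier_bounds \<beta> k1 k2 for \<beta> k1 k2 :: real +
  fixes K :: "real^2 \<Rightarrow> real^2^2" and lam_m lam_M :: real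
  assumes K: "\<And>i j. (\<lambda>x. K x $ i $ j) \<in> borel_measurable (lebesgue_on disk)"
    and K_sym: "\<And>x. x \<in> disk \<Longrightarrow> transpose (K x) = K x"
    and lam_m: "lam_m > 0" and lam_M: "lam_M > 0"
    and ell: "\<And>x \<xi>. x \<in> disk \<Longrightarrow> lam_m * (\<xi> \<bullet> \<xi>) \<le> \<xi> \<bullet> (K x *v \<xi>)"
      "\<And>x \<xi>. x \<in> disk \<Longrightarrow> \<xi> \<bullet> (K x *v \<xi>) \<le> lam_M * (\<xi> \<bullet> \<xi>)"
    and contrast: "lam_M * ((1 - \<beta>) / (1 + \<beta>)) < lam_m"
begin

abbreviation D :: "(real^2) measure" where "D \<equiv> disk_measure (\<beta> - 1)"

lemma K_bound:
  assumes x: "x \<in> disk"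
  shows "(K x *v \<xi>) \<bullet> (K x *v \<xi>) \<le> lam_M\<^sup>2 * (\<xi> \<bullet> \<xi>)"
proof (rule norm_symmetric_matrix_le [OF K_sym [OF x] lam_M _ ell(2) [OF x]])
  show "0 \<le> \<eta> \<bullet> (K x *v \<eta>)" for \<eta>
    using ell(1) [OF x, of \<eta>] lam_m mult_nonneg_nonneg [of lam_m "\<eta> \<bullet> \<eta>"] inner_ge_zero [of \<eta>] by linarith
qed

lemma K_sq_int:
  assumes f: "f \<in> sq_int D"
  shows "(\<lambda>x. K x *v f x) \<in> sq_int D"
    and "sq_norm D (\<lambda>x. K x *v f x) \<le> lam_M * sq_norm D f"
    and "lam_m * (sq_norm D f)\<^sup>2 \<le> sq_inner D (\<lambda>x. K x *v f x) f"
proof -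
  have m: "(\<lambda>x. K x *v f x) \<in> borel_measurable D"
    using borel_measurable_matrix_vector_mult [OF K, of f] sq_int_measurable [OF f] by simp
  have i: "integrable D (\<lambda>x. lam_M\<^sup>2 * (f x \<bullet> f x))" using f by (simp add: sq_int_def)
  have ae: "AE x in D. (K x *v f x) \<bullet> (K x *v f x) \<le> lam_M\<^sup>2 * (f x \<bullet> f x)"
    by (intro AE_disk_measureI K_bound)
  have "integrable D (\<lambda>x. (K x *v f x) \<bullet> (K x *v f x))"
  proof (rule Bochner_Integration.integrable_bound [OF i])
    show "(\<lambda>x. (K x *v f x) \<bullet> (K x *v f x)) \<in> borel_measurable D" using m by (intro borel_measurable_inner)
    show "AE x in D. norm ((K x *v f x) \<bullet> (K x *v f x)) \<le> norm (lam_M\<^sup>2 * (f x \<bullet> f x))"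
      using ae by eventually_elim simp
  qed
  then show s: "(\<lambda>x. K x *v f x) \<in> sq_int D" using m by (simp add: sq_int_def)
  have "sq_inner D (\<lambda>x. K x *v f x) (\<lambda>x. K x *v f x) \<le> (LINT x|D. lam_M\<^sup>2 * (f x \<bullet> f x))"
    unfolding sq_inner_def by (intro integral_mono_AE sq_int_integrable s i ae)
  then have "(sq_norm D (\<lambda>x. K x *v f x))\<^sup>2 \<le> (lam_M * sq_norm D f)\<^sup>2"
    unfolding power_mult_distrib sq_norm_power2 by (simp add: sq_inner_def)
  then show "sq_norm D (\<lambda>x. K x *v f x) \<le> lam_M * sq_norm D f"
    by (rule power2_le_imp_le) (use lam_M sq_norm_nonneg [of D f] in simp)
  have "(LINT x|D. lam_m * (f x \<bullet> f x)) \<le> sq_inner D f (\<lambda>x. K x *v f x)"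
    unfolding sq_inner_def
  proof (intro integral_mono_AE sq_int_integrable s f)
    show "integrable D (\<lambda>x. lam_m * (f x \<bullet> f x))" using f by (simp add: sq_int_def)
    show "AE x in D. lam_m * (f x \<bullet> f x) \<le> f x \<bullet> (K x *v f x)" by (intro AE_disk_measureI ell(1))
  qed
  then show "lam_m * (sq_norm D f)\<^sup>2 \<le> sq_inner D (\<lambda>x. K x *v f x) f"
    unfolding sq_norm_power2 sq_inner_commute [of D "\<lambda>x. K x *v f x"] by (simp add: sq_inner_def)
qed

abbreviation U :: "nat ell2 \<Rightarrow> real^2 \<Rightarrow> real^2" where "U \<equiv> ell_field \<beta> (grad_unit \<beta>)"
abbreviation W :: "nat ell2 \<Rightarrow> real^2 \<Rightarrow> real^2" where "W \<equiv> ell_field \<beta> (skew_unit \<beta>)"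

lemma U_sq_int: "U x \<in> sq_int D" and W_sq_int: "W x \<in> sq_int D"
  using ell_field_grad(1) [OF \<beta>, of x] ell_field_skew(1) [OF \<beta>, of x] by (simp_all add: sq_has_sum_def)

lemma KU_sq_int: "(\<lambda>z. K z *v U x z) \<in> sq_int D"
  by (rule K_sq_int(1) [OF U_sq_int])

lemma UW_sq_int: "(\<lambda>z. U y z + W y z) \<in> sq_int D"
  by (intro sq_int_add U_sq_int W_sq_int)

lemma norm_U: "sq_norm D (U x) = norm x"
  using ell_field_grad(2) [OF \<beta>, of x] sq_norm_nonneg [of D "U x"] by (simp add: power2_eq_iff_nonneg)

lemma norm_W: "sq_norm D (W x) \<le> (1 - \<beta>) / (1 + \<beta>) * norm x"
  by (rule ell_field_skew(2) [OF \<beta>])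

text \<open>By \<open>B_form_eq\<close> this is \<open>B_form\<close> in coordinates, with trial and
  test functions now ranging over the same Hilbert space.\<close>

definition ell_form :: "nat ell2 \<Rightarrow> nat ell2 \<Rightarrow> real" where
  "ell_form x y = sq_inner D (\<lambda>z. K z *v U x z) (\<lambda>z. U y z + W y z)"

text \<open>The chosen representatives are additive almost everywhere, which suffices under the
  integral; the other linearity laws follow the same pattern.\<close>

lemma ell_form_add_left: "ell_form (x + x') y = ell_form x y + ell_form x' y"
proof -
  have "ell_form (x + x') y = sq_inner D (\<lambda>z. K z *v U x z + K z *v U x' z) (\<lambda>z. U y z + W y z)"
    unfolding ell_form_def
  proof (intro sq_inner_cong_AE sq_int_measurable KU_sq_int UW_sq_int sq_int_add)
    show "AE z in D. K z *v U (x + x') z = K z *v U x z + K z *v U x' z"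
      using ell_field_add [OF ell_field_grad(1) [OF \<beta>], of x x']
      by eventually_elim (simp add: matrix_vector_right_distrib)
  qed auto
  then show ?thesis unfolding ell_form_def by (simp add: sq_inner_add_left KU_sq_int UW_sq_int)
qed

lemma ell_form_scaleR_left: "ell_form (c *\<^sub>R x) y = c * ell_form x y"
proof -
  have "ell_form (c *\<^sub>R x) y = sq_inner D (\<lambda>z. c *\<^sub>R (K z *v U x z)) (\<lambda>z. U y z + W y z)"
    unfolding ell_form_def
  proof (intro sq_inner_cong_AE sq_int_measurable KU_sq_int UW_sq_int sq_int_scaleR)
    show "AE z in D. K z *v U (c *\<^sub>R x) z = c *\<^sub>R (K z *v U x z)"
      using ell_field_scaleR [OF ell_field_grad(1) [OF \<beta>], of c x]
      by eventually_elim (simp add: matrix_vector_mult_scaleR)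
  qed auto
  then show ?thesis unfolding ell_form_def by (simp add: sq_inner_scaleR_left)
qed

lemma ell_form_add_right: "ell_form x (y + y') = ell_form x y + ell_form x y'"
proof -
  have "ell_form x (y + y') = sq_inner D (\<lambda>z. K z *v U x z) (\<lambda>z. (U y z + W y z) + (U y' z + W y' z))"
    unfolding ell_form_def
  proof (intro sq_inner_cong_AE sq_int_measurable KU_sq_int UW_sq_int sq_int_add U_sq_int W_sq_int)
    show "AE z in D. U (y + y') z + W (y + y') z = (U y z + W y z) + (U y' z + W y' z)"
      using ell_field_add [OF ell_field_grad(1) [OF \<beta>], of y y'] ell_field_add [OF ell_field_skew(1) [OF \<beta>], of y y']
      by eventually_elim simp
  qed auto
  then show ?thesis unfolding ell_form_def by (simp only: sq_inner_add_right KU_sq_int UW_sq_int)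
qed

lemma ell_form_scaleR_right: "ell_form x (c *\<^sub>R y) = c * ell_form x y"
proof -
  have "ell_form x (c *\<^sub>R y) = sq_inner D (\<lambda>z. K z *v U x z) (\<lambda>z. c *\<^sub>R (U y z + W y z))"
    unfolding ell_form_def
  proof (intro sq_inner_cong_AE sq_int_measurable KU_sq_int UW_sq_int sq_int_scaleR)
    show "AE z in D. U (c *\<^sub>R y) z + W (c *\<^sub>R y) z = c *\<^sub>R (U y z + W y z)"
      using ell_field_scaleR [OF ell_field_grad(1) [OF \<beta>], of c y] ell_field_scaleR [OF ell_field_skew(1) [OF \<beta>], of c y]
      by eventually_elim (simp add: scaleR_add_right)
  qed auto
  then show ?thesis unfolding ell_form_def by (simp only: sq_inner_scaleR_right)
qed

lemma norm_UW: "sq_norm D (\<lambda>z. U y z + W y z) \<le> (1 + (1 - \<beta>) / (1 + \<beta>)) * norm y"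
  using sq_norm_triangle [OF U_sq_int W_sq_int, of y y] norm_U [of y] norm_W [of y] by (simp add: ring_distribs)

lemma ell_form_bounded: "\<bar>ell_form x y\<bar> \<le> norm x * norm y * (lam_M * (1 + (1 - \<beta>) / (1 + \<beta>)))"
proof -
  have "\<bar>ell_form x y\<bar> \<le> sq_norm D (\<lambda>z. K z *v U x z) * sq_norm D (\<lambda>z. U y z + W y z)"
    unfolding ell_form_def by (rule sq_inner_Cauchy_Schwarz [OF KU_sq_int UW_sq_int])
  also have "\<dots> \<le> (lam_M * norm x) * ((1 + (1 - \<beta>) / (1 + \<beta>)) * norm y)"
    using K_sq_int(2) [OF U_sq_int, of x] lam_M
    by (intro mult_mono norm_UW sq_norm_nonneg) (auto simp: norm_U)
  finally show ?thesis by (simp only: mult_ac)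
qed

lemma ell_form_bilinear: "bounded_bilinear ell_form"
proof
  show "\<exists>C. \<forall>x y. norm (ell_form x y) \<le> norm x * norm y * C"
    using ell_form_bounded unfolding real_norm_def by blast
qed (simp_all add: ell_form_add_left ell_form_add_right ell_form_scaleR_left ell_form_scaleR_right)

definition coercivity :: real where "coercivity = lam_m - lam_M * ((1 - \<beta>) / (1 + \<beta>))"

lemma coercivity_pos: "coercivity > 0"
  using contrast by (simp add: coercivity_def)

text \<open>The gradient part contributes at least \<open>lam_m\<close>, and by Cauchy-Schwarz the
  skew part costs at most \<open>lam_M\<close> times its relative size.\<close>

lemma ell_form_coercive: "coercivity * (norm x)\<^sup>2 \<le> ell_form x x"
proof -
  have "\<bar>sq_inner D (\<lambda>z. K z *v U x z) (W x)\<bar> \<le> sq_norm D (\<lambda>z. K z *v U x z) * sq_norm D (W x)"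
    by (rule sq_inner_Cauchy_Schwarz [OF KU_sq_int W_sq_int])
  also have "\<dots> \<le> (lam_M * norm x) * ((1 - \<beta>) / (1 + \<beta>) * norm x)"
    using K_sq_int(2) [OF U_sq_int, of x] lam_M
    by (intro mult_mono norm_W sq_norm_nonneg) (auto simp: norm_U)
  finally have 1: "\<bar>sq_inner D (\<lambda>z. K z *v U x z) (W x)\<bar> \<le> lam_M * ((1 - \<beta>) / (1 + \<beta>)) * (norm x)\<^sup>2"
    by (simp only: power2_eq_square mult_ac)
  have 2: "lam_m * (norm x)\<^sup>2 \<le> sq_inner D (\<lambda>z. K z *v U x z) (U x)"
    using K_sq_int(3) [OF U_sq_int, of x] unfolding norm_U .
  have "ell_form x x = sq_inner D (\<lambda>z. K z *v U x z) (U x) + sq_inner D (\<lambda>z. K z *v U x z) (W x)"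
    unfolding ell_form_def by (rule sq_inner_add_right [OF U_sq_int W_sq_int KU_sq_int])
  then show ?thesis using 1 2 unfolding coercivity_def left_diff_distrib by linarith
qed

lemma ell_form_diff_left: "ell_form (x - x') y = ell_form x y - ell_form x' y"
  using ell_form_add_left [of x "(-1) *\<^sub>R x'" y] ell_form_scaleR_left [of "-1" x' y] by simp

lemma B_form_eq:
  assumes x: "coeffs \<beta> u = ell_coeff \<beta> x" and y: "\<And>i. coeffs \<beta> v i * lam \<beta> i = ell_coeff \<beta> y i"
  shows "B_form (2 * \<beta>) K u v = ell_form x y"
proof -
  have half: "2 * \<beta> / 2 = \<beta>" by simp
  note g = grad_field_ell [OF \<beta> x] and r = riesz_grad_field_ell [OF \<beta> y]
  have "B_form (2 * \<beta>) K u v = sq_inner D (\<lambda>z. K z *v grad_field (2 * \<beta>) u z) (riesz_grad_field (2 * \<beta>) v)"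
    unfolding B_form_def half
    using sq_int_measurable [OF K_sq_int(1) [OF g(1)]] sq_int_measurable [OF r(1)] by (intro L2_inner_eq) simp_all
  also have "\<dots> = ell_form x y"
    unfolding ell_form_def
  proof (intro sq_inner_cong_AE sq_int_measurable [OF K_sq_int(1)] sq_int_measurable [OF UW_sq_int] U_sq_int g(1) sq_int_measurable [OF r(1)] r(2))
    show "AE z in D. K z *v grad_field (2 * \<beta>) u z = K z *v U x z" using g(2) by eventually_elim simp
  qed
  finally show ?thesis .
qed

section \<open>Existence, uniqueness and the inf-sup condition\<close>

lemma weak_solution_exists:
  assumes f: "f \<in> H_series \<beta> (- (2 * \<beta> - 1))"
  shows "\<exists>u \<in> wH_space \<beta> 1. \<forall>v \<in> wH_space \<beta> (2 * \<beta> - 1). B_form (2 * \<beta>) K u v = F_form (2 * \<beta>) f v"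
proof -
  obtain r where r: "\<And>v y. (\<forall>i. coeffs \<beta> v i * lam \<beta> i = ell_coeff \<beta> y i) \<Longrightarrow> F_form (2 * \<beta>) f v = inner y r"
    using functional_exists [OF f] by blast
  have "bounded_linear (\<lambda>y. inner y r)" by (rule bounded_linear_inner_left)
  then obtain x where x: "\<And>y. ell_form x y = inner y r"
    using ell2_Lax_Milgram [OF ell_form_bilinear coercivity_pos ell_form_coercive] by blast
  obtain u where u: "u \<in> wH_space \<beta> 1" "coeffs \<beta> u = ell_coeff \<beta> x" using trial_exists [OF \<beta>] by blast
  have "B_form (2 * \<beta>) K u v = F_form (2 * \<beta>) f v" if v: "v \<in> wH_space \<beta> (2 * \<beta> - 1)" for v
  proof -
    obtain y where y: "\<And>i. coeffs \<beta> v i * lam \<beta> i = ell_coeff \<beta> y i" using test_coord [OF v] by metis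
    have "F_form (2 * \<beta>) f v = inner y r" by (rule r) (intro allI y)
    then show ?thesis unfolding B_form_eq [OF u(2) y] x by (rule sym)
  qed
  then show ?thesis using u(1) by blast
qed

text \<open>The test function whose coordinates are the difference of those of w and u turns the
  equation into a vanishing coercive form.\<close>

lemma weak_solution_unique:
  assumes u: "u \<in> wH_space \<beta> 1" and w: "w \<in> wH_space \<beta> 1"
    and eq: "\<And>v. v \<in> wH_space \<beta> (2 * \<beta> - 1) \<Longrightarrow> B_form (2 * \<beta>) K w v = B_form (2 * \<beta>) K u v"
  shows "AE x in lebesgue_on disk. w x = u x"
proof -
  obtain x x' where x: "ell_coeff \<beta> x = coeffs \<beta> u" "ell_coeff \<beta> x' = coeffs \<beta> w"
    using trial_coord [OF \<beta> u] trial_coord [OF \<beta> w] by blast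
  obtain v where v: "v \<in> wH_space \<beta> (2 * \<beta> - 1)" "\<And>i. coeffs \<beta> v i * lam \<beta> i = ell_coeff \<beta> (x' - x) i"
    using test_exists [of "x' - x"] by blast
  have "ell_form (x' - x) (x' - x) = 0"
    using eq [OF v(1)] unfolding ell_form_diff_left B_form_eq [OF x(1) [symmetric] v(2)] B_form_eq [OF x(2) [symmetric] v(2)] by simp
  then have "coercivity * (norm (x' - x))\<^sup>2 \<le> 0" using ell_form_coercive [of "x' - x"] by simp
  then have "x' = x" using coercivity_pos by (simp add: mult_le_0_iff not_le)
  then show ?thesis by (intro wH_space_eq_AE [OF \<beta>_gt(1) w u]) (simp flip: x)
qed

text \<open>For a solution the quotients in the supremum are quotients of the pairing, which the
  dual norm of f bounds; hence the estimate holds for every inf-sup constant.\<close>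

lemma inf_sup_le:
  assumes C: "inf_sup_constant (2 * \<beta>) K C" and u: "u \<in> wH_space \<beta> 1" and f: "f \<in> H_series \<beta> (- (2 * \<beta> - 1))"
    and sol: "\<And>v. v \<in> wH_space \<beta> (2 * \<beta> - 1) \<Longrightarrow> B_form (2 * \<beta>) K u v = F_form (2 * \<beta>) f v"
  shows "wH_norm \<beta> 1 u \<le> 1 / C * H_norm \<beta> (- (2 * \<beta> - 1)) f"
proof -
  let ?s = "2 * \<beta> - 1"
  have half: "2 * \<beta> / 2 = \<beta>" by simp
  let ?Z = "{z \<in> wH_space \<beta> ?s. \<not> (AE x in lebesgue_on disk. z x = 0)}"
  have "C > 0" and le: "ereal (C * wH_norm \<beta> 1 u) \<le> (SUP z\<in>?Z. ereal (\<bar>B_form (2 * \<beta>) K u z\<bar> / wH_norm \<beta> ?s z))"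
    using C u unfolding inf_sup_constant_def half by blast+
  note le
  also have "(SUP z\<in>?Z. ereal (\<bar>B_form (2 * \<beta>) K u z\<bar> / wH_norm \<beta> ?s z)) \<le> ereal (H_norm \<beta> (- ?s) f)"
  proof (rule SUP_least)
    fix z assume "z \<in> ?Z"
    then have z: "z \<in> wH_space \<beta> ?s" by blast
    have "\<bar>B_form (2 * \<beta>) K u z\<bar> \<le> H_norm \<beta> (- ?s) f * wH_norm \<beta> ?s z"
      unfolding sol [OF z] F_form_def half wH_norm_def
      by (rule pairing_bound [OF \<beta>_gt(1) f wH_space_coeffs(1) [OF \<beta>_gt(1) z]])
    moreover have "wH_norm \<beta> ?s z \<ge> 0" unfolding wH_norm_def by (rule H_norm_nonneg)
    ultimately have "\<bar>B_form (2 * \<beta>) K u z\<bar> / wH_norm \<beta> ?s z \<le> H_norm \<beta> (- ?s) f"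
      using H_norm_nonneg [of \<beta> "- ?s" f]
      \<comment> \<open>A quotient with norm 0 is 0, by the convention for division by zero.\<close>
      by (cases "wH_norm \<beta> ?s z = 0") (auto simp: pos_divide_le_eq)
    then show "ereal (\<bar>B_form (2 * \<beta>) K u z\<bar> / wH_norm \<beta> ?s z) \<le> ereal (H_norm \<beta> (- ?s) f)" by simp
  qed
  finally show ?thesis using \<open>C > 0\<close> by (simp add: pos_le_divide_eq mult.commute)
qed

lemma test_nonzero:
  assumes v: "v \<in> wH_space \<beta> (2 * \<beta> - 1)" and y: "\<And>i. coeffs \<beta> v i * lam \<beta> i = ell_coeff \<beta> y i" and "y \<noteq> 0"
  shows "\<not> (AE x in lebesgue_on disk. v x = 0)"
proof
  assume "AE x in lebesgue_on disk. v x = 0"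
  then have "coeffs \<beta> v = (\<lambda>_. 0)" by (rule wH_space_coeffs_0 [OF \<beta>_gt(1) v])
  then have "ell_coeff \<beta> y i = 0" for i using y [of i] by simp
  then have "ell_coeff \<beta> y = ell_coeff \<beta> 0" by (intro ext) (simp add: ell_coeff_def zero_ell2.rep_eq)
  then show False using ell_coeff_inj [OF \<beta>] \<open>y \<noteq> 0\<close> by blast
qed

text \<open>For w the test function with the same coordinates x is taken. Coercivity bounds the form
  below by a multiple of the square of \<open>norm x\<close>; one factor \<open>norm x\<close>
  dominates the trial norm, the other \<open>sqrt k1\<close> times the test norm.\<close>

lemma inf_sup_exists: "inf_sup_constant (2 * \<beta>) K (coercivity * sqrt k1)"
proof -
  let ?s = "2 * \<beta> - 1"
  have half: "2 * \<beta> / 2 = \<beta>" by simp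
  let ?Z = "{z \<in> wH_space \<beta> ?s. \<not> (AE x in lebesgue_on disk. z x = 0)}"
  have "\<exists>z\<in>?Z. coercivity * sqrt k1 * wH_norm \<beta> 1 w \<le> \<bar>B_form (2 * \<beta>) K w z\<bar> / wH_norm \<beta> ?s z" if w: "w \<in> wH_space \<beta> 1" for w
  proof -
    obtain x where x: "ell_coeff \<beta> x = coeffs \<beta> w" using trial_coord [OF \<beta> w] by blast
    have wx: "wH_norm \<beta> 1 w \<le> norm x" unfolding wH_norm_def x [symmetric] by (rule H_norm_1_le [OF \<beta>])
    \<comment> \<open>For x = 0 the supremum must still be at least 0, which takes some nonzero test
      function as witness.\<close>
    define y where "y = (if x = 0 then ell2_delta 0 else x)"
    have y0: "y \<noteq> 0"
    proof (cases "x = 0")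
      case True
      have "Rep_ell2 (ell2_delta (0::nat)) 0 \<noteq> Rep_ell2 0 0" by (simp add: ell2_delta.rep_eq zero_ell2.rep_eq)
      then show ?thesis using True by (auto simp: y_def)
    qed (simp add: y_def)
    obtain z where z: "z \<in> wH_space \<beta> ?s" "\<And>i. coeffs \<beta> z i * lam \<beta> i = ell_coeff \<beta> y i"
      using test_exists [of y] by blast
    let ?n = "wH_norm \<beta> ?s z"
    have n0: "?n \<ge> 0" unfolding wH_norm_def by (rule H_norm_nonneg)
    note tn = test_norm [OF z(2) wH_space_coeffs(1) [OF \<beta>_gt(1) z(1)], folded wH_norm_def]
    have n: "?n > 0"
    proof (rule ccontr)
      assume "\<not> ?n > 0"
      then have "?n = 0" using n0 by linarith
      then show False using tn(2) y0 by simp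
    qed
    have B: "B_form (2 * \<beta>) K w z = ell_form x y" by (rule B_form_eq [OF x [symmetric] z(2)])
    have "coercivity * sqrt k1 * wH_norm \<beta> 1 w * ?n \<le> \<bar>ell_form x y\<bar>"
    proof (cases "x = 0")
      case True
      then have "wH_norm \<beta> 1 w = 0" using wx H_norm_nonneg [of \<beta> 1 "coeffs \<beta> w"] by (simp add: wH_norm_def)
      then show ?thesis by simp
    next
      case False
      then have yx: "y = x" by (simp add: y_def)
      have "(sqrt k1 * ?n)\<^sup>2 \<le> (norm x)\<^sup>2" using tn(1) k unfolding yx power_mult_distrib by simp
      then have "sqrt k1 * ?n \<le> norm x" by (rule power2_le_imp_le) simp
      then have "wH_norm \<beta> 1 w * (sqrt k1 * ?n) \<le> norm x * norm x"
        using wx n0 k by (intro mult_mono) auto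
      then have "coercivity * (wH_norm \<beta> 1 w * (sqrt k1 * ?n)) \<le> coercivity * (norm x * norm x)"
        using coercivity_pos by (intro mult_left_mono) auto
      also have "\<dots> \<le> ell_form x x" using ell_form_coercive [of x] unfolding power2_eq_square .
      also have "\<dots> \<le> \<bar>ell_form x y\<bar>" unfolding yx by (rule abs_ge_self)
      finally show ?thesis by (simp only: mult_ac)
    qed
    then have "coercivity * sqrt k1 * wH_norm \<beta> 1 w \<le> \<bar>B_form (2 * \<beta>) K w z\<bar> / ?n"
      unfolding B using n by (simp add: pos_le_divide_eq)
    moreover have "z \<in> ?Z" using z(1) test_nonzero [OF z y0] by blast
    ultimately show ?thesis by blast
  qed
  then have "ereal (coercivity * sqrt k1 * wH_norm \<beta> 1 w) \<le> (SUP z\<in>?Z. ereal (\<bar>B_form (2 * \<beta>) K w z\<bar> / wH_norm \<beta> ?s z))"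
    if "w \<in> wH_space \<beta> 1" for w
    using that by (meson SUP_upper2 ereal_less_eq(3))
  moreover have "coercivity * sqrt k1 > 0" using coercivity_pos k by simp
  ultimately show ?thesis unfolding inf_sup_constant_def half by blast
qed

end

text \<open>With \<alpha> = 2 \<beta>, the factor of \<open>lam_m\<close> is at most (2 + 2 \<beta>)
  / (2 - 2 \<beta>) = (1 + \<beta>) / (1 - \<beta>), the reciprocal of the bound for
  \<open>skew\<close>.\<close>

lemma contrast_bound:
  fixes \<beta> lam_m lam_M :: real
  assumes \<beta>: "0 < \<beta>" "\<beta> < 1" and lam_m: "lam_m > 0"
    and less: "lam_M < sqrt (2 * \<beta> * (2 + 2 * \<beta>)) / (2 - 2 * \<beta>) * lam_m"
  shows "lam_M * ((1 - \<beta>) / (1 + \<beta>)) < lam_m"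
proof -
  have "sqrt (2 * \<beta> * (2 + 2 * \<beta>)) \<le> sqrt ((2 + 2 * \<beta>) * (2 + 2 * \<beta>))"
    using \<beta> by (intro real_sqrt_le_mono mult_right_mono) auto
  also have "\<dots> = 2 + 2 * \<beta>" using \<beta> by simp
  finally have "sqrt (2 * \<beta> * (2 + 2 * \<beta>)) / (2 - 2 * \<beta>) \<le> (2 + 2 * \<beta>) / (2 - 2 * \<beta>)"
    using \<beta> by (intro divide_right_mono) auto
  also have "\<dots> = (1 + \<beta>) / (1 - \<beta>)"
    using \<beta> mult_divide_mult_cancel_left [of 2 "1 + \<beta>" "1 - \<beta>"] by (simp add: algebra_simps)
  finally have "sqrt (2 * \<beta> * (2 + 2 * \<beta>)) / (2 - 2 * \<beta>) * lam_m \<le> (1 + \<beta>) / (1 - \<beta>) * lam_m"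
    using lam_m by (intro mult_right_mono) auto
  then have "lam_M < (1 + \<beta>) / (1 - \<beta>) * lam_m" using less by linarith
  then have "lam_M * ((1 - \<beta>) / (1 + \<beta>)) < (1 + \<beta>) / (1 - \<beta>) * lam_m * ((1 - \<beta>) / (1 + \<beta>))"
    using \<beta> by (intro mult_strict_right_mono) auto
  also have "\<dots> = lam_m" using \<beta> by simp
  finally show ?thesis .
qed

theorem theorem1:
  fixes \<alpha> lam_m lam_M :: real
    and K :: "real^2 \<Rightarrow> real^2^2"
  assumes "1 < \<alpha>" "\<alpha> < 2"
    and "\<And>i j. (\<lambda>x. K x $ i $ j) \<in> Linfty"
    and "\<And>x. x \<in> disk \<Longrightarrow> transpose (K x) = K x"
    and "\<And>x \<xi>. x \<in> disk \<Longrightarrow> \<xi> \<noteq> 0 \<Longrightarrow> \<xi> \<bullet> (K x *v \<xi>) > 0"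
    and "lam_m > 0" "lam_M > 0"
    and "\<And>x \<xi>. x \<in> disk \<Longrightarrow>
           lam_m * (\<xi> \<bullet> \<xi>) \<le> \<xi> \<bullet> (K x *v \<xi>) \<and> \<xi> \<bullet> (K x *v \<xi>) \<le> lam_M * (\<xi> \<bullet> \<xi>)"
    and "lam_M < sqrt (\<alpha> * (2 + \<alpha>)) / (2 - \<alpha>) * lam_m"
  shows "(\<exists>C\<^sub>2. inf_sup_constant \<alpha> K C\<^sub>2) \<and>
    (\<forall>f \<in> H_series (\<alpha> / 2) (- (\<alpha> - 1)).
       \<exists>u \<in> wH_space (\<alpha> / 2) 1.
         (\<forall>v \<in> wH_space (\<alpha> / 2) (\<alpha> - 1). B_form \<alpha> K u v = F_form \<alpha> f v) \<and>
         (\<forall>w \<in> wH_space (\<alpha> / 2) 1.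
            (\<forall>v \<in> wH_space (\<alpha> / 2) (\<alpha> - 1). B_form \<alpha> K w v = F_form \<alpha> f v)
            \<longrightarrow> (AE x in lebesgue_on disk. w x = u x)) \<and>
         (\<forall>C\<^sub>2. inf_sup_constant \<alpha> K C\<^sub>2 \<longrightarrow>
            wH_norm (\<alpha> / 2) 1 u \<le> 1 / C\<^sub>2 * H_norm (\<alpha> / 2) (- (\<alpha> - 1)) f))"
proof -
  define \<beta> where "\<beta> = \<alpha> / 2"
  have \<alpha>: "\<alpha> = 2 * \<beta>" and half: "2 * \<beta> / 2 = \<beta>" by (simp_all add: \<beta>_def)
  have \<beta>: "1 / 2 < \<beta>" "\<beta> < 1" using assms(1,2) by (simp_all add: \<alpha>)
  obtain k1 k2 where k: "0 < k1" "0 < k2"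
    and low_up: "\<forall>i. k1 * (ind_weight i powr (2 * \<beta> - 1) * basis_norm2 \<beta> i) \<le> (lam \<beta> i)\<^sup>2 * grad_norm2 \<beta> i
      \<and> (lam \<beta> i)\<^sup>2 * grad_norm2 \<beta> i \<le> k2 * (ind_weight i powr (2 * \<beta> - 1) * basis_norm2 \<beta> i)"
    using lam_grad_norm2_bounds [OF \<beta>] by blast
  interpret elliptic_problem \<beta> k1 k2 K lam_m lam_M
  proof
    show "lam_M * ((1 - \<beta>) / (1 + \<beta>)) < lam_m"
      by (rule contrast_bound) (use \<beta> assms(6) assms(9) [unfolded \<alpha>] in auto)
    show "(\<lambda>x. K x $ i $ j) \<in> borel_measurable (lebesgue_on disk)" for i j
      using assms(3) [of i j] unfolding Linfty_def by blast
    show "transpose (K x) = K x" if "x \<in> disk" for x by (rule assms(4) [OF that])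
    show "lam_m * (\<xi> \<bullet> \<xi>) \<le> \<xi> \<bullet> (K x *v \<xi>)" "\<xi> \<bullet> (K x *v \<xi>) \<le> lam_M * (\<xi> \<bullet> \<xi>)" if "x \<in> disk" for x \<xi>
      using assms(8) [OF that, of \<xi>] by blast+
  qed (use \<beta> k low_up assms(6,7) in \<open>blast+\<close>)
  show ?thesis
    unfolding \<alpha> half
  proof (intro conjI ballI)
    show "\<exists>C\<^sub>2. inf_sup_constant (2 * \<beta>) K C\<^sub>2" using inf_sup_exists by blast
    fix f assume f: "f \<in> H_series \<beta> (- (2 * \<beta> - 1))"
    obtain u where u: "u \<in> wH_space \<beta> 1"
      and sol: "\<And>v. v \<in> wH_space \<beta> (2 * \<beta> - 1) \<Longrightarrow> B_form (2 * \<beta>) K u v = F_form (2 * \<beta>) f v"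
      using weak_solution_exists [OF f] by blast
    show "\<exists>u\<in>wH_space \<beta> 1.
         (\<forall>v\<in>wH_space \<beta> (2 * \<beta> - 1). B_form (2 * \<beta>) K u v = F_form (2 * \<beta>) f v) \<and>
         (\<forall>w\<in>wH_space \<beta> 1. (\<forall>v\<in>wH_space \<beta> (2 * \<beta> - 1). B_form (2 * \<beta>) K w v = F_form (2 * \<beta>) f v) \<longrightarrow>
            (AE x in lebesgue_on disk. w x = u x)) \<and>
         (\<forall>C\<^sub>2. inf_sup_constant (2 * \<beta>) K C\<^sub>2 \<longrightarrow> wH_norm \<beta> 1 u \<le> 1 / C\<^sub>2 * H_norm \<beta> (- (2 * \<beta> - 1)) f)"
    proof (intro bexI [OF _ u] conjI ballI impI allI)
      fix w assume w: "w \<in> wH_space \<beta> 1" "\<forall>v\<in>wH_space \<beta> (2 * \<beta> - 1). B_form (2 * \<beta>) K w v = F_form (2 * \<beta>) f v"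
      show "AE x in lebesgue_on disk. w x = u x"
        by (rule weak_solution_unique [OF u w(1)]) (simp add: w(2) sol)
    next
      fix C assume "inf_sup_constant (2 * \<beta>) K C"
      then show "wH_norm \<beta> 1 u \<le> 1 / C * H_norm \<beta> (- (2 * \<beta> - 1)) f"
        by (rule inf_sup_le [OF _ u f sol])
    qed (rule sol)
  qed
qed

end
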